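(* Let $\Omega\subset\mathbb{R}^n$ be a smooth bounded domain and let $f:\mathbb{R}\to\mathbb{R}$ be a function of class $C^1$. Put $$M_f=\max\left\{0,\ 2\limsup_{|\xi|\to+\infty}\frac{\int_0^\xi f(t)\,dt}{\xi^2},\ \limsup_{|\xi|\to+\infty}\frac{f(\xi)}{\xi}\right\}$$ and assume $M_f<\sup_{\mathbb{R}}f'$ (here $\sup_{\mathbb{R}} f'$ may be $+\infty$). Moreover, if $n\ge 2$, assume that $$\sup_{\xi\in\mathbb{R}}\frac{|f'(\xi)|}{1+|\xi|^q}<+\infty$$ for some $q>0$, with $q<\frac{4}{n-2}$ if $n\ge 3$. Then, for each $\alpha\in L^\infty(\Omega)\setminus\{0\}$ with $\alpha\ge 0$, and for every real $\lambda$ satisfying $$\frac{\lambda_\alpha}{\sup_{\mathbb{R}}f'}<\lambda<\frac{\lambda_\alpha}{M_f},$$ the set of all $u\in H^1_0(\Omega)$ for which the problem $$-\Delta v=\lambda\,\alpha(x)f'(u(x))\,v \text{ in }\Omega,\qquad v|_{\partial\Omega}=0$$ has a non-zero weak solution is closed and not $\sigma$-compact in $H^1_0(\Omega)$.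
   Context: $H^1_0(\Omega)$ is endowed with the scalar product $\langle u,v\rangle=\int_\Omega\nabla u\cdot\nabla v\,dx$ and norm $\|u\|=(\int_\Omega|\nabla u|^2dx)^{1/2}$. For $\alpha\in L^\infty(\Omega)\setminus\{0\}$, $\alpha\ge0$, $\lambda_\alpha$ denotes the first eigenvalue of $-\Delta v=\lambda\alpha v$, $v|_{\partial\Omega}=0$, i.e. $\lambda_\alpha=\min_{v\in H^1_0(\Omega)\setminus\{0\}}\frac{\|v\|^2}{\int_\Omega\alpha|v|^2dx}$. A weak solution of $-\Delta v=\beta(x)v$, $v|_{\partial\Omega}=0$, is a $v\in H^1_0(\Omega)$ with $\int_\Omega\nabla v\cdot\nabla w\,dx=\int_\Omega\beta v w\,dx$ for all $w\in H^1_0(\Omega)$. Conventions: $\frac1{+\infty}=0$, $\frac10=+\infty$. A set in a topological space is $\sigma$-compact if it is the union of an at most countable family of compact sets. *)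

theory Defs
  imports "HOL-Analysis.Analysis"
begin

definition grad :: "('a::euclidean_space \<Rightarrow> real) \<Rightarrow> 'a \<Rightarrow> 'a" where
  "grad \<phi> x = (\<Sum>i\<in>Basis. frechet_derivative \<phi> (at x) i *\<^sub>R i)"

fun C_k :: "nat \<Rightarrow> ('a::euclidean_space \<Rightarrow> real) set" where
  "C_k 0 = {f. continuous_on UNIV f}"
| "C_k (Suc k) = {f. f differentiable_on UNIV \<and>
       (\<forall>i\<in>Basis. (\<lambda>x. frechet_derivative f (at x) i) \<in> C_k k)}"

definition smooth_fun :: "('a::euclidean_space \<Rightarrow> real) \<Rightarrow> bool" where
  "smooth_fun f \<longleftrightarrow> (\<forall>k. f \<in> C_k k)"

text \<open>Smooth bounded domain: nonempty bounded connected open set with C^\<infinity> boundary,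
  expressed via a global smooth defining function.\<close>
definition smooth_bounded_domain :: "'a::euclidean_space set \<Rightarrow> bool" where
  "smooth_bounded_domain \<Omega> \<longleftrightarrow> open \<Omega> \<and> connected \<Omega> \<and> bounded \<Omega> \<and> \<Omega> \<noteq> {} \<and>
     (\<exists>\<rho>. smooth_fun \<rho> \<and> \<Omega> = {x. \<rho> x < 0} \<and> (\<forall>x\<in>frontier \<Omega>. grad \<rho> x \<noteq> 0))"

definition test_fun :: "'a::euclidean_space set \<Rightarrow> ('a \<Rightarrow> real) \<Rightarrow> bool" where
  "test_fun \<Omega> \<phi> \<longleftrightarrow> smooth_fun \<phi> \<and> compact (closure {x. \<phi> x \<noteq> 0}) \<and>
     closure {x. \<phi> x \<noteq> 0} \<subseteq> \<Omega>"

definition L2_fun :: "'a::euclidean_space set \<Rightarrow> ('a \<Rightarrow> real) \<Rightarrow> bool" where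
  "L2_fun \<Omega> u \<longleftrightarrow> u \<in> borel_measurable (lebesgue_on \<Omega>) \<and>
     integrable (lebesgue_on \<Omega>) (\<lambda>x. (u x)\<^sup>2)"

definition L2_vfun :: "'a::euclidean_space set \<Rightarrow> ('a \<Rightarrow> 'a) \<Rightarrow> bool" where
  "L2_vfun \<Omega> G \<longleftrightarrow> G \<in> borel_measurable (lebesgue_on \<Omega>) \<and>
     integrable (lebesgue_on \<Omega>) (\<lambda>x. (norm (G x))\<^sup>2)"

definition weak_grad :: "'a::euclidean_space set \<Rightarrow> ('a \<Rightarrow> real) \<Rightarrow> ('a \<Rightarrow> 'a) \<Rightarrow> bool" where
  "weak_grad \<Omega> u G \<longleftrightarrow> L2_fun \<Omega> u \<and> L2_vfun \<Omega> G \<and>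
     (\<forall>\<phi>. test_fun \<Omega> \<phi> \<longrightarrow> (\<forall>i\<in>Basis.
        integral\<^sup>L (lebesgue_on \<Omega>) (\<lambda>x. u x * (grad \<phi> x \<bullet> i))
        = - integral\<^sup>L (lebesgue_on \<Omega>) (\<lambda>x. (G x \<bullet> i) * \<phi> x)))"

definition H10 :: "'a::euclidean_space set \<Rightarrow> ('a \<Rightarrow> real) set" where
  "H10 \<Omega> = {u. \<exists>G. weak_grad \<Omega> u G \<and>
     (\<exists>\<phi>::nat \<Rightarrow> 'a \<Rightarrow> real. (\<forall>k. test_fun \<Omega> (\<phi> k)) \<and>
        (\<lambda>k. integral\<^sup>L (lebesgue_on \<Omega>) (\<lambda>x. (\<phi> k x - u x)\<^sup>2)) \<longlonglongrightarrow> 0 \<and>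
        (\<lambda>k. integral\<^sup>L (lebesgue_on \<Omega>) (\<lambda>x. (norm (grad (\<phi> k) x - G x))\<^sup>2)) \<longlonglongrightarrow> 0)}"

definition wgrad :: "'a::euclidean_space set \<Rightarrow> ('a \<Rightarrow> real) \<Rightarrow> 'a \<Rightarrow> 'a" where
  "wgrad \<Omega> u = (SOME G. weak_grad \<Omega> u G)"

definition H10_inner :: "'a::euclidean_space set \<Rightarrow> ('a \<Rightarrow> real) \<Rightarrow> ('a \<Rightarrow> real) \<Rightarrow> real" where
  "H10_inner \<Omega> u v = integral\<^sup>L (lebesgue_on \<Omega>) (\<lambda>x. wgrad \<Omega> u x \<bullet> wgrad \<Omega> v x)"

definition H10_dist :: "'a::euclidean_space set \<Rightarrow> ('a \<Rightarrow> real) \<Rightarrow> ('a \<Rightarrow> real) \<Rightarrow> real" where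
  "H10_dist \<Omega> u v =
     sqrt (integral\<^sup>L (lebesgue_on \<Omega>) (\<lambda>x. (norm (wgrad \<Omega> u x - wgrad \<Omega> v x))\<^sup>2))"

text \<open>Norm topology of H^1_0(\<Omega>) (on representatives; a.e.-equal functions are
  topologically indistinguishable).\<close>
definition H10_top :: "'a::euclidean_space set \<Rightarrow> ('a \<Rightarrow> real) topology" where
  "H10_top \<Omega> = topology (\<lambda>U. U \<subseteq> H10 \<Omega> \<and>
     (\<forall>u\<in>U. \<exists>e>0. \<forall>v\<in>H10 \<Omega>. H10_dist \<Omega> u v < e \<longrightarrow> v \<in> U))"

definition sigma_compactin :: "'a topology \<Rightarrow> 'a set \<Rightarrow> bool" where
  "sigma_compactin X S \<longleftrightarrow> (\<exists>K::nat \<Rightarrow> 'a set. (\<forall>i. compactin X (K i)) \<and> S = (\<Union>i. K i))"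

definition ae_zero :: "'a::euclidean_space set \<Rightarrow> ('a \<Rightarrow> real) \<Rightarrow> bool" where
  "ae_zero \<Omega> v \<longleftrightarrow> (AE x in lebesgue_on \<Omega>. v x = 0)"

definition Linf_fun :: "'a::euclidean_space set \<Rightarrow> ('a \<Rightarrow> real) \<Rightarrow> bool" where
  "Linf_fun \<Omega> \<alpha> \<longleftrightarrow> \<alpha> \<in> borel_measurable (lebesgue_on \<Omega>) \<and>
     (\<exists>C. AE x in lebesgue_on \<Omega>. \<bar>\<alpha> x\<bar> \<le> C)"

text \<open>First eigenvalue: min of norm(v)^2 / \<integral>\<alpha> v^2 over v \<noteq> 0 (quotients with
  vanishing denominator are +\<infinity> and do not affect the minimum).\<close>
definition first_eig :: "'a::euclidean_space set \<Rightarrow> ('a \<Rightarrow> real) \<Rightarrow> real" where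
  "first_eig \<Omega> \<alpha> = Inf {H10_inner \<Omega> v v / integral\<^sup>L (lebesgue_on \<Omega>) (\<lambda>x. \<alpha> x * (v x)\<^sup>2) | v.
      v \<in> H10 \<Omega> \<and> \<not> ae_zero \<Omega> v \<and> integral\<^sup>L (lebesgue_on \<Omega>) (\<lambda>x. \<alpha> x * (v x)\<^sup>2) > 0}"

definition weak_sol :: "'a::euclidean_space set \<Rightarrow> ('a \<Rightarrow> real) \<Rightarrow> ('a \<Rightarrow> real) \<Rightarrow> bool" where
  "weak_sol \<Omega> \<beta> v \<longleftrightarrow> v \<in> H10 \<Omega> \<and>
     (\<forall>w\<in>H10 \<Omega>. H10_inner \<Omega> v w = integral\<^sup>L (lebesgue_on \<Omega>) (\<lambda>x. \<beta> x * v x * w x))"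

end

theory Submission
  imports Defs "HOL-Complex_Analysis.Great_Picard" "HOL-Library.Diagonal_Subsequence" "HOL-Real_Asymp.Real_Asymp"
begin

text \<open>
  For a weight \<open>\<beta>\<close>, let \<open>top_eig \<beta>\<close> be the supremum of \<open>\<integral> \<beta> v\<^sup>2\<close> over the unit ball of
  \<open>H\<^sup>1\<^sub>0\<close>. By compactness it is attained when positive, so that a weight with \<open>top_eig \<beta> = 1\<close> admits
  a non-zero solution, and \<open>u \<mapsto> top_eig (\<lambda> \<alpha> f'(u))\<close> is continuous. The bounds on \<open>\<lambda>\<close> provide
  constants \<open>c\<^sub>0\<close>, \<open>c\<^sub>1\<close> with \<open>\<lambda> f'(c\<^sub>1) < \<lambda>\<^sub>\<alpha> < \<lambda> f'(c\<^sub>0)\<close>; for \<open>c\<^sub>1\<close>, note that otherwise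
  \<open>f' \<ge> \<lambda>\<^sub>\<alpha> / \<lambda> > M\<^sub>f\<close> everywhere, whereas \<open>M\<^sub>f \<ge> limsup f(\<xi>)/\<xi> \<ge> inf f'\<close>.
  Functions \<open>u\<^sub>0\<close>, \<open>u\<^sub>1\<close> in \<open>H\<^sup>1\<^sub>0\<close> that are close to these constants on most of the domain then have
  \<open>top_eig > 1\<close> and \<open>top_eig < 1\<close>, respectively.
  Hence every segment from \<open>u\<^sub>0 + w\<close> to \<open>u\<^sub>1 + w\<close>, \<open>w\<close> small, meets the singular set. If that set were
  \<open>\<sigma>\<close>-compact, a ball of directions \<open>w\<close> would be covered by countably many totally bounded sets,
  which Baire's argument excludes in infinite dimension.

  Compactness rests on the subcritical Sobolev inequality and on Rellich's theorem. As \<open>H\<^sup>1\<^sub>0\<close> is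
  the closure of the test functions, both follow from estimates for test functions on the whole
  space, obtained by comparing \<open>\<phi>(x)\<close> with its averages over the balls of radius \<open>2\<^sup>-\<^sup>j\<close>.
\<close>

section \<open>Test functions\<close>

text \<open>Non-zero constants do not belong to \<open>H10 \<Omega>\<close>, and functions close to
  them on most of the domain may have very large gradients. They can be used nevertheless because a
  weight enters only through its quadratic form, and this form depends continuously on
  \<open>u\<close> in L^p. The exponent \<open>p\<close> must exceed \<open>q + 2\<close>, so that
  large values are absorbed, and satisfy n (p - 2) / 2 < p strictly, so that the Sobolev constants
  over the dyadic scales form a convergent geometric series; the bound on \<open>q\<close> leaves
  room for both. Compactness is always applied to a sequence on which the form of - \<Delta> v -
  \<beta> v nearly vanishes on differences; such a sequence converges in norm, so limits keep norm 1
  and stay non-zero. Total boundedness is the right notion of smallness for the category argument: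
  the directions whose segment hits a compact set K lie in K minus a compact curve, and are thus
  again totally bounded. In dimension one nothing limits the growth of \<open>f'\<close>. There
  bounded subsets of \<open>H10 \<Omega>\<close> are uniformly bounded, so \<open>f'\<close> may be
  cut off at a height depending on the subset.\<close>

lemma C_k_const: "(\<lambda>x. c) \<in> C_k k"
  by (induction k arbitrary: c) (auto simp: frechet_derivative_const)

lemma C_k_Suc_D: "f \<in> C_k (Suc k) \<Longrightarrow> f \<in> C_k k"
proof (induction k arbitrary: f)
  case 0
  then show ?case by (auto intro: differentiable_imp_continuous_on)
next
  case (Suc k)
  then have "\<forall>i\<in>Basis. (\<lambda>x. frechet_derivative f (at x) i) \<in> C_k (Suc k)" "f differentiable_on UNIV"
    using C_k.simps(2)[of "Suc k"] by blast+
  then show ?case using Suc.IH by simp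
qed

lemma C_k_add: "f \<in> C_k k \<Longrightarrow> g \<in> C_k k \<Longrightarrow> (\<lambda>x. f x + g x) \<in> C_k k"
proof (induction k arbitrary: f g)
  case 0
  then show ?case by (auto intro: continuous_intros)
next
  case (Suc k)
  have d: "f differentiable (at x)" "g differentiable (at x)" for x
    using Suc.prems by (auto simp: differentiable_on_def)
  have "frechet_derivative (\<lambda>x. f x + g x) (at x) = (\<lambda>h. frechet_derivative f (at x) h + frechet_derivative g (at x) h)" for x
    by (rule frechet_derivative_at[symmetric])
       (intro derivative_intros frechet_derivative_works[THEN iffD1] d)
  then show ?case using Suc by (auto simp: differentiable_on_def)
qed

lemma C_k_mult: "f \<in> C_k k \<Longrightarrow> g \<in> C_k k \<Longrightarrow> (\<lambda>x. f x * g x) \<in> C_k k"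
proof (induction k arbitrary: f g)
  case 0
  then show ?case by (auto intro: continuous_intros)
next
  case (Suc k)
  have d: "f differentiable (at x)" "g differentiable (at x)" for x
    using Suc.prems by (auto simp: differentiable_on_def)
  have eq: "frechet_derivative (\<lambda>x. f x * g x) (at x) =
     (\<lambda>h. f x * frechet_derivative g (at x) h + frechet_derivative f (at x) h * g x)" for x
    by (rule frechet_derivative_at[symmetric])
       (intro derivative_intros frechet_derivative_works[THEN iffD1] d)
  \<comment> \<open>The product rule pairs each undifferentiated factor with a derivative of the
    other, so the factors themselves are needed one order lower.\<close>
  have "f \<in> C_k k" "g \<in> C_k k" using Suc.prems C_k_Suc_D by blast+
  then show ?case using Suc by (auto simp: differentiable_on_def eq intro!: C_k_add)
qed

lemma smooth_fun_const: "smooth_fun (\<lambda>x. c)"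
  by (simp add: smooth_fun_def C_k_const)

lemma smooth_fun_add: "smooth_fun f \<Longrightarrow> smooth_fun g \<Longrightarrow> smooth_fun (\<lambda>x. f x + g x)"
  by (simp add: smooth_fun_def C_k_add)

lemma smooth_fun_mult: "smooth_fun f \<Longrightarrow> smooth_fun g \<Longrightarrow> smooth_fun (\<lambda>x. f x * g x)"
  by (simp add: smooth_fun_def C_k_mult)

lemma smooth_fun_diff: "smooth_fun f \<Longrightarrow> smooth_fun g \<Longrightarrow> smooth_fun (\<lambda>x. f x - g x)"
  using smooth_fun_add[OF _ smooth_fun_mult[OF smooth_fun_const[of "-1"]], of f g] by simp

lemma smooth_fun_power: "smooth_fun f \<Longrightarrow> smooth_fun (\<lambda>x. f x ^ n)"
  by (induction n) (auto intro: smooth_fun_const smooth_fun_mult)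

lemma smooth_fun_prod:
  "finite I \<Longrightarrow> (\<And>i. i \<in> I \<Longrightarrow> smooth_fun (f i)) \<Longrightarrow> smooth_fun (\<lambda>x. \<Prod>i\<in>I. f i x)"
  by (induction rule: finite_induct) (auto intro: smooth_fun_const smooth_fun_mult)

text \<open>The chain rule turns \<open>H m\<close> into a multiple of \<open>H (Suc m)\<close>. A
  whole sequence closed under differentiation is therefore carried along, with \<open>m\<close>
  generalised in the induction on the order.\<close>

lemma smooth_fun_along_axis:
  fixes H :: "nat \<Rightarrow> real \<Rightarrow> real" and e :: "'a::euclidean_space"
  assumes "\<And>m y. (H m has_real_derivative H (Suc m) y) (at y)"
  shows "smooth_fun (\<lambda>x. H m (s * (x \<bullet> e) + c))"
proof -
  have "(\<lambda>x. H m (s * (x \<bullet> e) + c)) \<in> C_k k" for k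
  proof (induction k arbitrary: m)
    case 0
    have "continuous_on UNIV (H m)"
      using assms by (meson DERIV_isCont continuous_at_imp_continuous_on)
    then show ?case
      by (auto intro!: continuous_intros intro: continuous_on_compose2)
  next
    case (Suc k)
    have d: "((\<lambda>x. H m (s * (x \<bullet> e) + c)) has_derivative
         (\<lambda>h. H (Suc m) (s * (x \<bullet> e) + c) * (s * (h \<bullet> e)))) (at x)" for x
    proof -
      have "((\<lambda>x. s * (x \<bullet> e) + c) has_derivative (\<lambda>h. s * (h \<bullet> e))) (at x)"
        by (auto intro!: derivative_eq_intros)
      from has_derivative_compose[OF this assms[unfolded has_field_derivative_def]]
      show ?thesis by simp
    qed
    then have eq: "frechet_derivative (\<lambda>x. H m (s * (x \<bullet> e) + c)) (at x) =
        (\<lambda>h. H (Suc m) (s * (x \<bullet> e) + c) * (s * (h \<bullet> e)))" for x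
      using frechet_derivative_at by metis
    show ?case
      using d by (auto simp: differentiable_on_def eq differentiable_def
          intro!: C_k_mult[OF Suc.IH C_k_const])
  qed
  then show ?thesis by (simp add: smooth_fun_def)
qed

text \<open>The flat function \<open>exp (- 1 / x)\<close> has derivatives \<open>p (1 / x) * exp (- 1 / x)\<close> with
  polynomials \<open>p\<close> satisfying the recursion below.\<close>

fun flat_poly :: "nat \<Rightarrow> real poly" where
  "flat_poly 0 = 1"
| "flat_poly (Suc m) = monom 1 2 * (flat_poly m - pderiv (flat_poly m))"

definition flat :: "nat \<Rightarrow> real \<Rightarrow> real" where
  "flat m x = (if x > 0 then poly (flat_poly m) (1 / x) * exp (- (1 / x)) else 0)"

lemma poly_times_exp_minus_tendsto_0:
  "((\<lambda>y::real. poly p y * exp (- y)) \<longlongrightarrow> 0) at_top"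
proof (induction p)
  case 0
  then show ?case by simp
next
  case (pCons a p)
  \<comment> \<open>The decay \<open>exp (- y)\<close> is split into two halves: one absorbs the
    polynomial \<open>p\<close>, the other the extra factor \<open>y\<close> contributed by
    \<open>pCons\<close>.\<close>
  have "((\<lambda>y. a * exp (- y) + (poly p y * exp (- (y/2))) * (y * exp (- (y/2)))) \<longlongrightarrow> a * 0 + 0 * 0) at_top" if
    "((\<lambda>y. poly p y * exp (- (y/2))) \<longlongrightarrow> 0) at_top"
    by (intro tendsto_intros that; real_asymp)
  moreover have "((\<lambda>y. poly p y * exp (- (y/2))) \<longlongrightarrow> 0) at_top" for p :: "real poly"
  proof -
    have "((\<lambda>y. coeff p i * (y ^ i * exp (- (y/2)))) \<longlongrightarrow> coeff p i * 0) at_top" for i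
    proof (intro tendsto_intros)
      show "((\<lambda>y::real. y ^ i * exp (- (y/2))) \<longlongrightarrow> 0) at_top" by real_asymp
    qed
    then have "((\<lambda>y. \<Sum>i\<le>degree p. coeff p i * (y ^ i * exp (- (y/2)))) \<longlongrightarrow> (\<Sum>i\<le>degree p. coeff p i * 0)) at_top"
      by (rule tendsto_sum)
    then show ?thesis by (simp add: poly_altdef sum_distrib_right mult.assoc)
  qed
  ultimately have "((\<lambda>y. a * exp (- y) + (poly p y * exp (- (y/2))) * (y * exp (- (y/2)))) \<longlongrightarrow> 0) at_top"
    by simp
  moreover have "a * exp (- y) + (poly p y * exp (- (y/2))) * (y * exp (- (y/2))) = poly (pCons a p) y * exp (- y)" for y
    using exp_add[of "-(y/2)" "-(y/2)"] by (simp add: algebra_simps)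
  ultimately show ?case by simp
qed

lemma flat_has_derivative: "(flat m has_real_derivative flat (Suc m) x) (at x)"
proof -
  consider "x > 0" | "x < 0" | "x = 0" by linarith
  then show ?thesis
  proof cases
    case 1
    have "((\<lambda>x. poly (flat_poly m) (1 / x) * exp (- (1 / x))) has_real_derivative flat (Suc m) x) (at x)"
      using 1 by (auto intro!: derivative_eq_intros poly_DERIV[THEN DERIV_chain2]
          simp: flat_def poly_monom field_simps power2_eq_square)
    then show ?thesis
      by (rule has_field_derivative_transform_within_open[of _ _ _ "{0<..}"])
         (use 1 in \<open>auto simp: flat_def\<close>)
  next
    case 2
    have "((\<lambda>x. 0) has_real_derivative flat (Suc m) x) (at x)"
      using 2 by (auto simp: flat_def)
    then show ?thesis
      by (rule has_field_derivative_transform_within_open[of _ _ _ "{..<0}"])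
         (use 2 in \<open>auto simp: flat_def\<close>)
  next
    case 3
    \<comment> \<open>At the origin the difference quotient divides by \<open>h\<close> once more;
      \<open>pCons 0\<close> records this additional factor \<open>1 / h\<close>.\<close>
    have "((\<lambda>h. poly (pCons 0 (flat_poly m)) (1/h) * exp (- (1/h))) \<longlongrightarrow> 0) (at_right (0::real))"
      by (rule filterlim_compose[OF poly_times_exp_minus_tendsto_0]) real_asymp
    then have "((\<lambda>h. (flat m (0 + h) - flat m 0) / h) \<longlongrightarrow> 0) (at_right 0)"
      by (rule Lim_transform_eventually)
         (auto simp: flat_def eventually_at_right_field intro!: exI[of _ 1])
    moreover have "((\<lambda>h. (flat m (0 + h) - flat m 0) / h) \<longlongrightarrow> 0) (at_left 0)"
      by (rule Lim_transform_eventually[OF tendsto_const])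
         (auto simp: flat_def eventually_at_left_field intro!: exI[of _ "-1"])
    ultimately have "((\<lambda>h. (flat m (0 + h) - flat m 0) / h) \<longlongrightarrow> 0) (at 0)"
      by (simp add: filterlim_split_at_real)
    then show ?thesis
      using 3 by (simp add: DERIV_def flat_def)
  qed
qed

text \<open>The product over the axes is non-zero exactly on the open box. Hence powers of
  \<open>1 - bump a b\<close> tend to 0 on the box and stay equal to 1 off it, which is how
  indicators and cutoffs are approximated later.\<close>

definition bump :: "'a::euclidean_space \<Rightarrow> 'a \<Rightarrow> 'a \<Rightarrow> real" where
  "bump a b x = (\<Prod>i\<in>Basis. flat 0 (x \<bullet> i - a \<bullet> i) * flat 0 (b \<bullet> i - x \<bullet> i))"

lemma flat_0_bounds: "0 \<le> flat 0 x" "flat 0 x \<le> 1" "flat 0 x = 0 \<longleftrightarrow> x \<le> 0"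
  by (auto simp: flat_def)

lemma bump_bounds: "0 \<le> bump a b x" "bump a b x \<le> 1"
  unfolding bump_def
  by (auto intro!: prod_nonneg prod_le_1 mult_nonneg_nonneg mult_le_one simp: flat_0_bounds)

lemma bump_eq_0_iff: "bump a b x = 0 \<longleftrightarrow> x \<notin> box a b"
  by (force simp: bump_def flat_0_bounds mem_box not_less)

lemma smooth_fun_bump: "smooth_fun (bump a b)"
proof -
  have "smooth_fun (\<lambda>x. flat 0 (x \<bullet> i - a \<bullet> i))" "smooth_fun (\<lambda>x. flat 0 (b \<bullet> i - x \<bullet> i))" for i
    using smooth_fun_along_axis[of flat 0 1 i "- (a \<bullet> i)"] smooth_fun_along_axis[of flat 0 "-1" i "b \<bullet> i"]
      flat_has_derivative by auto
  then show ?thesis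
    unfolding bump_def by (intro smooth_fun_prod smooth_fun_mult) auto
qed

section \<open>Supports and gradients of test functions\<close>

lemma zero_outside_support: "x \<notin> closure {x. \<phi> x \<noteq> 0} \<Longrightarrow> \<phi> x = 0"
  using closure_subset[of "{x. \<phi> x \<noteq> 0}"] by blast

lemma test_fun_smooth_vanishing:
  assumes "smooth_fun \<psi>" "compact K" "K \<subseteq> \<Omega>" "\<And>x. x \<notin> K \<Longrightarrow> \<psi> x = 0"
  shows "test_fun \<Omega> \<psi>"
proof -
  have "closure {x. \<psi> x \<noteq> 0} \<subseteq> K"
    using assms by (intro closure_minimal) (auto intro: compact_imp_closed)
  moreover from this have "compact (closure {x. \<psi> x \<noteq> 0})"
    using compact_Int_closed[OF assms(2) closed_closure, of "{x. \<psi> x \<noteq> 0}"] by (simp add: Int_absorb1)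
  ultimately show ?thesis
    using assms unfolding test_fun_def by blast
qed

lemma test_fun_bump: "cbox a b \<subseteq> \<Omega> \<Longrightarrow> test_fun \<Omega> (bump a b)"
  using box_subset_cbox[of a b]
  by (intro test_fun_smooth_vanishing[of _ "cbox a b"] smooth_fun_bump) (auto simp: bump_eq_0_iff)

lemma test_fun_lincomb:
  assumes "test_fun \<Omega> \<phi>" "test_fun \<Omega> \<psi>"
  shows "test_fun \<Omega> (\<lambda>x. s * \<phi> x + t * \<psi> x)"
proof (rule test_fun_smooth_vanishing)
  show "smooth_fun (\<lambda>x. s * \<phi> x + t * \<psi> x)"
    using assms by (intro smooth_fun_add smooth_fun_mult smooth_fun_const) (auto simp: test_fun_def)
  show "compact (closure {x. \<phi> x \<noteq> 0} \<union> closure {x. \<psi> x \<noteq> 0})"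
    using assms by (auto simp: test_fun_def intro: compact_Un)
  show "closure {x. \<phi> x \<noteq> 0} \<union> closure {x. \<psi> x \<noteq> 0} \<subseteq> \<Omega>"
    using assms by (auto simp: test_fun_def)
  show "s * \<phi> x + t * \<psi> x = 0" if "x \<notin> closure {x. \<phi> x \<noteq> 0} \<union> closure {x. \<psi> x \<noteq> 0}" for x
    using that by (metis UnI1 UnI2 add.right_neutral mult_zero_right zero_outside_support)
qed

lemma test_fun_mult:
  assumes "test_fun \<Omega> \<phi>" "smooth_fun \<psi>"
  shows "test_fun \<Omega> (\<lambda>x. \<phi> x * \<psi> x)"
proof (rule test_fun_smooth_vanishing[of _ "closure {x. \<phi> x \<noteq> 0}"])
  show "smooth_fun (\<lambda>x. \<phi> x * \<psi> x)"
    using assms by (intro smooth_fun_mult) (auto simp: test_fun_def)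
  show "\<phi> x * \<psi> x = 0" if "x \<notin> closure {x. \<phi> x \<noteq> 0}" for x
    using that by (metis mult_zero_left zero_outside_support)
qed (use assms in \<open>auto simp: test_fun_def\<close>)

lemma test_fun_zero_outside: "test_fun \<Omega> \<phi> \<Longrightarrow> x \<notin> \<Omega> \<Longrightarrow> \<phi> x = 0"
  unfolding test_fun_def using zero_outside_support[of x \<phi>] by blast

lemma smooth_fun_imp_grad:
  assumes "smooth_fun \<phi>"
  shows "(\<phi> has_derivative (\<lambda>h. grad \<phi> x \<bullet> h)) (at x)" "continuous_on UNIV \<phi>" "continuous_on UNIV (grad \<phi>)"
proof -
  have 1: "\<phi> \<in> C_k (Suc 0)" using assms smooth_fun_def by blast
  then have d: "(\<phi> has_derivative frechet_derivative \<phi> (at x)) (at x)" for x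
    by (auto simp: differentiable_on_def frechet_derivative_works)
  have "frechet_derivative \<phi> (at x) h = grad \<phi> x \<bullet> h" for x h
  proof -
    interpret linear "frechet_derivative \<phi> (at x)"
      using d has_derivative_linear by blast
    have "frechet_derivative \<phi> (at x) h = frechet_derivative \<phi> (at x) (\<Sum>i\<in>Basis. (h \<bullet> i) *\<^sub>R i)"
      by (simp add: euclidean_representation)
    also have "\<dots> = grad \<phi> x \<bullet> h"
      unfolding grad_def by (simp add: sum scaleR inner_sum_left inner_sum_right inner_commute mult.commute)
    finally show ?thesis .
  qed
  with d show "(\<phi> has_derivative (\<lambda>h. grad \<phi> x \<bullet> h)) (at x)"
    by (metis (no_types, lifting) ext)
  show "continuous_on UNIV \<phi>"
    using C_k_Suc_D[OF 1] by simp
  show "continuous_on UNIV (grad \<phi>)"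
    using 1 unfolding grad_def
    by (intro continuous_on_sum continuous_on_scaleR continuous_on_const) simp
qed

lemma grad_unique:
  assumes "(\<phi> has_derivative (\<lambda>h. g \<bullet> h)) (at x)"
  shows "grad \<phi> x = g"
proof -
  have "frechet_derivative \<phi> (at x) = (\<lambda>h. g \<bullet> h)"
    using assms frechet_derivative_at by metis
  then show ?thesis by (simp add: grad_def euclidean_representation)
qed

lemma grad_lincomb:
  assumes "smooth_fun \<phi>" "smooth_fun \<psi>"
  shows "grad (\<lambda>x. s * \<phi> x + t * \<psi> x) x = s *\<^sub>R grad \<phi> x + t *\<^sub>R grad \<psi> x"
proof (rule grad_unique)
  have "((\<lambda>x. s * \<phi> x + t * \<psi> x) has_derivative (\<lambda>h. s * (grad \<phi> x \<bullet> h) + t * (grad \<psi> x \<bullet> h))) (at x)"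
    by (intro derivative_intros smooth_fun_imp_grad assms)
  then show "((\<lambda>x. s * \<phi> x + t * \<psi> x) has_derivative (\<lambda>h. (s *\<^sub>R grad \<phi> x + t *\<^sub>R grad \<psi> x) \<bullet> h)) (at x)"
    by (simp add: inner_add_left)
qed

lemma grad_mult:
  assumes "smooth_fun \<phi>" "smooth_fun \<psi>"
  shows "grad (\<lambda>x. \<phi> x * \<psi> x) x = \<phi> x *\<^sub>R grad \<psi> x + \<psi> x *\<^sub>R grad \<phi> x"
proof (rule grad_unique)
  have "((\<lambda>x. \<phi> x * \<psi> x) has_derivative (\<lambda>h. \<phi> x * (grad \<psi> x \<bullet> h) + (grad \<phi> x \<bullet> h) * \<psi> x)) (at x)"
    by (intro derivative_intros smooth_fun_imp_grad assms)
  then show "((\<lambda>x. \<phi> x * \<psi> x) has_derivative (\<lambda>h. (\<phi> x *\<^sub>R grad \<psi> x + \<psi> x *\<^sub>R grad \<phi> x) \<bullet> h)) (at x)"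
    by (simp add: inner_add_left mult.commute)
qed

lemma test_fun_grad_zero:
  assumes "test_fun \<Omega> \<phi>" "x \<notin> closure {x. \<phi> x \<noteq> 0}"
  shows "grad \<phi> x = 0"
proof (rule grad_unique)
  have "((\<lambda>x. 0) has_derivative (\<lambda>h. (0::'a) \<bullet> h)) (at x)" by simp
  then show "(\<phi> has_derivative (\<lambda>h. 0 \<bullet> h)) (at x)"
  proof (rule has_derivative_transform_within_open)
    show "open (- closure {x. \<phi> x \<noteq> 0})" by blast
    show "x \<in> - closure {x. \<phi> x \<noteq> 0}" using assms(2) by blast
    show "0 = \<phi> y" if "y \<in> - closure {x. \<phi> x \<noteq> 0}" for y
      using that zero_outside_support[of y \<phi>] by (metis ComplD)
  qed
qed

lemma test_fun_grad_zero_outside: "test_fun \<Omega> \<phi> \<Longrightarrow> x \<notin> \<Omega> \<Longrightarrow> grad \<phi> x = 0"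
  using test_fun_grad_zero[of \<Omega> \<phi> x] unfolding test_fun_def by blast

lemma test_fun_smooth: "test_fun \<Omega> \<phi> \<Longrightarrow> smooth_fun \<phi>"
  by (simp add: test_fun_def)

section \<open>Square integrable functions\<close>

text \<open>One notion for functions and for gradients, over any measure; \<open>L2_fun\<close> and
  \<open>L2_vfun\<close> are its two instances on the domain.\<close>

definition L2 :: "'x measure \<Rightarrow> ('x \<Rightarrow> 'b::euclidean_space) \<Rightarrow> bool" where
  "L2 M F \<longleftrightarrow> F \<in> borel_measurable M \<and> integrable M (\<lambda>x. (norm (F x))\<^sup>2)"

definition L2_norm :: "'x measure \<Rightarrow> ('x \<Rightarrow> 'b::euclidean_space) \<Rightarrow> real" where
  "L2_norm M F = sqrt (\<integral>x. (norm (F x))\<^sup>2 \<partial>M)"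

text \<open>The Cauchy-Schwarz inequality for a semidefinite form, reduced to its restriction to a
  line. It serves the L2 product, weighted integrals and the form of the linearised problem, all of
  which may degenerate; hence the case \<open>c = 0\<close>.\<close>

lemma quadratic_nonneg_imp_discrim:
  fixes a b c :: real
  assumes "\<And>t. 0 \<le> a + 2 * b * t + c * t\<^sup>2" "0 \<le> c"
  shows "b\<^sup>2 \<le> a * c"
proof (cases "c = 0")
  case True
  have "b = 0"
  proof (rule ccontr)
    assume "b \<noteq> 0"
    \<comment> \<open>For \<open>c = 0\<close> the expression is affine in \<open>t\<close>; this
      value of \<open>t\<close> makes it equal to -1.\<close>
    then show False using assms(1)[of "- (a + 1) / (2 * b)"] True by simp
  qed
  then show ?thesis using True by simp
next
  case False
  have "0 \<le> (a + 2 * b * (- b / c) + c * (- b / c)\<^sup>2) * c"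
    using assms(1)[of "- b / c"] assms(2) by (intro mult_nonneg_nonneg)
  also have "\<dots> = a * c - b\<^sup>2"
    using False by (simp add: field_simps power2_eq_square)
  finally show ?thesis by simp
qed

lemma L2_measurable: "L2 M F \<Longrightarrow> F \<in> borel_measurable M"
  by (simp add: L2_def)

lemma L2_integrable: "L2 M F \<Longrightarrow> integrable M (\<lambda>x. (norm (F x))\<^sup>2)"
  by (simp add: L2_def)

lemma L2_norm_nonneg [simp]: "0 \<le> L2_norm M F"
  by (simp add: L2_norm_def)

lemma L2_norm_square: "(L2_norm M F)\<^sup>2 = (\<integral>x. (norm (F x))\<^sup>2 \<partial>M)"
  by (simp add: L2_norm_def)

lemma L2_norm_cong: "AE x in M. norm (F x) = norm (G x) \<Longrightarrow> F \<in> borel_measurable M \<Longrightarrow> G \<in> borel_measurable M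
   \<Longrightarrow> L2_norm M F = L2_norm M G"
  unfolding L2_norm_def by (auto intro!: arg_cong[where f=sqrt] integral_cong_AE)

lemma L2_norm_mult_integrable:
  assumes "L2 M F" "L2 M G"
  shows "integrable M (\<lambda>x. norm (F x) * norm (G x))"
proof (rule Bochner_Integration.integrable_bound)
  show "integrable M (\<lambda>x. (norm (F x))\<^sup>2 + (norm (G x))\<^sup>2)"
    using assms by (auto simp: L2_def)
  show "(\<lambda>x. norm (F x) * norm (G x)) \<in> borel_measurable M"
    using assms by (intro borel_measurable_times borel_measurable_norm borel_measurable_inner) (auto simp: L2_def)
  have "norm (F x) * norm (G x) \<le> (norm (F x))\<^sup>2 + (norm (G x))\<^sup>2" for x
  proof -
    have "0 \<le> norm (F x) * norm (G x)" by simp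
    then show ?thesis
      using sum_squares_bound[of "norm (F x)" "norm (G x)"] by linarith
  qed
  then show "AE x in M. norm (norm (F x) * norm (G x)) \<le> norm ((norm (F x))\<^sup>2 + (norm (G x))\<^sup>2)"
    by auto
qed

lemma L2_inner_integrable:
  assumes "L2 M F" "L2 M G"
  shows "integrable M (\<lambda>x. F x \<bullet> G x)"
proof (rule Bochner_Integration.integrable_bound[OF L2_norm_mult_integrable[OF assms]])
  show "(\<lambda>x. F x \<bullet> G x) \<in> borel_measurable M"
    using assms by (intro borel_measurable_times borel_measurable_norm borel_measurable_inner) (auto simp: L2_def)
  show "AE x in M. norm (F x \<bullet> G x) \<le> norm (norm (F x) * norm (G x))"
    by (auto simp: Cauchy_Schwarz_ineq2)
qed

lemma L2_lincomb:
  assumes "L2 M F" "L2 M G"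
  shows "L2 M (\<lambda>x. s *\<^sub>R F x + t *\<^sub>R G x)"
proof -
  have [measurable]: "F \<in> borel_measurable M" "G \<in> borel_measurable M"
    using assms by (auto simp: L2_def)
  have "integrable M (\<lambda>x. s\<^sup>2 * (norm (F x))\<^sup>2 + 2 * s * t * (F x \<bullet> G x) + t\<^sup>2 * (norm (G x))\<^sup>2)"
    using assms L2_inner_integrable[OF assms] by (auto simp: L2_def)
  moreover have "(norm (s *\<^sub>R F x + t *\<^sub>R G x))\<^sup>2 =
      s\<^sup>2 * (norm (F x))\<^sup>2 + 2 * s * t * (F x \<bullet> G x) + t\<^sup>2 * (norm (G x))\<^sup>2" for x
    unfolding power2_norm_eq_inner
    by (simp add: inner_add_left inner_add_right inner_commute power2_eq_square algebra_simps)
  ultimately show ?thesis by (simp add: L2_def)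
qed

lemma L2_scale: "L2 M F \<Longrightarrow> L2 M (\<lambda>x. s *\<^sub>R F x)"
  using L2_lincomb[of M F F s 0] by simp

lemma L2_add: "L2 M F \<Longrightarrow> L2 M G \<Longrightarrow> L2 M (\<lambda>x. F x + G x)"
  using L2_lincomb[of M F G 1 1] by simp

lemma L2_diff: "L2 M F \<Longrightarrow> L2 M G \<Longrightarrow> L2 M (\<lambda>x. F x - G x)"
  using L2_lincomb[of M F G 1 "-1"] by simp

lemma L2_Cauchy_Schwarz:
  assumes "L2 M F" "L2 M G"
  shows "(\<integral>x. norm (F x) * norm (G x) \<partial>M) \<le> L2_norm M F * L2_norm M G"
    and "\<bar>\<integral>x. F x \<bullet> G x \<partial>M\<bar> \<le> L2_norm M F * L2_norm M G"
proof -
  have "(\<integral>x. norm (F x) * norm (G x) \<partial>M)\<^sup>2 \<le> (\<integral>x. (norm (F x))\<^sup>2 \<partial>M) * (\<integral>x. (norm (G x))\<^sup>2 \<partial>M)"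
  proof (rule quadratic_nonneg_imp_discrim)
    fix t :: real
    note int = L2_integrable[OF assms(1)] L2_integrable[OF assms(2)] L2_norm_mult_integrable[OF assms]
    have "0 \<le> (\<integral>x. (norm (F x) + t * norm (G x))\<^sup>2 \<partial>M)" by simp
    also have "\<dots> = (\<integral>x. (norm (F x))\<^sup>2 + 2 * t * (norm (F x) * norm (G x)) + t\<^sup>2 * (norm (G x))\<^sup>2 \<partial>M)"
      by (intro Bochner_Integration.integral_cong) (auto simp: power2_eq_square algebra_simps)
    also have "\<dots> = (\<integral>x. (norm (F x))\<^sup>2 \<partial>M) + 2 * t * (\<integral>x. norm (F x) * norm (G x) \<partial>M)
        + t\<^sup>2 * (\<integral>x. (norm (G x))\<^sup>2 \<partial>M)"
      using int by simp
    finally show "0 \<le> (\<integral>x. (norm (F x))\<^sup>2 \<partial>M) + 2 * (\<integral>x. norm (F x) * norm (G x) \<partial>M) * t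
        + (\<integral>x. (norm (G x))\<^sup>2 \<partial>M) * t\<^sup>2" by (simp add: mult_ac)
  qed simp
  also have "\<dots> = (L2_norm M F * L2_norm M G)\<^sup>2"
    by (simp add: power_mult_distrib L2_norm_square)
  finally show 1: "(\<integral>x. norm (F x) * norm (G x) \<partial>M) \<le> L2_norm M F * L2_norm M G"
    by (rule power2_le_imp_le) simp
  have "\<bar>\<integral>x. F x \<bullet> G x \<partial>M\<bar> \<le> (\<integral>x. \<bar>F x \<bullet> G x\<bar> \<partial>M)"
    by (rule integral_abs_bound)
  also have "\<dots> \<le> (\<integral>x. norm (F x) * norm (G x) \<partial>M)"
    using L2_inner_integrable[OF assms] L2_norm_mult_integrable[OF assms]
    by (intro integral_mono) (auto simp: Cauchy_Schwarz_ineq2)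
  finally show "\<bar>\<integral>x. F x \<bullet> G x \<partial>M\<bar> \<le> L2_norm M F * L2_norm M G" using 1 by simp
qed

lemma L2_norm_triangle:
  assumes "L2 M F" "L2 M G"
  shows "L2_norm M (\<lambda>x. F x + G x) \<le> L2_norm M F + L2_norm M G"
proof (rule power2_le_imp_le)
  have "(L2_norm M (\<lambda>x. F x + G x))\<^sup>2 = (\<integral>x. (norm (F x))\<^sup>2 + 2 * (F x \<bullet> G x) + (norm (G x))\<^sup>2 \<partial>M)"
    unfolding L2_norm_square
    by (intro Bochner_Integration.integral_cong)
      (auto simp: power2_norm_eq_inner inner_add_left inner_add_right inner_commute)
  also have "\<dots> = (L2_norm M F)\<^sup>2 + 2 * (\<integral>x. F x \<bullet> G x \<partial>M) + (L2_norm M G)\<^sup>2"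
    using assms L2_inner_integrable[OF assms] by (simp add: L2_norm_square L2_def)
  also have "\<dots> \<le> (L2_norm M F + L2_norm M G)\<^sup>2"
    using L2_Cauchy_Schwarz(2)[OF assms] by (simp add: power2_sum)
  finally show "(L2_norm M (\<lambda>x. F x + G x))\<^sup>2 \<le> (L2_norm M F + L2_norm M G)\<^sup>2" .
qed simp

lemma L2_norm_scale: "L2_norm M (\<lambda>x. s *\<^sub>R F x) = \<bar>s\<bar> * L2_norm M F"
  by (simp add: L2_norm_def power_mult_distrib real_sqrt_mult)

lemma L2_norm_minus_commute: "L2_norm M (\<lambda>x. F x - G x) = L2_norm M (\<lambda>x. G x - F x)"
  by (simp add: L2_norm_def norm_minus_commute)

lemma L2_norm_triangle_diff:
  assumes "L2 M F" "L2 M G" "L2 M H"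
  shows "L2_norm M (\<lambda>x. F x - H x) \<le> L2_norm M (\<lambda>x. F x - G x) + L2_norm M (\<lambda>x. G x - H x)"
  using L2_norm_triangle[OF L2_diff[OF assms(1,2)] L2_diff[OF assms(2,3)]] by simp

lemma L2_norm_le_diff:
  assumes "L2 M F" "L2 M G"
  shows "L2_norm M F \<le> L2_norm M G + L2_norm M (\<lambda>x. F x - G x)"
  using L2_norm_triangle[OF assms(2) L2_diff[OF assms]] by simp

lemma L2_nn_integral:
  assumes "L2 M F"
  shows "(\<integral>\<^sup>+x. ennreal ((norm (F x))\<^sup>2) \<partial>M) = ennreal ((L2_norm M F)\<^sup>2)"
  unfolding L2_norm_square
  by (rule nn_integral_eq_integral) (use assms in \<open>auto simp: L2_def\<close>)

lemma L2_I_nn_integral: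
  assumes "F \<in> borel_measurable M" "(\<integral>\<^sup>+x. ennreal ((norm (F x))\<^sup>2) \<partial>M) \<le> ennreal (c\<^sup>2)" "0 \<le> c"
  shows "L2 M F" "L2_norm M F \<le> c"
proof -
  show "L2 M F"
    unfolding L2_def
    using assms by (auto intro!: integrableI_bounded simp: less_top[symmetric] top_unique)
  from L2_nn_integral[OF this] assms have "(L2_norm M F)\<^sup>2 \<le> c\<^sup>2"
    by simp
  then show "L2_norm M F \<le> c"
    using assms(3) by (rule power2_le_imp_le)
qed

lemma L2_norm_eq_0_imp_AE:
  assumes "L2 M F" "L2_norm M F = 0"
  shows "AE x in M. F x = 0"
proof -
  have "(\<integral>x. (norm (F x))\<^sup>2 \<partial>M) = 0"
    using assms L2_norm_square[of M F] by simp
  then have "AE x in M. (norm (F x))\<^sup>2 = 0"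
    using assms by (subst (asm) integral_nonneg_eq_0_iff_AE) (auto simp: L2_def)
  then show ?thesis by auto
qed

section \<open>Almost everywhere convergence and completeness of L2\<close>

lemma L2_tendsto_AE_subseq:
  assumes "\<And>k. L2 M (F k)" "L2 M G" "(\<lambda>k. L2_norm M (\<lambda>x. F k x - G x)) \<longlonglongrightarrow> 0"
  obtains r where "strict_mono (r :: nat \<Rightarrow> nat)" "AE x in M. (\<lambda>k. F (r k) x) \<longlonglongrightarrow> G x"
proof -
  have "(\<lambda>k. (L2_norm M (\<lambda>x. F k x - G x))\<^sup>2) \<longlonglongrightarrow> 0\<^sup>2"
    using assms(3) by (rule tendsto_power)
  then have *: "(\<lambda>k. \<integral>x. norm ((norm (F k x - G x))\<^sup>2) \<partial>M) \<longlonglongrightarrow> 0"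
    by (simp add: L2_norm_square)
  have "\<exists>r::nat\<Rightarrow>nat. strict_mono r \<and> (AE x in M. (\<lambda>n. (norm (F (r n) x - G x))\<^sup>2) \<longlonglongrightarrow> 0)"
    by (rule tendsto_L1_AE_subseq[OF _ *]) (use L2_diff[OF assms(1,2)] in \<open>auto simp: L2_def\<close>)
  then obtain r :: "nat \<Rightarrow> nat" where r: "strict_mono r" "AE x in M. (\<lambda>n. (norm (F (r n) x - G x))\<^sup>2) \<longlonglongrightarrow> 0"
    by blast
  from r(2) have "AE x in M. (\<lambda>k. F (r k) x) \<longlonglongrightarrow> G x"
  proof (rule AE_mp[OF _ AE_I2], intro impI)
    fix x assume "(\<lambda>n. (norm (F (r n) x - G x))\<^sup>2) \<longlonglongrightarrow> 0"
    from tendsto_real_sqrt[OF this] show "(\<lambda>k. F (r k) x) \<longlonglongrightarrow> G x"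
      by (simp add: LIM_zero_cancel tendsto_norm_zero_iff)
  qed
  with r(1) that show thesis by blast
qed

text \<open>The rate 4^-k leaves room for a weight: the squared increments multiplied by 4^k still
  have integrals at most 4^-k, so their sum is finite almost everywhere. At such a point the
  increments are at most a constant times 2^-k and can be summed.\<close>

lemma L2_fast_Cauchy_AE_convergent:
  fixes F :: "nat \<Rightarrow> 'x \<Rightarrow> 'b::euclidean_space"
  assumes "\<And>k. L2 M (F k)" "\<And>k. L2_norm M (\<lambda>x. F (Suc k) x - F k x) \<le> (1/4)^k"
  shows "AE x in M. convergent (\<lambda>k. F k x)"
proof -
  define d where "d k x = (norm (F (Suc k) x - F k x))\<^sup>2" for k x
  have [measurable]: "F k \<in> borel_measurable M" for k
    using assms(1) by (rule L2_measurable)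
  have "(\<integral>\<^sup>+x. ennreal (4^k * d k x) \<partial>M) \<le> ennreal ((1/4)^k)" for k
  proof -
    have "(\<integral>\<^sup>+x. ennreal (4^k * d k x) \<partial>M) = 4^k * ennreal ((L2_norm M (\<lambda>x. F (Suc k) x - F k x))\<^sup>2)"
      unfolding L2_nn_integral[OF L2_diff[OF assms(1) assms(1)], symmetric]
      by (simp add: d_def ennreal_mult nn_integral_cmult ennreal_power[symmetric])
    also have "\<dots> \<le> 4^k * ennreal (((1/4)^k)\<^sup>2)"
      by (intro mult_left_mono ennreal_leI power_mono assms) auto
    also have "\<dots> = ennreal (4^k * ((1/4)^k)\<^sup>2)"
      by (simp add: ennreal_mult ennreal_power[symmetric])
    also have "(4::real)^k * ((1/4)^k)\<^sup>2 = (1/4)^k"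
      by (simp add: power_divide power2_eq_square)
    finally show ?thesis .
  qed
  then have "(\<Sum>k. \<integral>\<^sup>+x. ennreal (4^k * d k x) \<partial>M) \<le> (\<Sum>k. ennreal ((1/4)^k))"
    by (intro suminf_le) auto
  also have "\<dots> < \<infinity>"
    by (subst suminf_ennreal2) (auto simp: suminf_geometric)
  finally have "(\<integral>\<^sup>+x. (\<Sum>k. ennreal (4^k * d k x)) \<partial>M) \<noteq> \<infinity>"
    by (subst nn_integral_suminf) (auto simp: d_def)
  then have "AE x in M. (\<Sum>k. ennreal (4^k * d k x)) \<noteq> \<infinity>"
    by (intro nn_integral_noteq_infinite) (auto simp: d_def)
  then show ?thesis
  proof (rule AE_mp[OF _ AE_I2], intro impI)
    fix x assume fin: "(\<Sum>k. ennreal (4^k * d k x)) \<noteq> \<infinity>"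
    then obtain c where c: "(\<Sum>k. ennreal (4^k * d k x)) = ennreal c" "0 \<le> c"
      by (cases "\<Sum>k. ennreal (4^k * d k x)") auto
    have b: "norm (F (Suc k) x - F k x) \<le> sqrt c * (1/2)^k" for k
    proof -
      have "ennreal (4^k * d k x) \<le> ennreal c"
        unfolding c(1)[symmetric]
        using ennreal_suminf_lessD[of "\<lambda>k. ennreal (4^k * d k x)" _ k] by (meson not_le order.irrefl)
      then have "4^k * d k x \<le> c" using c by simp
      then have "d k x \<le> c * (1/4)^k" by (simp add: field_simps power_divide)
      then have "sqrt (d k x) \<le> sqrt (c * (1/4)^k)" by simp
      then show ?thesis by (simp add: d_def real_sqrt_mult real_sqrt_power real_sqrt_divide)
    qed
    have "summable (\<lambda>k. sqrt c * (1/2::real)^k)"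
      by (intro summable_mult summable_geometric) simp
    then have "summable (\<lambda>k. F (Suc k) x - F k x)"
      by (rule summable_comparison_test') (rule b)
    then have "convergent (\<lambda>n. \<Sum>k<n. F (Suc k) x - F k x)"
      by (simp add: summable_iff_convergent)
    then have "convergent (\<lambda>n. F n x - F 0 x)"
      unfolding sum_lessThan_telescope[of "\<lambda>k. F k x"] .
    from convergent_add[OF this convergent_const[of "F 0 x"]]
    show "convergent (\<lambda>k. F k x)" by simp
  qed
qed

lemma L2_complete:
  fixes F :: "nat \<Rightarrow> 'x \<Rightarrow> 'b::euclidean_space"
  assumes L2: "\<And>k. L2 M (F k)"
    and C: "\<And>e. e > 0 \<Longrightarrow> \<exists>N. \<forall>m\<ge>N. \<forall>n\<ge>N. L2_norm M (\<lambda>x. F m x - F n x) < e"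
  obtains G where "L2 M G" "(\<lambda>k. L2_norm M (\<lambda>x. F k x - G x)) \<longlonglongrightarrow> 0"
proof -
  have m [measurable]: "F k \<in> borel_measurable M" for k
    using L2 by (rule L2_measurable)
  have "\<exists>N. \<forall>m\<ge>N. \<forall>n\<ge>N. L2_norm M (\<lambda>x. F m x - F n x) < (1/4)^k" for k
    by (rule C) simp
  then obtain N where N: "\<And>k m n. m \<ge> N k \<Longrightarrow> n \<ge> N k \<Longrightarrow> L2_norm M (\<lambda>x. F m x - F n x) < (1/4)^k"
    by metis
  \<comment> \<open>Summing all thresholds makes both \<open>r k\<close> and
    \<open>r (Suc k)\<close> at least \<open>N k\<close>; the summand \<open>k\<close> makes the
    indices tend to infinity.\<close>
  define r where "r k = k + (\<Sum>i\<le>k. N i)" for k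
  have r: "r k \<ge> N k" "r (Suc k) \<ge> N k" "r k \<ge> k" for k
    using member_le_sum[of k "{..k}" N] by (auto simp: r_def)
  have "AE x in M. convergent (\<lambda>k. F (r k) x)"
  proof (rule L2_fast_Cauchy_AE_convergent)
    show "L2_norm M (\<lambda>x. F (r (Suc k)) x - F (r k) x) \<le> (1/4)^k" for k
      using N[OF r(2) r(1)] less_imp_le by blast
  qed (rule L2)
  define G where "G x = lim (\<lambda>k. F (r k) x)" for x
  have [measurable]: "G \<in> borel_measurable M"
    unfolding G_def by measurable
  have conv: "AE x in M. (\<lambda>k. F (r k) x) \<longlonglongrightarrow> G x"
    using \<open>AE x in M. convergent (\<lambda>k. F (r k) x)\<close> unfolding G_def convergent_LIMSEQ_iff .
  \<comment> \<open>Fatou's lemma along \<open>r\<close> turns the Cauchy bound into a bound on the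
    distance to the pointwise limit. Square integrability of the difference comes with it, and
    thereby that of \<open>G\<close>.\<close>
  have *: "L2 M (\<lambda>x. F n x - G x) \<and> L2_norm M (\<lambda>x. F n x - G x) \<le> e"
    if "e > 0" and n: "\<And>k. k \<ge> n \<Longrightarrow> L2_norm M (\<lambda>x. F n x - F k x) < e" for n e
  proof -
    have "(\<integral>\<^sup>+x. ennreal ((norm (F n x - G x))\<^sup>2) \<partial>M)
        \<le> (\<integral>\<^sup>+x. liminf (\<lambda>k. ennreal ((norm (F n x - F (r k) x))\<^sup>2)) \<partial>M)"
    proof (rule nn_integral_mono_AE, rule AE_mp[OF conv AE_I2], intro impI)
      fix x assume "(\<lambda>k. F (r k) x) \<longlonglongrightarrow> G x"
      then have "(\<lambda>k. ennreal ((norm (F n x - F (r k) x))\<^sup>2)) \<longlonglongrightarrow> ennreal ((norm (F n x - G x))\<^sup>2)"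
        by (intro tendsto_intros)
      then show "ennreal ((norm (F n x - G x))\<^sup>2) \<le> liminf (\<lambda>k. ennreal ((norm (F n x - F (r k) x))\<^sup>2))"
        using lim_imp_Liminf[OF sequentially_bot, symmetric] by (intro eq_refl) blast
    qed
    also have "\<dots> \<le> liminf (\<lambda>k. \<integral>\<^sup>+x. ennreal ((norm (F n x - F (r k) x))\<^sup>2) \<partial>M)"
      by (rule nn_integral_liminf) simp
    also have "\<dots> = liminf (\<lambda>k. ennreal ((L2_norm M (\<lambda>x. F n x - F (r k) x))\<^sup>2))"
      by (simp add: L2_nn_integral[OF L2_diff[OF L2 L2]])
    also have "\<dots> \<le> liminf (\<lambda>k. ennreal (e\<^sup>2))"
    proof (rule Liminf_mono, rule eventually_sequentiallyI[of n])
      fix k assume "n \<le> k"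
      then have "L2_norm M (\<lambda>x. F n x - F (r k) x) < e" using n[of "r k"] r(3)[of k] by simp
      then show "ennreal ((L2_norm M (\<lambda>x. F n x - F (r k) x))\<^sup>2) \<le> ennreal (e\<^sup>2)"
        by (intro ennreal_leI power_mono) auto
    qed
    finally show ?thesis
      using L2_I_nn_integral[of "\<lambda>x. F n x - G x" M e] that(1) by (simp add: Liminf_const)
  qed
  have **: "\<exists>N. \<forall>n\<ge>N. L2 M (\<lambda>x. F n x - G x) \<and> L2_norm M (\<lambda>x. F n x - G x) \<le> e" if e: "e > 0" for e
  proof -
    from C[OF e] obtain N where N: "\<And>m n. m \<ge> N \<Longrightarrow> n \<ge> N \<Longrightarrow> L2_norm M (\<lambda>x. F m x - F n x) < e" by blast
    have "L2 M (\<lambda>x. F n x - G x) \<and> L2_norm M (\<lambda>x. F n x - G x) \<le> e" if "n \<ge> N" for n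
      by (rule *[OF e]) (use N that in force)
    then show ?thesis by blast
  qed
  show thesis
  proof
    from **[of 1] obtain n where "L2 M (\<lambda>x. F n x - G x)" by auto
    from L2_diff[OF L2[of n] this] show "L2 M G" by simp
    show "(\<lambda>k. L2_norm M (\<lambda>x. F k x - G x)) \<longlonglongrightarrow> 0"
    proof (rule LIMSEQ_I)
      fix e :: real assume "0 < e"
      with **[of "e/2"] obtain N where N: "\<And>n. n \<ge> N \<Longrightarrow> L2_norm M (\<lambda>x. F n x - G x) \<le> e/2" by auto
      have "norm (L2_norm M (\<lambda>x. F n x - G x) - 0) < e" if "n \<ge> N" for n
        using N[OF that] \<open>0 < e\<close> by simp
      then show "\<exists>no. \<forall>n\<ge>no. norm (L2_norm M (\<lambda>x. F n x - G x) - 0) < e"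
        by blast
    qed
  qed
qed

lemma L2_inner_tendsto:
  assumes "\<And>k. L2 M (F k)" "L2 M G" "(\<lambda>k. L2_norm M (\<lambda>x. F k x - G x)) \<longlonglongrightarrow> 0" "L2 M H"
  shows "(\<lambda>k. \<integral>x. F k x \<bullet> H x \<partial>M) \<longlonglongrightarrow> (\<integral>x. G x \<bullet> H x \<partial>M)"
proof -
  have 1: "\<bar>(\<integral>x. F k x \<bullet> H x \<partial>M) - (\<integral>x. G x \<bullet> H x \<partial>M)\<bar> \<le> L2_norm M (\<lambda>x. F k x - G x) * L2_norm M H" for k
    using L2_Cauchy_Schwarz(2)[OF L2_diff[OF assms(1,2)] assms(4), of k]
      L2_inner_integrable[OF assms(1,4)] L2_inner_integrable[OF assms(2,4)]
    by (simp add: inner_diff_left)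
  have 2: "(\<lambda>k. L2_norm M (\<lambda>x. F k x - G x) * L2_norm M H) \<longlonglongrightarrow> 0"
    using tendsto_mult_right[OF assms(3), of "L2_norm M H"] by simp
  have "(\<lambda>k. (\<integral>x. F k x \<bullet> H x \<partial>M) - (\<integral>x. G x \<bullet> H x \<partial>M)) \<longlonglongrightarrow> 0"
    by (rule Lim_null_comparison[OF always_eventually 2]) (use 1 in simp)
  then show ?thesis by (simp add: LIM_zero_iff)
qed

section \<open>The space \<open>H10\<close>\<close>

lemma tendsto_0_if_square_tendsto_0:
  fixes f :: "nat \<Rightarrow> real"
  assumes "(\<lambda>k. (f k)\<^sup>2) \<longlonglongrightarrow> 0"
  shows "f \<longlonglongrightarrow> 0"
  using tendsto_real_sqrt[OF assms] by (simp add: tendsto_rabs_zero_iff)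

lemma integrable_lborel_compact_support:
  fixes f :: "'a::euclidean_space \<Rightarrow> 'b::euclidean_space"
  assumes "continuous_on UNIV f" "compact K" "\<And>x. x \<notin> K \<Longrightarrow> f x = 0"
  shows "integrable lborel f"
proof -
  have "integrable lborel (\<lambda>x. indicator K x *\<^sub>R f x)"
    using assms by (intro borel_integrable_compact) (auto intro: continuous_on_subset)
  moreover have "(\<lambda>x. indicator K x *\<^sub>R f x) = f"
    using assms(3) by (auto simp: fun_eq_iff indicator_def)
  ultimately show ?thesis by simp
qed

text \<open>By translation invariance every difference quotient in the direction \<open>i\<close>
  has integral 0. Compact support makes \<open>\<eta>\<close> Lipschitz, so the quotients are
  dominated and the identity passes to the limit.\<close>

lemma integral_grad_eq_0:
  assumes "test_fun \<Omega> \<eta>"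
  shows "(\<integral>x. grad \<eta> x \<bullet> i \<partial>lborel) = 0"
proof -
  define K where "K = closure {x. \<eta> x \<noteq> 0}"
  have K: "compact K" "\<And>x. x \<notin> K \<Longrightarrow> \<eta> x = 0" "\<And>x. x \<notin> K \<Longrightarrow> grad \<eta> x = 0"
  proof -
    show "compact K" using assms by (simp add: K_def test_fun_def)
  qed (unfold K_def, rule zero_outside_support, assumption, rule test_fun_grad_zero[OF assms])
  note sm = smooth_fun_imp_grad[OF test_fun_smooth[OF assms]]
  obtain R where R: "\<And>x. x \<in> K \<Longrightarrow> norm x \<le> R"
    using compact_imp_bounded[OF K(1)] by (auto simp: bounded_iff)
  have "compact (grad \<eta> ` K)"
    using sm(3) K(1) by (intro compact_continuous_image) (auto intro: continuous_on_subset)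
  then obtain B where B: "\<And>x. x \<in> K \<Longrightarrow> norm (grad \<eta> x) \<le> B" "0 < B"
    using compact_imp_bounded bounded_pos by (metis imageI)
  have B': "norm (grad \<eta> x) \<le> B" for x
    using B K(3) by (cases "x \<in> K") auto
  have lip: "\<bar>\<eta> y - \<eta> x\<bar> \<le> B * norm (y - x)" for x y
  proof -
    have "norm (grad \<eta> x \<bullet> h) \<le> B * norm h" for x h
      using Cauchy_Schwarz_ineq2[of "grad \<eta> x" h] mult_right_mono[OF B'[of x] norm_ge_zero[of h]] by simp
    then have "onorm (\<lambda>h. grad \<eta> x \<bullet> h) \<le> B" for x
      by (rule onorm_le)
    then have "norm (\<eta> y - \<eta> x) \<le> B * norm (y - x)"
      by (intro differentiable_bound[of UNIV \<eta>]) (auto intro: has_derivative_at_withinI sm(1))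
    then show ?thesis by simp
  qed
  have int: "integrable lborel \<eta>"
    by (rule integrable_lborel_compact_support[OF sm(2) K(1,2)])
  define t where "t n = inverse (real (Suc n))" for n
  have t: "t n > 0" "t n \<le> 1" for n by (auto simp: t_def inverse_eq_divide divide_le_eq)
  have t0: "t \<longlonglongrightarrow> 0" unfolding t_def by (rule LIMSEQ_inverse_real_of_nat)
  have [measurable]: "\<eta> \<in> borel_measurable borel" "grad \<eta> \<in> borel_measurable borel"
    using sm by (auto intro: borel_measurable_continuous_onI)
  have zero: "(\<integral>x. (\<eta> (x + t n *\<^sub>R i) - \<eta> x) / t n \<partial>lborel) = 0" for n
  proof -
    have d: "lborel = distr lborel borel (\<lambda>x. t n *\<^sub>R i + x)"
      using lborel_distr_plus[of "t n *\<^sub>R i"] by simp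
    have "integrable lborel (\<lambda>x. \<eta> (t n *\<^sub>R i + x))"
      using int by (subst (asm) d) (simp add: integrable_distr_eq)
    moreover have "(\<integral>x. \<eta> x \<partial>lborel) = (\<integral>x. \<eta> (t n *\<^sub>R i + x) \<partial>lborel)"
      by (subst d) (simp add: integral_distr)
    ultimately show ?thesis using int by (simp add: add.commute)
  qed
  have "(\<lambda>n. \<integral>x. (\<eta> (x + t n *\<^sub>R i) - \<eta> x) / t n \<partial>lborel) \<longlonglongrightarrow> (\<integral>x. grad \<eta> x \<bullet> i \<partial>lborel)"
  \<comment> \<open>Since \<open>t n \<le> 1\<close>, shifting moves the support, which lies in the
    ball of radius \<open>R\<close>, by at most \<open>norm i\<close>. The enlarged ball carries all
    quotients.\<close>
  proof (rule integral_dominated_convergence[where w = "\<lambda>x. indicator (cball 0 (R + norm i)) x *\<^sub>R (B * norm i)"])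
    show "integrable lborel (\<lambda>x. indicat_real (cball 0 (R + norm i)) x *\<^sub>R (B * norm i))"
      by (intro borel_integrable_compact) auto
    show "AE x in lborel. (\<lambda>n. (\<eta> (x + t n *\<^sub>R i) - \<eta> x) / t n) \<longlonglongrightarrow> grad \<eta> x \<bullet> i"
    proof (rule AE_I2)
      fix x
      have "((\<lambda>s. \<eta> (x + s *\<^sub>R i)) has_derivative (\<lambda>s. grad \<eta> (x + 0 *\<^sub>R i) \<bullet> (s *\<^sub>R i))) (at 0)"
        by (rule has_derivative_compose[OF _ sm(1)]) (auto intro!: derivative_eq_intros)
      then have "((\<lambda>s. \<eta> (x + s *\<^sub>R i)) has_real_derivative (grad \<eta> x \<bullet> i)) (at 0)"
        by (simp add: has_field_derivative_def mult_commute_abs)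
      then have "((\<lambda>s. (\<eta> (x + s *\<^sub>R i) - \<eta> x) / s) \<longlongrightarrow> grad \<eta> x \<bullet> i) (at 0)"
        by (simp add: DERIV_def)
      moreover have "filterlim t (at 0) sequentially"
        using t0 t(1) by (auto simp: filterlim_at less_imp_neq[THEN not_sym] intro!: always_eventually)
      ultimately show "(\<lambda>n. (\<eta> (x + t n *\<^sub>R i) - \<eta> x) / t n) \<longlonglongrightarrow> grad \<eta> x \<bullet> i"
        by (rule filterlim_compose)
    qed
    show "AE x in lborel. norm ((\<eta> (x + t n *\<^sub>R i) - \<eta> x) / t n) \<le> indicat_real (cball 0 (R + norm i)) x *\<^sub>R (B * norm i)" for n
    proof (rule AE_I2)
      fix x
      show "norm ((\<eta> (x + t n *\<^sub>R i) - \<eta> x) / t n) \<le> indicat_real (cball 0 (R + norm i)) x *\<^sub>R (B * norm i)"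
      proof (cases "x \<in> cball 0 (R + norm i)")
        case True
        have "\<bar>\<eta> (x + t n *\<^sub>R i) - \<eta> x\<bar> \<le> B * (t n * norm i)"
          using lip[of "x + t n *\<^sub>R i" x] t(1)[of n] by simp
        then show ?thesis using True t(1)[of n] by (simp add: field_simps)
      next
        case False
        then have nx: "norm x > R + norm i" by simp
        have "norm (x + t n *\<^sub>R i) \<ge> norm x - t n * norm i"
          using norm_diff_ineq[of x "t n *\<^sub>R i"] t(1)[of n] by simp
        moreover have "t n * norm i \<le> norm i" using t(2)[of n] by (simp add: mult_left_le_one_le t(1) less_imp_le)
        ultimately have "x + t n *\<^sub>R i \<notin> K" "x \<notin> K"
          using nx R[of x] R[of "x + t n *\<^sub>R i"] norm_ge_zero[of i] by linarith+
        then show ?thesis using K(2) False by simp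
      qed
    qed
  qed measurable
  then show ?thesis unfolding zero by (simp add: LIMSEQ_const_iff)
qed

text \<open>The positive and the negative part of \<open>h\<close> are densities of two measures
  that agree on boxes. Boxes form an intersection-stable generator, so the measures coincide, and
  uniqueness of densities identifies the two parts almost everywhere. As one of them is 0 at each
  point, both vanish.\<close>

lemma AE_zero_if_integral_boxes_zero:
  fixes h :: "'a::euclidean_space \<Rightarrow> real"
  assumes int: "integrable lborel h"
    and box: "\<And>c d. (\<integral>x. h x * indicator (box c d) x \<partial>lborel) = 0"
  shows "AE x in lborel. h x = 0"
proof -
  have [measurable]: "h \<in> borel_measurable borel" using int by auto
  define P where "P x = ennreal (max 0 (h x))" for x
  define N where "N x = ennreal (max 0 (- h x))" for x
  have [measurable]: "P \<in> borel_measurable borel" "N \<in> borel_measurable borel"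
    unfolding P_def N_def by measurable
  have ip: "integrable lborel (\<lambda>x. max 0 (h x) * indicator A x)" "integrable lborel (\<lambda>x. max 0 (- h x) * indicator A x)"
    if "A \<in> sets borel" for A
    using integrable_mult_indicator[of A lborel "\<lambda>x. max 0 (h x)"] integrable_mult_indicator[of A lborel "\<lambda>x. max 0 (- h x)"]
      that int by (simp_all add: mult.commute)
  have eP: "emeasure (density lborel P) A = ennreal (\<integral>x. max 0 (h x) * indicator A x \<partial>lborel)" if "A \<in> sets borel" for A
    using that ip[OF that]
    by (subst nn_integral_eq_integral[symmetric])
       (auto simp: emeasure_density P_def ennreal_mult ennreal_indicator)
  have eN: "emeasure (density lborel N) A = ennreal (\<integral>x. max 0 (- h x) * indicator A x \<partial>lborel)" if "A \<in> sets borel" for A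
    using that ip[OF that]
    by (subst nn_integral_eq_integral[symmetric])
       (auto simp: emeasure_density N_def ennreal_mult ennreal_indicator)
  have "density lborel P = density lborel N"
  proof (rule measure_eqI_generator_eq[where E="range (\<lambda>(a, b). box a b)" and \<Omega>=UNIV and A="\<lambda>n. box (- real n *\<^sub>R One) (real n *\<^sub>R One)"])
    show "Int_stable (range (\<lambda>(a, b). box a (b::'a)))"
      by (auto simp: Int_stable_def box_Int_box)
    show "range (\<lambda>(a, b). box a b) \<subseteq> Pow UNIV" by simp
    show "sets (density lborel P) = sigma_sets UNIV (range (\<lambda>(a, b). box a b))"
      "sets (density lborel N) = sigma_sets UNIV (range (\<lambda>(a, b). box a b))"
      by (simp_all add: borel_eq_box)
    show "range (\<lambda>n. box (- real n *\<^sub>R One) (real n *\<^sub>R One)) \<subseteq> range (\<lambda>(a, b). box a (b::'a))"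
      by auto
    show "(\<Union>n. box (- real n *\<^sub>R One) (real n *\<^sub>R One)) = (UNIV::'a set)"
      by (simp add: UN_box_eq_UNIV)
    show "emeasure (density lborel P) (box (- real n *\<^sub>R One) (real n *\<^sub>R One)) \<noteq> \<infinity>" for n
      by (simp add: eP)
    fix X assume "X \<in> range (\<lambda>(a, b). box a (b::'a))"
    then obtain c d where X: "X = box c d" by auto
    have "(\<integral>x. max 0 (h x) * indicator X x \<partial>lborel) - (\<integral>x. max 0 (- h x) * indicator X x \<partial>lborel)
       = (\<integral>x. max 0 (h x) * indicator X x - max 0 (- h x) * indicator X x \<partial>lborel)"
      using ip[of X] X by simp
    also have "\<dots> = (\<integral>x. h x * indicator X x \<partial>lborel)"
      by (intro Bochner_Integration.integral_cong) (auto simp: max_def indicator_def)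
    finally show "emeasure (density lborel P) X = emeasure (density lborel N) X"
      using box X by (simp add: eP eN)
  qed
  then have "AE x in lborel. P x = N x"
    using sigma_finite_measure.density_unique_iff[OF lborel.sigma_finite_measure_axioms, of P N] by simp
  then show ?thesis
    by (rule AE_mp) (auto intro!: AE_I2 simp: P_def N_def max_def ennreal_eq_0_iff split: if_splits)
qed

text \<open>Countability allows the null sets of local statements to be united. The closed boxes
  stay inside the open set so that the bumps on them are test functions.\<close>

lemma open_countable_box_cover:
  fixes \<Omega> :: "'a::euclidean_space set"
  assumes "open \<Omega>" "\<Omega> \<noteq> {}"
  obtains a b :: "nat \<Rightarrow> 'a" where "\<And>i. cbox (a i) (b i) \<subseteq> \<Omega>" "(\<Union>i. box (a i) (b i)) = \<Omega>"
proof -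
  define F where "F = {box a b | a b. cbox a b \<subseteq> \<Omega>}"
  have "\<Union>F = \<Omega>"
  proof
    show "\<Union>F \<subseteq> \<Omega>" unfolding F_def using box_subset_cbox by blast
    show "\<Omega> \<subseteq> \<Union>F"
    proof
      fix x assume "x \<in> \<Omega>"
      then obtain a b where "x \<in> box a b" "cbox a b \<subseteq> \<Omega>"
        using open_contains_cbox assms(1) by metis
      then show "x \<in> \<Union>F" unfolding F_def by blast
    qed
  qed
  moreover obtain F' where F': "F' \<subseteq> F" "countable F'" "\<Union>F' = \<Union>F"
    using Lindelof[of F] unfolding F_def by blast
  ultimately have "F' \<noteq> {}" using assms by auto
  then obtain g :: "nat \<Rightarrow> 'a set" where g: "range g = F'"
    using F'(2) by (metis range_from_nat_into)
  have "\<exists>ab. g i = box (fst ab) (snd ab) \<and> cbox (fst ab) (snd ab) \<subseteq> \<Omega>" for i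
  proof -
    have "g i \<in> F" using g F'(1) by blast
    then obtain a b where "g i = box a b" "cbox a b \<subseteq> \<Omega>" unfolding F_def by blast
    then show ?thesis by (intro exI[of _ "(a, b)"]) simp
  qed
  then obtain ab where ab: "\<And>i. g i = box (fst (ab i)) (snd (ab i)) \<and> cbox (fst (ab i)) (snd (ab i)) \<subseteq> \<Omega>"
    by metis
  show thesis
  proof
    show "cbox ((fst \<circ> ab) i) ((snd \<circ> ab) i) \<subseteq> \<Omega>" for i using ab by simp
    have "(\<Union>i. box ((fst \<circ> ab) i) ((snd \<circ> ab) i)) = (\<Union>i. g i)" using ab by simp
    also have "\<dots> = \<Omega>" using g F'(3) \<open>\<Union>F = \<Omega>\<close> by simp
    finally show "(\<Union>i. box ((fst \<circ> ab) i) ((snd \<circ> ab) i)) = \<Omega>" .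
  qed
qed

locale bounded_domain =
  fixes \<Omega> :: "'a::euclidean_space set"
  assumes open_domain: "open \<Omega>" and bounded_domain: "bounded \<Omega>" and nonempty_domain: "\<Omega> \<noteq> {}"
begin

abbreviation M :: "'a measure" where "M \<equiv> lebesgue_on \<Omega>"

lemma sets_domain [simp, intro]: "\<Omega> \<in> sets lebesgue" "\<Omega> \<in> sets borel" "\<Omega> \<inter> space lebesgue \<in> sets lebesgue"
  using open_domain by auto

lemma finite_measure_M: "finite_measure M"
proof
  have "emeasure lborel \<Omega> < \<infinity>"
    using bounded_domain emeasure_bounded_finite by blast
  then show "emeasure M (space M) \<noteq> \<infinity>"
    by (simp add: emeasure_restrict_space space_restrict_space)
qed

sublocale M: finite_measure M by (rule finite_measure_M)

lemma borel_measurable_M: "f \<in> borel_measurable borel \<Longrightarrow> f \<in> borel_measurable M"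
  by (intro measurable_restrict_space1 measurable_completion) simp

lemma continuous_measurable_M:
  fixes f :: "'a \<Rightarrow> 'b::topological_space"
  shows "continuous_on UNIV f \<Longrightarrow> f \<in> borel_measurable M"
  by (intro borel_measurable_M borel_measurable_continuous_onI)

lemma nn_integral_M:
  assumes "f \<in> borel_measurable borel" "\<And>x. x \<notin> \<Omega> \<Longrightarrow> f x = 0"
  shows "(\<integral>\<^sup>+x. f x \<partial>M) = (\<integral>\<^sup>+x. f x \<partial>lborel)"
proof -
  have "(\<integral>\<^sup>+x. f x \<partial>M) = (\<integral>\<^sup>+x. f x * indicator \<Omega> x \<partial>lebesgue)"
    by (rule nn_integral_restrict_space) simp
  also have "\<dots> = (\<integral>\<^sup>+x. f x \<partial>lebesgue)"
    using assms(2) by (intro nn_integral_cong) (auto simp: indicator_def)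
  also have "\<dots> = (\<integral>\<^sup>+x. f x \<partial>lborel)"
    using assms(1) by (intro nn_integral_completion)
  finally show ?thesis .
qed

lemma integral_M:
  fixes f :: "'a \<Rightarrow> 'b::euclidean_space"
  assumes "f \<in> borel_measurable borel" "\<And>x. x \<notin> \<Omega> \<Longrightarrow> f x = 0"
  shows "(\<integral>x. f x \<partial>M) = (\<integral>x. f x \<partial>lborel)"
proof -
  have "(\<integral>x. f x \<partial>M) = (\<integral>x. indicator \<Omega> x *\<^sub>R f x \<partial>lebesgue)"
    by (rule integral_restrict_space) simp
  also have "\<dots> = (\<integral>x. f x \<partial>lebesgue)"
    using assms(2) by (intro Bochner_Integration.integral_cong) (auto simp: indicator_def)
  also have "\<dots> = (\<integral>x. f x \<partial>lborel)"
    using assms(1) by (intro integral_completion) simp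
  finally show ?thesis .
qed

lemma L2_bounded:
  fixes f :: "'a \<Rightarrow> 'b::euclidean_space"
  assumes "f \<in> borel_measurable M" "\<And>x. norm (f x) \<le> B"
  shows "L2 M f"
  unfolding L2_def
proof
  show "integrable M (\<lambda>x. (norm (f x))\<^sup>2)"
    by (rule M.integrable_const_bound[of _ "B\<^sup>2"]) (use assms in \<open>auto intro!: power_mono\<close>)
qed (rule assms)

lemma L2_integrable_M:
  fixes f :: "'a \<Rightarrow> 'b::euclidean_space"
  assumes "L2 M f" shows "integrable M f"
proof (rule Bochner_Integration.integrable_bound)
  show "integrable M (\<lambda>x. 1 + (norm (f x))\<^sup>2)" using assms by (auto simp: L2_def)
  show "f \<in> borel_measurable M" using assms by (simp add: L2_def)
  have "norm y \<le> 1 + (norm y)\<^sup>2" for y :: 'b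
  proof -
    have "2 * norm y \<le> 1 + (norm y)\<^sup>2" using sum_squares_bound[of 1 "norm y"] by simp
    then show ?thesis using norm_ge_zero[of y] by linarith
  qed
  then show "AE x in M. norm (f x) \<le> norm (1 + (norm (f x))\<^sup>2)" by auto
qed

lemma compact_support_bounded:
  fixes f :: "'a \<Rightarrow> 'b::euclidean_space"
  assumes "continuous_on UNIV f" "compact K" "\<And>x. x \<notin> K \<Longrightarrow> f x = 0"
  obtains B where "\<And>x. norm (f x) \<le> B" "0 < B"
proof -
  have "bounded (f ` K)"
    using assms by (intro compact_imp_bounded compact_continuous_image) (auto intro: continuous_on_subset)
  then obtain B where "\<And>x. x \<in> K \<Longrightarrow> norm (f x) \<le> B" "0 < B"
    unfolding bounded_pos by blast
  with assms(3) that show thesis by (metis norm_zero less_imp_le)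
qed

lemma test_fun_bounded:
  assumes "test_fun \<Omega> \<phi>"
  obtains B where "\<And>x. \<bar>\<phi> x\<bar> \<le> B" "\<And>x. norm (grad \<phi> x) \<le> B" "0 < B"
proof -
  note sm = smooth_fun_imp_grad[OF test_fun_smooth[OF assms]]
  have K: "compact (closure {x. \<phi> x \<noteq> 0})" using assms by (simp add: test_fun_def)
  obtain B where "\<And>x. norm (\<phi> x) \<le> B" "0 < B"
    using compact_support_bounded[OF sm(2) K zero_outside_support[of _ \<phi>]] by blast
  moreover obtain B' where "\<And>x. norm (grad \<phi> x) \<le> B'" "0 < B'"
    using compact_support_bounded[OF sm(3) K test_fun_grad_zero[OF assms]] by blast
  ultimately show thesis by (intro that[of "max B B'"]) (auto simp: le_max_iff_disj)
qed

lemma test_fun_L2: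
  assumes "test_fun \<Omega> \<phi>"
  shows "L2 M \<phi>" "L2 M (grad \<phi>)"
proof -
  note sm = smooth_fun_imp_grad[OF test_fun_smooth[OF assms]]
  obtain B where "\<And>x. \<bar>\<phi> x\<bar> \<le> B" "\<And>x. norm (grad \<phi> x) \<le> B" using test_fun_bounded[OF assms] by metis
  then show "L2 M \<phi>" "L2 M (grad \<phi>)"
    by (auto intro!: L2_bounded continuous_measurable_M sm)
qed

lemma integration_by_parts:
  assumes "test_fun \<Omega> \<phi>" "test_fun \<Omega> \<psi>"
  shows "(\<integral>x. \<phi> x * (grad \<psi> x \<bullet> i) \<partial>M) = - (\<integral>x. (grad \<phi> x \<bullet> i) * \<psi> x \<partial>M)"
proof -
  note sm = assms[THEN test_fun_smooth]
  note t = test_fun_mult[OF assms(1) sm(2)]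
  have L: "L2 M \<phi>" "L2 M \<psi>" "L2 M (\<lambda>x. grad \<phi> x \<bullet> i)" "L2 M (\<lambda>x. grad \<psi> x \<bullet> i)"
  proof -
    have "L2 M (\<lambda>x. grad \<phi> x \<bullet> i)" if t: "test_fun \<Omega> \<phi>" for \<phi>
    proof -
      obtain B where "\<And>x. norm (grad \<phi> x) \<le> B" using test_fun_bounded[OF t] by metis
      then have "norm (grad \<phi> x \<bullet> i) \<le> B * norm i" for x
        by (metis Cauchy_Schwarz_ineq2 mult_right_mono norm_ge_zero order_trans real_norm_def)
      then show ?thesis
        using smooth_fun_imp_grad(3)[OF test_fun_smooth[OF t]]
        by (intro L2_bounded continuous_measurable_M continuous_intros)
    qed
    then show "L2 M \<phi>" "L2 M \<psi>" "L2 M (\<lambda>x. grad \<phi> x \<bullet> i)" "L2 M (\<lambda>x. grad \<psi> x \<bullet> i)"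
      using assms test_fun_L2 by auto
  qed
  have "(\<integral>x. \<phi> x * (grad \<psi> x \<bullet> i) \<partial>M) + (\<integral>x. (grad \<phi> x \<bullet> i) * \<psi> x \<partial>M)
      = (\<integral>x. \<phi> x * (grad \<psi> x \<bullet> i) + (grad \<phi> x \<bullet> i) * \<psi> x \<partial>M)"
    using L2_inner_integrable[OF L(1,4)] L2_inner_integrable[OF L(3,2)] by simp
  also have "\<dots> = (\<integral>x. grad (\<lambda>x. \<phi> x * \<psi> x) x \<bullet> i \<partial>M)"
    by (simp add: grad_mult[OF sm] inner_add_left mult.commute)
  also have "\<dots> = (\<integral>x. grad (\<lambda>x. \<phi> x * \<psi> x) x \<bullet> i \<partial>lborel)"
    using smooth_fun_imp_grad(3)[OF test_fun_smooth[OF t]]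
    by (intro integral_M borel_measurable_continuous_onI continuous_intros)
       (auto simp: test_fun_grad_zero_outside[OF t])
  also have "\<dots> = 0" by (rule integral_grad_eq_0[OF t])
  finally show ?thesis by simp
qed

text \<open>Testing with \<open>1 - (1 - bump a b) ^ k\<close>, which tends to the indicator of the
  open box, shows that \<open>g\<close> has integral 0 over every box whose closed box lies in the
  domain. The criterion by boxes then applies on each member of a countable cover.\<close>

lemma fundamental_lemma:
  fixes g :: "'a \<Rightarrow> real"
  assumes "L2 M g" and zero: "\<And>\<psi>. test_fun \<Omega> \<psi> \<Longrightarrow> (\<integral>x. g x * \<psi> x \<partial>M) = 0"
  shows "AE x in M. g x = 0"
proof -
  have [measurable]: "g \<in> borel_measurable M" using assms by (simp add: L2_def)
  have int: "integrable M g" using L2_integrable_M assms(1) .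
  have box0: "(\<integral>x. g x * indicator (box a b) x \<partial>M) = 0" if ab: "cbox a b \<subseteq> \<Omega>" for a b
  proof -
    define \<psi> where "\<psi> k x = 1 - (1 - bump a b x) ^ k" for k :: nat and x
    have t: "test_fun \<Omega> (\<psi> k)" for k
    proof (rule test_fun_smooth_vanishing[of _ "cbox a b"])
      show "smooth_fun (\<psi> k)"
        unfolding \<psi>_def by (intro smooth_fun_diff smooth_fun_power smooth_fun_const smooth_fun_bump)
      show "\<psi> k x = 0" if "x \<notin> cbox a b" for x
      proof -
        have "bump a b x = 0" using that box_subset_cbox[of a b] by (auto simp: bump_eq_0_iff)
        then show ?thesis by (simp add: \<psi>_def)
      qed
    qed (use ab in auto)
    have "(\<lambda>k. \<integral>x. g x * \<psi> k x \<partial>M) \<longlonglongrightarrow> (\<integral>x. g x * indicator (box a b) x \<partial>M)"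
    proof (rule integral_dominated_convergence[where w="\<lambda>x. \<bar>g x\<bar>"])
      show "(\<lambda>x. g x * \<psi> k x) \<in> borel_measurable M" for k
        using continuous_measurable_M[OF smooth_fun_imp_grad(2)[OF test_fun_smooth[OF t]]] by simp
      show "(\<lambda>x. g x * indicator (box a b) x) \<in> borel_measurable M"
        by (rule borel_measurable_times[OF _ borel_measurable_M]) auto
      show "integrable M (\<lambda>x. \<bar>g x\<bar>)" using int by simp
      show "AE x in M. (\<lambda>k. g x * \<psi> k x) \<longlonglongrightarrow> g x * indicator (box a b) x"
      proof (rule AE_I2)
        fix x
        have "(\<lambda>k. \<psi> k x) \<longlonglongrightarrow> indicator (box a b) x"
        proof (cases "x \<in> box a b")
          case True
          then have "0 < bump a b x" "bump a b x \<le> 1"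
            using bump_bounds[of a b x] bump_eq_0_iff[of a b x] by auto
          then have "(\<lambda>k. (1 - bump a b x) ^ k) \<longlonglongrightarrow> 0"
            by (intro LIMSEQ_realpow_zero) auto
          from tendsto_diff[OF tendsto_const[of 1] this] show ?thesis
            using True by (simp add: \<psi>_def)
        next
          case False
          then have "bump a b x = 0" by (simp add: bump_eq_0_iff)
          then show ?thesis using False by (simp add: \<psi>_def)
        qed
        then show "(\<lambda>k. g x * \<psi> k x) \<longlonglongrightarrow> g x * indicator (box a b) x"
          by (intro tendsto_intros)
      qed
      show "AE x in M. norm (g x * \<psi> k x) \<le> \<bar>g x\<bar>" for k
      proof (rule AE_I2)
        fix x
        have "0 \<le> (1 - bump a b x) ^ k" "(1 - bump a b x) ^ k \<le> 1"
          using bump_bounds[of a b x] by (auto intro: power_le_one)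
        then have "\<bar>\<psi> k x\<bar> \<le> 1" by (simp add: \<psi>_def)
        then show "norm (g x * \<psi> k x) \<le> \<bar>g x\<bar>" by (simp add: abs_mult mult_left_le)
      qed
    qed
    then show ?thesis by (simp add: zero[OF t] LIMSEQ_const_iff)
  qed
  have AEbox: "AE x in M. x \<in> box a b \<longrightarrow> g x = 0" if ab: "cbox a b \<subseteq> \<Omega>" for a b
  proof -
    define h where "h x = indicator \<Omega> x *\<^sub>R (g x * indicator (box a b) x)" for x
    have sub: "box a b \<subseteq> \<Omega>" using ab box_subset_cbox by blast
    have "integrable M (\<lambda>x. indicator (box a b) x *\<^sub>R g x)"
      using int borel_measurable_M[of "indicator (box a b)"]
      by (intro integrable_mult_indicator) (auto simp: sets_restrict_space_iff sub)
    then have "integrable lebesgue h"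
      unfolding h_def by (subst integrable_restrict_space[symmetric]) (auto simp: mult.commute)
    then have mh: "h \<in> borel_measurable lebesgue" and hi: "integrable lebesgue h" by auto
    \<comment> \<open>The criterion by boxes concerns \<open>lborel\<close>, whereas
      \<open>g\<close> is only Lebesgue measurable; a Borel representative mediates.\<close>
    obtain h' where h': "h' \<in> borel_measurable lborel" "AE x in lborel. h x = h' x"
      using completion_ex_borel_measurable_real[OF mh] by blast
    have [measurable]: "h' \<in> borel_measurable borel" using h'(1) by simp
    have AE': "AE x in lebesgue. h x = h' x" using h'(2) by (rule AE_completion)
    have "integrable lebesgue h'"
      using hi mh AE' by (subst integrable_cong_AE[of h' lebesgue h]) (auto intro: measurable_completion)
    then have "integrable lborel h'"
      by (simp add: integrable_completion)
    moreover have "(\<integral>x. h' x * indicator (box c d) x \<partial>lborel) = 0" for c d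
    proof -
      have "(\<integral>x. h' x * indicator (box c d) x \<partial>lborel) = (\<integral>x. h' x * indicator (box c d) x \<partial>lebesgue)"
        by (rule integral_completion[symmetric]) simp
      also have "\<dots> = (\<integral>x. h x * indicator (box c d) x \<partial>lebesgue)"
      proof (rule integral_cong_AE)
        have "indicator (box c d) \<in> borel_measurable lebesgue" "h' \<in> borel_measurable lebesgue"
          by (intro measurable_completion; simp)+
        then show "(\<lambda>x. h' x * indicator (box c d) x) \<in> borel_measurable lebesgue"
          "(\<lambda>x. h x * indicator (box c d) x) \<in> borel_measurable lebesgue"
          using mh by (intro borel_measurable_times; simp)+
        show "AE x in lebesgue. h' x * indicator (box c d) x = h x * indicator (box c d) x"
          using AE' by eventually_elim simp
      qed
      also have "\<dots> = (\<integral>x. indicator \<Omega> x *\<^sub>R (g x * indicator (box a b \<inter> box c d) x) \<partial>lebesgue)"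
        by (intro Bochner_Integration.integral_cong) (auto simp: h_def indicator_def)
      also have "\<dots> = (\<integral>x. g x * indicator (box a b \<inter> box c d) x \<partial>M)"
        by (rule integral_restrict_space[symmetric]) simp
      also have "\<dots> = 0"
      proof -
        obtain a' b' where ab': "box a b \<inter> box c d = box a' b'"
          using box_Int_box[of a b c d] by blast
        show ?thesis
        \<comment> \<open>If the intersection is empty, \<open>cbox a' b'\<close> need not lie in
          the domain, but the integral is 0 anyway. Otherwise this closed box is the closure of the
          intersection and hence contained in \<open>cbox a b\<close>.\<close>
        proof (cases "box a' b' = {}")
          case False
          then have "cbox a' b' = closure (box a' b')" by (simp add: closure_box)
          also have "\<dots> \<subseteq> cbox a b"
            using ab' box_subset_cbox[of a b] by (intro closure_minimal) (auto simp: closed_cbox)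
          finally show ?thesis using box0[of a' b'] ab ab' by auto
        qed (simp add: ab')
      qed
      finally show ?thesis .
    qed
    ultimately have "AE x in lborel. h' x = 0" by (rule AE_zero_if_integral_boxes_zero)
    then have "AE x in lebesgue. h' x = 0" by (rule AE_completion)
    with AE' have "AE x in lebesgue. x \<in> \<Omega> \<longrightarrow> x \<in> box a b \<longrightarrow> g x = 0"
      by eventually_elim (auto simp: h_def)
    then show ?thesis by (subst AE_restrict_space_iff) auto
  qed
  obtain a b where ab: "\<And>i::nat. cbox (a i) (b i) \<subseteq> \<Omega>" "(\<Union>i. box (a i) (b i)) = \<Omega>"
    using open_countable_box_cover[OF open_domain nonempty_domain] by metis
  have "AE x in M. \<forall>i. x \<in> box (a i) (b i) \<longrightarrow> g x = 0"
    using AEbox[OF ab(1)] by (subst AE_all_countable) blast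
  moreover have "AE x in M. x \<in> \<Omega>" by (rule AE_I2) (simp add: space_restrict_space)
  ultimately show ?thesis by eventually_elim (use ab(2) in blast)
qed


text \<open>\<open>G\<close> is the weak gradient of \<open>u\<close>.\<close>
definition H10_pair :: "('a \<Rightarrow> real) \<Rightarrow> ('a \<Rightarrow> 'a) \<Rightarrow> bool" where
  "H10_pair u G \<longleftrightarrow> L2 M u \<and> L2 M G \<and> (\<exists>\<phi>::nat \<Rightarrow> 'a \<Rightarrow> real. (\<forall>k. test_fun \<Omega> (\<phi> k)) \<and>
     (\<lambda>k. L2_norm M (\<lambda>x. \<phi> k x - u x)) \<longlonglongrightarrow> 0 \<and>
     (\<lambda>k. L2_norm M (\<lambda>x. grad (\<phi> k) x - G x)) \<longlonglongrightarrow> 0)"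

lemma H10_pairE:
  assumes "H10_pair u G"
  obtains \<phi> where "\<And>k. test_fun \<Omega> (\<phi> k)" "(\<lambda>k. L2_norm M (\<lambda>x. \<phi> k x - u x)) \<longlonglongrightarrow> 0"
    "(\<lambda>k. L2_norm M (\<lambda>x. grad (\<phi> k) x - G x)) \<longlonglongrightarrow> 0"
  using assms unfolding H10_pair_def by blast

lemma H10_pair_L2: "H10_pair u G \<Longrightarrow> L2 M u" "H10_pair u G \<Longrightarrow> L2 M G"
  by (auto simp: H10_pair_def)

lemma H10_pair_test_fun: "test_fun \<Omega> \<phi> \<Longrightarrow> H10_pair \<phi> (grad \<phi>)"
  unfolding H10_pair_def by (auto simp: test_fun_L2 L2_norm_def intro!: exI[of _ "\<lambda>_. \<phi>"])

text \<open>The approximating test functions alone determine the weak gradient: classical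
  integration by parts holds for them, and both of its sides are continuous in L2.\<close>

lemma H10_pair_imp_weak_grad:
  assumes "H10_pair u G"
  shows "weak_grad \<Omega> u G"
  unfolding weak_grad_def L2_fun_def L2_vfun_def
proof (intro conjI allI impI ballI)
  have L: "L2 M u" "L2 M G" using assms H10_pair_L2 by auto
  then show "u \<in> borel_measurable M" "G \<in> borel_measurable M"
    "integrable M (\<lambda>x. (u x)\<^sup>2)" "integrable M (\<lambda>x. (norm (G x))\<^sup>2)"
    by (auto simp: L2_def)
  obtain \<phi> where \<phi>: "\<And>k. test_fun \<Omega> (\<phi> k)" "(\<lambda>k. L2_norm M (\<lambda>x. \<phi> k x - u x)) \<longlonglongrightarrow> 0"
    "(\<lambda>k. L2_norm M (\<lambda>x. grad (\<phi> k) x - G x)) \<longlonglongrightarrow> 0"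
    by (rule H10_pairE[OF assms]) (rule that)
  fix \<psi> i assume \<psi>: "test_fun \<Omega> \<psi>" and i: "i \<in> (Basis :: 'a set)"
  obtain B where B: "\<And>x. \<bar>\<psi> x\<bar> \<le> B" "\<And>x. norm (grad \<psi> x) \<le> B"
    using test_fun_bounded[OF \<psi>] by metis
  note sm = smooth_fun_imp_grad[OF test_fun_smooth[OF \<psi>]]
  have "norm (grad \<psi> x \<bullet> i) \<le> B" for x
    using Cauchy_Schwarz_ineq2[of "grad \<psi> x" i] B(2)[of x] i by simp
  then have "L2 M (\<lambda>x. grad \<psi> x \<bullet> i)"
    by (intro L2_bounded continuous_measurable_M continuous_intros sm)
  from L2_inner_tendsto[OF test_fun_L2(1)[OF \<phi>(1)] L(1) \<phi>(2) this]
  have 1: "(\<lambda>k. \<integral>x. \<phi> k x * (grad \<psi> x \<bullet> i) \<partial>M) \<longlonglongrightarrow> (\<integral>x. u x * (grad \<psi> x \<bullet> i) \<partial>M)" by simp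
  have "norm (\<psi> x *\<^sub>R i) \<le> B" for x using B(1)[of x] i by simp
  then have "L2 M (\<lambda>x. \<psi> x *\<^sub>R i)"
    by (intro L2_bounded continuous_measurable_M continuous_intros sm)
  from L2_inner_tendsto[OF test_fun_L2(2)[OF \<phi>(1)] L(2) \<phi>(3) this]
  have 2: "(\<lambda>k. \<integral>x. (grad (\<phi> k) x \<bullet> i) * \<psi> x \<partial>M) \<longlonglongrightarrow> (\<integral>x. (G x \<bullet> i) * \<psi> x \<partial>M)"
    by (simp add: mult.commute)
  from tendsto_minus[OF this] have "(\<lambda>k. \<integral>x. \<phi> k x * (grad \<psi> x \<bullet> i) \<partial>M) \<longlonglongrightarrow> - (\<integral>x. (G x \<bullet> i) * \<psi> x \<partial>M)"
    by (simp add: integration_by_parts[OF \<phi>(1) \<psi>])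
  from LIMSEQ_unique[OF 1 this]
  show "(\<integral>x. u x * (grad \<psi> x \<bullet> i) \<partial>M) = - (\<integral>x. (G x \<bullet> i) * \<psi> x \<partial>M)" .
qed

lemma weak_grad_L2: "weak_grad \<Omega> u G \<Longrightarrow> L2 M G" "weak_grad \<Omega> u G \<Longrightarrow> L2 M u"
  by (auto simp: weak_grad_def L2_vfun_def L2_fun_def L2_def)

text \<open>Each component of the difference of two weak gradients is orthogonal to all test
  functions. The arbitrary choice made in \<open>wgrad\<close> is thereby immaterial up to null
  sets.\<close>

lemma weak_grad_unique:
  assumes "weak_grad \<Omega> u G" "weak_grad \<Omega> u H"
  shows "AE x in M. G x = H x"
proof -
  have L: "L2 M G" "L2 M H" using assms weak_grad_L2 by auto
  have "AE x in M. (G x - H x) \<bullet> i = 0" if i: "i \<in> Basis" for i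
  proof (rule fundamental_lemma)
    have D: "L2 M (\<lambda>x. G x - H x)" by (rule L2_diff[OF L])
    then have [measurable]: "(\<lambda>x. G x - H x) \<in> borel_measurable M" by (simp add: L2_def)
    have "norm ((G x - H x) \<bullet> i) \<le> norm (G x - H x)" for x
      using Cauchy_Schwarz_ineq2[of "G x - H x" i] i by simp
    then have "norm (((G x - H x) \<bullet> i)\<^sup>2) \<le> norm ((norm (G x - H x))\<^sup>2)" for x
      by (auto simp: abs_le_square_iff[symmetric] power_abs[symmetric])
    then show "L2 M (\<lambda>x. (G x - H x) \<bullet> i)"
      unfolding L2_def using L2_integrable[OF D]
      by (auto intro: Bochner_Integration.integrable_bound)
    fix \<psi> assume \<psi>: "test_fun \<Omega> \<psi>"
    obtain B where B: "\<And>x. \<bar>\<psi> x\<bar> \<le> B" using test_fun_bounded[OF \<psi>] by metis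
    have "norm (\<psi> x *\<^sub>R i) \<le> B" for x using B(1)[of x] i by simp
    then have L': "L2 M (\<lambda>x. \<psi> x *\<^sub>R i)"
      using smooth_fun_imp_grad[OF test_fun_smooth[OF \<psi>]]
      by (intro L2_bounded continuous_measurable_M continuous_intros)
    have "(\<integral>x. u x * (grad \<psi> x \<bullet> i) \<partial>M) = - (\<integral>x. (K x \<bullet> i) * \<psi> x \<partial>M)" if "weak_grad \<Omega> u K" for K
      using that \<psi> i unfolding weak_grad_def by blast
    from this[OF assms(1)] this[OF assms(2)]
    have "(\<integral>x. (G x \<bullet> i) * \<psi> x \<partial>M) = (\<integral>x. (H x \<bullet> i) * \<psi> x \<partial>M)"
      by linarith
    moreover have "integrable M (\<lambda>x. (G x \<bullet> i) * \<psi> x)" "integrable M (\<lambda>x. (H x \<bullet> i) * \<psi> x)"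
      using L2_inner_integrable[OF L(1) L'] L2_inner_integrable[OF L(2) L'] by (simp_all add: mult.commute)
    ultimately show "(\<integral>x. (G x - H x) \<bullet> i * \<psi> x \<partial>M) = 0"
      by (simp add: inner_diff_left left_diff_distrib)
  qed
  then have "AE x in M. \<forall>i\<in>Basis. (G x - H x) \<bullet> i = 0"
    by (subst AE_finite_all) auto
  then show ?thesis
    by eventually_elim (simp add: euclidean_eq_iff[of "G _" "H _"] inner_diff_left)
qed

lemma H10_pair_cong:
  assumes "H10_pair u G" "AE x in M. G x = H x" "L2 M H"
  shows "H10_pair u H"
proof -
  obtain \<phi> where \<phi>: "\<And>k. test_fun \<Omega> (\<phi> k)" "(\<lambda>k. L2_norm M (\<lambda>x. \<phi> k x - u x)) \<longlonglongrightarrow> 0"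
    "(\<lambda>k. L2_norm M (\<lambda>x. grad (\<phi> k) x - G x)) \<longlonglongrightarrow> 0"
    by (rule H10_pairE[OF assms(1)]) (rule that)
  have "L2_norm M (\<lambda>x. grad (\<phi> k) x - G x) = L2_norm M (\<lambda>x. grad (\<phi> k) x - H x)" for k
    using L2_diff[OF test_fun_L2(2)[OF \<phi>(1)] assms(3), of k]
      L2_diff[OF test_fun_L2(2)[OF \<phi>(1)] H10_pair_L2(2)[OF assms(1)], of k]
    by (intro L2_norm_cong AE_mp[OF assms(2) AE_I2]) (auto simp: L2_def)
  then show ?thesis
    using \<phi> assms H10_pair_L2[OF assms(1)] unfolding H10_pair_def by auto
qed

lemma H10_iff_pair: "u \<in> H10 \<Omega> \<longleftrightarrow> (\<exists>G. H10_pair u G)"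
proof
  assume "u \<in> H10 \<Omega>"
  then obtain G \<phi> where G: "weak_grad \<Omega> u G" and \<phi>: "\<And>k. test_fun \<Omega> (\<phi> k)"
     "(\<lambda>k. \<integral>x. (\<phi> k x - u x)\<^sup>2 \<partial>M) \<longlonglongrightarrow> 0" "(\<lambda>k. \<integral>x. (norm (grad (\<phi> k) x - G x))\<^sup>2 \<partial>M) \<longlonglongrightarrow> 0"
    unfolding H10_def by blast
  have "(\<lambda>k. L2_norm M (\<lambda>x. \<phi> k x - u x)) \<longlonglongrightarrow> 0" "(\<lambda>k. L2_norm M (\<lambda>x. grad (\<phi> k) x - G x)) \<longlonglongrightarrow> 0"
    by (rule tendsto_0_if_square_tendsto_0; use \<phi> in \<open>simp add: L2_norm_square\<close>)+
  with G \<phi>(1) have "H10_pair u G"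
    unfolding H10_pair_def using weak_grad_L2 by blast
  then show "\<exists>G. H10_pair u G" by blast
next
  assume "\<exists>G. H10_pair u G"
  then obtain G where G: "H10_pair u G" by blast
  then obtain \<phi> where \<phi>: "\<And>k. test_fun \<Omega> (\<phi> k)" "(\<lambda>k. L2_norm M (\<lambda>x. \<phi> k x - u x)) \<longlonglongrightarrow> 0"
    "(\<lambda>k. L2_norm M (\<lambda>x. grad (\<phi> k) x - G x)) \<longlonglongrightarrow> 0"
    by (rule H10_pairE) (rule that)
  have "(\<lambda>k. \<integral>x. (\<phi> k x - u x)\<^sup>2 \<partial>M) \<longlonglongrightarrow> 0" "(\<lambda>k. \<integral>x. (norm (grad (\<phi> k) x - G x))\<^sup>2 \<partial>M) \<longlonglongrightarrow> 0"
    using tendsto_power[OF \<phi>(2), of 2] tendsto_power[OF \<phi>(3), of 2] by (simp_all add: L2_norm_square)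
  then show "u \<in> H10 \<Omega>"
    using H10_pair_imp_weak_grad[OF G] \<phi>(1) unfolding H10_def by blast
qed

lemma H10_pairI: "H10_pair u G \<Longrightarrow> u \<in> H10 \<Omega>"
  by (auto simp: H10_iff_pair)

lemma wgrad_AE:
  assumes "H10_pair u G"
  shows "AE x in M. wgrad \<Omega> u x = G x"
proof -
  have "weak_grad \<Omega> u (wgrad \<Omega> u)"
    unfolding wgrad_def by (rule someI[of "weak_grad \<Omega> u", OF H10_pair_imp_weak_grad[OF assms]])
  then show ?thesis using weak_grad_unique H10_pair_imp_weak_grad[OF assms] by blast
qed

lemma H10_pair_wgrad:
  assumes "u \<in> H10 \<Omega>"
  shows "H10_pair u (wgrad \<Omega> u)"
proof -
  obtain G where G: "H10_pair u G" using assms H10_iff_pair by blast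
  have "weak_grad \<Omega> u (wgrad \<Omega> u)"
    unfolding wgrad_def by (rule someI[of "weak_grad \<Omega> u", OF H10_pair_imp_weak_grad[OF G]])
  from weak_grad_L2(1)[OF this] wgrad_AE[OF G] show ?thesis
    by (intro H10_pair_cong[OF G]) auto
qed

lemma H10_L2: "u \<in> H10 \<Omega> \<Longrightarrow> L2 M u" "u \<in> H10 \<Omega> \<Longrightarrow> L2 M (wgrad \<Omega> u)"
  using H10_pair_wgrad H10_pair_L2 by blast+

lemma test_fun_H10: "test_fun \<Omega> \<phi> \<Longrightarrow> \<phi> \<in> H10 \<Omega>"
  using H10_pair_test_fun H10_pairI by blast

section \<open>Linear structure, norm and scalar product\<close>

lemma H10_pair_lincomb:
  assumes "H10_pair u G" "H10_pair v H"
  shows "H10_pair (\<lambda>x. s * u x + t * v x) (\<lambda>x. s *\<^sub>R G x + t *\<^sub>R H x)"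
proof -
  note L = H10_pair_L2[OF assms(1)] H10_pair_L2[OF assms(2)]
  obtain \<phi> where \<phi>: "\<And>k. test_fun \<Omega> (\<phi> k)" "(\<lambda>k. L2_norm M (\<lambda>x. \<phi> k x - u x)) \<longlonglongrightarrow> 0"
    "(\<lambda>k. L2_norm M (\<lambda>x. grad (\<phi> k) x - G x)) \<longlonglongrightarrow> 0"
    by (rule H10_pairE[OF assms(1)]) (rule that)
  obtain \<psi> where \<psi>: "\<And>k. test_fun \<Omega> (\<psi> k)" "(\<lambda>k. L2_norm M (\<lambda>x. \<psi> k x - v x)) \<longlonglongrightarrow> 0"
    "(\<lambda>k. L2_norm M (\<lambda>x. grad (\<psi> k) x - H x)) \<longlonglongrightarrow> 0"
    by (rule H10_pairE[OF assms(2)]) (rule that)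
  have gr: "grad (\<lambda>x. s * \<phi> k x + t * \<psi> k x) x = s *\<^sub>R grad (\<phi> k) x + t *\<^sub>R grad (\<psi> k) x" for k x
    by (intro grad_lincomb test_fun_smooth[OF \<phi>(1)] test_fun_smooth[OF \<psi>(1)])
  have b1: "L2_norm M (\<lambda>x. s *\<^sub>R f x + t *\<^sub>R g x - (s *\<^sub>R f' x + t *\<^sub>R g' x))
      \<le> \<bar>s\<bar> * L2_norm M (\<lambda>x. f x - f' x) + \<bar>t\<bar> * L2_norm M (\<lambda>x. g x - g' x)"
    if "L2 M f" "L2 M g" "L2 M f'" "L2 M g'" for f g f' g' :: "'a \<Rightarrow> 'b::euclidean_space"
  proof -
    have "(\<lambda>x. s *\<^sub>R f x + t *\<^sub>R g x - (s *\<^sub>R f' x + t *\<^sub>R g' x)) = (\<lambda>x. s *\<^sub>R (f x - f' x) + t *\<^sub>R (g x - g' x))"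
      by (auto simp: algebra_simps)
    then show ?thesis
      using L2_norm_triangle[OF L2_scale[OF L2_diff[OF that(1,3)], of s] L2_scale[OF L2_diff[OF that(2,4)], of t]]
      by (simp add: L2_norm_scale[of M s] L2_norm_scale[of M t])
  qed
  have b2: "(\<lambda>k. L2_norm M (\<lambda>x. s *\<^sub>R f k x + t *\<^sub>R g k x - (s *\<^sub>R f' x + t *\<^sub>R g' x))) \<longlonglongrightarrow> 0"
    if L': "\<And>k. L2 M (f k)" "\<And>k. L2 M (g k)" "L2 M f'" "L2 M g'"
      and lim: "(\<lambda>k. L2_norm M (\<lambda>x. f k x - f' x)) \<longlonglongrightarrow> 0" "(\<lambda>k. L2_norm M (\<lambda>x. g k x - g' x)) \<longlonglongrightarrow> 0"
    for f g and f' g' :: "'a \<Rightarrow> 'b::euclidean_space"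
  proof (rule Lim_null_comparison[OF always_eventually])
    show "\<forall>k. norm (L2_norm M (\<lambda>x. s *\<^sub>R f k x + t *\<^sub>R g k x - (s *\<^sub>R f' x + t *\<^sub>R g' x)))
        \<le> \<bar>s\<bar> * L2_norm M (\<lambda>x. f k x - f' x) + \<bar>t\<bar> * L2_norm M (\<lambda>x. g k x - g' x)"
      using b1[OF L'(1,2,3,4)] by simp
    show "(\<lambda>k. \<bar>s\<bar> * L2_norm M (\<lambda>x. f k x - f' x) + \<bar>t\<bar> * L2_norm M (\<lambda>x. g k x - g' x)) \<longlonglongrightarrow> 0"
      using tendsto_add[OF tendsto_mult_left[OF lim(1), of "\<bar>s\<bar>"] tendsto_mult_left[OF lim(2), of "\<bar>t\<bar>"]] by simp
  qed
  show ?thesis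
    unfolding H10_pair_def
  proof (intro conjI exI[of _ "\<lambda>k x. s * \<phi> k x + t * \<psi> k x"] allI)
    show "L2 M (\<lambda>x. s * u x + t * v x)" using L2_lincomb[OF L(1,3), of s t] by simp
    show "L2 M (\<lambda>x. s *\<^sub>R G x + t *\<^sub>R H x)" using L2_lincomb[OF L(2,4)] by simp
    show "test_fun \<Omega> (\<lambda>x. s * \<phi> k x + t * \<psi> k x)" for k by (intro test_fun_lincomb \<phi> \<psi>)
    show "(\<lambda>k. L2_norm M (\<lambda>x. s * \<phi> k x + t * \<psi> k x - (s * u x + t * v x))) \<longlonglongrightarrow> 0"
      using b2[OF test_fun_L2(1)[OF \<phi>(1)] test_fun_L2(1)[OF \<psi>(1)] L(1,3) \<phi>(2) \<psi>(2)] by simp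
    show "(\<lambda>k. L2_norm M (\<lambda>x. grad (\<lambda>x. s * \<phi> k x + t * \<psi> k x) x - (s *\<^sub>R G x + t *\<^sub>R H x))) \<longlonglongrightarrow> 0"
      unfolding gr by (rule b2[OF test_fun_L2(2)[OF \<phi>(1)] test_fun_L2(2)[OF \<psi>(1)] L(2,4) \<phi>(3) \<psi>(3)])
  qed
qed

text \<open>A diagonal choice: from the k-th pair take a test function that is within
  \<open>1 / real (Suc k)\<close> of it, both in value and in gradient. Completeness of
  \<open>H10 \<Omega>\<close> rests on this.\<close>

lemma H10_pair_closed:
  assumes "\<And>k. H10_pair (u k) (G k)" "L2 M v" "L2 M H"
    "(\<lambda>k. L2_norm M (\<lambda>x. u k x - v x)) \<longlonglongrightarrow> 0" "(\<lambda>k. L2_norm M (\<lambda>x. G k x - H x)) \<longlonglongrightarrow> 0"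
  shows "H10_pair v H"
proof -
  have "\<exists>\<phi>. test_fun \<Omega> \<phi> \<and> L2_norm M (\<lambda>x. \<phi> x - u k x) < 1 / real (Suc k) \<and>
      L2_norm M (\<lambda>x. grad \<phi> x - G k x) < 1 / real (Suc k)" for k
  proof -
    obtain \<phi> where \<phi>: "\<And>j. test_fun \<Omega> (\<phi> j)" "(\<lambda>j. L2_norm M (\<lambda>x. \<phi> j x - u k x)) \<longlonglongrightarrow> 0"
      "(\<lambda>j. L2_norm M (\<lambda>x. grad (\<phi> j) x - G k x)) \<longlonglongrightarrow> 0"
      by (rule H10_pairE[OF assms(1)[of k]]) (rule that)
    have "\<forall>\<^sub>F j in sequentially. L2_norm M (\<lambda>x. \<phi> j x - u k x) < 1 / real (Suc k)"
      "\<forall>\<^sub>F j in sequentially. L2_norm M (\<lambda>x. grad (\<phi> j) x - G k x) < 1 / real (Suc k)"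
      by (rule order_tendstoD(2)[OF \<phi>(2)] order_tendstoD(2)[OF \<phi>(3)]; simp)+
    then have "\<forall>\<^sub>F j in sequentially. L2_norm M (\<lambda>x. \<phi> j x - u k x) < 1 / real (Suc k) \<and>
       L2_norm M (\<lambda>x. grad (\<phi> j) x - G k x) < 1 / real (Suc k)"
      by eventually_elim simp
    then show ?thesis using \<phi>(1) by (blast dest: eventually_happens'[OF sequentially_bot])
  qed
  then obtain \<phi> where \<phi>: "\<And>k. test_fun \<Omega> (\<phi> k)" "\<And>k. L2_norm M (\<lambda>x. \<phi> k x - u k x) < 1 / real (Suc k)"
      "\<And>k. L2_norm M (\<lambda>x. grad (\<phi> k) x - G k x) < 1 / real (Suc k)"
    by metis
  have aux: "(\<lambda>k. L2_norm M (\<lambda>x. f k x - h x)) \<longlonglongrightarrow> 0"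
    if L': "\<And>k. L2 M (f k)" "\<And>k. L2 M (g k)" "L2 M h"
      and lim: "\<And>k. L2_norm M (\<lambda>x. f k x - g k x) < 1 / real (Suc k)" "(\<lambda>k. L2_norm M (\<lambda>x. g k x - h x)) \<longlonglongrightarrow> 0"
    for f g and h :: "'a \<Rightarrow> 'b::euclidean_space"
  proof (rule Lim_null_comparison[OF always_eventually])
    have "L2_norm M (\<lambda>x. f k x - h x) \<le> inverse (real (Suc k)) + L2_norm M (\<lambda>x. g k x - h x)" for k
      using L2_norm_triangle_diff[OF L'(1,2,3), of k k] lim(1)[of k] by (simp add: inverse_eq_divide)
    then show "\<forall>k. norm (L2_norm M (\<lambda>x. f k x - h x)) \<le> inverse (real (Suc k)) + L2_norm M (\<lambda>x. g k x - h x)"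
      by simp
    show "(\<lambda>k. inverse (real (Suc k)) + L2_norm M (\<lambda>x. g k x - h x)) \<longlonglongrightarrow> 0"
      using tendsto_add[OF LIMSEQ_inverse_real_of_nat lim(2)] by simp
  qed
  show ?thesis
    unfolding H10_pair_def
    using aux[OF test_fun_L2(1)[OF \<phi>(1)] H10_pair_L2(1)[OF assms(1)] assms(2) \<phi>(2) assms(4)]
      aux[OF test_fun_L2(2)[OF \<phi>(1)] H10_pair_L2(2)[OF assms(1)] assms(3) \<phi>(3) assms(5)] \<phi>(1) assms(2,3)
    by blast
qed

lemma H10_lincomb: "u \<in> H10 \<Omega> \<Longrightarrow> v \<in> H10 \<Omega> \<Longrightarrow> (\<lambda>x. s * u x + t * v x) \<in> H10 \<Omega>"
  using H10_pair_lincomb[OF H10_pair_wgrad H10_pair_wgrad] H10_pairI by blast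

lemma H10_diff: "u \<in> H10 \<Omega> \<Longrightarrow> v \<in> H10 \<Omega> \<Longrightarrow> (\<lambda>x. u x - v x) \<in> H10 \<Omega>"
  using H10_lincomb[of u v 1 "-1"] by simp

lemma H10_add: "u \<in> H10 \<Omega> \<Longrightarrow> v \<in> H10 \<Omega> \<Longrightarrow> (\<lambda>x. u x + v x) \<in> H10 \<Omega>"
  using H10_lincomb[of u v 1 1] by simp

lemma H10_scale: "u \<in> H10 \<Omega> \<Longrightarrow> (\<lambda>x. s * u x) \<in> H10 \<Omega>"
  using H10_lincomb[of u u s 0] by simp

lemma wgrad_lincomb:
  "u \<in> H10 \<Omega> \<Longrightarrow> v \<in> H10 \<Omega> \<Longrightarrow> AE x in M. wgrad \<Omega> (\<lambda>x. s * u x + t * v x) x = s *\<^sub>R wgrad \<Omega> u x + t *\<^sub>R wgrad \<Omega> v x"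
  by (rule wgrad_AE[OF H10_pair_lincomb[OF H10_pair_wgrad H10_pair_wgrad]])

definition H10_norm :: "('a \<Rightarrow> real) \<Rightarrow> real" where
  "H10_norm u = L2_norm M (wgrad \<Omega> u)"

lemma H10_norm_nonneg [simp]: "0 \<le> H10_norm u"
  by (simp add: H10_norm_def)

lemma H10_norm_pair:
  assumes "H10_pair u G"
  shows "H10_norm u = L2_norm M G"
  unfolding H10_norm_def
  using wgrad_AE[OF assms] H10_L2(2)[OF H10_pairI[OF assms]] H10_pair_L2(2)[OF assms]
  by (intro L2_norm_cong) (auto simp: L2_def elim: AE_mp)

lemma H10_inner_self: "H10_inner \<Omega> u u = (H10_norm u)\<^sup>2"
  by (simp add: H10_inner_def H10_norm_def L2_norm_square power2_norm_eq_inner)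

lemma H10_inner_commute: "H10_inner \<Omega> u v = H10_inner \<Omega> v u"
  by (simp add: H10_inner_def inner_commute)

lemma H10_inner_lincomb:
  assumes "u \<in> H10 \<Omega>" "v \<in> H10 \<Omega>" "w \<in> H10 \<Omega>"
  shows "H10_inner \<Omega> (\<lambda>x. s * u x + t * v x) w = s * H10_inner \<Omega> u w + t * H10_inner \<Omega> v w"
proof -
  note L = assms[THEN H10_L2(2)]
  have "H10_inner \<Omega> (\<lambda>x. s * u x + t * v x) w = (\<integral>x. (s *\<^sub>R wgrad \<Omega> u x + t *\<^sub>R wgrad \<Omega> v x) \<bullet> wgrad \<Omega> w x \<partial>M)"
    unfolding H10_inner_def
  proof (rule integral_cong_AE)
    show "AE x in M. wgrad \<Omega> (\<lambda>x. s * u x + t * v x) x \<bullet> wgrad \<Omega> w x = (s *\<^sub>R wgrad \<Omega> u x + t *\<^sub>R wgrad \<Omega> v x) \<bullet> wgrad \<Omega> w x"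
      using wgrad_lincomb[OF assms(1,2), of s t] by eventually_elim simp
    show "(\<lambda>x. wgrad \<Omega> (\<lambda>x. s * u x + t * v x) x \<bullet> wgrad \<Omega> w x) \<in> borel_measurable M"
      "(\<lambda>x. (s *\<^sub>R wgrad \<Omega> u x + t *\<^sub>R wgrad \<Omega> v x) \<bullet> wgrad \<Omega> w x) \<in> borel_measurable M"
      using L H10_L2(2)[OF H10_lincomb[OF assms(1,2)], of s t] L2_lincomb[OF L(1,2), of s t]
      by (intro borel_measurable_inner; simp add: L2_def)+
  qed
  also have "\<dots> = s * H10_inner \<Omega> u w + t * H10_inner \<Omega> v w"
    unfolding H10_inner_def
    using L2_inner_integrable[OF L(1,3)] L2_inner_integrable[OF L(2,3)] by (simp add: inner_add_left)
  finally show ?thesis .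
qed

lemma H10_inner_le: "u \<in> H10 \<Omega> \<Longrightarrow> v \<in> H10 \<Omega> \<Longrightarrow> \<bar>H10_inner \<Omega> u v\<bar> \<le> H10_norm u * H10_norm v"
  unfolding H10_inner_def H10_norm_def using H10_L2(2) by (intro L2_Cauchy_Schwarz(2))

lemma H10_norm_scale:
  assumes "u \<in> H10 \<Omega>" shows "H10_norm (\<lambda>x. s * u x) = \<bar>s\<bar> * H10_norm u"
  using H10_norm_pair[OF H10_pair_lincomb[OF H10_pair_wgrad[OF assms] H10_pair_wgrad[OF assms], of s 0]]
  by (simp add: L2_norm_scale H10_norm_def)

lemma H10_norm_add:
  assumes "u \<in> H10 \<Omega>" "v \<in> H10 \<Omega>"
  shows "H10_norm (\<lambda>x. u x + v x) \<le> H10_norm u + H10_norm v"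
  using H10_norm_pair[OF H10_pair_lincomb[OF assms[THEN H10_pair_wgrad], of 1 1]]
    L2_norm_triangle[OF assms[THEN H10_L2(2)]]
  by (simp add: H10_norm_def)

lemma H10_dist_norm:
  assumes "u \<in> H10 \<Omega>" "v \<in> H10 \<Omega>"
  shows "H10_dist \<Omega> u v = H10_norm (\<lambda>x. u x - v x)"
  using H10_norm_pair[OF H10_pair_lincomb[OF assms[THEN H10_pair_wgrad], of 1 "-1"]]
  by (simp add: H10_dist_def L2_norm_def)

lemma H10_norm_minus_commute:
  assumes "u \<in> H10 \<Omega>" "v \<in> H10 \<Omega>"
  shows "H10_norm (\<lambda>x. u x - v x) = H10_norm (\<lambda>x. v x - u x)"
  using H10_norm_scale[OF H10_diff[OF assms], of "-1"] by simp

lemma H10_norm_triangle_diff: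
  assumes "u \<in> H10 \<Omega>" "v \<in> H10 \<Omega>" "w \<in> H10 \<Omega>"
  shows "H10_norm (\<lambda>x. u x - w x) \<le> H10_norm (\<lambda>x. u x - v x) + H10_norm (\<lambda>x. v x - w x)"
  using H10_norm_add[OF H10_diff[OF assms(1,2)] H10_diff[OF assms(2,3)]] by simp

lemma H10_approx:
  assumes "u \<in> H10 \<Omega>" "e > 0"
  obtains \<phi> where "test_fun \<Omega> \<phi>" "L2_norm M (\<lambda>x. \<phi> x - u x) < e" "H10_norm (\<lambda>x. \<phi> x - u x) < e"
proof -
  obtain \<phi> where \<phi>: "\<And>j. test_fun \<Omega> (\<phi> j)" "(\<lambda>j. L2_norm M (\<lambda>x. \<phi> j x - u x)) \<longlonglongrightarrow> 0"
    "(\<lambda>j. L2_norm M (\<lambda>x. grad (\<phi> j) x - wgrad \<Omega> u x)) \<longlonglongrightarrow> 0"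
    by (rule H10_pairE[OF H10_pair_wgrad[OF assms(1)]]) (rule that)
  have eq: "L2_norm M (\<lambda>x. grad (\<phi> j) x - wgrad \<Omega> u x) = H10_norm (\<lambda>x. \<phi> j x - u x)" for j
    using H10_norm_pair[OF H10_pair_lincomb[OF H10_pair_test_fun[OF \<phi>(1)] H10_pair_wgrad[OF assms(1)], where s=1 and t="-1"]] by simp
  have "\<forall>\<^sub>F j in sequentially. L2_norm M (\<lambda>x. \<phi> j x - u x) < e"
    "\<forall>\<^sub>F j in sequentially. H10_norm (\<lambda>x. \<phi> j x - u x) < e"
    using order_tendstoD(2)[OF \<phi>(2) assms(2)] order_tendstoD(2)[OF \<phi>(3) assms(2)] by (simp_all add: eq)
  then have "\<forall>\<^sub>F j in sequentially. L2_norm M (\<lambda>x. \<phi> j x - u x) < e \<and> H10_norm (\<lambda>x. \<phi> j x - u x) < e"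
    by eventually_elim simp
  then obtain j where "L2_norm M (\<lambda>x. \<phi> j x - u x) < e \<and> H10_norm (\<lambda>x. \<phi> j x - u x) < e"
    by (blast dest: eventually_happens'[OF sequentially_bot])
  then show thesis using that \<phi>(1) by blast
qed

end

section \<open>Sobolev embedding and Rellich compactness\<close>

lemma nn_integral_lborel_affine:
  fixes f :: "'a::euclidean_space \<Rightarrow> ennreal"
  assumes [measurable]: "f \<in> borel_measurable borel" and "c > 0"
  shows "(\<integral>\<^sup>+x. f x \<partial>lborel) = ennreal (c ^ DIM('a)) * (\<integral>\<^sup>+x. f (a + c *\<^sub>R x) \<partial>lborel)"
proof -
  have "(\<integral>\<^sup>+x. f x \<partial>lborel) = (\<integral>\<^sup>+x. f x \<partial>(density (distr lborel borel (\<lambda>x. a + c *\<^sub>R x)) (\<lambda>_. ennreal (\<bar>c\<bar> ^ DIM('a)))))"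
    using lborel_affine[of c a] assms(2) by (simp add: ennreal_power)
  also have "\<dots> = ennreal (c ^ DIM('a)) * (\<integral>\<^sup>+x. f (a + c *\<^sub>R x) \<partial>lborel)"
    using assms(2) by (simp add: nn_integral_density nn_integral_distr nn_integral_cmult)
  finally show ?thesis .
qed

lemma nn_integral_lborel_scaled:
  fixes f :: "'a::euclidean_space \<Rightarrow> ennreal"
  assumes "f \<in> borel_measurable borel" "c > 0"
  shows "(\<integral>\<^sup>+x. f (a + c *\<^sub>R x) \<partial>lborel) = ennreal ((1 / c) ^ DIM('a)) * (\<integral>\<^sup>+x. f x \<partial>lborel)"
proof -
  have "ennreal ((1 / c) ^ DIM('a)) * ennreal (c ^ DIM('a)) = 1"
    using assms(2) by (simp add: ennreal_mult[symmetric] power_mult_distrib[symmetric])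
  then show ?thesis
    using nn_integral_lborel_affine[OF assms, of a] by (simp add: mult.assoc[symmetric])
qed

lemma nn_integral_lborel_shift:
  fixes f :: "'a::euclidean_space \<Rightarrow> ennreal"
  assumes "f \<in> borel_measurable borel"
  shows "(\<integral>\<^sup>+x. f (x + a) \<partial>lborel) = (\<integral>\<^sup>+x. f x \<partial>lborel)"
  using nn_integral_lborel_scaled[OF assms, of 1 a] by (simp add: add.commute)

lemma nn_integral_lborel_swap:
  fixes f :: "'a::euclidean_space \<Rightarrow> 'b::euclidean_space \<Rightarrow> ennreal"
  assumes "(\<lambda>(x, y). f x y) \<in> borel_measurable (borel \<Otimes>\<^sub>M borel)"
  shows "(\<integral>\<^sup>+x. \<integral>\<^sup>+y. f x y \<partial>lborel \<partial>lborel) = (\<integral>\<^sup>+y. \<integral>\<^sup>+x. f x y \<partial>lborel \<partial>lborel)"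
proof -
  have "sets (lborel \<Otimes>\<^sub>M lborel :: ('a \<times> 'b) measure) = sets (borel \<Otimes>\<^sub>M borel)"
    by (rule sets_pair_measure_cong) auto
  then have "(\<lambda>(x, y). f x y) \<in> borel_measurable (lborel \<Otimes>\<^sub>M lborel)"
    using assms by (simp cong: measurable_cong_sets)
  from lborel_pair.Fubini'[OF this] show ?thesis by simp
qed

text \<open>Valued in \<open>ennreal\<close> so that Tonelli's theorem and translations apply before
  any integrability is known.\<close>

definition grad_sq :: "('a::euclidean_space \<Rightarrow> real) \<Rightarrow> 'a \<Rightarrow> ennreal" where
  "grad_sq \<phi> x = ennreal ((norm (grad \<phi> x))\<^sup>2)"

lemma grad_sq_measurable:
  assumes "smooth_fun \<phi>"
  shows "grad_sq \<phi> \<in> borel_measurable borel"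
proof -
  have [measurable]: "grad \<phi> \<in> borel_measurable borel"
    using smooth_fun_imp_grad(3)[OF assms] by (rule borel_measurable_continuous_onI)
  show ?thesis unfolding grad_sq_def by measurable
qed

text \<open>This is the fundamental theorem of calculus along the segment, followed by the
  Cauchy-Schwarz inequality.\<close>

lemma square_diff_le_line_integral:
  fixes \<phi> :: "'a::euclidean_space \<Rightarrow> real"
  assumes "smooth_fun \<phi>" "a \<le> b"
  shows "ennreal ((\<phi> (x + b *\<^sub>R w) - \<phi> (x + a *\<^sub>R w))\<^sup>2)
    \<le> ennreal ((b - a) * (norm w)\<^sup>2) * (\<integral>\<^sup>+t. grad_sq \<phi> (x + t *\<^sub>R w) * indicator {a..b} t \<partial>lborel)"
proof (cases "a = b")
  case False
  with assms have ab: "a < b" by simp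
  note sm = smooth_fun_imp_grad[OF assms(1)]
  define g where "g t = \<phi> (x + t *\<^sub>R w)" for t
  define g' where "g' t = grad \<phi> (x + t *\<^sub>R w) \<bullet> w" for t
  have cont: "continuous_on S (\<lambda>t. grad \<phi> (x + t *\<^sub>R w))" for S
    by (rule continuous_on_compose2[OF sm(3)]) (auto intro!: continuous_intros)
  have "(g has_vector_derivative g' t) (at t within {a..b})" for t
  proof -
    have "((\<lambda>s. \<phi> (x + s *\<^sub>R w)) has_derivative (\<lambda>s. grad \<phi> (x + t *\<^sub>R w) \<bullet> (s *\<^sub>R w))) (at t within {a..b})"
      by (rule has_derivative_compose[OF _ sm(1)]) (auto intro!: derivative_eq_intros)
    then show ?thesis by (simp add: has_vector_derivative_def g_def[abs_def] g'_def)
  qed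
  then have ftc: "(g' has_integral (g b - g a)) {a..b}"
    using ab by (intro fundamental_theorem_of_calculus) auto
  \<comment> \<open>The mean slope. With it the integral of the nonnegative expression below is, up
    to the factor \<open>b - a\<close>, the difference of the two sides of the claim.\<close>
  define m where "m = (g b - g a) / (b - a)"
  define J where "J = integral {a..b} (\<lambda>t. (norm (grad \<phi> (x + t *\<^sub>R w)))\<^sup>2)"
  have J: "((\<lambda>t. (norm (grad \<phi> (x + t *\<^sub>R w)))\<^sup>2) has_integral J) {a..b}"
    unfolding J_def
    by (intro integrable_integral integrable_continuous_interval continuous_intros cont)
  have "((\<lambda>t. (norm w)\<^sup>2 * (norm (grad \<phi> (x + t *\<^sub>R w)))\<^sup>2 - 2 * m * g' t + m\<^sup>2) has_integral
      ((norm w)\<^sup>2 * J - 2 * m * (g b - g a) + (b - a) * m\<^sup>2)) {a..b}"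
    using has_integral_const_real[of "m\<^sup>2" a b] ab
    by (intro has_integral_add has_integral_diff has_integral_mult_right J ftc) auto
  then have "0 \<le> (norm w)\<^sup>2 * J - 2 * m * (g b - g a) + (b - a) * m\<^sup>2"
  proof (rule has_integral_nonneg)
    fix t assume "t \<in> {a..b}"
    have "(g' t)\<^sup>2 \<le> (norm w)\<^sup>2 * (norm (grad \<phi> (x + t *\<^sub>R w)))\<^sup>2"
      using Cauchy_Schwarz_ineq[of "grad \<phi> (x + t *\<^sub>R w)" w]
      by (simp add: g'_def power2_norm_eq_inner mult.commute)
    moreover have "0 \<le> (g' t - m)\<^sup>2" by simp
    ultimately show "0 \<le> (norm w)\<^sup>2 * (norm (grad \<phi> (x + t *\<^sub>R w)))\<^sup>2 - 2 * m * g' t + m\<^sup>2"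
      by (simp add: power2_diff mult_ac)
  qed
  also have "\<dots> = (norm w)\<^sup>2 * J - (g b - g a)\<^sup>2 / (b - a)"
  proof -
    have "(b - a) * m\<^sup>2 = m * (g b - g a)" using ab by (simp add: m_def power2_eq_square)
    moreover have "m * (g b - g a) = (g b - g a)\<^sup>2 / (b - a)" by (simp add: m_def power2_eq_square)
    ultimately show ?thesis by simp
  qed
  finally have le: "(g b - g a)\<^sup>2 \<le> ((b - a) * (norm w)\<^sup>2) * J"
    using ab by (simp add: field_simps)
  have "(\<integral>\<^sup>+t. grad_sq \<phi> (x + t *\<^sub>R w) * indicator {a..b} t \<partial>lborel) = ennreal J"
    unfolding grad_sq_def by (rule nn_integral_has_integral_lebesgue'[OF _ J]) simp
  then have "ennreal ((b - a) * (norm w)\<^sup>2) * (\<integral>\<^sup>+t. grad_sq \<phi> (x + t *\<^sub>R w) * indicator {a..b} t \<partial>lborel)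
    = ennreal (((b - a) * (norm w)\<^sup>2) * J)"
    using ab by (simp add: ennreal_mult')
  then show ?thesis using le by (simp add: g_def ennreal_leI)
qed simp

section \<open>Averages over balls\<close>

definition unit_volume :: "'a::euclidean_space itself \<Rightarrow> real" where
  "unit_volume _ = measure lborel (cball (0::'a) 1)"

text \<open>The ball of radius \<open>r\<close> is parametrised by the fixed unit ball. Thus
  \<open>r = 0\<close> returns \<open>\<phi>\<close> itself, and comparing two radii means comparing
  \<open>\<phi>\<close> at two points of the same ray.\<close>

definition average :: "real \<Rightarrow> ('a::euclidean_space \<Rightarrow> real) \<Rightarrow> 'a \<Rightarrow> real" where
  "average r \<phi> x = (\<integral>w. indicator (cball 0 1) w * \<phi> (x + r *\<^sub>R w) \<partial>lborel) / unit_volume TYPE('a)"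

lemma unit_volume_pos: "unit_volume TYPE('a::euclidean_space) > 0"
  unfolding unit_volume_def by (rule content_cball_pos) simp

lemma emeasure_unit_ball: "emeasure lborel (cball (0::'a::euclidean_space) 1) = ennreal (unit_volume TYPE('a))"
  unfolding unit_volume_def
  by (rule emeasure_eq_ennreal_measure) (use emeasure_compact_finite[of "cball (0::'a) 1"] in auto)

lemma integrable_unit_ball:
  fixes f :: "'a::euclidean_space \<Rightarrow> real"
  assumes "continuous_on UNIV f"
  shows "integrable lborel (\<lambda>w. indicator (cball 0 1) w * f w)"
  using borel_integrable_compact[of "cball 0 1" f] assms continuous_on_subset by fastforce

text \<open>Jensen's inequality for the square, obtained as Cauchy-Schwarz against the indicator of
  the unit ball.\<close>

lemma average_square_le:
  fixes f :: "'a::euclidean_space \<Rightarrow> real"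
  assumes "continuous_on UNIV f"
  shows "ennreal (((\<integral>w. indicator (cball 0 1) w * f w \<partial>lborel) / unit_volume TYPE('a))\<^sup>2)
    \<le> ennreal (1 / unit_volume TYPE('a)) * (\<integral>\<^sup>+w. ennreal ((f w)\<^sup>2) * indicator (cball 0 1) w \<partial>lborel)"
proof -
  let ?b = "unit_volume TYPE('a)" and ?B = "cball (0::'a) 1"
  have b: "?b > 0" by (rule unit_volume_pos)
  have [measurable]: "f \<in> borel_measurable borel" using assms by (rule borel_measurable_continuous_onI)
  have [measurable]: "?B \<in> sets borel" by simp
  have i1: "integrable lborel (\<lambda>w. indicator ?B w * (f w)\<^sup>2)"
    using assms by (intro integrable_unit_ball continuous_intros)
  have i0: "integrable lborel (indicat_real ?B)"
    using integrable_unit_ball[of "\<lambda>_. 1"] by simp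
  have eq1: "(norm (indicator ?B w * f w))\<^sup>2 = indicator ?B w * (f w)\<^sup>2"
    and eq0: "(norm (indicat_real ?B w))\<^sup>2 = indicator ?B w" for w
    by (auto simp: indicator_def)
  have L0: "L2 lborel (indicat_real ?B)" unfolding L2_def eq0 using i0 by auto
  have L1: "L2 lborel (\<lambda>w. indicat_real ?B w * f w)" unfolding L2_def eq1 using i1 by auto
  have n0: "(L2_norm lborel (indicat_real ?B))\<^sup>2 = ?b"
    unfolding L2_norm_square eq0 by (simp add: unit_volume_def)
  have "(\<integral>w. indicator ?B w * f w \<partial>lborel)\<^sup>2 \<le> (L2_norm lborel (indicat_real ?B) * L2_norm lborel (\<lambda>w. indicat_real ?B w * f w))\<^sup>2"
  proof -
    have "indicat_real ?B w \<bullet> (indicator ?B w * f w) = indicator ?B w * f w" for w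
      by (auto simp: indicator_def)
    then have "\<bar>\<integral>w. indicator ?B w * f w \<partial>lborel\<bar> \<le> L2_norm lborel (indicat_real ?B) * L2_norm lborel (\<lambda>w. indicat_real ?B w * f w)"
      using L2_Cauchy_Schwarz(2)[OF L0 L1] by (simp only:)
    then show ?thesis by (metis abs_ge_zero power2_abs power_mono)
  qed
  also have "\<dots> = ?b * (\<integral>w. indicator ?B w * (f w)\<^sup>2 \<partial>lborel)"
    unfolding power_mult_distrib n0 by (simp only: L2_norm_square eq1)
  finally have "((\<integral>w. indicator ?B w * f w \<partial>lborel) / ?b)\<^sup>2 \<le> (1 / ?b) * (\<integral>w. indicator ?B w * (f w)\<^sup>2 \<partial>lborel)"
    using b by (simp add: power_divide field_simps power2_eq_square)
  then have "ennreal (((\<integral>w. indicator ?B w * f w \<partial>lborel) / ?b)\<^sup>2)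
    \<le> ennreal (1 / ?b) * ennreal (\<integral>w. indicator ?B w * (f w)\<^sup>2 \<partial>lborel)"
    using b by (simp add: ennreal_mult[symmetric] ennreal_leI)
  also have "ennreal (\<integral>w. indicator ?B w * (f w)\<^sup>2 \<partial>lborel) = (\<integral>\<^sup>+w. ennreal (indicator ?B w * (f w)\<^sup>2) \<partial>lborel)"
    by (rule nn_integral_eq_integral[symmetric, OF i1]) auto
  also have "\<dots> = (\<integral>\<^sup>+w. ennreal ((f w)\<^sup>2) * indicator ?B w \<partial>lborel)"
    by (intro nn_integral_cong) (auto simp: indicator_def)
  finally show ?thesis .
qed

lemma average_diff:
  fixes \<phi> \<psi> :: "'a::euclidean_space \<Rightarrow> real"
  assumes "continuous_on UNIV \<phi>" "continuous_on UNIV \<psi>"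
  shows "(\<integral>w. indicator (cball 0 1) w * \<phi> w \<partial>lborel) / unit_volume TYPE('a) -
    (\<integral>w. indicator (cball 0 1) w * \<psi> w \<partial>lborel) / unit_volume TYPE('a)
    = (\<integral>w. indicator (cball 0 1) w * (\<phi> w - \<psi> w) \<partial>lborel) / unit_volume TYPE('a::euclidean_space)"
  using integrable_unit_ball[OF assms(1)] integrable_unit_ball[OF assms(2)]
  by (simp add: right_diff_distrib diff_divide_distrib)

lemma average_const: "(\<integral>w. indicator (cball (0::'a) 1) w * c \<partial>lborel) / unit_volume TYPE('a::euclidean_space) = c"
proof -
  have "(\<integral>w. indicator (cball (0::'a) 1) w * c \<partial>lborel) = unit_volume TYPE('a) * c"
    by (simp add: unit_volume_def)
  from this[THEN arg_cong[where f="\<lambda>z. z / unit_volume TYPE('a)"]] show ?thesis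
    using unit_volume_pos[where 'a='a] by (simp only: nonzero_mult_div_cancel_left)
qed

lemma continuous_on_affine_arg:
  fixes \<phi> :: "'a::euclidean_space \<Rightarrow> real"
  shows "continuous_on UNIV \<phi> \<Longrightarrow> continuous_on UNIV (\<lambda>w. \<phi> (x + r *\<^sub>R w))"
  by (rule continuous_on_compose2[of UNIV \<phi>]) (auto intro!: continuous_intros)

text \<open>The energy on the pieces from \<open>a\<close> to \<open>b\<close> of the rays
  \<open>x + t r w\<close>, averaged over \<open>w\<close>. Its integral over \<open>x\<close> is
  bounded by the Dirichlet energy for every \<open>r\<close>, while for the piece from 1/2 to 1 it
  is also bounded uniformly, by a multiple of \<open>r^-n\<close>. The Sobolev inequality
  interpolates between these two bounds.\<close>

definition segment_energy :: "('a::euclidean_space \<Rightarrow> real) \<Rightarrow> real \<Rightarrow> real \<Rightarrow> real \<Rightarrow> 'a \<Rightarrow> ennreal" where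
  "segment_energy \<phi> a b r x = ennreal (1 / unit_volume TYPE('a)) *
     (\<integral>\<^sup>+w. (\<integral>\<^sup>+t. grad_sq \<phi> (x + t *\<^sub>R (r *\<^sub>R w)) * indicator {a..b} t \<partial>lborel) * indicator (cball 0 1) w \<partial>lborel)"

lemma average_diff_square_le:
  fixes \<phi> :: "'a::euclidean_space \<Rightarrow> real"
  assumes "smooth_fun \<phi>" "0 \<le> a" "a \<le> b" "b \<le> 1" "0 \<le> r"
  shows "ennreal ((average (b * r) \<phi> x - average (a * r) \<phi> x)\<^sup>2) \<le> ennreal (r\<^sup>2) * segment_energy \<phi> a b r x"
proof -
  let ?B = "cball (0::'a) 1" and ?b = "unit_volume TYPE('a)"
  let ?f = "\<lambda>w. \<phi> (x + (b * r) *\<^sub>R w) - \<phi> (x + (a * r) *\<^sub>R w)"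
  let ?J = "\<lambda>w. \<integral>\<^sup>+t. grad_sq \<phi> (x + t *\<^sub>R (r *\<^sub>R w)) * indicator {a..b} t \<partial>lborel"
  note c = smooth_fun_imp_grad(2)[OF assms(1)]
  note [measurable] = grad_sq_measurable[OF assms(1)]
  have [measurable]: "?B \<in> sets borel" by simp
  have "ennreal ((average (b * r) \<phi> x - average (a * r) \<phi> x)\<^sup>2) =
    ennreal (((\<integral>w. indicator ?B w * ?f w \<partial>lborel) / ?b)\<^sup>2)"
    unfolding average_def by (subst average_diff) (auto intro!: continuous_on_affine_arg c)
  also have "\<dots> \<le> ennreal (1 / ?b) * (\<integral>\<^sup>+w. ennreal ((?f w)\<^sup>2) * indicator ?B w \<partial>lborel)"
    by (intro average_square_le continuous_intros continuous_on_affine_arg c)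
  finally have 1: "ennreal ((average (b * r) \<phi> x - average (a * r) \<phi> x)\<^sup>2)
    \<le> ennreal (1 / ?b) * (\<integral>\<^sup>+w. ennreal ((?f w)\<^sup>2) * indicator ?B w \<partial>lborel)" .
  have "(\<integral>\<^sup>+w. ennreal ((?f w)\<^sup>2) * indicator ?B w \<partial>lborel) \<le> (\<integral>\<^sup>+w. ennreal (r\<^sup>2) * (?J w * indicator ?B w) \<partial>lborel)"
  proof (rule nn_integral_mono)
    fix w :: 'a
    show "ennreal ((?f w)\<^sup>2) * indicator ?B w \<le> ennreal (r\<^sup>2) * (?J w * indicator ?B w)"
    proof (cases "w \<in> ?B")
      case True
      then have "(norm w)\<^sup>2 \<le> 1" by (simp add: power_le_one)
      then have "r\<^sup>2 * (norm w)\<^sup>2 \<le> r\<^sup>2" by (simp add: mult_left_le)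
      moreover have "(b - a) * (r\<^sup>2 * (norm w)\<^sup>2) \<le> r\<^sup>2 * (norm w)\<^sup>2"
        using assms by (intro mult_left_le_one_le) auto
      ultimately have le: "(b - a) * (norm (r *\<^sub>R w))\<^sup>2 \<le> r\<^sup>2"
        by (simp add: power_mult_distrib)
      have "ennreal ((?f w)\<^sup>2) \<le> ennreal ((b - a) * (norm (r *\<^sub>R w))\<^sup>2) * ?J w"
        using square_diff_le_line_integral[OF assms(1,3), of x "r *\<^sub>R w"] by simp
      also have "\<dots> \<le> ennreal (r\<^sup>2) * ?J w"
        by (intro mult_right_mono ennreal_leI le) simp
      finally show ?thesis using True by simp
    qed simp
  qed
  also have "\<dots> = ennreal (r\<^sup>2) * (\<integral>\<^sup>+w. ?J w * indicator ?B w \<partial>lborel)"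
    by (rule nn_integral_cmult) measurable
  finally have "ennreal (1 / ?b) * (\<integral>\<^sup>+w. ennreal ((?f w)\<^sup>2) * indicator ?B w \<partial>lborel)
     \<le> ennreal (1 / ?b) * (ennreal (r\<^sup>2) * (\<integral>\<^sup>+w. ?J w * indicator ?B w \<partial>lborel))"
    by (rule mult_left_mono) simp
  with 1 show ?thesis
    unfolding segment_energy_def by (simp only: mult.left_commute[of "ennreal (r\<^sup>2)"] order_trans)
qed

lemma segment_energy_measurable:
  fixes \<phi> :: "'a::euclidean_space \<Rightarrow> real"
  assumes "smooth_fun \<phi>"
  shows "segment_energy \<phi> a b r \<in> borel_measurable borel"
proof -
  note [measurable] = grad_sq_measurable[OF assms(1)]
  have [measurable]: "cball (0::'a) 1 \<in> sets borel" by simp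
  show ?thesis unfolding segment_energy_def by measurable
qed

text \<open>Tonelli's theorem moves the integration over \<open>x\<close> inside, where the argument
  is merely translated and the full energy appears. The average over \<open>w\<close> and the length
  \<open>b - a \<le> 1\<close> add nothing.\<close>

lemma nn_integral_segment_energy:
  fixes \<phi> :: "'a::euclidean_space \<Rightarrow> real"
  assumes "smooth_fun \<phi>" "0 \<le> a" "a \<le> b" "b \<le> 1"
  shows "(\<integral>\<^sup>+x. segment_energy \<phi> a b r x \<partial>lborel) \<le> (\<integral>\<^sup>+x. grad_sq \<phi> x \<partial>lborel)"
proof -
  let ?B = "cball (0::'a) 1" and ?b = "unit_volume TYPE('a)"
  note [measurable] = grad_sq_measurable[OF assms(1)]
  let ?I = "\<integral>\<^sup>+x. grad_sq \<phi> x \<partial>lborel"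
  have [measurable]: "?B \<in> sets borel" by simp
  have "(\<integral>\<^sup>+x. segment_energy \<phi> a b r x \<partial>lborel) = ennreal (1 / ?b) *
    (\<integral>\<^sup>+x. \<integral>\<^sup>+w. (\<integral>\<^sup>+t. grad_sq \<phi> (x + t *\<^sub>R (r *\<^sub>R w)) * indicator {a..b} t \<partial>lborel) * indicator ?B w \<partial>lborel \<partial>lborel)"
    unfolding segment_energy_def by (rule nn_integral_cmult) measurable
  also have "(\<integral>\<^sup>+x. \<integral>\<^sup>+w. (\<integral>\<^sup>+t. grad_sq \<phi> (x + t *\<^sub>R (r *\<^sub>R w)) * indicator {a..b} t \<partial>lborel) * indicator ?B w \<partial>lborel \<partial>lborel)
    = (\<integral>\<^sup>+w. \<integral>\<^sup>+x. (\<integral>\<^sup>+t. grad_sq \<phi> (x + t *\<^sub>R (r *\<^sub>R w)) * indicator {a..b} t \<partial>lborel) * indicator ?B w \<partial>lborel \<partial>lborel)"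
    by (rule nn_integral_lborel_swap) measurable
  also have "\<dots> = (\<integral>\<^sup>+w. (\<integral>\<^sup>+x. (\<integral>\<^sup>+t. grad_sq \<phi> (x + t *\<^sub>R (r *\<^sub>R w)) * indicator {a..b} t \<partial>lborel) \<partial>lborel) * indicator ?B w \<partial>lborel)"
    by (intro nn_integral_cong nn_integral_multc) measurable
  also have "\<dots> \<le> (\<integral>\<^sup>+w. ?I * indicator ?B w \<partial>lborel)"
  proof (rule nn_integral_mono, rule mult_right_mono)
    fix w :: 'a
    have "(\<integral>\<^sup>+x. (\<integral>\<^sup>+t. grad_sq \<phi> (x + t *\<^sub>R (r *\<^sub>R w)) * indicator {a..b} t \<partial>lborel) \<partial>lborel)
       = (\<integral>\<^sup>+t. (\<integral>\<^sup>+x. grad_sq \<phi> (x + t *\<^sub>R (r *\<^sub>R w)) * indicator {a..b} t \<partial>lborel) \<partial>lborel)"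
      by (rule nn_integral_lborel_swap) measurable
    also have "\<dots> = (\<integral>\<^sup>+t. ?I * indicator {a..b} t \<partial>lborel)"
      by (intro nn_integral_cong) (simp add: nn_integral_multc nn_integral_lborel_shift)
    also have "\<dots> = ?I * ennreal (b - a)"
      using assms by (simp add: nn_integral_cmult_indicator)
    also have "\<dots> \<le> ?I * 1"
      using assms by (intro mult_left_mono) (auto simp: ennreal_le_1)
    finally show "(\<integral>\<^sup>+x. (\<integral>\<^sup>+t. grad_sq \<phi> (x + t *\<^sub>R (r *\<^sub>R w)) * indicator {a..b} t \<partial>lborel) \<partial>lborel) \<le> ?I"
      by simp
  qed simp
  also have "\<dots> = ?I * ennreal ?b"
    by (simp add: nn_integral_cmult_indicator emeasure_unit_ball)
  finally have "(\<integral>\<^sup>+x. segment_energy \<phi> a b r x \<partial>lborel) \<le> ennreal (1 / ?b) * (?I * ennreal ?b)"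
    by (simp add: mult_left_mono)
  also have "\<dots> = ?I"
    using unit_volume_pos[where 'a='a] by (simp add: mult.left_commute[of _ ?I] ennreal_mult[symmetric])
  finally show ?thesis .
qed

text \<open>For \<open>t\<close> in \<open>{1/2..1}\<close> the dilation
  \<open>w \<mapsto> t r w\<close> has a Jacobian bounded away from 0. Down to \<open>t = 0\<close>
  the factor \<open>(1 / (t r))^n\<close> would not be integrable, which is why radii are compared
  dyadically.\<close>

lemma segment_energy_le:
  fixes \<phi> :: "'a::euclidean_space \<Rightarrow> real"
  assumes "smooth_fun \<phi>" "r > 0"
  shows "segment_energy \<phi> (1/2) 1 r x \<le> ennreal ((2 / r) ^ DIM('a) / unit_volume TYPE('a)) * (\<integral>\<^sup>+x. grad_sq \<phi> x \<partial>lborel)"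
proof -
  let ?B = "cball (0::'a) 1" and ?b = "unit_volume TYPE('a)"
  note [measurable] = grad_sq_measurable[OF assms(1)]
  let ?I = "\<integral>\<^sup>+x. grad_sq \<phi> x \<partial>lborel" and ?S = "{1/2..1::real}"
  have [measurable]: "?B \<in> sets borel" by simp
  have half: "ennreal (1/2) \<le> 1" unfolding ennreal_1[symmetric] by (rule ennreal_leI) simp
  have "(\<integral>\<^sup>+w. (\<integral>\<^sup>+t. grad_sq \<phi> (x + t *\<^sub>R (r *\<^sub>R w)) * indicator ?S t \<partial>lborel) * indicator ?B w \<partial>lborel)
    \<le> (\<integral>\<^sup>+w. (\<integral>\<^sup>+t. grad_sq \<phi> (x + t *\<^sub>R (r *\<^sub>R w)) * indicator ?S t \<partial>lborel) * 1 \<partial>lborel)"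
    by (intro nn_integral_mono mult_left_mono) (auto simp: indicator_def)
  also have "\<dots> = (\<integral>\<^sup>+t. (\<integral>\<^sup>+w. grad_sq \<phi> (x + t *\<^sub>R (r *\<^sub>R w)) * indicator ?S t \<partial>lborel) \<partial>lborel)"
    unfolding mult_1_right by (rule nn_integral_lborel_swap) measurable
  also have "\<dots> \<le> (\<integral>\<^sup>+t. ennreal ((2 / r) ^ DIM('a)) * ?I * indicator ?S t \<partial>lborel)"
  proof (rule nn_integral_mono)
    fix t :: real
    show "(\<integral>\<^sup>+w. grad_sq \<phi> (x + t *\<^sub>R (r *\<^sub>R w)) * indicator ?S t \<partial>lborel) \<le> ennreal ((2 / r) ^ DIM('a)) * ?I * indicator ?S t"
    proof (cases "t \<in> ?S")
      case True
      then have t: "t * r > 0" "1 / (t * r) \<le> 2 / r" using assms(2) by (auto simp: field_simps)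
      have "(\<integral>\<^sup>+w. grad_sq \<phi> (x + (t * r) *\<^sub>R w) \<partial>lborel) = ennreal ((1 / (t * r)) ^ DIM('a)) * ?I"
        by (rule nn_integral_lborel_scaled[OF _ t(1)]) measurable
      also have "\<dots> \<le> ennreal ((2 / r) ^ DIM('a)) * ?I"
        using t assms(2) by (intro mult_right_mono ennreal_leI power_mono) auto
      finally show ?thesis using True by simp
    qed simp
  qed
  also have "\<dots> = ennreal ((2 / r) ^ DIM('a)) * ?I * ennreal (1/2)"
    by (simp add: nn_integral_cmult_indicator)
  also have "\<dots> \<le> ennreal ((2 / r) ^ DIM('a)) * ?I * 1"
    by (intro mult_left_mono half) simp
  finally have "segment_energy \<phi> (1/2) 1 r x \<le> ennreal (1 / ?b) * (ennreal ((2 / r) ^ DIM('a)) * ?I)"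
    unfolding segment_energy_def by (intro mult_left_mono) auto
  also have "\<dots> = ennreal ((2 / r) ^ DIM('a) / ?b) * ?I"
    using assms(2) unit_volume_pos[where 'a='a] by (simp add: mult.assoc[symmetric] ennreal_mult[symmetric])
  finally show ?thesis .
qed

lemma average_tendsto:
  fixes \<phi> :: "'a::euclidean_space \<Rightarrow> real"
  assumes "continuous_on UNIV \<phi>" "r \<longlonglongrightarrow> 0"
  shows "(\<lambda>j. average (r j) \<phi> x) \<longlonglongrightarrow> \<phi> x"
proof (rule LIMSEQ_I)
  fix e :: real assume e: "0 < e"
  let ?B = "cball (0::'a) 1" and ?b = "unit_volume TYPE('a)"
  have b: "?b > 0" by (rule unit_volume_pos)
  have "isCont \<phi> x" using assms(1) by (simp add: continuous_on_eq_continuous_at)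
  then obtain d where d: "d > 0" "\<And>y. dist y x < d \<Longrightarrow> dist (\<phi> y) (\<phi> x) < e / 2"
    using e unfolding continuous_at_eps_delta by (meson half_gt_zero)
  obtain N where N: "\<And>j. j \<ge> N \<Longrightarrow> \<bar>r j\<bar> < d"
    using LIMSEQ_D[OF assms(2) d(1)] by auto
  have "norm (average (r j) \<phi> x - \<phi> x) < e" if "j \<ge> N" for j
  proof -
    have c: "continuous_on UNIV (\<lambda>w. \<phi> (x + r j *\<^sub>R w))" by (rule continuous_on_affine_arg[OF assms(1)])
    have eq: "average (r j) \<phi> x - \<phi> x = (\<integral>w. indicator ?B w * (\<phi> (x + r j *\<^sub>R w) - \<phi> x) \<partial>lborel) / ?b"
      using average_diff[OF c continuous_on_const[of _ "\<phi> x"]] by (simp only: average_def average_const)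
    have "\<bar>\<integral>w. indicator ?B w * (\<phi> (x + r j *\<^sub>R w) - \<phi> x) \<partial>lborel\<bar> \<le> (\<integral>w. indicator ?B w * (e / 2) \<partial>lborel)"
    proof (rule integral_abs_bound_integral)
      show "integrable lborel (\<lambda>w. indicator ?B w * (\<phi> (x + r j *\<^sub>R w) - \<phi> x))"
        "integrable lborel (\<lambda>w. indicator ?B w * (e / 2))"
        by (intro integrable_unit_ball continuous_intros c)+
      fix w :: 'a
      show "\<bar>indicator ?B w * (\<phi> (x + r j *\<^sub>R w) - \<phi> x)\<bar> \<le> indicator ?B w * (e / 2)"
      proof (cases "w \<in> ?B")
        case True
        then have "\<bar>r j\<bar> * norm w < d" using N[OF that] mult_left_le[of "norm w" "\<bar>r j\<bar>"] by simp
        then have "dist (\<phi> (x + r j *\<^sub>R w)) (\<phi> x) < e / 2" by (intro d(2)) (simp add: dist_norm)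
        then show ?thesis using True by (simp add: dist_real_def)
      qed simp
    qed
    then have "\<bar>\<integral>w. indicator ?B w * (\<phi> (x + r j *\<^sub>R w) - \<phi> x) \<partial>lborel\<bar> / ?b \<le> e / 2"
      using average_const[of "e / 2", where 'a='a] b by (metis divide_right_mono less_imp_le)
    then have "norm (average (r j) \<phi> x - \<phi> x) \<le> e / 2"
      unfolding eq using b by simp
    then show ?thesis using e by simp
  qed
  then show "\<exists>no. \<forall>n\<ge>no. norm (average (r n) \<phi> x - \<phi> x) < e" by blast
qed

text \<open>The thresholds form a geometric series with sum \<open>\<bar>y\<bar> / 2\<close>. If all
  increments stayed below them, the limit would be at most
  \<open>\<bar>a 0\<bar> + \<bar>y\<bar> / 2\<close> in modulus, less than
  \<open>\<bar>y\<bar>\<close>. Selecting one large increment takes the place of summing increments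
  in a norm.\<close>

lemma ex_large_increment:
  fixes a :: "nat \<Rightarrow> real"
  assumes "a \<longlonglongrightarrow> y" "0 < \<theta>" "\<theta> < 1" "\<bar>a 0\<bar> < \<bar>y\<bar> / 2"
  shows "\<exists>j. (1 - \<theta>) * \<theta> ^ j * \<bar>y\<bar> / 2 \<le> \<bar>a j - a (Suc j)\<bar>"
proof (rule ccontr)
  assume "\<not> ?thesis"
  then have lt: "\<bar>a j - a (Suc j)\<bar> \<le> (1 - \<theta>) * \<theta> ^ j * \<bar>y\<bar> / 2" for j by (meson linear)
  have tele: "(1 - \<theta>) * \<theta> ^ j * \<bar>y\<bar> / 2 = \<theta> ^ j * \<bar>y\<bar> / 2 - \<theta> ^ Suc j * \<bar>y\<bar> / 2" for j
    by (simp add: field_simps)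
  have b: "\<bar>a n\<bar> \<le> \<bar>a 0\<bar> + (\<bar>y\<bar> / 2 - \<theta> ^ n * \<bar>y\<bar> / 2)" for n
  proof (induction n)
    case (Suc n)
    have "\<bar>a (Suc n)\<bar> \<le> \<bar>a n\<bar> + \<bar>a n - a (Suc n)\<bar>" by simp
    then show ?case using Suc lt[of n] tele[of n] by linarith
  qed simp
  have "\<bar>a n\<bar> \<le> \<bar>a 0\<bar> + \<bar>y\<bar> / 2" for n
  proof -
    have "0 \<le> \<theta> ^ n * \<bar>y\<bar> / 2" using assms(2) by simp
    then show ?thesis using b[of n] by linarith
  qed
  then have "\<bar>y\<bar> \<le> \<bar>a 0\<bar> + \<bar>y\<bar> / 2"
    using tendsto_rabs[OF assms(1)] by (intro LIMSEQ_le_const2) auto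
  with assms(4) show False by simp
qed

lemma power_powr_swap: "0 < x \<Longrightarrow> (x ^ j) powr a = (x powr a) ^ j" for x :: real
  by (simp add: powr_realpow[symmetric] powr_powr mult.commute)

text \<open>Interpolation between an integral and a uniform bound: of the exponent
  \<open>p / 2\<close> of \<open>E\<close>, one power is kept for integration and the remaining
  \<open>p / 2 - 1\<close> is paid for by the uniform bound \<open>s\<close>.\<close>

lemma powr_le_if_square_le:
  fixes p c s y :: real
  assumes "2 \<le> p" "0 \<le> c" "0 \<le> s" "ennreal (y\<^sup>2) \<le> ennreal c * E" "E \<le> ennreal s"
  shows "ennreal (\<bar>y\<bar> powr p) \<le> ennreal (c powr (p / 2) * s powr (p / 2 - 1)) * E"
proof -
  obtain e where e: "E = ennreal e" "0 \<le> e" "e \<le> s"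
    using assms(3,5) by (cases E) (auto simp: ennreal_le_iff2 top_unique)
  have ye: "y\<^sup>2 \<le> c * e"
    using assms(2,4) e by (simp add: ennreal_mult[symmetric])
  have "\<bar>y\<bar> powr p = (y\<^sup>2) powr (p / 2)"
  proof (cases "y = 0")
    case False
    have "y\<^sup>2 = \<bar>y\<bar> powr 2" by (simp add: powr_numeral)
    then show ?thesis by (simp only: powr_powr) simp
  qed simp
  also have "\<dots> \<le> (c * e) powr (p / 2)"
    using ye assms(1) by (intro powr_mono2) auto
  also have "\<dots> = c powr (p / 2) * (e powr (p / 2 - 1) * e)"
  proof (cases "e = 0")
    case False
    then have "e powr (p / 2) = e powr (p / 2 - 1) * e"
      using e by (simp add: powr_diff)
    then show ?thesis using assms(2) e by (simp add: powr_mult)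
  qed simp
  also have "\<dots> \<le> c powr (p / 2) * (s powr (p / 2 - 1) * e)"
    using e assms(1) by (intro mult_left_mono mult_right_mono powr_mono2) auto
  finally have "\<bar>y\<bar> powr p \<le> c powr (p / 2) * s powr (p / 2 - 1) * e" by (simp add: mult.assoc)
  then show ?thesis
    using e by (simp add: ennreal_mult[symmetric] ennreal_leI)
qed

context bounded_domain
begin

section \<open>The Poincare and Sobolev inequalities\<close>

lemma H10_norm_test: "test_fun \<Omega> \<phi> \<Longrightarrow> H10_norm \<phi> = L2_norm M (grad \<phi>)"
  by (rule H10_norm_pair[OF H10_pair_test_fun])

lemma nn_integral_grad_sq:
  assumes "test_fun \<Omega> \<phi>"
  shows "(\<integral>\<^sup>+x. grad_sq \<phi> x \<partial>lborel) = ennreal ((H10_norm \<phi>)\<^sup>2)"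
  using L2_nn_integral[OF test_fun_L2(2)[OF assms]]
    nn_integral_M[OF grad_sq_measurable[OF test_fun_smooth[OF assms]]]
    test_fun_grad_zero_outside[OF assms]
  by (simp add: H10_norm_test[OF assms] grad_sq_def[abs_def])

lemma nn_integral_test_square:
  assumes "test_fun \<Omega> \<phi>"
  shows "(\<integral>\<^sup>+x. ennreal ((\<phi> x)\<^sup>2) \<partial>lborel) = ennreal ((L2_norm M \<phi>)\<^sup>2)"
proof -
  have [measurable]: "\<phi> \<in> borel_measurable borel"
    using smooth_fun_imp_grad(2)[OF test_fun_smooth[OF assms]] by (rule borel_measurable_continuous_onI)
  show ?thesis
    using L2_nn_integral[OF test_fun_L2(1)[OF assms]] nn_integral_M[of "\<lambda>x. ennreal ((\<phi> x)\<^sup>2)"]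
      test_fun_zero_outside[OF assms] by simp
qed

text \<open>Approximants within distance 1 of \<open>u\<close> have norm at most 2. Halving returns
  them to the unit ball, where the estimates for test functions are stated, and the factor 2
  reappears in the limit.\<close>

lemma H10_norm_approx:
  assumes "u \<in> H10 \<Omega>" "H10_norm u \<le> 1"
  obtains \<phi> where "\<And>k. test_fun \<Omega> (\<phi> k)" "\<And>k. H10_norm (\<phi> k) \<le> 1"
    "AE x in M. (\<lambda>k. 2 * \<phi> k x) \<longlonglongrightarrow> u x"
proof -
  have "\<exists>\<phi>. test_fun \<Omega> \<phi> \<and> L2_norm M (\<lambda>x. \<phi> x - u x) < inverse (real (Suc k)) \<and>
      H10_norm (\<lambda>x. \<phi> x - u x) < inverse (real (Suc k))" for k
    by (rule H10_approx[OF assms(1), of "inverse (real (Suc k))"]) auto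
  then obtain \<phi> where \<phi>: "\<And>k. test_fun \<Omega> (\<phi> k)" "\<And>k. L2_norm M (\<lambda>x. \<phi> k x - u x) < inverse (real (Suc k))"
      "\<And>k. H10_norm (\<lambda>x. \<phi> k x - u x) < inverse (real (Suc k))"
    by metis
  have "(\<lambda>k. L2_norm M (\<lambda>x. \<phi> k x - u x)) \<longlonglongrightarrow> 0"
    by (rule Lim_null_comparison[OF always_eventually LIMSEQ_inverse_real_of_nat])
       (use \<phi>(2) in \<open>simp add: less_imp_le\<close>)
  then obtain r where r: "strict_mono (r :: nat \<Rightarrow> nat)" "AE x in M. (\<lambda>k. \<phi> (r k) x) \<longlonglongrightarrow> u x"
    by (rule L2_tendsto_AE_subseq[OF test_fun_L2(1)[OF \<phi>(1)] H10_L2(1)[OF assms(1)]]) (rule that)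
  define \<psi> where "\<psi> k x = (1/2) * \<phi> (r k) x" for k x
  have t: "test_fun \<Omega> (\<psi> k)" for k
    using test_fun_lincomb[OF \<phi>(1) \<phi>(1), of "1/2" "r k" 0 "r k"] by (simp add: \<psi>_def[abs_def])
  have "H10_norm (\<psi> k) \<le> 1" for k
  proof -
    have n2: "H10_norm (\<phi> j) \<le> 2" for j
    proof -
      have "H10_norm (\<lambda>x. (\<phi> j x - u x) + u x) \<le> H10_norm (\<lambda>x. \<phi> j x - u x) + H10_norm u"
        by (intro H10_norm_add H10_diff test_fun_H10 \<phi> assms)
      moreover have "inverse (real (Suc j)) \<le> 1" by (simp add: inverse_eq_divide)
      ultimately show ?thesis using \<phi>(3)[of j] assms(2) by simp
    qed
    show ?thesis
      using n2[of "r k"] H10_norm_scale[OF test_fun_H10[OF \<phi>(1)], of "1/2" "r k"] by (simp add: \<psi>_def[abs_def])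
  qed
  moreover have "AE x in M. (\<lambda>k. 2 * \<psi> k x) \<longlonglongrightarrow> u x"
    using r(2) by (simp add: \<psi>_def)
  ultimately show thesis using that t by blast
qed

text \<open>A shift by twice the radius of a ball around 0 containing the domain carries the domain
  off itself, so \<open>\<phi> x\<close> is its own difference along the shift. Integrating the line
  estimate over \<open>x\<close> gives the constant \<open>2 * R\<close>, and density extends it to
  the whole space.\<close>

lemma Poincare:
  obtains P where "0 < P" "\<And>u. u \<in> H10 \<Omega> \<Longrightarrow> L2_norm M u \<le> P * H10_norm u"
proof -
  obtain R where R: "R > 0" "\<And>x. x \<in> \<Omega> \<Longrightarrow> norm x < R"
    using bounded_domain bounded_pos_less by blast
  obtain i :: 'a where i: "i \<in> Basis" using nonempty_Basis by blast
  define w where "w = (2 * R) *\<^sub>R i"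
  have nw: "norm w = 2 * R" using R i by (simp add: w_def)
  have test: "L2_norm M \<phi> \<le> (2 * R) * H10_norm \<phi>" if t: "test_fun \<Omega> \<phi>" for \<phi>
  proof -
    note sm = test_fun_smooth[OF t]
    note [measurable] = grad_sq_measurable[OF sm]
    have "(\<integral>\<^sup>+x. ennreal ((\<phi> x)\<^sup>2) \<partial>lborel) \<le>
       (\<integral>\<^sup>+x. ennreal ((2 * R)\<^sup>2) * (\<integral>\<^sup>+t. grad_sq \<phi> (x + t *\<^sub>R w) * indicator {0..1} t \<partial>lborel) \<partial>lborel)"
    proof (rule nn_integral_mono)
      fix x
      show "ennreal ((\<phi> x)\<^sup>2) \<le> ennreal ((2 * R)\<^sup>2) * (\<integral>\<^sup>+t. grad_sq \<phi> (x + t *\<^sub>R w) * indicator {0..1} t \<partial>lborel)"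
      proof (cases "x \<in> \<Omega>")
        case True
        have "norm w - norm x \<le> norm (x + w)" using norm_triangle_ineq2[of w "- x"] by (simp add: add.commute)
        then have "x + w \<notin> \<Omega>" using R(2)[OF True] R(2)[of "x + w"] nw by auto
        then have "\<phi> (x + w) = 0" by (rule test_fun_zero_outside[OF t])
        then show ?thesis
          using square_diff_le_line_integral[OF sm, of 0 1 x w] nw by simp
      next
        case False
        then show ?thesis using test_fun_zero_outside[OF t] by simp
      qed
    qed
    also have "\<dots> = ennreal ((2 * R)\<^sup>2) * (\<integral>\<^sup>+x. \<integral>\<^sup>+t. grad_sq \<phi> (x + t *\<^sub>R w) * indicator {0..1} t \<partial>lborel \<partial>lborel)"
      by (rule nn_integral_cmult) measurable
    also have "(\<integral>\<^sup>+x. \<integral>\<^sup>+t. grad_sq \<phi> (x + t *\<^sub>R w) * indicator {0..1::real} t \<partial>lborel \<partial>lborel)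
       = (\<integral>\<^sup>+t. \<integral>\<^sup>+x. grad_sq \<phi> (x + t *\<^sub>R w) * indicator {0..1} t \<partial>lborel \<partial>lborel)"
      by (rule nn_integral_lborel_swap) measurable
    also have "\<dots> = (\<integral>\<^sup>+t. (\<integral>\<^sup>+x. grad_sq \<phi> x \<partial>lborel) * indicator {0..1::real} t \<partial>lborel)"
      by (intro nn_integral_cong) (simp add: nn_integral_multc nn_integral_lborel_shift)
    also have "\<dots> = (\<integral>\<^sup>+x. grad_sq \<phi> x \<partial>lborel)"
      by (simp add: nn_integral_cmult_indicator)
    finally have "(L2_norm M \<phi>)\<^sup>2 \<le> ((2 * R) * H10_norm \<phi>)\<^sup>2"
      by (simp add: nn_integral_test_square[OF t] nn_integral_grad_sq[OF t] ennreal_mult[symmetric] power_mult_distrib)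
    then show ?thesis by (rule power2_le_imp_le) (use R(1) in simp)
  qed
  have "L2_norm M u \<le> (2 * R) * H10_norm u" if u: "u \<in> H10 \<Omega>" for u
  proof (rule field_le_epsilon)
    fix e :: real assume e: "0 < e"
    define d where "d = e / (2 * R + 1)"
    have d: "d > 0" "(2 * R + 1) * d = e" using e R(1) by (auto simp: d_def)
    obtain \<phi> where \<phi>: "test_fun \<Omega> \<phi>" "L2_norm M (\<lambda>x. \<phi> x - u x) < d" "H10_norm (\<lambda>x. \<phi> x - u x) < d"
      using H10_approx[OF u d(1)] by blast
    have "L2_norm M u \<le> L2_norm M \<phi> + d"
      using L2_norm_le_diff[OF H10_L2(1)[OF u] test_fun_L2(1)[OF \<phi>(1)]] \<phi>(2)
        L2_norm_minus_commute[of M u \<phi>] by linarith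
    also have "L2_norm M \<phi> \<le> (2 * R) * H10_norm \<phi>" by (rule test[OF \<phi>(1)])
    also have "H10_norm \<phi> \<le> H10_norm u + d"
      using H10_norm_add[OF H10_diff[OF test_fun_H10[OF \<phi>(1)] u] u] \<phi>(3) by simp
    finally have "L2_norm M u \<le> (2 * R) * (H10_norm u + d) + d" using R(1) by simp
    also have "\<dots> = (2 * R) * H10_norm u + e" using d(2) by (simp add: algebra_simps)
    finally show "L2_norm M u \<le> (2 * R) * H10_norm u + e" .
  qed
  then show thesis using that[of "2 * R"] R(1) by simp
qed

text \<open>The mean of the square of \<open>\<phi>\<close> over the unit ball at \<open>x\<close>.
  It dominates the square of the coarsest average, where the dyadic comparison starts.\<close>

definition ball_energy :: "('a \<Rightarrow> real) \<Rightarrow> 'a \<Rightarrow> ennreal" where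
  "ball_energy \<phi> x = ennreal (1 / unit_volume TYPE('a)) *
     (\<integral>\<^sup>+w. ennreal ((\<phi> (x + w))\<^sup>2) * indicator (cball 0 1) w \<partial>lborel)"

lemma ball_energy_bounds:
  assumes "continuous_on UNIV \<phi>"
  shows "ball_energy \<phi> \<in> borel_measurable borel"
    "ball_energy \<phi> x \<le> ennreal (1 / unit_volume TYPE('a)) * (\<integral>\<^sup>+x. ennreal ((\<phi> x)\<^sup>2) \<partial>lborel)"
    "(\<integral>\<^sup>+x. ball_energy \<phi> x \<partial>lborel) = (\<integral>\<^sup>+x. ennreal ((\<phi> x)\<^sup>2) \<partial>lborel)"
proof -
  let ?B = "cball (0::'a) 1" and ?b = "unit_volume TYPE('a)"
  have [measurable]: "\<phi> \<in> borel_measurable borel" using assms by (rule borel_measurable_continuous_onI)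
  have [measurable]: "?B \<in> sets borel" by simp
  show "ball_energy \<phi> \<in> borel_measurable borel" unfolding ball_energy_def by measurable
  have "(\<integral>\<^sup>+w. ennreal ((\<phi> (x + w))\<^sup>2) * indicator ?B w \<partial>lborel) \<le> (\<integral>\<^sup>+w. ennreal ((\<phi> (w + x))\<^sup>2) \<partial>lborel)"
    by (intro nn_integral_mono) (auto simp: indicator_def add.commute)
  also have "\<dots> = (\<integral>\<^sup>+x. ennreal ((\<phi> x)\<^sup>2) \<partial>lborel)"
    by (rule nn_integral_lborel_shift) measurable
  finally show "ball_energy \<phi> x \<le> ennreal (1 / ?b) * (\<integral>\<^sup>+x. ennreal ((\<phi> x)\<^sup>2) \<partial>lborel)"
    unfolding ball_energy_def by (intro mult_left_mono) auto
  have "(\<integral>\<^sup>+x. ball_energy \<phi> x \<partial>lborel) = ennreal (1 / ?b) *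
     (\<integral>\<^sup>+x. \<integral>\<^sup>+w. ennreal ((\<phi> (x + w))\<^sup>2) * indicator ?B w \<partial>lborel \<partial>lborel)"
    unfolding ball_energy_def by (rule nn_integral_cmult) measurable
  also have "(\<integral>\<^sup>+x. \<integral>\<^sup>+w. ennreal ((\<phi> (x + w))\<^sup>2) * indicator ?B w \<partial>lborel \<partial>lborel)
    = (\<integral>\<^sup>+w. \<integral>\<^sup>+x. ennreal ((\<phi> (x + w))\<^sup>2) * indicator ?B w \<partial>lborel \<partial>lborel)"
    by (rule nn_integral_lborel_swap) measurable
  also have "\<dots> = (\<integral>\<^sup>+w. (\<integral>\<^sup>+x. ennreal ((\<phi> x)\<^sup>2) \<partial>lborel) * indicator ?B w \<partial>lborel)"
    by (intro nn_integral_cong)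
       (simp add: nn_integral_multc nn_integral_lborel_shift[of "\<lambda>x. ennreal ((\<phi> x)\<^sup>2)"])
  also have "\<dots> = (\<integral>\<^sup>+x. ennreal ((\<phi> x)\<^sup>2) \<partial>lborel) * ennreal ?b"
    by (simp add: nn_integral_cmult_indicator emeasure_unit_ball)
  finally show "(\<integral>\<^sup>+x. ball_energy \<phi> x \<partial>lborel) = (\<integral>\<^sup>+x. ennreal ((\<phi> x)\<^sup>2) \<partial>lborel)"
    using unit_volume_pos[where 'a='a] by (simp add: mult.left_commute[of _ "nn_integral _ _"] ennreal_mult[symmetric])
qed

text \<open>Either the average at radius 1 has at least half the modulus of \<open>\<phi> x\<close>,
  or one of the increments between consecutive dyadic radii is large. The parameter
  \<open>\<theta>\<close> sets the decay of the thresholds and is adapted to the dimension and the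
  exponent by the users of this bound.\<close>

lemma test_fun_pointwise_bound:
  assumes "test_fun \<Omega> \<phi>" "0 < \<theta>" "\<theta> < 1"
  shows "ennreal ((\<phi> x)\<^sup>2) \<le> ennreal 4 * ball_energy \<phi> x \<or>
    (\<exists>j. ennreal ((\<phi> x)\<^sup>2) \<le> ennreal (4 / (1 - \<theta>)\<^sup>2 * ((1/2) ^ j / \<theta> ^ j)\<^sup>2) * segment_energy \<phi> (1/2) 1 ((1/2) ^ j) x)"
proof -
  note sm = test_fun_smooth[OF assms(1)]
  note c = smooth_fun_imp_grad(2)[OF sm]
  define a where "a j = average ((1/2) ^ j) \<phi> x" for j
  have lim: "a \<longlonglongrightarrow> \<phi> x"
    unfolding a_def by (intro average_tendsto c LIMSEQ_realpow_zero) auto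
  show ?thesis
  proof (cases "\<bar>a 0\<bar> < \<bar>\<phi> x\<bar> / 2")
    case True
    then obtain j where j: "(1 - \<theta>) * \<theta> ^ j * \<bar>\<phi> x\<bar> / 2 \<le> \<bar>a j - a (Suc j)\<bar>"
      using ex_large_increment[OF lim assms(2,3)] by blast
    define k where "k = 2 / ((1 - \<theta>) * \<theta> ^ j)"
    have k: "k > 0" using assms by (simp add: k_def)
    have "\<bar>\<phi> x\<bar> \<le> k * \<bar>a j - a (Suc j)\<bar>"
      using j assms by (simp add: k_def field_simps)
    then have "\<bar>\<phi> x\<bar>\<^sup>2 \<le> (k * \<bar>a j - a (Suc j)\<bar>)\<^sup>2" by (intro power_mono) auto
    then have "ennreal ((\<phi> x)\<^sup>2) \<le> ennreal (k\<^sup>2 * (a j - a (Suc j))\<^sup>2)"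
      by (intro ennreal_leI) (simp add: power_mult_distrib)
    also have "\<dots> = ennreal (k\<^sup>2) * ennreal ((a j - a (Suc j))\<^sup>2)"
      by (rule ennreal_mult) auto
    also have "\<dots> \<le> ennreal (k\<^sup>2) * (ennreal (((1/2) ^ j)\<^sup>2) * segment_energy \<phi> (1/2) 1 ((1/2) ^ j) x)"
      using average_diff_square_le[OF sm, of "1/2" 1 "(1/2) ^ j" x]
      by (intro mult_left_mono) (simp_all add: a_def)
    also have "\<dots> = ennreal (k\<^sup>2 * ((1/2) ^ j)\<^sup>2) * segment_energy \<phi> (1/2) 1 ((1/2) ^ j) x"
      by (simp add: ennreal_mult mult.assoc)
    also have "k\<^sup>2 * ((1/2) ^ j)\<^sup>2 = 4 / (1 - \<theta>)\<^sup>2 * ((1/2) ^ j / \<theta> ^ j)\<^sup>2"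
      using assms by (simp add: k_def power_divide power_mult_distrib)
    finally show ?thesis by blast
  next
    case False
    then have "\<bar>\<phi> x\<bar>\<^sup>2 \<le> (2 * \<bar>a 0\<bar>)\<^sup>2" by (intro power_mono) auto
    then have "ennreal ((\<phi> x)\<^sup>2) \<le> ennreal (4 * (a 0)\<^sup>2)"
      by (intro ennreal_leI) (simp add: power_mult_distrib)
    also have "\<dots> = ennreal 4 * ennreal ((a 0)\<^sup>2)" by (rule ennreal_mult) auto
    also have "ennreal ((a 0)\<^sup>2) \<le> ball_energy \<phi> x"
      using average_square_le[OF continuous_on_affine_arg[OF c, of x 1]]
      by (simp add: a_def average_def ball_energy_def)
    finally show ?thesis by (auto simp: mult_left_mono)
  qed
qed

text \<open>The subcritical Sobolev inequality. At each scale the pointwise bound is interpolated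
  between the integral and the uniform bound on \<open>segment_energy\<close>; the strict inequality
  assumed for \<open>p\<close> makes the resulting constants \<open>D j\<close> decay
  geometrically.\<close>

lemma test_fun_powr_bound:
  fixes p :: real
  assumes "2 \<le> p" "real DIM('a) * (p - 2) / 2 < p"
  obtains C where "0 \<le> C" "\<And>\<phi>. test_fun \<Omega> \<phi> \<Longrightarrow> H10_norm \<phi> \<le> 1 \<Longrightarrow>
     (\<integral>\<^sup>+x. ennreal (\<bar>\<phi> x\<bar> powr p) \<partial>lborel) \<le> ennreal C"
proof -
  let ?n = "DIM('a)" and ?b = "unit_volume TYPE('a)"
  have b: "?b > 0" by (rule unit_volume_pos)
  obtain P where P: "0 < P" "\<And>u. u \<in> H10 \<Omega> \<Longrightarrow> L2_norm M u \<le> P * H10_norm u"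
    by (rule Poincare) (rule that)
  \<comment> \<open>Half of the relative slack in the hypothesis on \<open>p\<close>. The exponent
    of 2 gained per scale is \<open>(\<epsilon> - 1) * p + n * (p / 2 - 1)\<close>, which this
    choice makes equal to \<open>- (\<epsilon> * p)\<close>.\<close>
  define \<epsilon> where "\<epsilon> = (1 - real ?n * (p - 2) / (2 * p)) / 2"
  have \<epsilon>: "\<epsilon> > 0" "(\<epsilon> - 1) * p + real ?n * (p / 2 - 1) = - (\<epsilon> * p)"
    using assms by (auto simp: \<epsilon>_def field_simps)
  define \<theta> :: real where "\<theta> = 2 powr (- \<epsilon>)"
  have \<theta>: "0 < \<theta>" "\<theta> < 1" using \<epsilon>(1) by (auto simp: \<theta>_def powr_less_one)
  define K where "K = 4 / (1 - \<theta>)\<^sup>2"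
  have K: "K > 0" using \<theta> by (simp add: K_def)
  define c where "c j = K * ((1/2) ^ j / \<theta> ^ j)\<^sup>2" for j :: nat
  define S where "S j = (2 / (1/2) ^ j) ^ ?n / ?b" for j :: nat
  define D where "D j = c j powr (p / 2) * S j powr (p / 2 - 1)" for j
  define D' where "D' = 4 powr (p / 2) * (P\<^sup>2 / ?b) powr (p / 2 - 1)"
  \<comment> \<open>The ratio of consecutive \<open>D j\<close>: its first factor comes from
    \<open>c j\<close>, which scales like \<open>(2 \<theta>)^(-2 j)\<close>, its second from
    \<open>S j\<close>, which scales like \<open>2^(n j)\<close>.\<close>
  define \<rho> where "\<rho> = ((1 / (2 * \<theta>))\<^sup>2) powr (p / 2) * (2 ^ ?n) powr (p / 2 - 1)"
  have "(1 / (2 * \<theta>))\<^sup>2 = 2 powr (2 * (\<epsilon> - 1))"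
    by (simp add: \<theta>_def powr_minus powr_diff powr_add powr_mult_base field_simps power2_eq_square powr_add[symmetric])
  then have "\<rho> = (2 powr (2 * (\<epsilon> - 1))) powr (p / 2) * (2 powr real ?n) powr (p / 2 - 1)"
    by (simp only: \<rho>_def powr_realpow[OF zero_less_numeral])
  also have "\<dots> = 2 powr ((\<epsilon> - 1) * p) * 2 powr (real ?n * (p / 2 - 1))"
  proof -
    have "2 * (\<epsilon> - 1) * (p / 2) = (\<epsilon> - 1) * p" by (simp add: field_simps)
    then show ?thesis by (simp only: powr_powr)
  qed
  also have "\<dots> = 2 powr ((\<epsilon> - 1) * p + real ?n * (p / 2 - 1))"
    by (rule powr_add[symmetric])
  finally have "\<rho> = 2 powr ((\<epsilon> - 1) * p + real ?n * (p / 2 - 1))" .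
  then have "\<rho> = 2 powr (- (\<epsilon> * p))" using \<epsilon>(2) by simp
  moreover have "\<epsilon> * p > 0" using \<epsilon>(1) assms(1) by simp
  ultimately have \<rho>: "0 < \<rho>" "\<rho> < 1" by (auto simp: powr_less_one)
  have c_eq: "c j = K * ((1 / (2 * \<theta>))\<^sup>2) ^ j" for j
  proof -
    have "(1/2) ^ j / \<theta> ^ j = (1 / (2 * \<theta>)) ^ j" by (simp add: power_divide power_mult_distrib)
    moreover have "((1 / (2 * \<theta>)) ^ j)\<^sup>2 = ((1 / (2 * \<theta>))\<^sup>2) ^ j"
      by (simp only: power_mult[symmetric] mult.commute)
    ultimately show ?thesis by (simp only: c_def)
  qed
  have S_eq: "S j = 2 ^ ?n / ?b * (2 ^ ?n) ^ j" for j
    by (simp add: S_def power_mult_distrib power_mult[symmetric] mult.commute power_one_over divide_simps)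
  have D_eq: "D j = D 0 * \<rho> ^ j" for j
  proof -
    have "c j powr (p / 2) = K powr (p / 2) * (((1 / (2 * \<theta>))\<^sup>2) powr (p / 2)) ^ j"
      using K \<theta> by (simp add: c_eq powr_mult power_powr_swap)
    moreover have "S j powr (p / 2 - 1) = (2 ^ ?n / ?b) powr (p / 2 - 1) * ((2 ^ ?n) powr (p / 2 - 1)) ^ j"
      unfolding S_eq using b
      by (subst powr_mult)
         (simp_all only: power_powr_swap[OF zero_less_power[OF zero_less_numeral]])
    ultimately show ?thesis
      by (simp add: D_def c_eq[of 0] S_eq[of 0] \<rho>_def power_mult_distrib mult_ac)
  qed
  have "summable (\<lambda>j. D 0 * \<rho> ^ j)"
    by (intro summable_mult summable_geometric) (use \<rho> in simp)
  moreover have "D = (\<lambda>j. D 0 * \<rho> ^ j)" by (rule ext) (rule D_eq)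
  ultimately have sD: "summable D" by metis
  have D0: "D j \<ge> 0" for j by (simp add: D_def)
  show thesis
  proof (rule that)
    show "0 \<le> D' * P\<^sup>2 + (\<Sum>j. D j)"
      using suminf_nonneg[OF sD D0] by (simp add: D'_def)
    fix \<phi> assume t: "test_fun \<Omega> \<phi>" and n: "H10_norm \<phi> \<le> 1"
    note sm = test_fun_smooth[OF t]
    note cont = smooth_fun_imp_grad(2)[OF sm]
    have I: "(\<integral>\<^sup>+x. grad_sq \<phi> x \<partial>lborel) \<le> 1"
      using n by (simp add: nn_integral_grad_sq[OF t] power_le_one)
    have "P * H10_norm \<phi> \<le> P * 1" using n P(1) by (intro mult_left_mono) auto
    then have "L2_norm M \<phi> \<le> P" using P(2)[OF test_fun_H10[OF t]] by linarith
    then have J: "(\<integral>\<^sup>+x. ennreal ((\<phi> x)\<^sup>2) \<partial>lborel) \<le> ennreal (P\<^sup>2)"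
      by (simp add: nn_integral_test_square[OF t] power_mono ennreal_leI)
    note [measurable] = ball_energy_bounds(1)[OF cont] segment_energy_measurable[OF sm]
    \<comment> \<open>The alternative and the index \<open>j\<close> depend on \<open>x\<close>.
      Adding the bounds for all cases yields one measurable majorant that can be integrated term by
      term.\<close>
    have "ennreal (\<bar>\<phi> x\<bar> powr p) \<le> ennreal D' * ball_energy \<phi> x +
        (\<Sum>j. ennreal (D j) * segment_energy \<phi> (1/2) 1 ((1/2) ^ j) x)" for x
      using test_fun_pointwise_bound[OF t \<theta>, of x]
    proof
      assume 1: "ennreal ((\<phi> x)\<^sup>2) \<le> ennreal 4 * ball_energy \<phi> x"
      have "ball_energy \<phi> x \<le> ennreal (1 / ?b) * ennreal (P\<^sup>2)"
        using ball_energy_bounds(2)[OF cont] J by (meson mult_left_mono order_trans zero_le)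
      then have "ball_energy \<phi> x \<le> ennreal (P\<^sup>2 / ?b)"
        using b by (simp add: ennreal_mult[symmetric])
      from powr_le_if_square_le[OF assms(1) _ _ 1 this] b
      have "ennreal (\<bar>\<phi> x\<bar> powr p) \<le> ennreal D' * ball_energy \<phi> x" by (simp add: D'_def)
      then show ?thesis by (rule order_trans) simp
    next
      assume "\<exists>j. ennreal ((\<phi> x)\<^sup>2) \<le> ennreal (4 / (1 - \<theta>)\<^sup>2 * ((1/2) ^ j / \<theta> ^ j)\<^sup>2) * segment_energy \<phi> (1/2) 1 ((1/2) ^ j) x"
      then obtain j where 1: "ennreal ((\<phi> x)\<^sup>2) \<le> ennreal (c j) * segment_energy \<phi> (1/2) 1 ((1/2) ^ j) x"
        unfolding c_def K_def by blast
      have "segment_energy \<phi> (1/2) 1 ((1/2) ^ j) x \<le> ennreal (S j) * 1"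
        using segment_energy_le[OF sm, of "(1/2) ^ j" x] I unfolding S_def
        by (meson mult_left_mono order_trans zero_le zero_less_power half_gt_zero zero_less_one)
      then have 2: "segment_energy \<phi> (1/2) 1 ((1/2) ^ j) x \<le> ennreal (S j)" by simp
      have "0 \<le> c j" "0 \<le> S j" using K b by (auto simp: c_def S_def)
      from powr_le_if_square_le[OF assms(1) this 1 2]
      have "ennreal (\<bar>\<phi> x\<bar> powr p) \<le> ennreal (D j) * segment_energy \<phi> (1/2) 1 ((1/2) ^ j) x"
        by (simp add: D_def)
      also have "\<dots> \<le> (\<Sum>j. ennreal (D j) * segment_energy \<phi> (1/2) 1 ((1/2) ^ j) x)"
        using sum_le_suminf[of "\<lambda>j. ennreal (D j) * segment_energy \<phi> (1/2) 1 ((1/2) ^ j) x" "{j}"] by simp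
      finally show ?thesis by (rule order_trans) simp
    qed
    then have "(\<integral>\<^sup>+x. ennreal (\<bar>\<phi> x\<bar> powr p) \<partial>lborel) \<le>
       (\<integral>\<^sup>+x. ennreal D' * ball_energy \<phi> x + (\<Sum>j. ennreal (D j) * segment_energy \<phi> (1/2) 1 ((1/2) ^ j) x) \<partial>lborel)"
      by (intro nn_integral_mono)
    also have "\<dots> = ennreal D' * (\<integral>\<^sup>+x. ball_energy \<phi> x \<partial>lborel) +
        (\<Sum>j. ennreal (D j) * (\<integral>\<^sup>+x. segment_energy \<phi> (1/2) 1 ((1/2) ^ j) x \<partial>lborel))"
      by (simp add: nn_integral_add nn_integral_cmult nn_integral_suminf)
    also have "\<dots> \<le> ennreal D' * ennreal (P\<^sup>2) + (\<Sum>j. ennreal (D j) * 1)"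
    proof (intro add_mono mult_left_mono suminf_le)
      show "(\<integral>\<^sup>+x. ball_energy \<phi> x \<partial>lborel) \<le> ennreal (P\<^sup>2)"
        using ball_energy_bounds(3)[OF cont] J by simp
      show "(\<integral>\<^sup>+x. segment_energy \<phi> (1/2) 1 ((1/2) ^ j) x \<partial>lborel) \<le> 1" for j
        using nn_integral_segment_energy[OF sm, of "1/2" 1 "(1/2)^j"] I by simp
    qed auto
    also have "\<dots> = ennreal (D' * P\<^sup>2 + (\<Sum>j. D j))"
      using suminf_nonneg[OF sD D0]
      by (simp add: suminf_ennreal2[OF D0 sD] ennreal_mult[symmetric] ennreal_plus[symmetric] D'_def del: ennreal_plus)
    finally show "(\<integral>\<^sup>+x. ennreal (\<bar>\<phi> x\<bar> powr p) \<partial>lborel) \<le> ennreal (D' * P\<^sup>2 + (\<Sum>j. D j))" .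
  qed
qed

text \<open>In dimension one the uniform bound on \<open>segment_energy\<close> grows only like
  \<open>2^j\<close>. With \<open>\<theta> = 3/4\<close> the other factor decays like
  \<open>(4/9)^j\<close>, so their product is of order \<open>(8/9)^j\<close> and the estimate is
  pointwise.\<close>

lemma test_fun_sup_bound_1D:
  assumes "DIM('a) = 1"
  obtains C where "0 \<le> C" "\<And>\<phi> x. test_fun \<Omega> \<phi> \<Longrightarrow> H10_norm \<phi> \<le> 1 \<Longrightarrow> \<bar>\<phi> x\<bar> \<le> C"
proof -
  let ?b = "unit_volume TYPE('a)"
  have b: "?b > 0" by (rule unit_volume_pos)
  obtain P where P: "0 < P" "\<And>u. u \<in> H10 \<Omega> \<Longrightarrow> L2_norm M u \<le> P * H10_norm u"
    by (rule Poincare) (rule that)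
  \<comment> \<open>One summand for each alternative: 4 times the bound on
    \<open>ball_energy\<close>, and 64 = 4 / (1 - 3/4)^2 times the factor 2 that comes from halving
    the radius.\<close>
  define C where "C = 4 * P\<^sup>2 / ?b + 128 / ?b"
  have C: "C \<ge> 0" "4 * P\<^sup>2 / ?b \<le> C" "128 / ?b \<le> C" using b by (auto simp: C_def)
  show thesis
  proof (rule that)
    show "0 \<le> sqrt C" using C by simp
    fix \<phi> x assume t: "test_fun \<Omega> \<phi>" and n: "H10_norm \<phi> \<le> 1"
    note sm = test_fun_smooth[OF t]
    note cont = smooth_fun_imp_grad(2)[OF sm]
    have I: "(\<integral>\<^sup>+x. grad_sq \<phi> x \<partial>lborel) \<le> 1"
      using n by (simp add: nn_integral_grad_sq[OF t] power_le_one)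
    have "P * H10_norm \<phi> \<le> P * 1" using n P(1) by (intro mult_left_mono) auto
    then have "L2_norm M \<phi> \<le> P" using P(2)[OF test_fun_H10[OF t]] by linarith
    then have J: "(\<integral>\<^sup>+x. ennreal ((\<phi> x)\<^sup>2) \<partial>lborel) \<le> ennreal (P\<^sup>2)"
      by (simp add: nn_integral_test_square[OF t] power_mono ennreal_leI)
    have "ennreal ((\<phi> x)\<^sup>2) \<le> ennreal C"
    proof (rule disjE[OF test_fun_pointwise_bound[OF t, of "3/4" x]])
      assume "ennreal ((\<phi> x)\<^sup>2) \<le> ennreal 4 * ball_energy \<phi> x"
      also have "\<dots> \<le> ennreal 4 * (ennreal (1 / ?b) * ennreal (P\<^sup>2))"
        using ball_energy_bounds(2)[OF cont, of x] J by (meson mult_left_mono order_trans zero_le)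
      also have "\<dots> = ennreal (4 * P\<^sup>2 / ?b)"
        using b by (simp add: ennreal_mult[symmetric] del: ennreal_numeral)
      also have "\<dots> \<le> ennreal C" by (intro ennreal_leI C)
      finally show ?thesis .
    next
      assume "\<exists>j. ennreal ((\<phi> x)\<^sup>2) \<le> ennreal (4 / (1 - 3/4)\<^sup>2 * ((1/2) ^ j / (3/4) ^ j)\<^sup>2) * segment_energy \<phi> (1/2) 1 ((1/2) ^ j) x"
      moreover have "4 / (1 - 3/4)\<^sup>2 = (64::real)" by (simp add: power2_eq_square)
      ultimately obtain j where "ennreal ((\<phi> x)\<^sup>2) \<le> ennreal (64 * ((1/2) ^ j / (3/4) ^ j)\<^sup>2) * segment_energy \<phi> (1/2) 1 ((1/2) ^ j) x"
        by (simp only:) blast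
      also have "\<dots> \<le> ennreal (64 * ((1/2) ^ j / (3/4) ^ j)\<^sup>2) * (ennreal (2 / (1/2) ^ j / ?b) * 1)"
      proof (rule mult_left_mono)
        have "segment_energy \<phi> (1/2) 1 ((1/2) ^ j) x \<le> ennreal ((2 / (1/2) ^ j) ^ DIM('a) / ?b) * 1"
          by (rule order_trans[OF segment_energy_le[OF sm] mult_left_mono[OF I]]) auto
        then show "segment_energy \<phi> (1/2) 1 ((1/2) ^ j) x \<le> ennreal (2 / (1/2) ^ j / ?b) * 1"
          by (simp add: assms)
      qed simp
      also have "\<dots> = ennreal (64 * ((1/2) ^ j / (3/4) ^ j)\<^sup>2 * (2 / (1/2) ^ j / ?b))"
        using b by (simp add: ennreal_mult[symmetric])
      also have "\<dots> = ennreal (128 / ?b * (8/9) ^ j)"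
      proof -
        have "(1/2) ^ j / (3/4) ^ j = (2/3::real) ^ j"
          by (subst power_divide[symmetric]) simp
        moreover have "((2/3::real) ^ j)\<^sup>2 = ((2/3)\<^sup>2) ^ j"
          by (simp only: power_mult[symmetric] mult.commute)
        moreover have "((2/3)\<^sup>2) ^ j / (1/2::real) ^ j = (8/9) ^ j"
          by (subst power_divide[symmetric]) (simp add: power2_eq_square)
        moreover have "64 * X * (2 / h / ?b) = 128 / ?b * (X / h)" for X h :: real by simp
        ultimately show ?thesis by (simp only:)
      qed
      also have "ennreal (128 / ?b * (8/9) ^ j) \<le> ennreal C"
      proof (rule ennreal_leI)
        have "128 / ?b * (8/9) ^ j \<le> 128 / ?b * 1" using b by (intro mult_left_mono) (auto simp: power_le_one)
        then show "128 / ?b * (8/9) ^ j \<le> C" using C(3) by simp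
      qed
      finally show ?thesis .
    qed simp_all
    then have "(\<phi> x)\<^sup>2 \<le> C" using C(1) by simp
    then show "\<bar>\<phi> x\<bar> \<le> sqrt C" by (rule real_le_rsqrt[of "\<bar>\<phi> x\<bar>", simplified])
  qed
qed


text \<open>Fatou's lemma carries the estimate from test functions to their almost everywhere limit;
  \<open>2 powr p\<close> undoes the halving of the approximants.\<close>

lemma H10_powr_bound:
  fixes p :: real
  assumes "2 \<le> p" "real DIM('a) * (p - 2) / 2 < p"
  obtains C where "0 \<le> C" "\<And>u. u \<in> H10 \<Omega> \<Longrightarrow> H10_norm u \<le> 1 \<Longrightarrow>
     (\<integral>\<^sup>+x. ennreal (\<bar>u x\<bar> powr p) \<partial>M) \<le> ennreal C"
proof -
  obtain C where C: "0 \<le> C" "\<And>\<phi>. test_fun \<Omega> \<phi> \<Longrightarrow> H10_norm \<phi> \<le> 1 \<Longrightarrow>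
     (\<integral>\<^sup>+x. ennreal (\<bar>\<phi> x\<bar> powr p) \<partial>lborel) \<le> ennreal C"
    by (rule test_fun_powr_bound[OF assms]) (rule that)
  show thesis
  proof (rule that)
    show "0 \<le> 2 powr p * C" using C(1) by simp
    fix u assume u: "u \<in> H10 \<Omega>" "H10_norm u \<le> 1"
    obtain \<phi> where \<phi>: "\<And>k. test_fun \<Omega> (\<phi> k)" "\<And>k. H10_norm (\<phi> k) \<le> 1"
      "AE x in M. (\<lambda>k. 2 * \<phi> k x) \<longlonglongrightarrow> u x"
      by (rule H10_norm_approx[OF u]) (rule that)
    have m [measurable]: "\<phi> k \<in> borel_measurable borel" for k
      using smooth_fun_imp_grad(2)[OF test_fun_smooth[OF \<phi>(1)]] by (rule borel_measurable_continuous_onI)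
    note m' [measurable] = borel_measurable_M[OF m]
    have "(\<integral>\<^sup>+x. ennreal (\<bar>u x\<bar> powr p) \<partial>M) \<le> (\<integral>\<^sup>+x. liminf (\<lambda>k. ennreal (\<bar>2 * \<phi> k x\<bar> powr p)) \<partial>M)"
    proof (rule nn_integral_mono_AE, rule AE_mp[OF \<phi>(3) AE_I2], intro impI)
      fix x assume "(\<lambda>k. 2 * \<phi> k x) \<longlonglongrightarrow> u x"
      then have "(\<lambda>k. \<bar>2 * \<phi> k x\<bar> powr p) \<longlonglongrightarrow> \<bar>u x\<bar> powr p"
        by (intro tendsto_powr' tendsto_rabs tendsto_const) (use assms in auto)
      then have "(\<lambda>k. ennreal (\<bar>2 * \<phi> k x\<bar> powr p)) \<longlonglongrightarrow> ennreal (\<bar>u x\<bar> powr p)"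
        by (rule tendsto_ennrealI)
      then show "ennreal (\<bar>u x\<bar> powr p) \<le> liminf (\<lambda>k. ennreal (\<bar>2 * \<phi> k x\<bar> powr p))"
        using lim_imp_Liminf[OF sequentially_bot, symmetric] by (intro eq_refl) blast
    qed
    also have "\<dots> \<le> liminf (\<lambda>k. \<integral>\<^sup>+x. ennreal (\<bar>2 * \<phi> k x\<bar> powr p) \<partial>M)"
      by (rule nn_integral_liminf) measurable
    also have "\<dots> \<le> liminf (\<lambda>k. ennreal (2 powr p * C))"
    proof (rule Liminf_mono, rule always_eventually, rule allI)
      fix k
      have "(\<integral>\<^sup>+x. ennreal (\<bar>2 * \<phi> k x\<bar> powr p) \<partial>M) = (\<integral>\<^sup>+x. ennreal (2 powr p) * ennreal (\<bar>\<phi> k x\<bar> powr p) \<partial>M)"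
        by (intro nn_integral_cong) (simp add: abs_mult powr_mult ennreal_mult)
      also have "\<dots> = ennreal (2 powr p) * (\<integral>\<^sup>+x. ennreal (\<bar>\<phi> k x\<bar> powr p) \<partial>M)"
        by (rule nn_integral_cmult) measurable
      also have "(\<integral>\<^sup>+x. ennreal (\<bar>\<phi> k x\<bar> powr p) \<partial>M) = (\<integral>\<^sup>+x. ennreal (\<bar>\<phi> k x\<bar> powr p) \<partial>lborel)"
        using test_fun_zero_outside[OF \<phi>(1)] by (intro nn_integral_M) auto
      also have "ennreal (2 powr p) * \<dots> \<le> ennreal (2 powr p) * ennreal C"
        by (intro mult_left_mono C \<phi>) simp
      also have "\<dots> = ennreal (2 powr p * C)" using C(1) by (simp add: ennreal_mult)
      finally show "(\<integral>\<^sup>+x. ennreal (\<bar>2 * \<phi> k x\<bar> powr p) \<partial>M) \<le> ennreal (2 powr p * C)" .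
    qed
    finally show "(\<integral>\<^sup>+x. ennreal (\<bar>u x\<bar> powr p) \<partial>M) \<le> ennreal (2 powr p * C)"
      by (simp add: Liminf_const)
  qed
qed

lemma H10_sup_bound_1D:
  assumes "DIM('a) = 1"
  obtains C where "0 \<le> C" "\<And>u. u \<in> H10 \<Omega> \<Longrightarrow> H10_norm u \<le> 1 \<Longrightarrow> AE x in M. \<bar>u x\<bar> \<le> C"
proof -
  obtain C where C: "0 \<le> C" "\<And>\<phi> x. test_fun \<Omega> \<phi> \<Longrightarrow> H10_norm \<phi> \<le> 1 \<Longrightarrow> \<bar>\<phi> x\<bar> \<le> C"
    by (rule test_fun_sup_bound_1D[OF assms]) (rule that)
  show thesis
  proof (rule that)
    show "0 \<le> 2 * C" using C by simp
    fix u assume u: "u \<in> H10 \<Omega>" "H10_norm u \<le> 1"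
    obtain \<phi> where \<phi>: "\<And>k. test_fun \<Omega> (\<phi> k)" "\<And>k. H10_norm (\<phi> k) \<le> 1"
      "AE x in M. (\<lambda>k. 2 * \<phi> k x) \<longlonglongrightarrow> u x"
      by (rule H10_norm_approx[OF u]) (rule that)
    show "AE x in M. \<bar>u x\<bar> \<le> 2 * C"
      using \<phi>(3)
    proof (rule AE_mp[OF _ AE_I2], intro impI)
      fix x assume "(\<lambda>k. 2 * \<phi> k x) \<longlonglongrightarrow> u x"
      then have "(\<lambda>k. \<bar>2 * \<phi> k x\<bar>) \<longlonglongrightarrow> \<bar>u x\<bar>" by (rule tendsto_rabs)
      then show "\<bar>u x\<bar> \<le> 2 * C"
        by (rule LIMSEQ_le_const2) (use C(2)[OF \<phi>(1,2)] in \<open>simp add: abs_mult\<close>)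
    qed
  qed
qed

section \<open>Rellich's compactness theorem\<close>

lemma average_zero: "average 0 \<phi> = \<phi>" for \<phi> :: "'a \<Rightarrow> real"
  unfolding average_def by (rule ext) (simp only: scaleR_zero_left add_0_right average_const)

lemma average_measurable:
  fixes \<phi> :: "'a \<Rightarrow> real"
  assumes "continuous_on UNIV \<phi>"
  shows "average r \<phi> \<in> borel_measurable borel"
proof -
  have [measurable]: "\<phi> \<in> borel_measurable borel" using assms by (rule borel_measurable_continuous_onI)
  have [measurable]: "cball (0::'a) 1 \<in> sets borel" by simp
  show ?thesis unfolding average_def by measurable
qed

lemma nn_integral_M_le:
  assumes [measurable]: "f \<in> borel_measurable borel"
  shows "(\<integral>\<^sup>+x. f x \<partial>M) \<le> (\<integral>\<^sup>+x. f x \<partial>lborel)"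
proof -
  have [measurable]: "\<Omega> \<in> sets borel" by simp
  have "(\<integral>\<^sup>+x. f x \<partial>M) = (\<integral>\<^sup>+x. f x * indicator \<Omega> x \<partial>M)"
    by (intro nn_integral_cong) (simp add: space_restrict_space)
  also have "\<dots> = (\<integral>\<^sup>+x. f x * indicator \<Omega> x \<partial>lborel)"
    by (rule nn_integral_M) auto
  also have "\<dots> \<le> (\<integral>\<^sup>+x. f x \<partial>lborel)"
    by (intro nn_integral_mono) (auto simp: indicator_def)
  finally show ?thesis .
qed

text \<open>The error is the same for all test functions in the unit ball, so precompactness can be
  checked on the averages at one small radius.\<close>

lemma average_close:
  assumes "test_fun \<Omega> \<phi>" "H10_norm \<phi> \<le> 1" "0 \<le> r"
  shows "L2 M (\<lambda>x. average r \<phi> x - \<phi> x)" "L2_norm M (\<lambda>x. average r \<phi> x - \<phi> x) \<le> r"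
proof -
  note sm = test_fun_smooth[OF assms(1)]
  note cont = smooth_fun_imp_grad(2)[OF sm]
  have [measurable]: "average r \<phi> \<in> borel_measurable borel" "\<phi> \<in> borel_measurable borel"
    using average_measurable[OF cont] cont by (auto intro: borel_measurable_continuous_onI)
  have I: "(\<integral>\<^sup>+x. grad_sq \<phi> x \<partial>lborel) \<le> 1"
    using assms(2) by (simp add: nn_integral_grad_sq[OF assms(1)] power_le_one)
  have "(\<integral>\<^sup>+x. ennreal ((norm (average r \<phi> x - \<phi> x))\<^sup>2) \<partial>M) \<le> (\<integral>\<^sup>+x. ennreal ((norm (average r \<phi> x - \<phi> x))\<^sup>2) \<partial>lborel)"
    by (rule nn_integral_M_le) measurable
  also have "\<dots> \<le> (\<integral>\<^sup>+x. ennreal (r\<^sup>2) * segment_energy \<phi> 0 1 r x \<partial>lborel)"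
    using average_diff_square_le[OF sm, of 0 1 r] assms(3)
    by (intro nn_integral_mono) (simp add: average_zero)
  also have "\<dots> = ennreal (r\<^sup>2) * (\<integral>\<^sup>+x. segment_energy \<phi> 0 1 r x \<partial>lborel)"
    by (rule nn_integral_cmult) (use segment_energy_measurable[OF sm] in simp)
  also have "\<dots> \<le> ennreal (r\<^sup>2) * 1"
    by (intro mult_left_mono order_trans[OF nn_integral_segment_energy[OF sm] I]) auto
  finally have "(\<integral>\<^sup>+x. ennreal ((norm (average r \<phi> x - \<phi> x))\<^sup>2) \<partial>M) \<le> ennreal (r\<^sup>2)" by simp
  moreover have "(\<lambda>x. average r \<phi> x - \<phi> x) \<in> borel_measurable M"
    by (rule borel_measurable_M) measurable
  ultimately show "L2 M (\<lambda>x. average r \<phi> x - \<phi> x)" "L2_norm M (\<lambda>x. average r \<phi> x - \<phi> x) \<le> r"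
    using L2_I_nn_integral[of "\<lambda>x. average r \<phi> x - \<phi> x" M r] assms(3) by blast+
qed

lemma average_bound:
  assumes "test_fun \<Omega> \<phi>" "0 < r"
  shows "(average r \<phi> x)\<^sup>2 \<le> (1 / r) ^ DIM('a) / unit_volume TYPE('a) * (L2_norm M \<phi>)\<^sup>2"
proof -
  let ?b = "unit_volume TYPE('a)"
  have b: "?b > 0" by (rule unit_volume_pos)
  note cont = smooth_fun_imp_grad(2)[OF test_fun_smooth[OF assms(1)]]
  have [measurable]: "\<phi> \<in> borel_measurable borel"
    using cont by (auto intro: borel_measurable_continuous_onI)
  have "ennreal ((average r \<phi> x)\<^sup>2) \<le> ennreal (1 / ?b) * (\<integral>\<^sup>+w. ennreal ((\<phi> (x + r *\<^sub>R w))\<^sup>2) * indicator (cball 0 1) w \<partial>lborel)"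
    unfolding average_def by (intro average_square_le continuous_on_affine_arg cont)
  also have "\<dots> \<le> ennreal (1 / ?b) * (\<integral>\<^sup>+w. ennreal ((\<phi> (x + r *\<^sub>R w))\<^sup>2) \<partial>lborel)"
    by (intro mult_left_mono nn_integral_mono) (auto simp: indicator_def)
  also have "(\<integral>\<^sup>+w. ennreal ((\<phi> (x + r *\<^sub>R w))\<^sup>2) \<partial>lborel) = ennreal ((1 / r) ^ DIM('a)) * ennreal ((L2_norm M \<phi>)\<^sup>2)"
    using nn_integral_lborel_scaled[of "\<lambda>x. ennreal ((\<phi> x)\<^sup>2)", OF _ assms(2), of x]
    by (simp add: nn_integral_test_square[OF assms(1)])
  also have "ennreal (1 / ?b) * \<dots> = ennreal ((1 / r) ^ DIM('a) / ?b * (L2_norm M \<phi>)\<^sup>2)"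
    using b assms(2) by (simp add: ennreal_mult[symmetric] mult_ac)
  finally show ?thesis using b assms(2) by simp
qed

text \<open>Moving the centre from \<open>y\<close> to \<open>x\<close> costs the energy on parallel
  segments, one for each \<open>w\<close>, and Tonelli's theorem bounds it by the total energy. For
  fixed \<open>r\<close> this is the equicontinuity required by the Arzela-Ascoli theorem.\<close>

lemma average_Lipschitz:
  assumes "test_fun \<Omega> \<phi>" "H10_norm \<phi> \<le> 1" "0 < r"
  shows "(average r \<phi> x - average r \<phi> y)\<^sup>2 \<le> (1 / r) ^ DIM('a) / unit_volume TYPE('a) * (norm (x - y))\<^sup>2"
proof -
  let ?b = "unit_volume TYPE('a)"
  have b: "?b > 0" by (rule unit_volume_pos)
  note sm = test_fun_smooth[OF assms(1)]
  note cont = smooth_fun_imp_grad(2)[OF sm]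
  note [measurable] = grad_sq_measurable[OF sm]
  have I: "(\<integral>\<^sup>+x. grad_sq \<phi> x \<partial>lborel) \<le> 1"
    using assms(2) by (simp add: nn_integral_grad_sq[OF assms(1)] power_le_one)
  let ?f = "\<lambda>w. \<phi> (x + r *\<^sub>R w) - \<phi> (y + r *\<^sub>R w)"
  let ?J = "\<lambda>w. \<integral>\<^sup>+t. grad_sq \<phi> ((y + t *\<^sub>R (x - y)) + r *\<^sub>R w) * indicator {0..1::real} t \<partial>lborel"
  have "(average r \<phi> x - average r \<phi> y) = (\<integral>w. indicator (cball 0 1) w * ?f w \<partial>lborel) / ?b"
    unfolding average_def by (intro average_diff continuous_on_affine_arg cont)
  then have "ennreal ((average r \<phi> x - average r \<phi> y)\<^sup>2) \<le> ennreal (1 / ?b) * (\<integral>\<^sup>+w. ennreal ((?f w)\<^sup>2) * indicator (cball 0 1) w \<partial>lborel)"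
    by (simp only:) (intro average_square_le continuous_intros continuous_on_affine_arg cont)
  also have "\<dots> \<le> ennreal (1 / ?b) * (\<integral>\<^sup>+w. ennreal ((norm (x - y))\<^sup>2) * ?J w \<partial>lborel)"
  proof (rule mult_left_mono[OF nn_integral_mono])
    fix w :: 'a
    have "ennreal ((?f w)\<^sup>2) \<le> ennreal ((norm (x - y))\<^sup>2) * ?J w"
      using square_diff_le_line_integral[OF sm, of 0 1 "y + r *\<^sub>R w" "x - y"] by (simp add: add_ac)
    then show "ennreal ((?f w)\<^sup>2) * indicator (cball 0 1) w \<le> ennreal ((norm (x - y))\<^sup>2) * ?J w"
      by (auto simp: indicator_def)
  qed simp
  also have "(\<integral>\<^sup>+w. ennreal ((norm (x - y))\<^sup>2) * ?J w \<partial>lborel) = ennreal ((norm (x - y))\<^sup>2) * (\<integral>\<^sup>+w. ?J w \<partial>lborel)"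
    by (rule nn_integral_cmult) measurable
  also have "(\<integral>\<^sup>+w. ?J w \<partial>lborel) = (\<integral>\<^sup>+t. \<integral>\<^sup>+w. grad_sq \<phi> ((y + t *\<^sub>R (x - y)) + r *\<^sub>R w) * indicator {0..1::real} t \<partial>lborel \<partial>lborel)"
    by (rule nn_integral_lborel_swap) measurable
  also have "\<dots> = (\<integral>\<^sup>+t. (ennreal ((1 / r) ^ DIM('a)) * (\<integral>\<^sup>+x. grad_sq \<phi> x \<partial>lborel)) * indicator {0..1::real} t \<partial>lborel)"
    by (intro nn_integral_cong) (simp add: nn_integral_multc nn_integral_lborel_scaled[OF _ assms(3)])
  also have "\<dots> = ennreal ((1 / r) ^ DIM('a)) * (\<integral>\<^sup>+x. grad_sq \<phi> x \<partial>lborel)"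
    by (simp add: nn_integral_cmult_indicator)
  finally have "ennreal ((average r \<phi> x - average r \<phi> y)\<^sup>2) \<le> ennreal (1 / ?b) * (ennreal ((norm (x - y))\<^sup>2) *
      (ennreal ((1 / r) ^ DIM('a)) * (\<integral>\<^sup>+x. grad_sq \<phi> x \<partial>lborel)))" .
  also have "\<dots> \<le> ennreal (1 / ?b) * (ennreal ((norm (x - y))\<^sup>2) * (ennreal ((1 / r) ^ DIM('a)) * 1))"
    by (intro mult_left_mono I) auto
  also have "\<dots> = ennreal ((1 / r) ^ DIM('a) / ?b * (norm (x - y))\<^sup>2)"
    using b assms(3) by (simp add: ennreal_mult[symmetric] mult_ac)
  finally show ?thesis using b assms(3) by simp
qed

lemma L2_norm_le_sup:
  fixes f :: "'a \<Rightarrow> real"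
  assumes "f \<in> borel_measurable M" "\<And>x. x \<in> \<Omega> \<Longrightarrow> \<bar>f x\<bar> \<le> B" "0 \<le> B"
  shows "L2 M f" "L2_norm M f \<le> B * sqrt (measure M \<Omega>)"
proof -
  have "(\<integral>\<^sup>+x. ennreal ((norm (f x))\<^sup>2) \<partial>M) \<le> (\<integral>\<^sup>+x. ennreal (B\<^sup>2) \<partial>M)"
  proof (rule nn_integral_mono, rule ennreal_leI)
    fix x assume "x \<in> space M"
    then have "\<bar>f x\<bar> \<le> B" using assms(2) by (simp add: space_restrict_space)
    then have "\<bar>f x\<bar>\<^sup>2 \<le> B\<^sup>2" by (intro power_mono) auto
    then show "(norm (f x))\<^sup>2 \<le> B\<^sup>2" by simp
  qed
  also have "\<dots> = ennreal (B\<^sup>2) * emeasure M (space M)" by simp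
  also have "emeasure M (space M) = ennreal (measure M \<Omega>)"
    by (simp add: M.emeasure_eq_measure space_restrict_space)
  also have "ennreal (B\<^sup>2) * \<dots> = ennreal ((B * sqrt (measure M \<Omega>))\<^sup>2)"
    by (simp add: ennreal_mult[symmetric] power_mult_distrib)
  finally show "L2 M f" "L2_norm M f \<le> B * sqrt (measure M \<Omega>)"
    using L2_I_nn_integral[OF assms(1)] assms(3) by auto
qed

text \<open>Averages at radius \<open>\<delta> / 4\<close> are equibounded and equicontinuous, so a
  subsequence of them converges uniformly. Two averaging errors of \<open>\<delta> / 4\<close> and
  an error of at most \<open>\<delta> / 4\<close> between the averages stay below
  \<open>\<delta>\<close>. As the radius is tied to \<open>\<delta>\<close>, a diagonal argument has
  to follow.\<close>

lemma Rellich_test_step: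
  fixes \<phi> :: "nat \<Rightarrow> 'a \<Rightarrow> real"
  assumes "\<And>k. test_fun \<Omega> (\<phi> k)" "\<And>k. H10_norm (\<phi> k) \<le> 1" "0 < \<delta>"
  shows "\<exists>r. strict_mono (r :: nat \<Rightarrow> nat) \<and>
    (\<exists>N. \<forall>k\<ge>N. \<forall>l\<ge>N. L2_norm M (\<lambda>x. \<phi> (r k) x - \<phi> (r l) x) < \<delta>)"
proof -
  let ?b = "unit_volume TYPE('a)"
  have b: "?b > 0" by (rule unit_volume_pos)
  obtain P where P: "0 < P" "\<And>u. u \<in> H10 \<Omega> \<Longrightarrow> L2_norm M u \<le> P * H10_norm u"
    by (rule Poincare) (rule that)
  define r where "r = \<delta> / 4"
  have r: "r > 0" using assms(3) by (simp add: r_def)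
  define L where "L = sqrt ((1 / r) ^ DIM('a) / ?b)"
  have L: "L \<ge> 0" "L\<^sup>2 = (1 / r) ^ DIM('a) / ?b" using b r by (auto simp: L_def)
  have bound: "\<bar>average r (\<phi> k) x\<bar> \<le> L * P" for k x
  proof (rule power2_le_imp_le)
    have "P * H10_norm (\<phi> k) \<le> P * 1" using assms(2)[of k] P(1) by (intro mult_left_mono) auto
    then have "L2_norm M (\<phi> k) \<le> P" using P(2)[OF test_fun_H10[OF assms(1)], of k] by linarith
    then have "(L2_norm M (\<phi> k))\<^sup>2 \<le> P\<^sup>2" by (intro power_mono) auto
    then have "L\<^sup>2 * (L2_norm M (\<phi> k))\<^sup>2 \<le> L\<^sup>2 * P\<^sup>2" by (intro mult_left_mono) auto
    with average_bound[OF assms(1) r, of k x] show "\<bar>average r (\<phi> k) x\<bar>\<^sup>2 \<le> (L * P)\<^sup>2"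
      by (simp add: power_mult_distrib L(2))
  qed (use L P in simp)
  have lip: "\<bar>average r (\<phi> k) x - average r (\<phi> k) y\<bar> \<le> L * norm (x - y)" for k x y
  proof (rule power2_le_imp_le)
    show "\<bar>average r (\<phi> k) x - average r (\<phi> k) y\<bar>\<^sup>2 \<le> (L * norm (x - y))\<^sup>2"
      using average_Lipschitz[OF assms(1,2) r, of k x y] by (simp add: power_mult_distrib L(2))
  qed (use L in simp)
  have "compact (closure \<Omega>)" using bounded_domain by (simp add: compact_closure)
  then obtain g s where s: "strict_mono (s :: nat \<Rightarrow> nat)"
    and g: "\<And>e. 0 < e \<Longrightarrow> \<exists>N. \<forall>n x. n \<ge> N \<and> x \<in> closure \<Omega> \<longrightarrow> norm (average r (\<phi> (s n)) x - g x) < e"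
  proof (rule Arzela_Ascoli[where \<F>="\<lambda>n. average r (\<phi> n)" and M="L * P"])
    show "norm (average r (\<phi> n) x) \<le> L * P" for n x using bound by simp
    show "\<exists>d>0. \<forall>n y. y \<in> closure \<Omega> \<and> norm (x - y) < d \<longrightarrow> norm (average r (\<phi> n) x - average r (\<phi> n) y) < e"
      if "0 < e" for x e
    proof (intro exI[of _ "e / (L + 1)"] conjI allI impI)
      show "0 < e / (L + 1)" using that L by simp
      fix n y assume "y \<in> closure \<Omega> \<and> norm (x - y) < e / (L + 1)"
      then have "(L + 1) * norm (x - y) < e" using L(1) by (simp add: pos_less_divide_eq mult.commute)
      moreover have "L * norm (x - y) \<le> (L + 1) * norm (x - y)" by (intro mult_right_mono) auto
      ultimately show "norm (average r (\<phi> n) x - average r (\<phi> n) y) < e"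
        using lip[of n x y] by simp
    qed
  qed (rule that)
  define V where "V = sqrt (measure M \<Omega>)"
  have V: "V \<ge> 0" by (simp add: V_def)
  \<comment> \<open>Two uniform errors \<open>e\<close>, multiplied by the root \<open>V\<close> of
    the volume, amount to at most \<open>\<delta> / 4\<close>; the summand 1 keeps the denominator
    positive.\<close>
  define e where "e = \<delta> / (8 * (V + 1))"
  have e: "e > 0" using assms(3) V by (simp add: e_def)
  have eV: "2 * e * V \<le> \<delta> / 4"
  proof -
    have "2 * e * (V + 1) = \<delta> / 4" using V by (simp add: e_def field_simps)
    moreover have "2 * e * V \<le> 2 * e * (V + 1)" using e by simp
    ultimately show ?thesis by simp
  qed
  obtain N where N: "\<And>n x. n \<ge> N \<Longrightarrow> x \<in> \<Omega> \<Longrightarrow> \<bar>average r (\<phi> (s n)) x - g x\<bar> < e"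
    using g[OF e] closure_subset[of \<Omega>] by fastforce
  have "L2_norm M (\<lambda>x. \<phi> (s k) x - \<phi> (s l) x) < \<delta>" if "k \<ge> N" "l \<ge> N" for k l
  proof -
    let ?A = "\<lambda>k. average r (\<phi> (s k))"
    note ac = average_close[OF assms(1,2) less_imp_le[OF r]]
    have L2A: "L2 M (?A k)" for k
      using L2_add[OF ac(1)[of "s k"] test_fun_L2(1)[OF assms(1), of "s k"]] by simp
    have m: "(\<lambda>x. ?A k x - ?A l x) \<in> borel_measurable M"
      using L2_diff[OF L2A L2A] by (simp add: L2_def)
    have b2: "\<bar>?A k x - ?A l x\<bar> \<le> 2 * e" if "x \<in> \<Omega>" for x
      using N[OF \<open>k \<ge> N\<close> that] N[OF \<open>l \<ge> N\<close> that] by linarith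
    have "L2_norm M (\<lambda>x. ?A k x - ?A l x) \<le> 2 * e * V"
      unfolding V_def by (rule L2_norm_le_sup(2)[OF m b2]) (use e in auto)
    moreover have "L2_norm M (\<lambda>x. \<phi> (s k) x - \<phi> (s l) x) \<le> L2_norm M (\<lambda>x. \<phi> (s k) x - ?A k x) + L2_norm M (\<lambda>x. ?A k x - \<phi> (s l) x)"
      by (intro L2_norm_triangle_diff test_fun_L2 assms L2A)
    moreover have "L2_norm M (\<lambda>x. ?A k x - \<phi> (s l) x) \<le> L2_norm M (\<lambda>x. ?A k x - ?A l x) + L2_norm M (\<lambda>x. ?A l x - \<phi> (s l) x)"
      by (intro L2_norm_triangle_diff test_fun_L2 assms L2A)
    moreover have "L2_norm M (\<lambda>x. \<phi> (s k) x - ?A k x) \<le> r"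
      using ac(2)[of "s k"] L2_norm_minus_commute[of M "\<phi> (s k)" "?A k"] by linarith
    ultimately show ?thesis using ac(2)[of "s l"] eV assms(3) by (simp add: r_def)
  qed
  then show ?thesis using s by blast
qed

lemma Rellich_test:
  fixes \<phi> :: "nat \<Rightarrow> 'a \<Rightarrow> real"
  assumes "\<And>k. test_fun \<Omega> (\<phi> k)" "\<And>k. H10_norm (\<phi> k) \<le> 1"
  obtains r where "strict_mono (r :: nat \<Rightarrow> nat)"
    "\<And>e. 0 < e \<Longrightarrow> \<exists>N. \<forall>k\<ge>N. \<forall>l\<ge>N. L2_norm M (\<lambda>x. \<phi> (r k) x - \<phi> (r l) x) < e"
proof -
  define Q where "Q n s \<longleftrightarrow> (\<exists>N. \<forall>k\<ge>N. \<forall>l\<ge>N. L2_norm M (\<lambda>x. \<phi> (s k) x - \<phi> (s l) x) < (1/2) ^ n)"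
    for n :: nat and s :: "nat \<Rightarrow> nat"
  interpret subseqs Q
  proof
    fix n and s :: "nat \<Rightarrow> nat"
    show "\<exists>r'. strict_mono r' \<and> Q n (s \<circ> r')"
      using Rellich_test_step[of "\<phi> \<circ> s" "(1/2) ^ n"] assms by (simp add: Q_def)
  qed
  have stable: "Q n (s \<circ> r)" if r: "strict_mono r" and Q: "Q n s" for r s n
  proof -
    from Q obtain N where "\<forall>k\<ge>N. \<forall>l\<ge>N. L2_norm M (\<lambda>x. \<phi> (s k) x - \<phi> (s l) x) < (1/2) ^ n"
      unfolding Q_def by blast
    moreover have "r k \<ge> N" if "k \<ge> N" for k using seq_suble[OF r, of k] that by simp
    ultimately show ?thesis unfolding Q_def by (intro exI[of _ N]) simp
  qed
  show thesis
  proof (rule that)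
    show "strict_mono diagseq" by (rule subseq_diagseq)
    fix e :: real assume "0 < e"
    then obtain n where n: "(1/2) ^ n < e" using real_arch_pow_inv[of e "1/2"] by auto
    \<comment> \<open>Only from index \<open>Suc n\<close> on is the diagonal sequence a subsequence
      of the \<open>n\<close>-th selection, hence the shift.\<close>
    have "Q n (diagseq \<circ> (+) (Suc n))" by (rule diagseq_holds[OF stable])
    then obtain N where N: "\<And>k l. k \<ge> N \<Longrightarrow> l \<ge> N \<Longrightarrow>
        L2_norm M (\<lambda>x. \<phi> (diagseq (Suc n + k)) x - \<phi> (diagseq (Suc n + l)) x) < (1/2) ^ n"
      unfolding Q_def by auto
    have "L2_norm M (\<lambda>x. \<phi> (diagseq k) x - \<phi> (diagseq l) x) < e" if "k \<ge> Suc n + N" "l \<ge> Suc n + N" for k l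
    proof -
      have "Suc n + (k - Suc n) = k" "Suc n + (l - Suc n) = l" "k - Suc n \<ge> N" "l - Suc n \<ge> N" using that by auto
      then show ?thesis using N[of "k - Suc n" "l - Suc n"] n by simp
    qed
    then show "\<exists>N. \<forall>k\<ge>N. \<forall>l\<ge>N. L2_norm M (\<lambda>x. \<phi> (diagseq k) x - \<phi> (diagseq l) x) < e" by blast
  qed
qed

text \<open>Each \<open>v k\<close> is replaced by a test function at distance less than
  \<open>inverse (real (Suc k))\<close>, halved to return to the unit ball. The replacement errors
  tend to 0 along every subsequence.\<close>

lemma Rellich:
  fixes v :: "nat \<Rightarrow> 'a \<Rightarrow> real"
  assumes "\<And>k. v k \<in> H10 \<Omega>" "\<And>k. H10_norm (v k) \<le> 1"
  obtains r where "strict_mono (r :: nat \<Rightarrow> nat)"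
    "\<And>e. 0 < e \<Longrightarrow> \<exists>N. \<forall>k\<ge>N. \<forall>l\<ge>N. L2_norm M (\<lambda>x. v (r k) x - v (r l) x) < e"
proof -
  have "\<exists>\<phi>. test_fun \<Omega> \<phi> \<and> L2_norm M (\<lambda>x. \<phi> x - v k x) < inverse (real (Suc k)) \<and>
      H10_norm (\<lambda>x. \<phi> x - v k x) < inverse (real (Suc k))" for k
    by (rule H10_approx[OF assms(1)[of k], of "inverse (real (Suc k))"]) auto
  then obtain \<phi> where \<phi>: "\<And>k. test_fun \<Omega> (\<phi> k)" "\<And>k. L2_norm M (\<lambda>x. \<phi> k x - v k x) < inverse (real (Suc k))"
      "\<And>k. H10_norm (\<lambda>x. \<phi> k x - v k x) < inverse (real (Suc k))"
    by metis
  define \<psi> where "\<psi> k x = (1/2) * \<phi> k x" for k x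
  have t: "test_fun \<Omega> (\<psi> k)" for k
    using test_fun_lincomb[OF \<phi>(1) \<phi>(1), of "1/2" k 0 k] by (simp add: \<psi>_def[abs_def])
  have n: "H10_norm (\<psi> k) \<le> 1" for k
  proof -
    have "H10_norm (\<lambda>x. (\<phi> k x - v k x) + v k x) \<le> H10_norm (\<lambda>x. \<phi> k x - v k x) + H10_norm (v k)"
      by (intro H10_norm_add H10_diff test_fun_H10 \<phi> assms)
    moreover have "inverse (real (Suc k)) \<le> 1" by (simp add: inverse_eq_divide)
    ultimately have "H10_norm (\<phi> k) \<le> 2" using \<phi>(3)[of k] assms(2)[of k] by simp
    then show ?thesis
      using H10_norm_scale[OF test_fun_H10[OF \<phi>(1)], of "1/2" k] by (simp add: \<psi>_def[abs_def])
  qed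
  obtain r where r: "strict_mono (r :: nat \<Rightarrow> nat)"
    "\<And>e. 0 < e \<Longrightarrow> \<exists>N. \<forall>k\<ge>N. \<forall>l\<ge>N. L2_norm M (\<lambda>x. \<psi> (r k) x - \<psi> (r l) x) < e"
    by (rule Rellich_test[OF t n]) (rule that)
  show thesis
  proof (rule that[OF r(1)])
    fix e :: real assume e: "0 < e"
    obtain N1 where N1: "\<And>k l. k \<ge> N1 \<Longrightarrow> l \<ge> N1 \<Longrightarrow> L2_norm M (\<lambda>x. \<psi> (r k) x - \<psi> (r l) x) < e / 4"
      using r(2)[of "e / 4"] e by auto
    obtain N2 where N2: "inverse (real (Suc N2)) < e / 4"
      using reals_Archimedean[of "e / 4"] e by auto
    have small: "L2_norm M (\<lambda>x. \<phi> (r k) x - v (r k) x) < e / 4" if "k \<ge> N2" for k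
    proof -
      have "r k \<ge> N2" using seq_suble[OF r(1), of k] that by simp
      then have "inverse (real (Suc (r k))) \<le> inverse (real (Suc N2))" by (intro le_imp_inverse_le) auto
      then show ?thesis using \<phi>(2)[of "r k"] N2 by linarith
    qed
    have "L2_norm M (\<lambda>x. v (r k) x - v (r l) x) < e" if k: "k \<ge> max N1 N2" and l: "l \<ge> max N1 N2" for k l
    proof -
      note L = test_fun_L2(1)[OF \<phi>(1)] H10_L2(1)[OF assms(1)]
      have "L2_norm M (\<lambda>x. v (r k) x - v (r l) x) \<le> L2_norm M (\<lambda>x. v (r k) x - \<phi> (r k) x) + L2_norm M (\<lambda>x. \<phi> (r k) x - v (r l) x)"
        by (intro L2_norm_triangle_diff L)
      moreover have "L2_norm M (\<lambda>x. \<phi> (r k) x - v (r l) x) \<le> L2_norm M (\<lambda>x. \<phi> (r k) x - \<phi> (r l) x) + L2_norm M (\<lambda>x. \<phi> (r l) x - v (r l) x)"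
        by (intro L2_norm_triangle_diff L)
      moreover have "L2_norm M (\<lambda>x. \<phi> (r k) x - \<phi> (r l) x) = 2 * L2_norm M (\<lambda>x. \<psi> (r k) x - \<psi> (r l) x)"
        using L2_norm_scale[of M 2 "\<lambda>x. \<psi> (r k) x - \<psi> (r l) x"] by (simp add: \<psi>_def algebra_simps)
      moreover have "L2_norm M (\<lambda>x. \<psi> (r k) x - \<psi> (r l) x) < e / 4" using N1 k l by simp
      moreover have "L2_norm M (\<lambda>x. v (r k) x - \<phi> (r k) x) < e / 4"
        using small[of k] k L2_norm_minus_commute[of M "v (r k)" "\<phi> (r k)"] by simp
      moreover have "L2_norm M (\<lambda>x. \<phi> (r l) x - v (r l) x) < e / 4" using small[of l] l by simp
      ultimately show ?thesis by linarith
    qed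
    then show "\<exists>N. \<forall>k\<ge>N. \<forall>l\<ge>N. L2_norm M (\<lambda>x. v (r k) x - v (r l) x) < e" by blast
  qed
qed

end

section \<open>Weighted quadratic forms on \<open>H10\<close>\<close>

context bounded_domain
begin

text \<open>By the Poincare inequality the functions are Cauchy in L2 together with their gradients.
  Closedness of the pairs identifies the two limits as a function and its weak gradient.\<close>

lemma H10_complete:
  assumes v: "\<And>k. v k \<in> H10 \<Omega>"
    and C: "\<And>e. 0 < e \<Longrightarrow> \<exists>N. \<forall>k\<ge>N. \<forall>l\<ge>N. H10_norm (\<lambda>x. v k x - v l x) < e"
  obtains w where "w \<in> H10 \<Omega>" "(\<lambda>k. H10_norm (\<lambda>x. v k x - w x)) \<longlonglongrightarrow> 0"
proof -
  obtain P where P: "0 < P" "\<And>u. u \<in> H10 \<Omega> \<Longrightarrow> L2_norm M u \<le> P * H10_norm u"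
    by (rule Poincare) (rule that)
  have gr: "L2_norm M (\<lambda>x. wgrad \<Omega> u x - wgrad \<Omega> u' x) = H10_norm (\<lambda>x. u x - u' x)"
    if "u \<in> H10 \<Omega>" "u' \<in> H10 \<Omega>" for u u'
    using H10_dist_norm[OF that] by (simp add: H10_dist_def L2_norm_def)
  obtain w where w: "L2 M w" "(\<lambda>k. L2_norm M (\<lambda>x. v k x - w x)) \<longlonglongrightarrow> 0"
  proof (rule L2_complete[OF H10_L2(1)[OF v]])
    fix e :: real assume "0 < e"
    then obtain N where N: "\<And>k l. k \<ge> N \<Longrightarrow> l \<ge> N \<Longrightarrow> H10_norm (\<lambda>x. v k x - v l x) < e / P"
      using C[of "e / P"] P(1) by auto
    have "L2_norm M (\<lambda>x. v k x - v l x) < e" if "k \<ge> N" "l \<ge> N" for k l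
    proof -
      have "P * H10_norm (\<lambda>x. v k x - v l x) < e"
        using N[OF that] P(1) by (simp add: pos_less_divide_eq mult.commute)
      then show ?thesis using P(2)[OF H10_diff[OF v v], of k l] by linarith
    qed
    then show "\<exists>N. \<forall>m\<ge>N. \<forall>n\<ge>N. L2_norm M (\<lambda>x. v m x - v n x) < e" by blast
  qed (rule that)
  obtain H where H: "L2 M H" "(\<lambda>k. L2_norm M (\<lambda>x. wgrad \<Omega> (v k) x - H x)) \<longlonglongrightarrow> 0"
  proof (rule L2_complete[OF H10_L2(2)[OF v]])
    show "\<exists>N. \<forall>m\<ge>N. \<forall>n\<ge>N. L2_norm M (\<lambda>x. wgrad \<Omega> (v m) x - wgrad \<Omega> (v n) x) < e" if "0 < e" for e
      using C[OF that] by (simp add: gr[OF v v])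
  qed (rule that)
  have pair: "H10_pair w H"
    by (rule H10_pair_closed[OF H10_pair_wgrad[OF v] w(1) H(1) w(2) H(2)])
  show thesis
  proof (rule that[OF H10_pairI[OF pair]])
    have "H10_norm (\<lambda>x. v k x - w x) = L2_norm M (\<lambda>x. wgrad \<Omega> (v k) x - H x)" for k
      using H10_norm_pair[OF H10_pair_lincomb[OF H10_pair_wgrad[OF v] pair, where s=1 and t="-1"]] by simp
    then show "(\<lambda>k. H10_norm (\<lambda>x. v k x - w x)) \<longlonglongrightarrow> 0" using H(2) by simp
  qed
qed

lemma H10_norm_tendsto:
  assumes "\<And>k. v k \<in> H10 \<Omega>" "w \<in> H10 \<Omega>" "(\<lambda>k. H10_norm (\<lambda>x. v k x - w x)) \<longlonglongrightarrow> 0"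
  shows "(\<lambda>k. H10_norm (v k)) \<longlonglongrightarrow> H10_norm w"
proof -
  have "\<bar>H10_norm (v k) - H10_norm w\<bar> \<le> H10_norm (\<lambda>x. v k x - w x)" for k
    using H10_norm_add[OF H10_diff[OF assms(1,2)] assms(2), of k]
      H10_norm_add[OF H10_diff[OF assms(2,1)] assms(1), of k k] H10_norm_minus_commute[OF assms(1,2), of k]
    by simp
  then have "(\<lambda>k. H10_norm (v k) - H10_norm w) \<longlonglongrightarrow> 0"
    by (intro Lim_null_comparison[OF always_eventually assms(3)]) simp
  then show ?thesis by (simp add: LIM_zero_iff)
qed

lemma H10_norm_0_imp_AE:
  assumes "v \<in> H10 \<Omega>" "H10_norm v = 0"
  shows "AE x in M. v x = 0"
proof -
  obtain P where P: "0 < P" "\<And>u. u \<in> H10 \<Omega> \<Longrightarrow> L2_norm M u \<le> P * H10_norm u"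
    by (rule Poincare) (rule that)
  have "L2_norm M v = 0" using P(2)[OF assms(1)] assms(2) L2_norm_nonneg[of M v] by simp
  then show ?thesis using L2_norm_eq_0_imp_AE H10_L2(1)[OF assms(1)] by blast
qed

text \<open>A weight is measured by the size of its quadratic form on the unit ball and not by a
  norm of its own. With the nonnegative integral, integrability is a consequence and not a side
  condition.\<close>

definition form_le :: "('a \<Rightarrow> real) \<Rightarrow> real \<Rightarrow> bool" where
  "form_le \<gamma> \<epsilon> \<longleftrightarrow> \<gamma> \<in> borel_measurable M \<and> 0 \<le> \<epsilon> \<and>
     (\<forall>v\<in>H10 \<Omega>. H10_norm v \<le> 1 \<longrightarrow> (\<integral>\<^sup>+x. ennreal (\<bar>\<gamma> x\<bar> * (v x)\<^sup>2) \<partial>M) \<le> ennreal \<epsilon>)"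

lemma form_leD:
  assumes "form_le \<gamma> \<epsilon>" "v \<in> H10 \<Omega>"
  shows "integrable M (\<lambda>x. \<bar>\<gamma> x\<bar> * (v x)\<^sup>2)" "(\<integral>x. \<bar>\<gamma> x\<bar> * (v x)\<^sup>2 \<partial>M) \<le> \<epsilon> * (H10_norm v)\<^sup>2"
proof -
  have [measurable]: "\<gamma> \<in> borel_measurable M" "v \<in> borel_measurable M"
    using assms H10_L2(1) by (auto simp: form_le_def L2_def)
  have \<epsilon>: "0 \<le> \<epsilon>" using assms by (simp add: form_le_def)
  have *: "(\<integral>\<^sup>+x. ennreal (\<bar>\<gamma> x\<bar> * (v x)\<^sup>2) \<partial>M) \<le> ennreal (\<epsilon> * (H10_norm v)\<^sup>2)"
  proof (cases "H10_norm v = 0")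
    case True
    have "AE x in M. ennreal (\<bar>\<gamma> x\<bar> * (v x)\<^sup>2) = 0"
      using H10_norm_0_imp_AE[OF assms(2) True] by eventually_elim simp
    then have "(\<integral>\<^sup>+x. ennreal (\<bar>\<gamma> x\<bar> * (v x)\<^sup>2) \<partial>M) = 0"
      by (subst nn_integral_0_iff_AE) auto
    then show ?thesis by simp
  next
    case False
    define n where "n = H10_norm v"
    have n: "n > 0" using False by (auto simp: n_def less_le)
    have "H10_norm (\<lambda>x. (1 / n) * v x) \<le> 1"
      using H10_norm_scale[OF assms(2), of "1 / n"] n by (simp add: n_def)
    then have le: "(\<integral>\<^sup>+x. ennreal (\<bar>\<gamma> x\<bar> * ((1 / n) * v x)\<^sup>2) \<partial>M) \<le> ennreal \<epsilon>"
      using assms H10_scale[OF assms(2), of "1 / n"] unfolding form_le_def by blast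
    have "(\<integral>\<^sup>+x. ennreal (\<bar>\<gamma> x\<bar> * (v x)\<^sup>2) \<partial>M) = (\<integral>\<^sup>+x. ennreal (n\<^sup>2) * ennreal (\<bar>\<gamma> x\<bar> * ((1 / n) * v x)\<^sup>2) \<partial>M)"
      using n by (intro nn_integral_cong) (simp add: ennreal_mult[symmetric] power_mult_distrib power_divide)
    also have "\<dots> = ennreal (n\<^sup>2) * (\<integral>\<^sup>+x. ennreal (\<bar>\<gamma> x\<bar> * ((1 / n) * v x)\<^sup>2) \<partial>M)"
      by (rule nn_integral_cmult) measurable
    also have "\<dots> \<le> ennreal (n\<^sup>2) * ennreal \<epsilon>" by (intro mult_left_mono le) simp
    also have "\<dots> = ennreal (\<epsilon> * (H10_norm v)\<^sup>2)"
      using \<epsilon> by (simp add: ennreal_mult[symmetric] n_def mult.commute)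
    finally show ?thesis .
  qed
  show int: "integrable M (\<lambda>x. \<bar>\<gamma> x\<bar> * (v x)\<^sup>2)"
    using le_less_trans[OF *] by (intro integrableI_nonneg) (auto simp: less_top)
  have "ennreal (\<integral>x. \<bar>\<gamma> x\<bar> * (v x)\<^sup>2 \<partial>M) \<le> ennreal (\<epsilon> * (H10_norm v)\<^sup>2)"
    using * by (subst nn_integral_eq_integral[symmetric, OF int]) auto
  then show "(\<integral>x. \<bar>\<gamma> x\<bar> * (v x)\<^sup>2 \<partial>M) \<le> \<epsilon> * (H10_norm v)\<^sup>2"
    using \<epsilon> by (simp add: ennreal_le_iff)
qed

lemma form_le_integrable:
  assumes "form_le \<gamma> \<epsilon>" "v \<in> H10 \<Omega>" "w \<in> H10 \<Omega>"
  shows "integrable M (\<lambda>x. \<gamma> x * v x * w x)"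
proof (rule Bochner_Integration.integrable_bound)
  have [measurable]: "\<gamma> \<in> borel_measurable M" "v \<in> borel_measurable M" "w \<in> borel_measurable M"
    using assms H10_L2(1) by (auto simp: form_le_def L2_def)
  show "integrable M (\<lambda>x. \<bar>\<gamma> x\<bar> * (v x)\<^sup>2 + \<bar>\<gamma> x\<bar> * (w x)\<^sup>2)"
    using form_leD(1)[OF assms(1,2)] form_leD(1)[OF assms(1,3)] by simp
  show "(\<lambda>x. \<gamma> x * v x * w x) \<in> borel_measurable M" by measurable
  have "\<bar>a * b\<bar> \<le> a\<^sup>2 + b\<^sup>2" for a b :: real
  proof -
    have "2 * \<bar>a\<bar> * \<bar>b\<bar> \<le> \<bar>a\<bar>\<^sup>2 + \<bar>b\<bar>\<^sup>2" by (rule sum_squares_bound)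
    moreover have "0 \<le> \<bar>a\<bar> * \<bar>b\<bar>" by simp
    ultimately show ?thesis unfolding abs_mult power2_abs by linarith
  qed
  then have "\<bar>\<gamma> x\<bar> * \<bar>v x * w x\<bar> \<le> \<bar>\<gamma> x\<bar> * ((v x)\<^sup>2 + (w x)\<^sup>2)" for x
    by (intro mult_left_mono) auto
  then show "AE x in M. norm (\<gamma> x * v x * w x) \<le> norm (\<bar>\<gamma> x\<bar> * (v x)\<^sup>2 + \<bar>\<gamma> x\<bar> * (w x)\<^sup>2)"
    by (intro AE_I2) (simp add: abs_mult distrib_left mult.assoc)
qed

lemma form_le_bound:
  assumes "form_le \<gamma> \<epsilon>" "v \<in> H10 \<Omega>" "w \<in> H10 \<Omega>"
  shows "\<bar>\<integral>x. \<gamma> x * v x * w x \<partial>M\<bar> \<le> \<epsilon> * H10_norm v * H10_norm w"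
proof -
  have \<epsilon>: "0 \<le> \<epsilon>" using assms by (simp add: form_le_def)
  note i = form_leD(1)[OF assms(1,2)] form_leD(1)[OF assms(1,3)]
  have j: "integrable M (\<lambda>x. \<bar>\<gamma> x\<bar> * (\<bar>v x\<bar> * \<bar>w x\<bar>))"
    using integrable_abs[OF form_le_integrable[OF assms]] by (simp add: abs_mult mult.assoc)
  have "(\<integral>x. \<bar>\<gamma> x\<bar> * (\<bar>v x\<bar> * \<bar>w x\<bar>) \<partial>M)\<^sup>2 \<le> (\<integral>x. \<bar>\<gamma> x\<bar> * (v x)\<^sup>2 \<partial>M) * (\<integral>x. \<bar>\<gamma> x\<bar> * (w x)\<^sup>2 \<partial>M)"
  proof (rule quadratic_nonneg_imp_discrim)
    fix t :: real
    have "0 \<le> (\<integral>x. \<bar>\<gamma> x\<bar> * (\<bar>v x\<bar> + t * \<bar>w x\<bar>)\<^sup>2 \<partial>M)" by simp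
    also have "\<dots> = (\<integral>x. \<bar>\<gamma> x\<bar> * (v x)\<^sup>2 + 2 * t * (\<bar>\<gamma> x\<bar> * (\<bar>v x\<bar> * \<bar>w x\<bar>)) + t\<^sup>2 * (\<bar>\<gamma> x\<bar> * (w x)\<^sup>2) \<partial>M)"
      by (intro Bochner_Integration.integral_cong) (auto simp: power2_sum power_mult_distrib algebra_simps)
    also have "\<dots> = (\<integral>x. \<bar>\<gamma> x\<bar> * (v x)\<^sup>2 \<partial>M) + 2 * t * (\<integral>x. \<bar>\<gamma> x\<bar> * (\<bar>v x\<bar> * \<bar>w x\<bar>) \<partial>M)
        + t\<^sup>2 * (\<integral>x. \<bar>\<gamma> x\<bar> * (w x)\<^sup>2 \<partial>M)"
      using i j by simp
    finally show "0 \<le> (\<integral>x. \<bar>\<gamma> x\<bar> * (v x)\<^sup>2 \<partial>M) + 2 * (\<integral>x. \<bar>\<gamma> x\<bar> * (\<bar>v x\<bar> * \<bar>w x\<bar>) \<partial>M) * t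
        + (\<integral>x. \<bar>\<gamma> x\<bar> * (w x)\<^sup>2 \<partial>M) * t\<^sup>2" by (simp add: mult_ac)
  qed simp
  also have "\<dots> \<le> (\<epsilon> * (H10_norm v)\<^sup>2) * (\<epsilon> * (H10_norm w)\<^sup>2)"
    using form_leD(2)[OF assms(1,2)] form_leD(2)[OF assms(1,3)] \<epsilon> by (intro mult_mono) auto
  also have "\<dots> = (\<epsilon> * H10_norm v * H10_norm w)\<^sup>2" by (simp add: power_mult_distrib power2_eq_square mult_ac)
  finally have "(\<integral>x. \<bar>\<gamma> x\<bar> * (\<bar>v x\<bar> * \<bar>w x\<bar>) \<partial>M) \<le> \<epsilon> * H10_norm v * H10_norm w"
    by (rule power2_le_imp_le) (use \<epsilon> in simp)
  moreover have "\<bar>\<integral>x. \<gamma> x * v x * w x \<partial>M\<bar> \<le> (\<integral>x. \<bar>\<gamma> x * v x * w x\<bar> \<partial>M)"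
    by (rule integral_abs_bound)
  ultimately show ?thesis by (simp add: abs_mult mult.assoc)
qed

lemma form_square_le:
  assumes "form_le \<gamma> \<epsilon>" "v \<in> H10 \<Omega>"
  shows "\<bar>\<integral>x. \<gamma> x * v x * v x \<partial>M\<bar> \<le> (\<integral>x. \<bar>\<gamma> x\<bar> * (v x)\<^sup>2 \<partial>M)"
proof -
  have "\<bar>\<integral>x. \<gamma> x * v x * v x \<partial>M\<bar> \<le> (\<integral>x. \<bar>\<gamma> x * v x * v x\<bar> \<partial>M)" by (rule integral_abs_bound)
  then show ?thesis by (simp add: abs_mult mult.assoc power2_eq_square)
qed

text \<open>Weights whose quadratic form is compact relative to the \<open>H10\<close>-norm.\<close>
definition admissible :: "('a \<Rightarrow> real) \<Rightarrow> bool" where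
  "admissible \<beta> \<longleftrightarrow> \<beta> \<in> borel_measurable M \<and> (\<forall>e>0. \<exists>C\<ge>0. \<forall>v\<in>H10 \<Omega>. H10_norm v \<le> 1 \<longrightarrow>
     (\<integral>\<^sup>+x. ennreal (\<bar>\<beta> x\<bar> * (v x)\<^sup>2) \<partial>M) \<le> ennreal (e + C * (L2_norm M v)\<^sup>2))"

lemma admissible_form_le:
  assumes "admissible \<beta>"
  obtains K where "form_le \<beta> K"
proof -
  obtain P where P: "0 < P" "\<And>u. u \<in> H10 \<Omega> \<Longrightarrow> L2_norm M u \<le> P * H10_norm u"
    by (rule Poincare) (rule that)
  obtain C where C: "C \<ge> 0" "\<And>v. v \<in> H10 \<Omega> \<Longrightarrow> H10_norm v \<le> 1 \<Longrightarrow>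
     (\<integral>\<^sup>+x. ennreal (\<bar>\<beta> x\<bar> * (v x)\<^sup>2) \<partial>M) \<le> ennreal (1 + C * (L2_norm M v)\<^sup>2)"
    using assms unfolding admissible_def by (meson zero_less_one)
  have "form_le \<beta> (1 + C * P\<^sup>2)"
    unfolding form_le_def
  proof (intro conjI ballI impI)
    show "\<beta> \<in> borel_measurable M" using assms by (simp add: admissible_def)
    show "0 \<le> 1 + C * P\<^sup>2" using C(1) by simp
    fix v assume v: "v \<in> H10 \<Omega>" "H10_norm v \<le> 1"
    have "P * H10_norm v \<le> P * 1" using v P(1) by (intro mult_left_mono) auto
    then have "L2_norm M v \<le> P" using P(2)[OF v(1)] by linarith
    then have "C * (L2_norm M v)\<^sup>2 \<le> C * P\<^sup>2" using C(1) by (intro mult_left_mono power_mono) auto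
    then have "ennreal (1 + C * (L2_norm M v)\<^sup>2) \<le> ennreal (1 + C * P\<^sup>2)" by (intro ennreal_leI) simp
    with C(2)[OF v] show "(\<integral>\<^sup>+x. ennreal (\<bar>\<beta> x\<bar> * (v x)\<^sup>2) \<partial>M) \<le> ennreal (1 + C * P\<^sup>2)"
      by (rule order_trans)
  qed
  then show thesis by (rule that)
qed

text \<open>Rellich's theorem gives a subsequence that is Cauchy in L2; admissibility trades the
  weighted integral for an arbitrarily small constant plus a multiple of the squared L2
  norm.\<close>

lemma admissible_compact:
  assumes "admissible \<beta>" "\<And>k. v k \<in> H10 \<Omega>" "\<And>k. H10_norm (v k) \<le> 1"
  obtains r where "strict_mono (r :: nat \<Rightarrow> nat)"
    "\<And>e. 0 < e \<Longrightarrow> \<exists>N. \<forall>k\<ge>N. \<forall>l\<ge>N. (\<integral>x. \<bar>\<beta> x\<bar> * (v (r k) x - v (r l) x)\<^sup>2 \<partial>M) < e"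
proof -
  obtain r where r: "strict_mono (r :: nat \<Rightarrow> nat)"
    "\<And>e. 0 < e \<Longrightarrow> \<exists>N. \<forall>k\<ge>N. \<forall>l\<ge>N. L2_norm M (\<lambda>x. v (r k) x - v (r l) x) < e"
    by (rule Rellich[OF assms(2,3)]) (rule that)
  obtain K where K: "form_le \<beta> K" by (rule admissible_form_le[OF assms(1)])
  show thesis
  proof (rule that[OF r(1)])
    fix e :: real assume e: "0 < e"
    \<comment> \<open>Differences of elements of the unit ball have norm at most 2 and are halved
      before admissibility applies. Undoing this costs a factor 4, so the constant contributes
      \<open>e / 4\<close>, next to \<open>C * d\<^sup>2 \<le> e / 2\<close>.\<close>
    have "0 < e / 16" using e by simp
    then obtain C where C: "C \<ge> 0" "\<And>v. v \<in> H10 \<Omega> \<Longrightarrow> H10_norm v \<le> 1 \<Longrightarrow>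
       (\<integral>\<^sup>+x. ennreal (\<bar>\<beta> x\<bar> * (v x)\<^sup>2) \<partial>M) \<le> ennreal (e / 16 + C * (L2_norm M v)\<^sup>2)"
      using assms(1) unfolding admissible_def by blast
    define d where "d = sqrt (e / (2 * (C + 1)))"
    have d: "d > 0" using e C(1) by (simp add: d_def)
    have d2: "C * d\<^sup>2 \<le> e / 2"
    proof -
      have "C * d\<^sup>2 = (C / (C + 1)) * (e / 2)" using C(1) e by (simp add: d_def)
      also have "\<dots> \<le> 1 * (e / 2)" using C(1) e by (intro mult_right_mono) auto
      finally show ?thesis by simp
    qed
    obtain N where N: "\<And>k l. k \<ge> N \<Longrightarrow> l \<ge> N \<Longrightarrow> L2_norm M (\<lambda>x. v (r k) x - v (r l) x) < d"
      using r(2)[OF d] by blast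
    have "(\<integral>x. \<bar>\<beta> x\<bar> * (v (r k) x - v (r l) x)\<^sup>2 \<partial>M) < e" if kl: "k \<ge> N" "l \<ge> N" for k l
    proof -
      define w where "w x = v (r k) x - v (r l) x" for x
      have w: "w \<in> H10 \<Omega>" unfolding w_def[abs_def] by (intro H10_diff assms)
      define z where "z x = (1/2) * w x" for x
      have z: "z \<in> H10 \<Omega>" unfolding z_def[abs_def] by (rule H10_scale[OF w])
      have "H10_norm w \<le> H10_norm (v (r k)) + H10_norm (v (r l))"
        using H10_norm_add[OF assms(2)[of "r k"] H10_scale[OF assms(2)[of "r l"], of "-1"]] H10_norm_scale[OF assms(2)[of "r l"], of "-1"]
        by (simp add: w_def[abs_def])
      then have "H10_norm w \<le> 2" using assms(3)[of "r k"] assms(3)[of "r l"] by linarith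
      then have nz: "H10_norm z \<le> 1" using H10_norm_scale[OF w, of "1/2"] by (simp add: z_def[abs_def])
      have Lz: "L2_norm M z = L2_norm M w / 2" using L2_norm_scale[of M "1/2" w] by (simp add: z_def[abs_def])
      have Lw: "L2_norm M w < d" using N[OF kl] by (simp add: w_def[abs_def])
      have "ennreal (\<integral>x. \<bar>\<beta> x\<bar> * (z x)\<^sup>2 \<partial>M) \<le> ennreal (e / 16 + C * (L2_norm M z)\<^sup>2)"
        using C(2)[OF z nz] by (subst nn_integral_eq_integral[symmetric, OF form_leD(1)[OF K z]]) auto
      then have le: "(\<integral>x. \<bar>\<beta> x\<bar> * (z x)\<^sup>2 \<partial>M) \<le> e / 16 + C * (L2_norm M z)\<^sup>2"
        by (rule ennreal_le_iff[THEN iffD1, rotated]) (use e C(1) in simp)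
      have "(\<integral>x. \<bar>\<beta> x\<bar> * (w x)\<^sup>2 \<partial>M) = (\<integral>x. 4 * (\<bar>\<beta> x\<bar> * (z x)\<^sup>2) \<partial>M)"
        by (intro Bochner_Integration.integral_cong) (auto simp: z_def power_divide)
      also have "\<dots> = 4 * (\<integral>x. \<bar>\<beta> x\<bar> * (z x)\<^sup>2 \<partial>M)" by simp
      also have "\<dots> \<le> 4 * (e / 16 + C * (L2_norm M z)\<^sup>2)" using le by simp
      also have "\<dots> = e / 4 + C * (L2_norm M w)\<^sup>2" by (simp add: Lz power_divide)
      also have "\<dots> \<le> e / 4 + C * d\<^sup>2"
        using Lw C(1) by (intro add_left_mono mult_left_mono power_mono) auto
      also have "\<dots> < e" using d2 e by simp
      finally show ?thesis by (simp add: w_def)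
    qed
    then show "\<exists>N. \<forall>k\<ge>N. \<forall>l\<ge>N. (\<integral>x. \<bar>\<beta> x\<bar> * (v (r k) x - v (r l) x)\<^sup>2 \<partial>M) < e" by blast
  qed
qed

section \<open>The form of the linearised problem and its null vectors\<close>

lemma form_lincomb:
  assumes "form_le \<beta> K" "u \<in> H10 \<Omega>" "v \<in> H10 \<Omega>" "w \<in> H10 \<Omega>"
  shows "(\<integral>x. \<beta> x * (s * u x + t * v x) * w x \<partial>M) = s * (\<integral>x. \<beta> x * u x * w x \<partial>M) + t * (\<integral>x. \<beta> x * v x * w x \<partial>M)"
proof -
  have "(\<integral>x. \<beta> x * (s * u x + t * v x) * w x \<partial>M) = (\<integral>x. s * (\<beta> x * u x * w x) + t * (\<beta> x * v x * w x) \<partial>M)"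
    by (intro Bochner_Integration.integral_cong) (auto simp: algebra_simps)
  also have "\<dots> = s * (\<integral>x. \<beta> x * u x * w x \<partial>M) + t * (\<integral>x. \<beta> x * v x * w x \<partial>M)"
    using form_le_integrable[OF assms(1,2,4)] form_le_integrable[OF assms(1,3,4)] by simp
  finally show ?thesis .
qed

text \<open>The bilinear form of the operator \<open>- \<Delta> v - \<beta> v\<close>.\<close>
definition defect :: "('a \<Rightarrow> real) \<Rightarrow> ('a \<Rightarrow> real) \<Rightarrow> ('a \<Rightarrow> real) \<Rightarrow> real" where
  "defect \<beta> v w = H10_inner \<Omega> v w - (\<integral>x. \<beta> x * v x * w x \<partial>M)"

lemma defect_commute: "defect \<beta> v w = defect \<beta> w v"
  unfolding defect_def H10_inner_commute[of v] by (simp add: mult_ac)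

lemma defect_lincomb:
  assumes "form_le \<beta> K" "u \<in> H10 \<Omega>" "v \<in> H10 \<Omega>" "w \<in> H10 \<Omega>"
  shows "defect \<beta> (\<lambda>x. s * u x + t * v x) w = s * defect \<beta> u w + t * defect \<beta> v w"
  using form_lincomb[OF assms] H10_inner_lincomb[OF assms(2-)]
  by (simp add: defect_def algebra_simps)

lemma defect_square_lincomb:
  assumes "form_le \<beta> K" "u \<in> H10 \<Omega>" "v \<in> H10 \<Omega>"
  shows "defect \<beta> (\<lambda>x. s * u x + t * v x) (\<lambda>x. s * u x + t * v x) =
    s\<^sup>2 * defect \<beta> u u + 2 * s * t * defect \<beta> u v + t\<^sup>2 * defect \<beta> v v"
proof -
  let ?w = "\<lambda>x. s * u x + t * v x"
  have w: "?w \<in> H10 \<Omega>" by (rule H10_lincomb[OF assms(2,3)])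
  have "defect \<beta> ?w ?w = s * defect \<beta> u ?w + t * defect \<beta> v ?w" by (rule defect_lincomb[OF assms w])
  also have "defect \<beta> u ?w = s * defect \<beta> u u + t * defect \<beta> u v"
    using defect_lincomb[OF assms assms(2), of s t] defect_commute[of \<beta> u ?w] defect_commute[of \<beta> v u] by simp
  also have "defect \<beta> v ?w = s * defect \<beta> u v + t * defect \<beta> v v"
    using defect_lincomb[OF assms assms(3), of s t] defect_commute[of \<beta> v ?w] by simp
  finally show ?thesis by (simp add: algebra_simps power2_eq_square)
qed

lemma defect_bound:
  assumes "form_le \<beta> K" "v \<in> H10 \<Omega>" "w \<in> H10 \<Omega>"
  shows "\<bar>defect \<beta> v w\<bar> \<le> (1 + K) * H10_norm v * H10_norm w"
proof -
  have "\<bar>defect \<beta> v w\<bar> \<le> \<bar>H10_inner \<Omega> v w\<bar> + \<bar>\<integral>x. \<beta> x * v x * w x \<partial>M\<bar>"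
    unfolding defect_def by simp
  also have "\<dots> \<le> H10_norm v * H10_norm w + K * H10_norm v * H10_norm w"
    by (intro add_mono H10_inner_le form_le_bound assms)
  finally show ?thesis by (simp add: algebra_simps)
qed

lemma defect_self: "defect \<beta> v v = (H10_norm v)\<^sup>2 - (\<integral>x. \<beta> x * v x * v x \<partial>M)"
  by (simp add: defect_def H10_inner_self)

lemma defect_diff_weight:
  assumes "form_le \<beta> K" "form_le \<beta>' K'" "v \<in> H10 \<Omega>" "w \<in> H10 \<Omega>"
  shows "defect \<beta> v w - defect \<beta>' v w = (\<integral>x. (\<beta>' x - \<beta> x) * v x * w x \<partial>M)"
  using form_le_integrable[OF assms(1,3,4)] form_le_integrable[OF assms(2,3,4)]
  by (simp add: defect_def left_diff_distrib)

text \<open>The squared norm of a difference is its \<open>defect\<close> plus its weighted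
  integral. The former is small by assumption, the latter along a subsequence by compactness, so the
  subsequence converges in norm. Both the closedness of the singular set and the attainment of
  \<open>top_eig\<close> reduce to this.\<close>

lemma approx_null_Cauchy:
  assumes adm: "admissible \<beta>" and v: "\<And>k. v k \<in> H10 \<Omega>" "\<And>k. H10_norm (v k) \<le> 1"
    and small: "\<And>e. 0 < e \<Longrightarrow> \<exists>N. \<forall>k\<ge>N. \<forall>l\<ge>N. defect \<beta> (\<lambda>x. v k x - v l x) (\<lambda>x. v k x - v l x) < e"
  obtains r w where "strict_mono (r :: nat \<Rightarrow> nat)" "w \<in> H10 \<Omega>"
    "(\<lambda>k. H10_norm (\<lambda>x. v (r k) x - w x)) \<longlonglongrightarrow> 0"
proof -
  obtain K where K: "form_le \<beta> K" by (rule admissible_form_le[OF adm])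
  obtain r where r: "strict_mono (r :: nat \<Rightarrow> nat)"
    "\<And>e. 0 < e \<Longrightarrow> \<exists>N. \<forall>k\<ge>N. \<forall>l\<ge>N. (\<integral>x. \<bar>\<beta> x\<bar> * (v (r k) x - v (r l) x)\<^sup>2 \<partial>M) < e"
    by (rule admissible_compact[OF adm v]) (rule that)
  obtain w where "w \<in> H10 \<Omega>" "(\<lambda>k. H10_norm (\<lambda>x. v (r k) x - w x)) \<longlonglongrightarrow> 0"
  proof (rule H10_complete[of "\<lambda>k. v (r k)"])
    fix e :: real assume e: "0 < e"
    obtain N1 where N1: "\<And>k l. k \<ge> N1 \<Longrightarrow> l \<ge> N1 \<Longrightarrow> (\<integral>x. \<bar>\<beta> x\<bar> * (v (r k) x - v (r l) x)\<^sup>2 \<partial>M) < e\<^sup>2 / 2"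
      using r(2)[of "e\<^sup>2 / 2"] e by auto
    obtain N2 where N2: "\<And>k l. k \<ge> N2 \<Longrightarrow> l \<ge> N2 \<Longrightarrow> defect \<beta> (\<lambda>x. v k x - v l x) (\<lambda>x. v k x - v l x) < e\<^sup>2 / 2"
      using small[of "e\<^sup>2 / 2"] e by auto
    have "H10_norm (\<lambda>x. v (r k) x - v (r l) x) < e" if kl: "k \<ge> max N1 N2" "l \<ge> max N1 N2" for k l
    proof (rule power2_less_imp_less)
      let ?d = "\<lambda>x. v (r k) x - v (r l) x"
      have d: "?d \<in> H10 \<Omega>" by (intro H10_diff v)
      have "r k \<ge> N2" "r l \<ge> N2" using seq_suble[OF r(1), of k] seq_suble[OF r(1), of l] kl by auto
      then have "defect \<beta> ?d ?d < e\<^sup>2 / 2" by (rule N2)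
      moreover have "(\<integral>x. \<bar>\<beta> x\<bar> * (?d x)\<^sup>2 \<partial>M) < e\<^sup>2 / 2" using N1 kl by simp
      ultimately show "(H10_norm ?d)\<^sup>2 < e\<^sup>2"
        using form_square_le[OF K d] defect_self[of \<beta> ?d] by linarith
    qed (use e in simp)
    then show "\<exists>N. \<forall>k\<ge>N. \<forall>l\<ge>N. H10_norm (\<lambda>x. v (r k) x - v (r l) x) < e" by blast
  qed (use v in \<open>auto intro: that\<close>)
  with r(1) show thesis by (rule that)
qed

text \<open>A unit solution for \<open>\<beta> k\<close> solves the limit problem up to
  \<open>\<epsilon> k\<close> times the norm of the test element, so differences of these solutions
  have small \<open>defect\<close>. Convergence in norm preserves the equation and the norm 1, hence
  non-triviality.\<close>

lemma solutions_closed: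
  assumes adm: "\<And>k. admissible (\<beta> k)" "admissible \<gamma>"
    and close: "\<And>k. form_le (\<lambda>x. \<beta> k x - \<gamma> x) (\<epsilon> k)" "\<epsilon> \<longlonglongrightarrow> 0"
    and v: "\<And>k. v k \<in> H10 \<Omega>" "\<And>k. H10_norm (v k) = 1"
    and sol: "\<And>k w. w \<in> H10 \<Omega> \<Longrightarrow> defect (\<beta> k) (v k) w = 0"
  obtains u where "u \<in> H10 \<Omega>" "H10_norm u = 1" "\<And>w. w \<in> H10 \<Omega> \<Longrightarrow> defect \<gamma> u w = 0"
proof -
  obtain K where K: "form_le \<gamma> K" by (rule admissible_form_le[OF adm(2)])
  have b: "\<bar>defect \<gamma> (v k) w\<bar> \<le> \<epsilon> k * H10_norm w" if w: "w \<in> H10 \<Omega>" for k w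
  proof -
    obtain K' where K': "form_le (\<beta> k) K'" by (rule admissible_form_le[OF adm(1)])
    have "defect \<gamma> (v k) w = (\<integral>x. (\<beta> k x - \<gamma> x) * v k x * w x \<partial>M)"
      using defect_diff_weight[OF K K' v(1)[of k] w] sol[OF w, of k] by simp
    then show ?thesis using form_le_bound[OF close(1)[of k] v(1)[of k] w] v(2)[of k] by simp
  qed
  have \<epsilon>0: "0 \<le> \<epsilon> k" for k using close(1) by (simp add: form_le_def)
  obtain r u where ru: "strict_mono (r :: nat \<Rightarrow> nat)" "u \<in> H10 \<Omega>"
    "(\<lambda>k. H10_norm (\<lambda>x. v (r k) x - u x)) \<longlonglongrightarrow> 0"
  proof (rule approx_null_Cauchy[OF adm(2) v(1)])
    show "H10_norm (v k) \<le> 1" for k using v(2) by simp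
    fix e :: real assume e: "0 < e"
    obtain N where N: "\<And>k. k \<ge> N \<Longrightarrow> \<epsilon> k < e / 4"
      using order_tendstoD(2)[OF close(2), of "e / 4"] e unfolding eventually_sequentially by auto
    have "defect \<gamma> (\<lambda>x. v k x - v l x) (\<lambda>x. v k x - v l x) < e" if kl: "k \<ge> N" "l \<ge> N" for k l
    proof -
      let ?d = "\<lambda>x. v k x - v l x"
      have d: "?d \<in> H10 \<Omega>" by (intro H10_diff v)
      have nd: "H10_norm ?d \<le> 2"
        using H10_norm_add[OF v(1)[of k] H10_scale[OF v(1)[of l], of "-1"]] H10_norm_scale[OF v(1)[of l], of "-1"] v(2)
        by simp
      have "defect \<gamma> ?d ?d = defect \<gamma> (v k) ?d - defect \<gamma> (v l) ?d"
        using defect_lincomb[OF K v(1) v(1) d, of 1 k "-1" l] by simp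
      also have "\<dots> \<le> \<epsilon> k * H10_norm ?d + \<epsilon> l * H10_norm ?d"
        using b[OF d, of k] b[OF d, of l] by linarith
      also have "\<dots> \<le> \<epsilon> k * 2 + \<epsilon> l * 2"
        using \<epsilon>0 nd by (intro add_mono mult_left_mono) auto
      also have "\<dots> < e" using N[OF kl(1)] N[OF kl(2)] by simp
      finally show ?thesis .
    qed
    then show "\<exists>N. \<forall>k\<ge>N. \<forall>l\<ge>N. defect \<gamma> (\<lambda>x. v k x - v l x) (\<lambda>x. v k x - v l x) < e" by blast
  qed (rule that)
  show thesis
  proof (rule that[OF ru(2)])
    have "(\<lambda>k. H10_norm (v (r k))) \<longlonglongrightarrow> H10_norm u" by (rule H10_norm_tendsto[OF v(1) ru(2,3)])
    then show "H10_norm u = 1" by (simp add: v(2) LIMSEQ_const_iff)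
    fix w assume w: "w \<in> H10 \<Omega>"
    have le: "\<bar>defect \<gamma> u w\<bar> \<le> \<epsilon> (r k) * H10_norm w + (1 + K) * H10_norm (\<lambda>x. v (r k) x - u x) * H10_norm w" for k
    proof -
      have "defect \<gamma> (\<lambda>x. v (r k) x - u x) w = defect \<gamma> (v (r k)) w - defect \<gamma> u w"
        using defect_lincomb[OF K v(1) ru(2) w, where s=1 and t="-1"] by simp
      then show ?thesis using b[OF w, of "r k"] defect_bound[OF K H10_diff[OF v(1) ru(2)] w, of "r k"] by linarith
    qed
    have "(\<lambda>k. \<epsilon> (r k)) \<longlonglongrightarrow> 0" using LIMSEQ_subseq_LIMSEQ[OF close(2) ru(1)] by (simp add: o_def)
    then have "(\<lambda>k. \<epsilon> (r k) * H10_norm w + (1 + K) * H10_norm (\<lambda>x. v (r k) x - u x) * H10_norm w) \<longlonglongrightarrow> 0 * H10_norm w + (1 + K) * 0 * H10_norm w"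
      by (intro tendsto_intros ru(3))
    then have "\<bar>defect \<gamma> u w\<bar> \<le> 0" using le by (intro LIMSEQ_le_const) auto
    then show "defect \<gamma> u w = 0" by simp
  qed
qed

text \<open>The largest eigenvalue (or \<open>0\<close>, if it is negative) of \<open>(- \<Delta>)\<^sup>-\<^sup>1 \<beta>\<close>.\<close>
definition top_eig :: "('a \<Rightarrow> real) \<Rightarrow> real" where
  "top_eig \<beta> = Sup {\<integral>x. \<beta> x * v x * v x \<partial>M | v. v \<in> H10 \<Omega> \<and> H10_norm v \<le> 1}"

lemma H10_zero: "(\<lambda>x. 0) \<in> H10 \<Omega>" "H10_norm (\<lambda>x. 0) = 0"
proof -
  have "test_fun \<Omega> (\<lambda>x. 0)"
    by (rule test_fun_smooth_vanishing[of _ "{}"]) (auto intro: smooth_fun_const)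
  then show z: "(\<lambda>x. 0) \<in> H10 \<Omega>" by (rule test_fun_H10)
  show "H10_norm (\<lambda>x. 0) = 0" using H10_norm_scale[OF z, of 0] by simp
qed

lemma top_eig_upper:
  assumes "form_le \<beta> K" "v \<in> H10 \<Omega>" "H10_norm v \<le> 1"
  shows "(\<integral>x. \<beta> x * v x * v x \<partial>M) \<le> top_eig \<beta>"
  unfolding top_eig_def
proof (rule cSup_upper)
  show "bdd_above {\<integral>x. \<beta> x * v x * v x \<partial>M | v. v \<in> H10 \<Omega> \<and> H10_norm v \<le> 1}"
  proof (rule bdd_aboveI[of _ K])
    fix y assume "y \<in> {\<integral>x. \<beta> x * v x * v x \<partial>M | v. v \<in> H10 \<Omega> \<and> H10_norm v \<le> 1}"
    then obtain v where v: "y = (\<integral>x. \<beta> x * v x * v x \<partial>M)" "v \<in> H10 \<Omega>" "H10_norm v \<le> 1" by blast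
    have "\<bar>y\<bar> \<le> K * H10_norm v * H10_norm v" unfolding v(1) by (rule form_le_bound[OF assms(1) v(2) v(2)])
    also have "\<dots> \<le> K * 1 * 1" using v assms(1) by (intro mult_mono) (auto simp: form_le_def)
    finally show "y \<le> K" by simp
  qed
qed (use assms in blast)

lemma top_eig_least:
  assumes "\<And>v. v \<in> H10 \<Omega> \<Longrightarrow> H10_norm v \<le> 1 \<Longrightarrow> (\<integral>x. \<beta> x * v x * v x \<partial>M) \<le> c"
  shows "top_eig \<beta> \<le> c"
  unfolding top_eig_def using assms H10_zero by (intro cSup_least) auto

lemma top_eig_mono_add:
  assumes "form_le \<beta> K" "form_le \<beta>' K'" "form_le (\<lambda>x. \<beta>' x - \<beta> x) \<epsilon>"
  shows "top_eig \<beta>' \<le> top_eig \<beta> + \<epsilon>"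
proof (rule top_eig_least)
  fix v assume v: "v \<in> H10 \<Omega>" "H10_norm v \<le> 1"
  have \<epsilon>: "0 \<le> \<epsilon>" using assms(3) by (simp add: form_le_def)
  have "(\<integral>x. \<beta>' x * v x * v x \<partial>M) = (\<integral>x. \<beta> x * v x * v x \<partial>M) + (\<integral>x. (\<beta>' x - \<beta> x) * v x * v x \<partial>M)"
    using form_le_integrable[OF assms(1) v(1) v(1)] form_le_integrable[OF assms(2) v(1) v(1)]
    by (simp add: left_diff_distrib)
  moreover have "\<bar>\<integral>x. (\<beta>' x - \<beta> x) * v x * v x \<partial>M\<bar> \<le> \<epsilon> * H10_norm v * H10_norm v"
    by (rule form_le_bound[OF assms(3) v(1) v(1)])
  moreover have "\<epsilon> * H10_norm v * H10_norm v \<le> \<epsilon> * 1 * 1"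
    using v \<epsilon> by (intro mult_mono) auto
  ultimately show "(\<integral>x. \<beta>' x * v x * v x \<partial>M) \<le> top_eig \<beta> + \<epsilon>"
    using top_eig_upper[OF assms(1) v] by linarith
qed

lemma form_le_minus_commute: "form_le (\<lambda>x. \<beta> x - \<beta>' x) \<epsilon> \<Longrightarrow> form_le (\<lambda>x. \<beta>' x - \<beta> x) \<epsilon>"
proof -
  assume a: "form_le (\<lambda>x. \<beta> x - \<beta>' x) \<epsilon>"
  then have "(\<lambda>x. - (\<beta> x - \<beta>' x)) \<in> borel_measurable M"
    unfolding form_le_def by (intro borel_measurable_uminus) blast
  with a show ?thesis by (simp add: form_le_def abs_minus_commute)
qed

lemma top_eig_close:
  assumes "form_le \<beta> K" "form_le \<beta>' K'" "form_le (\<lambda>x. \<beta>' x - \<beta> x) \<epsilon>"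
  shows "\<bar>top_eig \<beta>' - top_eig \<beta>\<bar> \<le> \<epsilon>"
  using top_eig_mono_add[OF assms] top_eig_mono_add[OF assms(2,1) form_le_minus_commute[OF assms(3)]] by linarith

text \<open>For \<open>top_eig \<beta> = 1\<close> the form \<open>defect \<beta>\<close> is
  positive semidefinite, and a maximising sequence drives it to 0. Its limit is a null vector, and
  by Cauchy-Schwarz a null vector of a semidefinite form lies in its kernel.\<close>

lemma top_eig_1_imp_solution:
  assumes adm: "admissible \<beta>" and one: "top_eig \<beta> = 1"
  obtains u where "u \<in> H10 \<Omega>" "H10_norm u = 1" "\<And>w. w \<in> H10 \<Omega> \<Longrightarrow> defect \<beta> u w = 0"
proof -
  obtain K where K: "form_le \<beta> K" by (rule admissible_form_le[OF adm])
  have psd: "0 \<le> defect \<beta> v v" if v: "v \<in> H10 \<Omega>" for v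
  proof (cases "H10_norm v = 0")
    case True
    have "\<bar>defect \<beta> v v\<bar> \<le> 0" using defect_bound[OF K v v] True by simp
    then show ?thesis by simp
  next
    case False
    define n where "n = H10_norm v"
    have n: "n > 0" using False by (auto simp: n_def less_le)
    let ?z = "\<lambda>x. (1 / n) * v x"
    have "H10_norm ?z = 1" using H10_norm_scale[OF v, of "1 / n"] n by (simp add: n_def)
    then have "0 \<le> defect \<beta> ?z ?z"
      using top_eig_upper[OF K H10_scale[OF v, of "1 / n"]] one defect_self[of \<beta> ?z] by simp
    then show ?thesis using defect_square_lincomb[OF K v v, of "1 / n" 0] n by (simp add: zero_le_mult_iff zero_le_divide_iff)
  qed
  have "\<exists>v. v \<in> H10 \<Omega> \<and> H10_norm v \<le> 1 \<and> 1 - inverse (real (Suc k)) < (\<integral>x. \<beta> x * v x * v x \<partial>M)" for k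
  proof -
    have "1 - inverse (real (Suc k)) < top_eig \<beta>" using one by simp
    then show ?thesis unfolding top_eig_def using H10_zero by (subst (asm) less_cSup_iff)
      (auto intro!: bdd_aboveI[of _ "top_eig \<beta>"] top_eig_upper[OF K])
  qed
  then obtain v where v: "\<And>k. v k \<in> H10 \<Omega>" "\<And>k. H10_norm (v k) \<le> 1"
    "\<And>k. 1 - inverse (real (Suc k)) < (\<integral>x. \<beta> x * v k x * v k x \<partial>M)" by metis
  have sq: "(H10_norm (v k))\<^sup>2 \<le> 1" for k using v(2)[of k] by (simp add: power_le_one)
  have dk: "defect \<beta> (v k) (v k) \<le> inverse (real (Suc k))" for k
    using v(3)[of k] sq[of k] by (simp add: defect_self)
  \<comment> \<open>The parallelogram identity without its nonnegative term for the sum. It makes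
    the form small on differences of a maximising sequence.\<close>
  have par: "defect \<beta> (\<lambda>x. a x - b x) (\<lambda>x. a x - b x) \<le> 2 * defect \<beta> a a + 2 * defect \<beta> b b"
    if "a \<in> H10 \<Omega>" "b \<in> H10 \<Omega>" for a b
    using defect_square_lincomb[OF K that, of 1 "-1"] defect_square_lincomb[OF K that, of 1 1] psd[OF H10_add[OF that]] by simp
  obtain r u where ru: "strict_mono (r :: nat \<Rightarrow> nat)" "u \<in> H10 \<Omega>"
    "(\<lambda>k. H10_norm (\<lambda>x. v (r k) x - u x)) \<longlonglongrightarrow> 0"
  proof (rule approx_null_Cauchy[OF adm v(1,2)])
    fix e :: real assume "0 < e"
    then obtain N where N: "inverse (real (Suc N)) < e / 4" using reals_Archimedean[of "e / 4"] by auto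
    have "defect \<beta> (\<lambda>x. v k x - v l x) (\<lambda>x. v k x - v l x) < e" if "k \<ge> N" "l \<ge> N" for k l
    proof -
      have "inverse (real (Suc k)) \<le> inverse (real (Suc N))" "inverse (real (Suc l)) \<le> inverse (real (Suc N))"
        using that by (intro le_imp_inverse_le; simp)+
      then show ?thesis using par[OF v(1) v(1), of k l] dk[of k] dk[of l] N by linarith
    qed
    then show "\<exists>N. \<forall>k\<ge>N. \<forall>l\<ge>N. defect \<beta> (\<lambda>x. v k x - v l x) (\<lambda>x. v k x - v l x) < e" by blast
  qed (rule that)
  have inv: "(\<lambda>k. inverse (real (Suc (r k)))) \<longlonglongrightarrow> 0"
    using LIMSEQ_subseq_LIMSEQ[OF LIMSEQ_inverse_real_of_nat ru(1)] by (simp add: o_def)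
  have null: "defect \<beta> u u = 0"
  proof -
    have le: "defect \<beta> u u \<le> 2 * inverse (real (Suc (r k))) + 2 * ((1 + K) * (H10_norm (\<lambda>x. v (r k) x - u x))\<^sup>2)" for k
    proof -
      \<comment> \<open>Written as a difference, the limit falls under the same inequality, with one
        term small by maximality and the other by convergence in norm.\<close>
      have "u = (\<lambda>x. v (r k) x - (v (r k) x - u x))" by simp
      then have "defect \<beta> u u \<le> 2 * defect \<beta> (v (r k)) (v (r k)) + 2 * defect \<beta> (\<lambda>x. v (r k) x - u x) (\<lambda>x. v (r k) x - u x)"
        using par[OF v(1) H10_diff[OF v(1) ru(2)], of "r k" "r k"] by simp
      moreover have "defect \<beta> (\<lambda>x. v (r k) x - u x) (\<lambda>x. v (r k) x - u x) \<le> (1 + K) * (H10_norm (\<lambda>x. v (r k) x - u x))\<^sup>2"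
        using defect_bound[OF K H10_diff[OF v(1) ru(2)] H10_diff[OF v(1) ru(2)], of "r k" "r k"]
        by (simp add: power2_eq_square mult.assoc)
      ultimately show ?thesis using dk[of "r k"] by linarith
    qed
    have "(\<lambda>k. 2 * inverse (real (Suc (r k))) + 2 * ((1 + K) * (H10_norm (\<lambda>x. v (r k) x - u x))\<^sup>2)) \<longlonglongrightarrow> 2 * 0 + 2 * ((1 + K) * 0\<^sup>2)"
      by (intro tendsto_intros inv ru(3))
    then have "defect \<beta> u u \<le> 0" using le by (intro LIMSEQ_le_const) auto
    then show ?thesis using psd[OF ru(2)] by simp
  qed
  show thesis
  proof (rule that[OF ru(2)])
    have lim: "(\<lambda>k. (H10_norm (v (r k)))\<^sup>2) \<longlonglongrightarrow> (H10_norm u)\<^sup>2"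
      by (intro tendsto_power H10_norm_tendsto v ru)
    \<comment> \<open>The lower bound comes from semidefiniteness: the squared norm is at least the
      weighted integral, which exceeds \<open>1 - inverse (real (Suc (r k)))\<close>.\<close>
    have "(\<lambda>k. (H10_norm (v (r k)))\<^sup>2) \<longlonglongrightarrow> 1"
    proof (rule tendsto_sandwich[of "\<lambda>k. 1 - inverse (real (Suc (r k)))" _ _ "\<lambda>k. 1"])
      show "\<forall>\<^sub>F k in sequentially. 1 - inverse (real (Suc (r k))) \<le> (H10_norm (v (r k)))\<^sup>2"
      proof (rule always_eventually, rule allI)
        fix k
        show "1 - inverse (real (Suc (r k))) \<le> (H10_norm (v (r k)))\<^sup>2"
          using v(3)[of "r k"] psd[OF v(1), of "r k"] defect_self[of \<beta> "v (r k)"] by linarith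
      qed
      show "(\<lambda>k. 1 - inverse (real (Suc (r k)))) \<longlonglongrightarrow> 1"
        using tendsto_diff[OF tendsto_const[of 1] inv] by simp
    qed (use sq in auto)
    from LIMSEQ_unique[OF lim this] have "(H10_norm u)\<^sup>2 = 1" .
    then show "H10_norm u = 1" using H10_norm_nonneg[of u] by (simp add: power2_eq_1_iff)
    fix w assume w: "w \<in> H10 \<Omega>"
    have "(defect \<beta> u w)\<^sup>2 \<le> defect \<beta> u u * defect \<beta> w w"
    proof (rule quadratic_nonneg_imp_discrim)
      fix t :: real
      have "0 \<le> defect \<beta> (\<lambda>x. 1 * u x + t * w x) (\<lambda>x. 1 * u x + t * w x)"
        by (rule psd[OF H10_lincomb[OF ru(2) w]])
      then show "0 \<le> defect \<beta> u u + 2 * defect \<beta> u w * t + defect \<beta> w w * t\<^sup>2"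
        unfolding defect_square_lincomb[OF K ru(2) w] by (simp add: mult_ac)
    qed (rule psd[OF w])
    then show "defect \<beta> u w = 0" by (simp add: null)
  qed
qed

end

section \<open>The singular set\<close>

lemma openin_H10_top:
  "openin (H10_top \<Omega>) U \<longleftrightarrow> U \<subseteq> H10 \<Omega> \<and> (\<forall>u\<in>U. \<exists>e>0. \<forall>v\<in>H10 \<Omega>. H10_dist \<Omega> u v < e \<longrightarrow> v \<in> U)"
proof -
  have "istopology (\<lambda>U. U \<subseteq> H10 \<Omega> \<and> (\<forall>u\<in>U. \<exists>e>0. \<forall>v\<in>H10 \<Omega>. H10_dist \<Omega> u v < e \<longrightarrow> v \<in> U))"
    unfolding istopology_def
  proof (intro conjI allI impI)
    fix S T assume S: "S \<subseteq> H10 \<Omega> \<and> (\<forall>u\<in>S. \<exists>e>0. \<forall>v\<in>H10 \<Omega>. H10_dist \<Omega> u v < e \<longrightarrow> v \<in> S)"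
      and T: "T \<subseteq> H10 \<Omega> \<and> (\<forall>u\<in>T. \<exists>e>0. \<forall>v\<in>H10 \<Omega>. H10_dist \<Omega> u v < e \<longrightarrow> v \<in> T)"
    show "S \<inter> T \<subseteq> H10 \<Omega>" using S by blast
    show "\<forall>u\<in>S \<inter> T. \<exists>e>0. \<forall>v\<in>H10 \<Omega>. H10_dist \<Omega> u v < e \<longrightarrow> v \<in> S \<inter> T"
    proof
      fix u assume "u \<in> S \<inter> T"
      then obtain e1 e2 where "e1 > 0" "\<forall>v\<in>H10 \<Omega>. H10_dist \<Omega> u v < e1 \<longrightarrow> v \<in> S"
        "e2 > 0" "\<forall>v\<in>H10 \<Omega>. H10_dist \<Omega> u v < e2 \<longrightarrow> v \<in> T" using S T by blast
      then show "\<exists>e>0. \<forall>v\<in>H10 \<Omega>. H10_dist \<Omega> u v < e \<longrightarrow> v \<in> S \<inter> T"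
        by (intro exI[of _ "min e1 e2"]) auto
    qed
  next
    fix \<K> assume K: "\<forall>K\<in>\<K>. K \<subseteq> H10 \<Omega> \<and> (\<forall>u\<in>K. \<exists>e>0. \<forall>v\<in>H10 \<Omega>. H10_dist \<Omega> u v < e \<longrightarrow> v \<in> K)"
    show "\<Union>\<K> \<subseteq> H10 \<Omega>" using K by blast
    show "\<forall>u\<in>\<Union>\<K>. \<exists>e>0. \<forall>v\<in>H10 \<Omega>. H10_dist \<Omega> u v < e \<longrightarrow> v \<in> \<Union>\<K>"
    proof
      fix u assume "u \<in> \<Union>\<K>"
      then obtain K' where K': "K' \<in> \<K>" "u \<in> K'" by blast
      then obtain e where "e > 0" "\<forall>v\<in>H10 \<Omega>. H10_dist \<Omega> u v < e \<longrightarrow> v \<in> K'" using K by blast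
      then show "\<exists>e>0. \<forall>v\<in>H10 \<Omega>. H10_dist \<Omega> u v < e \<longrightarrow> v \<in> \<Union>\<K>" using K'(1) by blast
    qed
  qed
  then show ?thesis unfolding H10_top_def by (simp add: topology_inverse')
qed

lemma topspace_H10_top: "topspace (H10_top \<Omega>) = H10 \<Omega>"
proof
  show "topspace (H10_top \<Omega>) \<subseteq> H10 \<Omega>" using openin_H10_top openin_topspace by blast
  have "openin (H10_top \<Omega>) (H10 \<Omega>)" unfolding openin_H10_top using zero_less_one by blast
  then show "H10 \<Omega> \<subseteq> topspace (H10_top \<Omega>)" by (rule openin_subset)
qed

context bounded_domain
begin

text \<open>The points of a net are taken from \<open>H10 \<Omega>\<close> and need not lie in
  \<open>C\<close>, so nets obtained by subtracting points of a segment need no recentring.\<close>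

definition totally_bounded_H10 :: "('a \<Rightarrow> real) set \<Rightarrow> bool" where
  "totally_bounded_H10 C \<longleftrightarrow> (\<forall>\<eta>>0. \<exists>F. finite F \<and> F \<subseteq> H10 \<Omega> \<and>
     (\<forall>w\<in>C. \<exists>z\<in>F. H10_norm (\<lambda>x. w x - z x) < \<eta>))"

lemma compactin_imp_totally_bounded:
  assumes K: "compactin (H10_top \<Omega>) K"
  shows "totally_bounded_H10 K"
  unfolding totally_bounded_H10_def
proof (intro allI impI)
  fix \<eta> :: real assume \<eta>: "0 < \<eta>"
  have KH: "K \<subseteq> H10 \<Omega>" using compactin_subset_topspace[OF K] by (simp add: topspace_H10_top)
  define B where "B k = {v \<in> H10 \<Omega>. H10_norm (\<lambda>x. v x - k x) < \<eta>}" for k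
  have op: "openin (H10_top \<Omega>) (B k)" if k: "k \<in> H10 \<Omega>" for k
    unfolding openin_H10_top
  proof (intro conjI ballI)
    show "B k \<subseteq> H10 \<Omega>" by (auto simp: B_def)
    fix u assume u: "u \<in> B k"
    then have uH: "u \<in> H10 \<Omega>" and uk: "H10_norm (\<lambda>x. u x - k x) < \<eta>" by (auto simp: B_def)
    show "\<exists>e>0. \<forall>v\<in>H10 \<Omega>. H10_dist \<Omega> u v < e \<longrightarrow> v \<in> B k"
    proof (intro exI[of _ "\<eta> - H10_norm (\<lambda>x. u x - k x)"] conjI ballI impI)
      show "0 < \<eta> - H10_norm (\<lambda>x. u x - k x)" using uk by simp
      fix v assume v: "v \<in> H10 \<Omega>" "H10_dist \<Omega> u v < \<eta> - H10_norm (\<lambda>x. u x - k x)"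
      have "H10_norm (\<lambda>x. v x - k x) \<le> H10_norm (\<lambda>x. v x - u x) + H10_norm (\<lambda>x. u x - k x)"
        by (rule H10_norm_triangle_diff[OF v(1) uH k])
      then have "H10_norm (\<lambda>x. v x - k x) < \<eta>"
        using v(2) H10_dist_norm[OF uH v(1)] H10_norm_minus_commute[OF uH v(1)] by linarith
      then show "v \<in> B k" using v(1) by (simp add: B_def)
    qed
  qed
  have self: "k \<in> B k" if "k \<in> H10 \<Omega>" for k
    using that \<eta> H10_zero(2) by (simp add: B_def)
  have "\<exists>\<F>. finite \<F> \<and> \<F> \<subseteq> B ` K \<and> K \<subseteq> \<Union>\<F>"
  proof -
    have "\<forall>u\<in>B ` K. openin (H10_top \<Omega>) u" using op KH by blast
    moreover have "K \<subseteq> \<Union>(B ` K)" using self KH by blast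
    ultimately show ?thesis using K unfolding compactin_def by meson
  qed
  then obtain F where F: "finite F" "F \<subseteq> K" "K \<subseteq> \<Union>(B ` F)"
    by (metis finite_subset_image)
  show "\<exists>F. finite F \<and> F \<subseteq> H10 \<Omega> \<and> (\<forall>w\<in>K. \<exists>z\<in>F. H10_norm (\<lambda>x. w x - z x) < \<eta>)"
  proof (intro exI[of _ F] conjI ballI)
    show "\<exists>z\<in>F. H10_norm (\<lambda>x. w x - z x) < \<eta>" if "w \<in> K" for w
      using F(3) that by (auto simp: B_def)
  qed (use F KH in auto)
qed

definition segment :: "('a \<Rightarrow> real) \<Rightarrow> ('a \<Rightarrow> real) \<Rightarrow> real \<Rightarrow> 'a \<Rightarrow> real" where
  "segment u0 u1 t = (\<lambda>x. (1 - t) * u0 x + t * u1 x)"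

lemma segment_H10: "u0 \<in> H10 \<Omega> \<Longrightarrow> u1 \<in> H10 \<Omega> \<Longrightarrow> segment u0 u1 t \<in> H10 \<Omega>"
  unfolding segment_def by (rule H10_lincomb)

lemma segment_diff_norm:
  assumes "u0 \<in> H10 \<Omega>" "u1 \<in> H10 \<Omega>"
  shows "H10_norm (\<lambda>x. segment u0 u1 s x - segment u0 u1 t x) = \<bar>s - t\<bar> * H10_norm (\<lambda>x. u1 x - u0 x)"
proof -
  have "(\<lambda>x. segment u0 u1 s x - segment u0 u1 t x) = (\<lambda>x. (s - t) * (u1 x - u0 x))"
    by (auto simp: segment_def algebra_simps)
  then show ?thesis using H10_norm_scale[OF H10_diff[OF assms(2,1)]] by simp
qed

text \<open>The set is contained in \<open>K\<close> minus a compact curve, so a net for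
  \<open>K\<close> and a net for the parameter interval together give a net for it. In this way a
  compact piece of the singular set yields a thin set of directions.\<close>

lemma totally_bounded_minus_segment:
  assumes u: "u0 \<in> H10 \<Omega>" "u1 \<in> H10 \<Omega>" and K: "totally_bounded_H10 K" "K \<subseteq> H10 \<Omega>"
  shows "totally_bounded_H10 {w \<in> H10 \<Omega>. \<exists>t\<in>{0..1}. (\<lambda>x. w x + segment u0 u1 t x) \<in> K}"
  unfolding totally_bounded_H10_def
proof (intro allI impI)
  fix \<eta> :: real assume \<eta>: "0 < \<eta>"
  define D where "D = H10_norm (\<lambda>x. u1 x - u0 x)"
  have D: "D \<ge> 0" by (simp add: D_def)
  obtain F where F: "finite F" "F \<subseteq> H10 \<Omega>" "\<And>w. w \<in> K \<Longrightarrow> \<exists>z\<in>F. H10_norm (\<lambda>x. w x - z x) < \<eta> / 2"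
    using K(1) \<eta> unfolding totally_bounded_H10_def by (meson half_gt_zero)
  have "compact {0..1::real}" by simp
  \<comment> \<open>The segment is traversed with speed \<open>D\<close>, so parameters this close
    contribute at most \<open>\<eta> / 2\<close>; the summand 1 covers \<open>D = 0\<close>.\<close>
  moreover have "0 < \<eta> / (2 * (D + 1))" using \<eta> D by simp
  ultimately have "\<exists>T. finite T \<and> {0..1::real} \<subseteq> (\<Union>t\<in>T. ball t (\<eta> / (2 * (D + 1))))"
    unfolding compact_eq_totally_bounded by blast
  then obtain T where T: "finite T" "{0..1::real} \<subseteq> (\<Union>t\<in>T. ball t (\<eta> / (2 * (D + 1))))"
    by blast
  let ?F = "(\<lambda>(z, t) x. z x - segment u0 u1 t x) ` (F \<times> T)"
  show "\<exists>F. finite F \<and> F \<subseteq> H10 \<Omega> \<and> (\<forall>w\<in>{w \<in> H10 \<Omega>. \<exists>t\<in>{0..1}. (\<lambda>x. w x + segment u0 u1 t x) \<in> K}.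
     \<exists>z\<in>F. H10_norm (\<lambda>x. w x - z x) < \<eta>)"
  proof (intro exI[of _ ?F] conjI ballI)
    show "finite ?F" using F(1) T(1) by simp
    show "?F \<subseteq> H10 \<Omega>" using F(2) u by (auto intro!: H10_diff segment_H10)
    fix w assume "w \<in> {w \<in> H10 \<Omega>. \<exists>t\<in>{0..1}. (\<lambda>x. w x + segment u0 u1 t x) \<in> K}"
    then obtain t where w: "w \<in> H10 \<Omega>" and t: "t \<in> {0..1}" "(\<lambda>x. w x + segment u0 u1 t x) \<in> K" by blast
    obtain z where z: "z \<in> F" "H10_norm (\<lambda>x. (w x + segment u0 u1 t x) - z x) < \<eta> / 2" using F(3)[OF t(2)] by blast
    obtain t' where t': "t' \<in> T" "\<bar>t' - t\<bar> < \<eta> / (2 * (D + 1))"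
      using T(2) t(1) by (auto simp: dist_real_def)
    have zH: "z \<in> H10 \<Omega>" using z F by blast
    have "\<bar>t' - t\<bar> * D \<le> \<eta> / (2 * (D + 1)) * D" using t'(2) D by (intro mult_right_mono) auto
    also have "\<dots> \<le> \<eta> / 2" using D \<eta> by (simp add: field_simps)
    finally have tD: "\<bar>t' - t\<bar> * D \<le> \<eta> / 2" .
    have eq: "(\<lambda>x. w x - (z x - segment u0 u1 t' x)) =
       (\<lambda>x. ((w x + segment u0 u1 t x) - z x) + (segment u0 u1 t' x - segment u0 u1 t x))" by auto
    have "H10_norm (\<lambda>x. w x - (z x - segment u0 u1 t' x)) \<le>
       H10_norm (\<lambda>x. (w x + segment u0 u1 t x) - z x) + H10_norm (\<lambda>x. segment u0 u1 t' x - segment u0 u1 t x)"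
      unfolding eq by (intro H10_norm_add H10_diff H10_add segment_H10 w zH u)
    also have "\<dots> < \<eta>" using z(2) tD by (simp add: segment_diff_norm[OF u] D_def)
    finally show "\<exists>z\<in>?F. H10_norm (\<lambda>x. w x - z x) < \<eta>"
      using z(1) t'(1) by (intro bexI[of _ "\<lambda>x. z x - segment u0 u1 t' x"]) auto
  qed
qed

section \<open>Infinite dimension and the category argument\<close>

lemma H10_inner_test:
  assumes "test_fun \<Omega> \<phi>" "test_fun \<Omega> \<psi>"
  shows "H10_inner \<Omega> \<phi> \<psi> = (\<integral>x. grad \<phi> x \<bullet> grad \<psi> x \<partial>M)"
  unfolding H10_inner_def
proof (rule integral_cong_AE)
  show "AE x in M. wgrad \<Omega> \<phi> x \<bullet> wgrad \<Omega> \<psi> x = grad \<phi> x \<bullet> grad \<psi> x"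
    using wgrad_AE[OF H10_pair_test_fun[OF assms(1)]] wgrad_AE[OF H10_pair_test_fun[OF assms(2)]]
    by eventually_elim simp
  show "(\<lambda>x. wgrad \<Omega> \<phi> x \<bullet> wgrad \<Omega> \<psi> x) \<in> borel_measurable M"
    using H10_L2(2)[OF test_fun_H10[OF assms(1)]] H10_L2(2)[OF test_fun_H10[OF assms(2)]]
    by (intro borel_measurable_inner) (auto simp: L2_def)
  show "(\<lambda>x. grad \<phi> x \<bullet> grad \<psi> x) \<in> borel_measurable M"
    using test_fun_L2(2)[OF assms(1)] test_fun_L2(2)[OF assms(2)]
    by (intro borel_measurable_inner) (auto simp: L2_def)
qed

lemma bump_norm_pos:
  assumes "cbox a b \<subseteq> \<Omega>" "box a b \<noteq> {}"
  shows "0 < H10_norm (bump a b)"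
proof (rule ccontr)
  assume "\<not> 0 < H10_norm (bump a b)"
  then have "H10_norm (bump a b) = 0" using H10_norm_nonneg[of "bump a b"] by linarith
  then have "AE x in M. bump a b x = 0"
    by (rule H10_norm_0_imp_AE[OF test_fun_H10[OF test_fun_bump[OF assms(1)]]])
  then have "AE x in lebesgue. x \<in> \<Omega> \<longrightarrow> bump a b x = 0"
    by (subst (asm) AE_restrict_space_iff) auto
  then have "AE x in lebesgue. x \<notin> box a b"
    by eventually_elim (use assms(1) box_subset_cbox[of a b] in \<open>auto simp: bump_eq_0_iff\<close>)
  then have "emeasure lebesgue (box a b) = 0"
    by (subst (asm) AE_iff_measurable[of "box a b"]) auto
  then have "negligible (box a b)" by (simp add: negligible_iff_emeasure0)
  then show False using assms(2) open_not_negligible[of "box a b"] by (simp add: open_box)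
qed

text \<open>The centres approach \<open>x0\<close> geometrically along one axis, and each box lies
  in a ball whose radius is a quarter of the distance of its centre from \<open>x0\<close>. Two
  centres are at least half the larger distance apart, which exceeds the sum of the two
  radii.\<close>

lemma disjoint_cboxes:
  obtains a b :: "nat \<Rightarrow> 'a" where "\<And>m. cbox (a m) (b m) \<subseteq> \<Omega>" "\<And>m. box (a m) (b m) \<noteq> {}"
    "\<And>m l. m < l \<Longrightarrow> cbox (a m) (b m) \<inter> cbox (a l) (b l) = {}"
proof -
  obtain x0 r where r: "0 < r" "ball x0 r \<subseteq> \<Omega>"
    using open_domain nonempty_domain open_contains_ball by blast
  obtain i :: 'a where i: "i \<in> Basis" using nonempty_Basis by blast
  define h where "h m = r / 2 ^ (m + 1)" for m :: nat
  have h: "0 < h m" "h (Suc m) = h m / 2" "h m \<le> r / 2" for m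
    using r(1) by (auto simp: h_def field_simps)
  define y where "y m = x0 + h m *\<^sub>R i" for m
  have "\<exists>a b. y m \<in> box a b \<and> cbox a b \<subseteq> ball (y m) (h m / 4)" for m
    by (rule open_contains_cbox[of "ball (y m) (h m / 4)" "y m"]) (use h(1)[of m] in auto)
  then obtain a b where ab: "\<And>m. y m \<in> box (a m) (b m)" "\<And>m. cbox (a m) (b m) \<subseteq> ball (y m) (h m / 4)"
    by metis
  show thesis
  proof (rule that[of a b])
    show "cbox (a m) (b m) \<subseteq> \<Omega>" for m
    proof -
      have "ball (y m) (h m / 4) \<subseteq> ball x0 r"
      proof
        fix z assume "z \<in> ball (y m) (h m / 4)"
        then have "dist (y m) z < h m / 4" by simp
        moreover have "dist x0 (y m) = h m" using i h(1)[of m] by (simp add: y_def dist_norm)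
        ultimately have "dist x0 z < h m + h m / 4" using dist_triangle[of x0 z "y m"] by linarith
        then show "z \<in> ball x0 r" using h(1)[of m] h(3)[of m] by simp
      qed
      then show ?thesis using ab(2) r(2) by blast
    qed
    show "box (a m) (b m) \<noteq> {}" for m using ab(1) by blast
    fix m l :: nat assume ml: "m < l"
    have "decseq h" using h(1) by (intro decseq_SucI) (simp add: h(2) less_imp_le)
    then have "h l \<le> h (Suc m)" using ml by (simp add: decseqD Suc_leI)
    then have hl: "h l \<le> h m / 2" by (simp add: h(2))
    have "y m - y l = (h m - h l) *\<^sub>R i" by (simp add: y_def algebra_simps)
    then have d: "dist (y m) (y l) = h m - h l" using i hl h(1)[of m] by (simp add: dist_norm)
    show "cbox (a m) (b m) \<inter> cbox (a l) (b l) = {}"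
    proof (rule ccontr)
      assume "cbox (a m) (b m) \<inter> cbox (a l) (b l) \<noteq> {}"
      then obtain z where "dist (y m) z < h m / 4" "dist (y l) z < h l / 4" using ab(2) by fastforce
      then have "h m - h l < h m / 4 + h l / 4" using d dist_triangle2[of "y m" "y l" z] by linarith
      then show False using hl h(1)[of m] h(1)[of l] by linarith
    qed
  qed
qed

text \<open>Bumps on disjoint boxes are orthogonal, since their gradients have disjoint supports.
  Pairing a difference of two normalised bumps with one of them shows that its norm is at least
  1.\<close>

lemma separated_unit_vectors:
  obtains \<psi> where "\<And>m::nat. \<psi> m \<in> H10 \<Omega>" "\<And>m. H10_norm (\<psi> m) = 1"
    "\<And>m l. m \<noteq> l \<Longrightarrow> 1 \<le> H10_norm (\<lambda>x. \<psi> m x - \<psi> l x)"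
proof -
  obtain a b :: "nat \<Rightarrow> 'a" where ab: "\<And>m. cbox (a m) (b m) \<subseteq> \<Omega>" "\<And>m. box (a m) (b m) \<noteq> {}"
    "\<And>m l. m < l \<Longrightarrow> cbox (a m) (b m) \<inter> cbox (a l) (b l) = {}"
    by (rule disjoint_cboxes) (rule that)
  define \<phi> where "\<phi> m = bump (a m) (b m)" for m
  have t: "test_fun \<Omega> (\<phi> m)" for m unfolding \<phi>_def by (rule test_fun_bump[OF ab(1)])
  have disj: "grad (\<phi> m) x \<bullet> grad (\<phi> l) x = 0" if "m \<noteq> l" for m l x
  proof -
    have z: "grad (\<phi> m) x = 0" if "x \<notin> cbox (a m) (b m)" for m
    proof (rule test_fun_grad_zero[OF t])
      have "closure {x. \<phi> m x \<noteq> 0} \<subseteq> cbox (a m) (b m)"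
        unfolding \<phi>_def by (intro closure_minimal closed_cbox) (use box_subset_cbox in \<open>auto simp: bump_eq_0_iff\<close>)
      then show "x \<notin> closure {x. \<phi> m x \<noteq> 0}" using that by blast
    qed
    have "cbox (a m) (b m) \<inter> cbox (a l) (b l) = {}" using ab(3)[of m l] ab(3)[of l m] that by (cases "m < l") auto
    then have "x \<notin> cbox (a m) (b m) \<or> x \<notin> cbox (a l) (b l)" by blast
    then show ?thesis using z[of m] z[of l] by auto
  qed
  have n: "0 < H10_norm (\<phi> m)" for m unfolding \<phi>_def by (rule bump_norm_pos[OF ab(1,2)])
  define \<psi> where "\<psi> m x = (1 / H10_norm (\<phi> m)) * \<phi> m x" for m x
  have H: "\<psi> m \<in> H10 \<Omega>" for m unfolding \<psi>_def[abs_def] by (rule H10_scale[OF test_fun_H10[OF t]])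
  have n1: "H10_norm (\<psi> m) = 1" for m
    using H10_norm_scale[OF test_fun_H10[OF t[of m]], of "1 / H10_norm (\<phi> m)"] n[of m] by (simp add: \<psi>_def[abs_def])
  have orth: "H10_inner \<Omega> (\<psi> m) (\<psi> l) = 0" if "m \<noteq> l" for m l
  proof -
    have 0: "H10_inner \<Omega> (\<phi> m) (\<phi> l) = 0" by (simp add: H10_inner_test[OF t t] disj[OF that])
    have "H10_inner \<Omega> (\<psi> m) (\<phi> l) = 0"
      using H10_inner_lincomb[OF test_fun_H10[OF t[of m]] test_fun_H10[OF t[of m]] test_fun_H10[OF t[of l]], of "1 / H10_norm (\<phi> m)" 0] 0
      by (simp add: \<psi>_def[abs_def])
    then have "H10_inner \<Omega> (\<phi> l) (\<psi> m) = 0" by (subst H10_inner_commute)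
    then have "H10_inner \<Omega> (\<psi> l) (\<psi> m) = 0"
      using H10_inner_lincomb[OF test_fun_H10[OF t[of l]] test_fun_H10[OF t[of l]] H[of m], of "1 / H10_norm (\<phi> l)" 0]
      by (simp add: \<psi>_def[abs_def])
    then show ?thesis by (subst H10_inner_commute)
  qed
  show thesis
  proof (rule that[OF H n1])
    fix m l :: nat assume ml: "m \<noteq> l"
    let ?d = "\<lambda>x. \<psi> m x - \<psi> l x"
    have d: "?d \<in> H10 \<Omega>" by (rule H10_diff[OF H H])
    have "H10_inner \<Omega> ?d (\<psi> m) = 1"
      using H10_inner_lincomb[OF H H H, of 1 m "-1" l m] orth[of l m] ml n1[of m] by (simp add: H10_inner_self)
    then show "1 \<le> H10_norm ?d" using H10_inner_le[OF d H[of m]] n1[of m] by simp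
  qed
qed

text \<open>The infinitely many points \<open>p m\<close> around \<open>b\<close> are
  \<open>\<rho> / 2\<close> apart, so each point of a finite net is within \<open>\<rho> / 4\<close>
  of at most one of them, and some \<open>p m\<close> is far from the whole net. Of this distance
  \<open>\<rho> / 8\<close> is spent on the mesh of the net and \<open>\<rho> / 8\<close> on the new
  ball, which remains inside the old one.\<close>

lemma avoid_totally_bounded:
  assumes C: "totally_bounded_H10 C" "C \<subseteq> H10 \<Omega>" and b: "b \<in> H10 \<Omega>" and \<rho>: "0 < \<rho>"
  shows "\<exists>w\<in>H10 \<Omega>. \<forall>z\<in>H10 \<Omega>. H10_norm (\<lambda>x. z x - w x) \<le> \<rho> / 8 \<longrightarrow> z \<notin> C \<and> H10_norm (\<lambda>x. z x - b x) \<le> \<rho>"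
proof -
  obtain \<psi> where \<psi>: "\<And>m::nat. \<psi> m \<in> H10 \<Omega>" "\<And>m. H10_norm (\<psi> m) = 1"
    "\<And>m l. m \<noteq> l \<Longrightarrow> 1 \<le> H10_norm (\<lambda>x. \<psi> m x - \<psi> l x)"
    by (rule separated_unit_vectors) (rule that)
  have "0 < \<rho> / 8" using \<rho> by simp
  from C(1)[unfolded totally_bounded_H10_def, rule_format, OF this]
  obtain F where F: "finite F" "F \<subseteq> H10 \<Omega>" "\<And>w. w \<in> C \<Longrightarrow> \<exists>z\<in>F. H10_norm (\<lambda>x. w x - z x) < \<rho> / 8"
    by blast
  define p where "p m x = b x + (\<rho> / 2) * \<psi> m x" for m x
  have p: "p m \<in> H10 \<Omega>" for m unfolding p_def[abs_def] by (intro H10_add H10_scale b \<psi>)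
  have sep: "\<rho> / 2 \<le> H10_norm (\<lambda>x. p m x - p l x)" if "m \<noteq> l" for m l
  proof -
    have "(\<lambda>x. p m x - p l x) = (\<lambda>x. (\<rho> / 2) * (\<psi> m x - \<psi> l x))" by (auto simp: p_def algebra_simps)
    then have "H10_norm (\<lambda>x. p m x - p l x) = (\<rho> / 2) * H10_norm (\<lambda>x. \<psi> m x - \<psi> l x)"
      using H10_norm_scale[OF H10_diff[OF \<psi>(1) \<psi>(1)], of "\<rho> / 2" m l] \<rho> by simp
    then show ?thesis using mult_left_mono[OF \<psi>(3)[OF that], of "\<rho> / 2"] \<rho> by simp
  qed
  have one: "finite {m. H10_norm (\<lambda>x. p m x - z x) < \<rho> / 4}" if z: "z \<in> H10 \<Omega>" for z
  proof -
    have "m = l" if "H10_norm (\<lambda>x. p m x - z x) < \<rho> / 4" "H10_norm (\<lambda>x. p l x - z x) < \<rho> / 4" for m l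
    proof (rule ccontr)
      assume "m \<noteq> l"
      then have "\<rho> / 2 \<le> H10_norm (\<lambda>x. p m x - p l x)" by (rule sep)
      then show False
        using that H10_norm_triangle_diff[OF p z p, of m l] H10_norm_minus_commute[OF z p, of l] by linarith
    qed
    then have "{m. H10_norm (\<lambda>x. p m x - z x) < \<rho> / 4} \<subseteq> {m0}" if "H10_norm (\<lambda>x. p m0 x - z x) < \<rho> / 4" for m0
      using that by blast
    then show ?thesis by (metis (mono_tags, lifting) Collect_empty_eq finite.emptyI finite.insertI finite_subset)
  qed
  have "finite (\<Union>z\<in>F. {m. H10_norm (\<lambda>x. p m x - z x) < \<rho> / 4})"
    using F(1,2) one by (intro finite_UN_I) auto
  then obtain m where "m \<notin> (\<Union>z\<in>F. {m. H10_norm (\<lambda>x. p m x - z x) < \<rho> / 4})"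
    using ex_new_if_finite[OF infinite_UNIV_nat] by blast
  then have m: "\<And>y. y \<in> F \<Longrightarrow> \<rho> / 4 \<le> H10_norm (\<lambda>x. p m x - y x)" by force
  show ?thesis
  proof (intro bexI[of _ "p m"] ballI impI conjI)
    show "p m \<in> H10 \<Omega>" by (rule p)
    fix z assume z: "z \<in> H10 \<Omega>" "H10_norm (\<lambda>x. z x - p m x) \<le> \<rho> / 8"
    show "z \<notin> C"
    proof
      assume "z \<in> C"
      then obtain y where y: "y \<in> F" "H10_norm (\<lambda>x. z x - y x) < \<rho> / 8" using F(3) by blast
      have yH: "y \<in> H10 \<Omega>" using y F by blast
      show False
        using m[OF y(1)] y(2) z(2) H10_norm_triangle_diff[OF p z(1) yH, of m] H10_norm_minus_commute[OF z(1) p, of m] by linarith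
    qed
    have "H10_norm (\<lambda>x. p m x - b x) = \<rho> / 2"
      using H10_norm_scale[OF \<psi>(1), of "\<rho> / 2" m] \<psi>(2)[of m] \<rho> by (simp add: p_def)
    then show "H10_norm (\<lambda>x. z x - b x) \<le> \<rho>"
      using H10_norm_triangle_diff[OF z(1) p b, of m] z(2) \<rho> by linarith
  qed
qed

text \<open>Baire's argument: as the dimension is infinite, every ball contains a smaller ball that misses
  a given totally bounded set.\<close>
lemma totally_bounded_not_cover_ball:
  assumes C: "\<And>i::nat. totally_bounded_H10 (C i)" "\<And>i. C i \<subseteq> H10 \<Omega>" and \<rho>: "0 < \<rho>"
  obtains z where "z \<in> H10 \<Omega>" "H10_norm z \<le> \<rho>" "\<And>i. z \<notin> C i"
proof -
  \<comment> \<open>Each avoidance step shrinks the radius by the factor 8. The radii tend to 0, so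
    the centres form a Cauchy sequence.\<close>
  define R where "R i = \<rho> / 8 ^ i" for i :: nat
  have R: "R i > 0" "R (Suc i) = R i / 8" for i using \<rho> by (auto simp: R_def)
  \<comment> \<open>The clause for \<open>i = 0\<close> fixes the first centre at 0, so that the
    point found in the end lies in the ball of radius \<open>\<rho>\<close> around 0.\<close>
  have "\<exists>b. \<forall>i. (b i \<in> H10 \<Omega> \<and> (i = 0 \<longrightarrow> b i = (\<lambda>x. 0))) \<and>
     (\<forall>z\<in>H10 \<Omega>. H10_norm (\<lambda>x. z x - b (Suc i) x) \<le> R i / 8 \<longrightarrow> z \<notin> C i \<and> H10_norm (\<lambda>x. z x - b i x) \<le> R i)"
  proof (rule dependent_nat_choice)
    show "\<exists>x. x \<in> H10 \<Omega> \<and> (0 = 0 \<longrightarrow> x = (\<lambda>x. 0))" using H10_zero by blast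
    fix x and i :: nat assume "x \<in> H10 \<Omega> \<and> (i = 0 \<longrightarrow> x = (\<lambda>x. 0))"
    then show "\<exists>y. (y \<in> H10 \<Omega> \<and> (Suc i = 0 \<longrightarrow> y = (\<lambda>x. 0))) \<and>
       (\<forall>z\<in>H10 \<Omega>. H10_norm (\<lambda>x. z x - y x) \<le> R i / 8 \<longrightarrow> z \<notin> C i \<and> H10_norm (\<lambda>xa. z xa - x xa) \<le> R i)"
      using avoid_totally_bounded[OF C(1,2) _ R(1), of x i i] by auto
  qed
  then obtain b where b: "\<And>i. b i \<in> H10 \<Omega>" "b 0 = (\<lambda>x. 0)"
    "\<And>i z. z \<in> H10 \<Omega> \<Longrightarrow> H10_norm (\<lambda>x. z x - b (Suc i) x) \<le> R (Suc i) \<Longrightarrow> z \<notin> C i \<and> H10_norm (\<lambda>x. z x - b i x) \<le> R i"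
    unfolding R(2) by blast
  have nest: "H10_norm (\<lambda>x. z x - b i x) \<le> R i" if "z \<in> H10 \<Omega>" "H10_norm (\<lambda>x. z x - b (i + j) x) \<le> R (i + j)" for z i j
    using that(2)
  proof (induction j)
    case (Suc j)
    then show ?case using b(3)[OF that(1), of "i + j"] by simp
  qed simp
  have near: "H10_norm (\<lambda>x. b k x - b i x) \<le> R i" if "i \<le> k" for i k
  proof -
    have "H10_norm (\<lambda>x. b k x - b (i + (k - i)) x) \<le> R (i + (k - i))"
      using that H10_zero(2) R(1)[of k] by (simp add: less_imp_le)
    then show ?thesis by (rule nest[OF b(1)])
  qed
  have R0: "R \<longlonglongrightarrow> 0"
  proof -
    have "R = (\<lambda>i. \<rho> * (1/8) ^ i)" by (rule ext) (simp add: R_def power_one_over)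
    then show ?thesis using tendsto_mult_left[OF LIMSEQ_realpow_zero[of "1/8::real"], of \<rho>] by simp
  qed
  obtain z where z: "z \<in> H10 \<Omega>" "(\<lambda>k. H10_norm (\<lambda>x. b k x - z x)) \<longlonglongrightarrow> 0"
  proof (rule H10_complete[OF b(1)])
    fix e :: real assume e: "0 < e"
    then obtain N where N: "R N < e / 2"
      using order_tendstoD(2)[OF R0, of "e / 2"] unfolding eventually_sequentially by auto
    have "H10_norm (\<lambda>x. b k x - b l x) < e" if "k \<ge> N" "l \<ge> N" for k l
      using near[OF that(1)] near[OF that(2)] N H10_norm_triangle_diff[OF b(1) b(1) b(1), of k l N]
        H10_norm_minus_commute[OF b(1) b(1), of N l] by linarith
    then show "\<exists>N. \<forall>k\<ge>N. \<forall>l\<ge>N. H10_norm (\<lambda>x. b k x - b l x) < e" by blast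
  qed (rule that)
  have zb: "H10_norm (\<lambda>x. z x - b i x) \<le> R i" for i
  proof -
    have "(\<lambda>k. H10_norm (\<lambda>x. b k x - z x) + R i) \<longlonglongrightarrow> 0 + R i" by (intro tendsto_intros z)
    moreover have "H10_norm (\<lambda>x. z x - b i x) \<le> H10_norm (\<lambda>x. b k x - z x) + R i" if "k \<ge> i" for k
      using near[OF that] H10_norm_triangle_diff[OF z(1) b(1) b(1), of i k] H10_norm_minus_commute[OF z(1) b(1), of k] by linarith
    ultimately have "H10_norm (\<lambda>x. z x - b i x) \<le> 0 + R i" by (intro LIMSEQ_le_const[of _ "0 + R i"]) auto
    then show ?thesis by simp
  qed
  show thesis
  proof (rule that[OF z(1)])
    show "H10_norm z \<le> \<rho>" using zb[of 0] by (simp add: b(2) R_def)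
    show "z \<notin> C i" for i using b(3)[OF z(1) zb] by blast
  qed
qed

definition singular_set :: "(('a \<Rightarrow> real) \<Rightarrow> 'a \<Rightarrow> real) \<Rightarrow> ('a \<Rightarrow> real) set" where
  "singular_set W = {u \<in> H10 \<Omega>. \<exists>v. \<not> ae_zero \<Omega> v \<and> weak_sol \<Omega> (W u) v}"

text \<open>Norm 1 survives limits in norm, whereas being non-zero would not; hence the
  normalisation. Conversely, a solution of norm 1 that vanished almost everywhere would contradict
  the equation tested with the solution itself.\<close>

lemma singular_set_iff:
  assumes adm: "admissible (W u)"
  shows "u \<in> singular_set W \<longleftrightarrow> u \<in> H10 \<Omega> \<and> (\<exists>v\<in>H10 \<Omega>. H10_norm v = 1 \<and> (\<forall>w\<in>H10 \<Omega>. defect (W u) v w = 0))"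
proof
  obtain K where K: "form_le (W u) K" by (rule admissible_form_le[OF adm])
  assume "u \<in> singular_set W"
  then obtain v where v: "u \<in> H10 \<Omega>" "\<not> ae_zero \<Omega> v" "v \<in> H10 \<Omega>" "\<And>w. w \<in> H10 \<Omega> \<Longrightarrow> defect (W u) v w = 0"
    unfolding singular_set_def weak_sol_def defect_def by auto
  define n where "n = H10_norm v"
  have "n \<noteq> 0" using H10_norm_0_imp_AE[OF v(3)] v(2) by (auto simp: n_def ae_zero_def)
  then have n: "n > 0" by (simp add: n_def less_le)
  let ?z = "\<lambda>x. (1 / n) * v x"
  have "H10_norm ?z = 1" using H10_norm_scale[OF v(3), of "1 / n"] n by (simp add: n_def)
  moreover have "defect (W u) ?z w = 0" if "w \<in> H10 \<Omega>" for w
    using defect_lincomb[OF K v(3) v(3) that, of "1 / n" 0] v(4)[OF that] by simp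
  ultimately show "u \<in> H10 \<Omega> \<and> (\<exists>v\<in>H10 \<Omega>. H10_norm v = 1 \<and> (\<forall>w\<in>H10 \<Omega>. defect (W u) v w = 0))"
    using v(1) H10_scale[OF v(3), of "1 / n"] by blast
next
  assume "u \<in> H10 \<Omega> \<and> (\<exists>v\<in>H10 \<Omega>. H10_norm v = 1 \<and> (\<forall>w\<in>H10 \<Omega>. defect (W u) v w = 0))"
  then obtain v where v: "u \<in> H10 \<Omega>" "v \<in> H10 \<Omega>" "H10_norm v = 1" "\<And>w. w \<in> H10 \<Omega> \<Longrightarrow> defect (W u) v w = 0" by blast
  have "\<not> ae_zero \<Omega> v"
  proof
    assume "ae_zero \<Omega> v"
    then have "AE x in M. W u x * v x * v x = 0" unfolding ae_zero_def by eventually_elim simp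
    then have "(\<integral>x. W u x * v x * v x \<partial>M) = 0" by (rule integral_eq_zero_AE)
    then show False using v(3) v(4)[OF v(2)] defect_self[of "W u" v] by simp
  qed
  moreover have "weak_sol \<Omega> (W u) v" unfolding weak_sol_def using v(2,4) by (simp add: defect_def)
  ultimately show "u \<in> singular_set W" using v(1) unfolding singular_set_def by blast
qed

theorem singular_set_closed_not_sigma_compact:
  assumes adm: "\<And>u. u \<in> H10 \<Omega> \<Longrightarrow> admissible (W u)"
    and cont: "\<And>u e. u \<in> H10 \<Omega> \<Longrightarrow> 0 < e \<Longrightarrow> \<exists>\<delta>>0. \<forall>w\<in>H10 \<Omega>.
       H10_norm (\<lambda>x. w x - u x) < \<delta> \<longrightarrow> form_le (\<lambda>x. W w x - W u x) e"
    and u0: "u0 \<in> H10 \<Omega>" "1 < top_eig (W u0)" and u1: "u1 \<in> H10 \<Omega>" "top_eig (W u1) < 1"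
  shows "closedin (H10_top \<Omega>) (singular_set W)" "\<not> sigma_compactin (H10_top \<Omega>) (singular_set W)"
proof -
  have sub: "singular_set W \<subseteq> H10 \<Omega>" by (auto simp: singular_set_def)
  show "closedin (H10_top \<Omega>) (singular_set W)"
    unfolding closedin_def topspace_H10_top openin_H10_top
  proof (intro conjI sub ballI)
    fix u assume u: "u \<in> H10 \<Omega> - singular_set W"
    show "\<exists>e>0. \<forall>v\<in>H10 \<Omega>. H10_dist \<Omega> u v < e \<longrightarrow> v \<in> H10 \<Omega> - singular_set W"
    proof (rule ccontr)
      assume not_open: "\<not> ?thesis"
      have uH: "u \<in> H10 \<Omega>" using u by blast
      \<comment> \<open>If no ball around \<open>u\<close> avoided the singular set, there would be
        singular points whose weights tend to \<open>W u\<close> in the sense of forms, which is the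
        convergence required by \<open>solutions_closed\<close>.\<close>
      have "\<exists>w. w \<in> singular_set W \<and> form_le (\<lambda>x. W w x - W u x) (inverse (real (Suc j)))" for j
      proof -
        obtain \<delta> where \<delta>: "\<delta> > 0" "\<And>w. w \<in> H10 \<Omega> \<Longrightarrow> H10_norm (\<lambda>x. w x - u x) < \<delta> \<Longrightarrow> form_le (\<lambda>x. W w x - W u x) (inverse (real (Suc j)))"
          using cont[OF uH, of "inverse (real (Suc j))"] by auto
        obtain w where w: "w \<in> H10 \<Omega>" "H10_dist \<Omega> u w < \<delta>" "w \<in> singular_set W" using not_open \<delta>(1) by blast
        have "H10_norm (\<lambda>x. w x - u x) < \<delta>"
          using w(2) H10_dist_norm[OF uH w(1)] H10_norm_minus_commute[OF uH w(1)] by simp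
        then show ?thesis using \<delta>(2)[OF w(1)] w(3) by blast
      qed
      then obtain w where w: "\<And>j. w j \<in> singular_set W" "\<And>j. form_le (\<lambda>x. W (w j) x - W u x) (inverse (real (Suc j)))"
        by metis
      have wH: "w j \<in> H10 \<Omega>" for j using w(1) sub by blast
      have "\<exists>v\<in>H10 \<Omega>. H10_norm v = 1 \<and> (\<forall>z\<in>H10 \<Omega>. defect (W (w j)) v z = 0)" for j
        using w(1)[of j] singular_set_iff[of W "w j", OF adm[OF wH]] by blast
      then obtain v where v: "\<And>j. v j \<in> H10 \<Omega>" "\<And>j. H10_norm (v j) = 1" "\<And>j z. z \<in> H10 \<Omega> \<Longrightarrow> defect (W (w j)) (v j) z = 0"
        by metis
      obtain z where "z \<in> H10 \<Omega>" "H10_norm z = 1" "\<And>y. y \<in> H10 \<Omega> \<Longrightarrow> defect (W u) z y = 0"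
        by (rule solutions_closed[where \<beta>="\<lambda>j. W (w j)" and \<gamma>="W u", OF adm[OF wH] adm[OF uH] w(2) LIMSEQ_inverse_real_of_nat v]) (assumption, rule that)
      then have "u \<in> singular_set W" using singular_set_iff[of W u, OF adm[OF uH]] uH by blast
      then show False using u by blast
    qed
  qed blast
  have m_cont: "\<exists>\<delta>>0. \<forall>w\<in>H10 \<Omega>. H10_norm (\<lambda>x. w x - u x) < \<delta> \<longrightarrow> \<bar>top_eig (W w) - top_eig (W u)\<bar> \<le> e"
    if uH: "u \<in> H10 \<Omega>" and e: "0 < e" for u e
  proof -
    obtain \<delta> where \<delta>: "\<delta> > 0" "\<And>w. w \<in> H10 \<Omega> \<Longrightarrow> H10_norm (\<lambda>x. w x - u x) < \<delta> \<Longrightarrow> form_le (\<lambda>x. W w x - W u x) e"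
      using cont[OF uH e] by blast
    obtain K where K: "form_le (W u) K" by (rule admissible_form_le[OF adm[OF uH]])
    have "\<bar>top_eig (W w) - top_eig (W u)\<bar> \<le> e" if w: "w \<in> H10 \<Omega>" "H10_norm (\<lambda>x. w x - u x) < \<delta>" for w
    proof -
      obtain K' where K': "form_le (W w) K'" by (rule admissible_form_le[OF adm[OF w(1)]])
      show ?thesis by (rule top_eig_close[OF K K' \<delta>(2)[OF w]])
    qed
    then show ?thesis using \<delta>(1) by blast
  qed
  \<comment> \<open>The tolerance is the whole gap to 1: translates of \<open>u0\<close> by less
    than \<open>\<delta>0\<close> keep \<open>top_eig\<close> at least 1, and a weak inequality is
    enough for the intermediate value theorem. \<open>\<delta>1\<close> plays the same part at
    \<open>u1\<close>.\<close>
  obtain \<delta>0 where \<delta>0: "\<delta>0 > 0" "\<And>w. w \<in> H10 \<Omega> \<Longrightarrow> H10_norm (\<lambda>x. w x - u0 x) < \<delta>0 \<Longrightarrow> \<bar>top_eig (W w) - top_eig (W u0)\<bar> \<le> top_eig (W u0) - 1"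
    using m_cont[OF u0(1), of "top_eig (W u0) - 1"] u0(2) by auto
  obtain \<delta>1 where \<delta>1: "\<delta>1 > 0" "\<And>w. w \<in> H10 \<Omega> \<Longrightarrow> H10_norm (\<lambda>x. w x - u1 x) < \<delta>1 \<Longrightarrow> \<bar>top_eig (W w) - top_eig (W u1)\<bar> \<le> 1 - top_eig (W u1)"
    using m_cont[OF u1(1), of "1 - top_eig (W u1)"] u1(2) by auto
  have hit: "\<exists>t\<in>{0..1}. (\<lambda>x. w x + segment u0 u1 t x) \<in> singular_set W"
    if w: "w \<in> H10 \<Omega>" "H10_norm w < \<delta>0" "H10_norm w < \<delta>1" for w
  proof -
    define \<gamma> where "\<gamma> t = (\<lambda>x. w x + segment u0 u1 t x)" for t
    have \<gamma>: "\<gamma> t \<in> H10 \<Omega>" for t unfolding \<gamma>_def by (intro H10_add segment_H10 w u0 u1)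
    define D where "D = H10_norm (\<lambda>x. u1 x - u0 x)"
    have D: "D \<ge> 0" by (simp add: D_def)
    have "continuous_on {0..1} (\<lambda>t. top_eig (W (\<gamma> t)))"
      unfolding continuous_on_iff
    proof (intro ballI allI impI)
      fix t e :: real assume e: "0 < e"
      obtain \<delta> where \<delta>: "\<delta> > 0" "\<And>z. z \<in> H10 \<Omega> \<Longrightarrow> H10_norm (\<lambda>x. z x - \<gamma> t x) < \<delta> \<Longrightarrow> \<bar>top_eig (W z) - top_eig (W (\<gamma> t))\<bar> \<le> e / 2"
        using m_cont[OF \<gamma>[of t], of "e / 2"] e by auto
      show "\<exists>d>0. \<forall>s\<in>{0..1}. dist s t < d \<longrightarrow> dist (top_eig (W (\<gamma> s))) (top_eig (W (\<gamma> t))) < e"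
      proof (intro exI[of _ "\<delta> / (D + 1)"] conjI ballI impI)
        show "0 < \<delta> / (D + 1)" using \<delta>(1) D by simp
        fix s assume "dist s t < \<delta> / (D + 1)"
        then have "\<bar>s - t\<bar> * (D + 1) < \<delta>" using D by (simp add: dist_real_def pos_less_divide_eq)
        moreover have "\<bar>s - t\<bar> * D \<le> \<bar>s - t\<bar> * (D + 1)" by (intro mult_left_mono) auto
        ultimately have "H10_norm (\<lambda>x. \<gamma> s x - \<gamma> t x) < \<delta>"
          using segment_diff_norm[OF u0(1) u1(1), of s t] by (simp add: \<gamma>_def D_def)
        then show "dist (top_eig (W (\<gamma> s))) (top_eig (W (\<gamma> t))) < e"
          using \<delta>(2)[OF \<gamma>, of s] e by (simp add: dist_real_def)
      qed
    qed
    moreover have "1 \<le> top_eig (W (\<gamma> 0))"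
      using \<delta>0(2)[OF \<gamma>, of 0] w(2) by (simp add: \<gamma>_def segment_def)
    moreover have "top_eig (W (\<gamma> 1)) \<le> 1"
      using \<delta>1(2)[OF \<gamma>, of 1] w(3) by (simp add: \<gamma>_def segment_def)
    ultimately obtain t where t: "0 \<le> t" "t \<le> 1" "top_eig (W (\<gamma> t)) = 1"
      using IVT2'[of "\<lambda>t. top_eig (W (\<gamma> t))" 1 1 0] by auto
    obtain v where "v \<in> H10 \<Omega>" "H10_norm v = 1" "\<And>y. y \<in> H10 \<Omega> \<Longrightarrow> defect (W (\<gamma> t)) v y = 0"
      by (rule top_eig_1_imp_solution[OF adm[OF \<gamma>] t(3)]) (rule that)
    then have "\<gamma> t \<in> singular_set W" using singular_set_iff[of W "\<gamma> t", OF adm[OF \<gamma>]] \<gamma> by blast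
    then show ?thesis unfolding \<gamma>_def using t(1,2) by auto
  qed
  show "\<not> sigma_compactin (H10_top \<Omega>) (singular_set W)"
  proof
    assume "sigma_compactin (H10_top \<Omega>) (singular_set W)"
    then obtain K :: "nat \<Rightarrow> ('a \<Rightarrow> real) set" where K: "\<And>i. compactin (H10_top \<Omega>) (K i)" "singular_set W = (\<Union>i. K i)"
      unfolding sigma_compactin_def by blast
    \<comment> \<open>If the singular set were the union of the \<open>K i\<close>, these sets would
      contain every sufficiently small direction, because each correspondingly translated segment
      meets the singular set.\<close>
    define C where "C i = {w \<in> H10 \<Omega>. \<exists>t\<in>{0..1}. (\<lambda>x. w x + segment u0 u1 t x) \<in> K i}" for i
    have C: "totally_bounded_H10 (C i)" "C i \<subseteq> H10 \<Omega>" for i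
    proof -
      have "K i \<subseteq> H10 \<Omega>" using K(2) sub by blast
      then show "totally_bounded_H10 (C i)" unfolding C_def
        by (intro totally_bounded_minus_segment u0 u1 compactin_imp_totally_bounded K)
    qed (auto simp: C_def)
    have "0 < min \<delta>0 \<delta>1 / 2" using \<delta>0(1) \<delta>1(1) by simp
    then obtain z where z: "z \<in> H10 \<Omega>" "H10_norm z \<le> min \<delta>0 \<delta>1 / 2" "\<And>i. z \<notin> C i"
      by (rule totally_bounded_not_cover_ball[OF C]) (rule that)
    have "H10_norm z < \<delta>0" "H10_norm z < \<delta>1" using z(2) \<delta>0(1) \<delta>1(1) by auto
    from hit[OF z(1) this] obtain t i where "t \<in> {0..1}" "(\<lambda>x. z x + segment u0 u1 t x) \<in> K i" using K(2) by blast
    then have "z \<in> C i" unfolding C_def using z(1) by blast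
    then show False using z(3) by blast
  qed
qed

end

section \<open>Weights of controlled growth\<close>

text \<open>Unless all three moduli are at most \<open>R\<close>, the largest of them,
  \<open>X\<close>, exceeds \<open>R\<close>, and the left side is of order
  \<open>X powr (q + 2)\<close>. As \<open>p\<close> exceeds \<open>q + 2\<close> by
  \<open>s > 0\<close>, a large \<open>R\<close> lets the factor \<open>X powr s\<close> absorb the
  constant into \<open>\<epsilon> * X powr p\<close>.\<close>

lemma growth_dominated:
  fixes g :: "real \<Rightarrow> real"
  assumes "0 \<le> C" "\<And>x. \<bar>g x\<bar> \<le> C * (1 + \<bar>x\<bar> powr q)" "0 < q" "q + 2 < p" "0 < \<epsilon>"
  obtains R where "1 \<le> R" "\<And>a b v. \<not> (\<bar>a\<bar> \<le> R \<and> \<bar>b\<bar> \<le> R \<and> \<bar>v\<bar> \<le> R) \<Longrightarrow>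
     (\<bar>g a\<bar> + \<bar>g b\<bar>) * v\<^sup>2 \<le> \<epsilon> * (1 + \<bar>a\<bar> powr p + \<bar>b\<bar> powr p + \<bar>v\<bar> powr p)"
proof -
  define s where "s = p - (q + 2)"
  have s: "s > 0" using assms by (simp add: s_def)
  define K where "K = 4 * C + 1"
  have K: "K > 0" using assms by (simp add: K_def)
  define R where "R = max 1 ((K / \<epsilon>) powr (1 / s))"
  have R: "1 \<le> R" by (simp add: R_def)
  have "K / \<epsilon> = ((K / \<epsilon>) powr (1 / s)) powr s" using s K assms(5) by (simp add: powr_powr)
  also have "\<dots> \<le> R powr s" using s by (intro powr_mono2) (auto simp: R_def)
  finally have KR: "K \<le> \<epsilon> * R powr s" using assms(5) by (simp add: pos_divide_le_eq mult.commute)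
  show thesis
  proof (rule that[OF R])
    fix a b v assume n: "\<not> (\<bar>a\<bar> \<le> R \<and> \<bar>b\<bar> \<le> R \<and> \<bar>v\<bar> \<le> R)"
    define X where "X = max \<bar>a\<bar> (max \<bar>b\<bar> \<bar>v\<bar>)"
    have X: "R < X" "\<bar>a\<bar> \<le> X" "\<bar>b\<bar> \<le> X" "\<bar>v\<bar> \<le> X" using n by (auto simp: X_def)
    have X1: "1 \<le> X" using X R by linarith
    have Xq: "1 \<le> X powr q" using X1 assms(3) by (simp add: ge_one_powr_ge_zero)
    have g: "\<bar>g y\<bar> \<le> 2 * C * X powr q" if "\<bar>y\<bar> \<le> X" for y
    proof -
      have "\<bar>y\<bar> powr q \<le> X powr q" using that assms(3) by (intro powr_mono2) auto
      then have "1 + \<bar>y\<bar> powr q \<le> 2 * X powr q" using Xq by linarith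
      then have "C * (1 + \<bar>y\<bar> powr q) \<le> C * (2 * X powr q)" using assms(1) by (intro mult_left_mono)
      then show ?thesis using assms(2)[of y] by (simp add: mult_ac)
    qed
    have "\<bar>v\<bar>\<^sup>2 \<le> X\<^sup>2" using X(4) by (intro power_mono) auto
    then have v2: "v\<^sup>2 \<le> X powr 2" using X1 by (simp add: powr_numeral)
    have "(\<bar>g a\<bar> + \<bar>g b\<bar>) * v\<^sup>2 \<le> (4 * C * X powr q) * X powr 2"
      using g[OF X(2)] g[OF X(3)] v2 assms(1) by (intro mult_mono) auto
    also have "\<dots> \<le> K * (X powr q * X powr 2)" by (simp add: K_def distrib_right)
    also have "\<dots> \<le> (\<epsilon> * X powr s) * (X powr q * X powr 2)"
    proof (intro mult_right_mono)
      have "R powr s \<le> X powr s" using X R s by (intro powr_mono2) auto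
      then have "\<epsilon> * R powr s \<le> \<epsilon> * X powr s" using assms(5) by (intro mult_left_mono) auto
      then show "K \<le> \<epsilon> * X powr s" using KR by linarith
    qed simp
    also have "\<dots> = \<epsilon> * X powr p" by (simp add: mult.assoc powr_add[symmetric] s_def)
    also have "\<dots> \<le> \<epsilon> * (1 + \<bar>a\<bar> powr p + \<bar>b\<bar> powr p + \<bar>v\<bar> powr p)"
    proof (intro mult_left_mono)
      have "X = \<bar>a\<bar> \<or> X = \<bar>b\<bar> \<or> X = \<bar>v\<bar>" unfolding X_def by linarith
      then have "X powr p = \<bar>a\<bar> powr p \<or> X powr p = \<bar>b\<bar> powr p \<or> X powr p = \<bar>v\<bar> powr p" by metis
      moreover have "0 \<le> \<bar>a\<bar> powr p" "0 \<le> \<bar>b\<bar> powr p" "0 \<le> \<bar>v\<bar> powr p" by simp_all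
      ultimately show "X powr p \<le> 1 + \<bar>a\<bar> powr p + \<bar>b\<bar> powr p + \<bar>v\<bar> powr p"
        by linarith
    qed (use assms in simp)
    finally show "(\<bar>g a\<bar> + \<bar>g b\<bar>) * v\<^sup>2 \<le> \<epsilon> * (1 + \<bar>a\<bar> powr p + \<bar>b\<bar> powr p + \<bar>v\<bar> powr p)" .
  qed
qed

text \<open>The pointwise version of admissibility: large values of \<open>a\<close> or
  \<open>v\<close> are absorbed by \<open>p\<close>-th powers, whose integrals are bounded, and for
  the remaining values \<open>g a\<close> is bounded, which leaves a multiple of
  \<open>v\<^sup>2\<close>.\<close>

lemma growth_weight_le:
  fixes g :: "real \<Rightarrow> real"
  assumes "0 \<le> C" "\<And>x. \<bar>g x\<bar> \<le> C * (1 + \<bar>x\<bar> powr q)" "0 < q" "q + 2 < p" "0 < \<epsilon>"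
  obtains D where "0 \<le> D" "\<And>a v. \<bar>g a\<bar> * v\<^sup>2 \<le> \<epsilon> * (1 + \<bar>a\<bar> powr p + \<bar>v\<bar> powr p) + D * v\<^sup>2"
proof -
  obtain R where R: "1 \<le> R" "\<And>a b v. \<not> (\<bar>a\<bar> \<le> R \<and> \<bar>b\<bar> \<le> R \<and> \<bar>v\<bar> \<le> R) \<Longrightarrow>
     (\<bar>g a\<bar> + \<bar>g b\<bar>) * v\<^sup>2 \<le> \<epsilon> * (1 + \<bar>a\<bar> powr p + \<bar>b\<bar> powr p + \<bar>v\<bar> powr p)"
    by (rule growth_dominated[OF assms]) (rule that)
  define D where "D = C * (1 + R powr q)"
  have D: "0 \<le> D" using assms(1) by (simp add: D_def)
  show thesis
  proof (rule that[OF D])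
    fix a v :: real
    show "\<bar>g a\<bar> * v\<^sup>2 \<le> \<epsilon> * (1 + \<bar>a\<bar> powr p + \<bar>v\<bar> powr p) + D * v\<^sup>2"
    proof (cases "\<bar>a\<bar> \<le> R \<and> \<bar>v\<bar> \<le> R")
      case True
      have "\<bar>a\<bar> powr q \<le> R powr q" using True assms(3) by (intro powr_mono2) auto
      then have "C * (1 + \<bar>a\<bar> powr q) \<le> D" unfolding D_def using assms(1) by (intro mult_left_mono) auto
      then have "\<bar>g a\<bar> \<le> D" using assms(2)[of a] by linarith
      then have "\<bar>g a\<bar> * v\<^sup>2 \<le> D * v\<^sup>2" by (intro mult_right_mono) auto
      moreover have "0 \<le> \<epsilon> * (1 + \<bar>a\<bar> powr p + \<bar>v\<bar> powr p)" using assms(5) by (intro mult_nonneg_nonneg) auto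
      ultimately show ?thesis by linarith
    next
      case False
      \<comment> \<open>The estimate for two arguments is specialised to the second argument 0,
        whose \<open>p\<close>-th power vanishes.\<close>
      then have "(\<bar>g a\<bar> + \<bar>g 0\<bar>) * v\<^sup>2 \<le> \<epsilon> * (1 + \<bar>a\<bar> powr p + \<bar>0\<bar> powr p + \<bar>v\<bar> powr p)"
        by (intro R(2)) auto
      moreover have "\<bar>g a\<bar> * v\<^sup>2 \<le> (\<bar>g a\<bar> + \<bar>g 0\<bar>) * v\<^sup>2" by (intro mult_right_mono) auto
      moreover have "0 \<le> D * v\<^sup>2" using D by simp
      ultimately show ?thesis by simp
    qed
  qed
qed

text \<open>The pointwise version of continuity of the superposition operator. For bounded values,
  uniform continuity handles arguments closer than \<open>\<eta>\<close>, and arguments further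
  apart are charged to \<open>\<bar>a - b\<bar> powr p \<ge> \<eta> powr p\<close>; large values are
  absorbed. After integration, closeness in L^p is all that is required.\<close>

lemma growth_weight_diff_le:
  fixes g :: "real \<Rightarrow> real"
  assumes "0 \<le> C" "\<And>x. \<bar>g x\<bar> \<le> C * (1 + \<bar>x\<bar> powr q)" "0 < q" "q + 2 < p" "0 < \<epsilon>"
    and cont: "continuous_on UNIV g"
  obtains D where "0 \<le> D" "\<And>a b v. \<bar>g a - g b\<bar> * v\<^sup>2 \<le>
     \<epsilon> * (1 + \<bar>a\<bar> powr p + \<bar>b\<bar> powr p + \<bar>v\<bar> powr p) + D * \<bar>a - b\<bar> powr p"
proof -
  obtain R where R: "1 \<le> R" "\<And>a b v. \<not> (\<bar>a\<bar> \<le> R \<and> \<bar>b\<bar> \<le> R \<and> \<bar>v\<bar> \<le> R) \<Longrightarrow>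
     (\<bar>g a\<bar> + \<bar>g b\<bar>) * v\<^sup>2 \<le> \<epsilon> * (1 + \<bar>a\<bar> powr p + \<bar>b\<bar> powr p + \<bar>v\<bar> powr p)"
    by (rule growth_dominated[OF assms(1-5)]) (rule that)
  have "uniformly_continuous_on (cball 0 R) g"
    using cont by (intro compact_uniformly_continuous) (auto intro: continuous_on_subset)
  moreover have "0 < \<epsilon> / R\<^sup>2" using assms(5) R(1) by simp
  ultimately obtain \<eta> where \<eta>: "0 < \<eta>" "\<And>a b. \<bar>a\<bar> \<le> R \<Longrightarrow> \<bar>b\<bar> \<le> R \<Longrightarrow> \<bar>a - b\<bar> < \<eta> \<Longrightarrow> \<bar>g a - g b\<bar> < \<epsilon> / R\<^sup>2"
    unfolding uniformly_continuous_on_def by (auto simp: dist_real_def)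
  define B where "B = C * (1 + R powr q)"
  have B0: "0 \<le> B" using assms(1) by (simp add: B_def)
  have B: "\<bar>g a\<bar> \<le> B" if "\<bar>a\<bar> \<le> R" for a
  proof -
    have "\<bar>a\<bar> powr q \<le> R powr q" using that assms(3) by (intro powr_mono2) auto
    then have "C * (1 + \<bar>a\<bar> powr q) \<le> B" unfolding B_def using assms(1) by (intro mult_left_mono) auto
    then show ?thesis using assms(2)[of a] by linarith
  qed
  define D where "D = 2 * B * R\<^sup>2 / \<eta> powr p"
  have D: "0 \<le> D" using B0 by (simp add: D_def)
  show thesis
  proof (rule that[OF D])
    fix a b v :: real
    let ?T = "1 + \<bar>a\<bar> powr p + \<bar>b\<bar> powr p + \<bar>v\<bar> powr p"
    have T: "1 \<le> ?T" by simp
    have Dp: "0 \<le> D * \<bar>a - b\<bar> powr p" using D by simp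
    show "\<bar>g a - g b\<bar> * v\<^sup>2 \<le> \<epsilon> * ?T + D * \<bar>a - b\<bar> powr p"
    proof (cases "\<bar>a\<bar> \<le> R \<and> \<bar>b\<bar> \<le> R \<and> \<bar>v\<bar> \<le> R")
      case True
      have "\<bar>v\<bar>\<^sup>2 \<le> R\<^sup>2" using True by (intro power_mono) auto
      then have v2: "v\<^sup>2 \<le> R\<^sup>2" by simp
      show ?thesis
      proof (cases "\<bar>a - b\<bar> < \<eta>")
        case lt: True
        have "\<bar>g a - g b\<bar> * v\<^sup>2 \<le> (\<epsilon> / R\<^sup>2) * R\<^sup>2"
          using \<eta>(2)[of a b] True lt v2 assms(5) by (intro mult_mono) auto
        also have "\<dots> = \<epsilon> * 1" using R(1) by simp
        also have "\<dots> \<le> \<epsilon> * ?T" using assms(5) T by (intro mult_left_mono) auto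
        finally show ?thesis using Dp by linarith
      next
        case False
        have "\<bar>g a - g b\<bar> * v\<^sup>2 \<le> (2 * B) * R\<^sup>2"
          using B[of a] B[of b] True v2 B0 by (intro mult_mono) auto
        also have "\<dots> = D * \<eta> powr p" using \<eta>(1) by (simp add: D_def)
        also have "\<dots> \<le> D * \<bar>a - b\<bar> powr p"
          using False \<eta>(1) D assms(3,4) by (intro mult_left_mono powr_mono2) auto
        finally have "\<bar>g a - g b\<bar> * v\<^sup>2 \<le> D * \<bar>a - b\<bar> powr p" .
        moreover have "0 \<le> \<epsilon> * ?T" using assms(5) T by (intro mult_nonneg_nonneg) auto
        ultimately show ?thesis by linarith
      qed
    next
      case False
      have "\<bar>g a - g b\<bar> * v\<^sup>2 \<le> (\<bar>g a\<bar> + \<bar>g b\<bar>) * v\<^sup>2" by (intro mult_right_mono) auto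
      then show ?thesis using R(2)[OF False] Dp by linarith
    qed
  qed
qed

context bounded_domain
begin

lemma emeasure_M: "emeasure M (space M) = ennreal (measure M \<Omega>)"
  by (simp add: M.emeasure_eq_measure space_restrict_space)

lemma growth_weight_admissible:
  fixes g :: "real \<Rightarrow> real"
  assumes p: "2 \<le> p" "real DIM('a) * (p - 2) / 2 < p"
    and g: "0 \<le> C" "\<And>x. \<bar>g x\<bar> \<le> C * (1 + \<bar>x\<bar> powr q)" "0 < q" "q + 2 < p" "continuous_on UNIV g"
    and \<alpha>: "\<alpha> \<in> borel_measurable M" "AE x in M. \<bar>\<alpha> x\<bar> \<le> A" "0 \<le> A"
    and u: "u \<in> borel_measurable M" "(\<integral>\<^sup>+x. ennreal (\<bar>u x\<bar> powr p) \<partial>M) \<le> ennreal U" "0 \<le> U"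
  shows "admissible (\<lambda>x. lam * \<alpha> x * g (u x))"
  unfolding admissible_def
proof (intro conjI allI impI)
  have [measurable]: "g \<in> borel_measurable borel" using g(5) by (rule borel_measurable_continuous_onI)
  note [measurable] = \<alpha>(1) u(1)
  show "(\<lambda>x. lam * \<alpha> x * g (u x)) \<in> borel_measurable M" by measurable
  obtain S where S: "0 \<le> S" "\<And>u. u \<in> H10 \<Omega> \<Longrightarrow> H10_norm u \<le> 1 \<Longrightarrow>
     (\<integral>\<^sup>+x. ennreal (\<bar>u x\<bar> powr p) \<partial>M) \<le> ennreal S"
    by (rule H10_powr_bound[OF p]) (rule that)
  define L where "L = \<bar>lam\<bar> * A"
  have L: "0 \<le> L" using \<alpha>(3) by (simp add: L_def)
  define V where "V = measure M \<Omega>"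
  have V: "0 \<le> V" by (simp add: V_def)
  fix e :: real assume e: "0 < e"
  \<comment> \<open>\<open>V\<close>, \<open>U\<close> and \<open>S\<close> bound the integrals of 1
    and of the \<open>p\<close>-th powers of \<open>u\<close> and \<open>v\<close>; this choice
    keeps their joint contribution at most \<open>e\<close>.\<close>
  define \<epsilon> where "\<epsilon> = e / (L * (V + U + S) + 1)"
  have n: "0 \<le> L * (V + U + S)" using L V u(3) S(1) by simp
  have \<epsilon>: "0 < \<epsilon>" using e n by (simp add: \<epsilon>_def)
  have \<epsilon>e: "L * \<epsilon> * (V + U + S) \<le> e"
  proof -
    have "L * \<epsilon> * (V + U + S) = e * (L * (V + U + S) / (L * (V + U + S) + 1))" by (simp add: \<epsilon>_def)
    also have "\<dots> \<le> e * 1" using n e by (intro mult_left_mono) auto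
    finally show ?thesis by simp
  qed
  obtain D where D: "0 \<le> D" "\<And>a v. \<bar>g a\<bar> * v\<^sup>2 \<le> \<epsilon> * (1 + \<bar>a\<bar> powr p + \<bar>v\<bar> powr p) + D * v\<^sup>2"
    by (rule growth_weight_le[OF g(1-4) \<epsilon>]) (rule that)
  show "\<exists>C\<ge>0. \<forall>v\<in>H10 \<Omega>. H10_norm v \<le> 1 \<longrightarrow>
     (\<integral>\<^sup>+x. ennreal (\<bar>lam * \<alpha> x * g (u x)\<bar> * (v x)\<^sup>2) \<partial>M) \<le> ennreal (e + C * (L2_norm M v)\<^sup>2)"
  proof (intro exI[of _ "L * D"] conjI ballI impI)
    show "0 \<le> L * D" using L D by simp
    fix v assume v: "v \<in> H10 \<Omega>" "H10_norm v \<le> 1"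
    have [measurable]: "v \<in> borel_measurable M" using H10_L2(1)[OF v(1)] by (simp add: L2_def)
    have "(\<integral>\<^sup>+x. ennreal (\<bar>lam * \<alpha> x * g (u x)\<bar> * (v x)\<^sup>2) \<partial>M) \<le>
      (\<integral>\<^sup>+x. ennreal (L * \<epsilon>) * (1 + ennreal (\<bar>u x\<bar> powr p) + ennreal (\<bar>v x\<bar> powr p)) + ennreal (L * D) * ennreal ((norm (v x))\<^sup>2) \<partial>M)"
    proof (rule nn_integral_mono_AE, rule AE_mp[OF \<alpha>(2) AE_I2], intro impI)
      fix x assume a: "\<bar>\<alpha> x\<bar> \<le> A"
      have "\<bar>lam * \<alpha> x * g (u x)\<bar> * (v x)\<^sup>2 = (\<bar>lam\<bar> * \<bar>\<alpha> x\<bar>) * (\<bar>g (u x)\<bar> * (v x)\<^sup>2)"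
        by (simp add: abs_mult)
      also have "\<dots> \<le> L * (\<epsilon> * (1 + \<bar>u x\<bar> powr p + \<bar>v x\<bar> powr p) + D * (v x)\<^sup>2)"
        unfolding L_def using a D(2)[of "u x" "v x"] \<alpha>(3) by (intro mult_mono mult_left_mono) auto
      also have "\<dots> = L * \<epsilon> * (1 + \<bar>u x\<bar> powr p + \<bar>v x\<bar> powr p) + L * D * (norm (v x))\<^sup>2"
        by (simp add: algebra_simps)
      finally have "ennreal (\<bar>lam * \<alpha> x * g (u x)\<bar> * (v x)\<^sup>2) \<le>
         ennreal (L * \<epsilon> * (1 + \<bar>u x\<bar> powr p + \<bar>v x\<bar> powr p) + L * D * (norm (v x))\<^sup>2)"
        by (rule ennreal_leI)
      also have "\<dots> = ennreal (L * \<epsilon>) * (1 + ennreal (\<bar>u x\<bar> powr p) + ennreal (\<bar>v x\<bar> powr p)) + ennreal (L * D) * ennreal ((norm (v x))\<^sup>2)"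
        using L \<epsilon> D(1) by (simp add: ennreal_plus ennreal_mult)
      finally show "ennreal (\<bar>lam * \<alpha> x * g (u x)\<bar> * (v x)\<^sup>2) \<le>
        ennreal (L * \<epsilon>) * (1 + ennreal (\<bar>u x\<bar> powr p) + ennreal (\<bar>v x\<bar> powr p)) + ennreal (L * D) * ennreal ((norm (v x))\<^sup>2)" .
    qed
    also have "\<dots> = ennreal (L * \<epsilon>) * (emeasure M (space M) + (\<integral>\<^sup>+x. ennreal (\<bar>u x\<bar> powr p) \<partial>M) + (\<integral>\<^sup>+x. ennreal (\<bar>v x\<bar> powr p) \<partial>M))
       + ennreal (L * D) * (\<integral>\<^sup>+x. ennreal ((norm (v x))\<^sup>2) \<partial>M)"
      by (simp add: nn_integral_add nn_integral_cmult)
    also have "\<dots> \<le> ennreal (L * \<epsilon>) * (ennreal V + ennreal U + ennreal S) + ennreal (L * D) * ennreal ((L2_norm M v)\<^sup>2)"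
      unfolding L2_nn_integral[OF H10_L2(1)[OF v(1)]] emeasure_M V_def
      by (intro add_mono mult_left_mono u(2) S(2)[OF v]) auto
    also have "\<dots> = ennreal (L * \<epsilon> * (V + U + S) + L * D * (L2_norm M v)\<^sup>2)"
      using L \<epsilon> V u(3) S(1) D(1) by (simp add: ennreal_plus ennreal_mult)
    also have "\<dots> \<le> ennreal (e + L * D * (L2_norm M v)\<^sup>2)"
      using \<epsilon>e by (intro ennreal_leI) simp
    finally show "(\<integral>\<^sup>+x. ennreal (\<bar>lam * \<alpha> x * g (u x)\<bar> * (v x)\<^sup>2) \<partial>M) \<le> ennreal (e + L * D * (L2_norm M v)\<^sup>2)" .
  qed
qed

text \<open>The number \<open>\<delta>\<close> depends on the bound \<open>U\<close> and not on the
  functions, so the continuity is uniform on bounded sets. \<open>u\<close> and \<open>w\<close> are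
  only measurable and L^p-bounded, which permits a comparison of elements of
  \<open>H10 \<Omega>\<close> with constants.\<close>

lemma growth_weight_continuous:
  fixes g :: "real \<Rightarrow> real"
  assumes p: "2 \<le> p" "real DIM('a) * (p - 2) / 2 < p"
    and g: "0 \<le> C" "\<And>x. \<bar>g x\<bar> \<le> C * (1 + \<bar>x\<bar> powr q)" "0 < q" "q + 2 < p" "continuous_on UNIV g"
    and \<alpha>: "\<alpha> \<in> borel_measurable M" "AE x in M. \<bar>\<alpha> x\<bar> \<le> A" "0 \<le> A"
    and U: "0 \<le> U" and e: "0 < e"
  obtains \<delta> where "0 < \<delta>" "\<And>u w. u \<in> borel_measurable M \<Longrightarrow> w \<in> borel_measurable M \<Longrightarrow>
     (\<integral>\<^sup>+x. ennreal (\<bar>u x\<bar> powr p) \<partial>M) \<le> ennreal U \<Longrightarrow> (\<integral>\<^sup>+x. ennreal (\<bar>w x\<bar> powr p) \<partial>M) \<le> ennreal U \<Longrightarrow>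
     (\<integral>\<^sup>+x. ennreal (\<bar>w x - u x\<bar> powr p) \<partial>M) \<le> ennreal \<delta> \<Longrightarrow>
     form_le (\<lambda>x. lam * \<alpha> x * g (w x) - lam * \<alpha> x * g (u x)) e"
proof -
  have [measurable]: "g \<in> borel_measurable borel" using g(5) by (rule borel_measurable_continuous_onI)
  note [measurable] = \<alpha>(1)
  obtain S where S: "0 \<le> S" "\<And>u. u \<in> H10 \<Omega> \<Longrightarrow> H10_norm u \<le> 1 \<Longrightarrow>
     (\<integral>\<^sup>+x. ennreal (\<bar>u x\<bar> powr p) \<partial>M) \<le> ennreal S"
    by (rule H10_powr_bound[OF p]) (rule that)
  define L where "L = \<bar>lam\<bar> * A"
  have L: "0 \<le> L" using \<alpha>(3) by (simp add: L_def)
  define V where "V = measure M \<Omega>"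
  have V: "0 \<le> V" by (simp add: V_def)
  define \<epsilon> where "\<epsilon> = e / (2 * (L * (V + U + U + S) + 1))"
  have n: "0 \<le> L * (V + U + U + S)" using L V U S(1) by simp
  have \<epsilon>: "0 < \<epsilon>" using e n by (simp add: \<epsilon>_def)
  have \<epsilon>e: "L * \<epsilon> * (V + U + U + S) \<le> e / 2"
  proof -
    have "L * \<epsilon> * (V + U + U + S) = e / 2 * (L * (V + U + U + S) / (L * (V + U + U + S) + 1))"
      using n by (simp add: \<epsilon>_def)
    also have "\<dots> \<le> e / 2 * 1" using n e by (intro mult_left_mono) auto
    finally show ?thesis by simp
  qed
  obtain D where D: "0 \<le> D" "\<And>a b v. \<bar>g a - g b\<bar> * v\<^sup>2 \<le>
     \<epsilon> * (1 + \<bar>a\<bar> powr p + \<bar>b\<bar> powr p + \<bar>v\<bar> powr p) + D * \<bar>a - b\<bar> powr p"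
    by (rule growth_weight_diff_le[OF g(1-4) \<epsilon> g(5)]) (rule that)
  define \<delta> where "\<delta> = e / (2 * (L * D + 1))"
  have LD: "0 \<le> L * D" using L D by simp
  have \<delta>: "0 < \<delta>" using e LD by (simp add: \<delta>_def)
  have \<delta>e: "L * D * \<delta> \<le> e / 2"
  proof -
    have "L * D * \<delta> = e / 2 * (L * D / (L * D + 1))" using LD by (simp add: \<delta>_def)
    also have "\<dots> \<le> e / 2 * 1" using LD e by (intro mult_left_mono) auto
    finally show ?thesis by simp
  qed
  show thesis
  proof (rule that[OF \<delta>])
    fix u w assume uw [measurable]: "u \<in> borel_measurable M" "w \<in> borel_measurable M"
      and b: "(\<integral>\<^sup>+x. ennreal (\<bar>u x\<bar> powr p) \<partial>M) \<le> ennreal U" "(\<integral>\<^sup>+x. ennreal (\<bar>w x\<bar> powr p) \<partial>M) \<le> ennreal U"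
        "(\<integral>\<^sup>+x. ennreal (\<bar>w x - u x\<bar> powr p) \<partial>M) \<le> ennreal \<delta>"
    show "form_le (\<lambda>x. lam * \<alpha> x * g (w x) - lam * \<alpha> x * g (u x)) e"
      unfolding form_le_def
    proof (intro conjI ballI impI)
      show "(\<lambda>x. lam * \<alpha> x * g (w x) - lam * \<alpha> x * g (u x)) \<in> borel_measurable M" by measurable
      show "0 \<le> e" using e by simp
      fix v assume v: "v \<in> H10 \<Omega>" "H10_norm v \<le> 1"
      have [measurable]: "v \<in> borel_measurable M" using H10_L2(1)[OF v(1)] by (simp add: L2_def)
      have "(\<integral>\<^sup>+x. ennreal (\<bar>lam * \<alpha> x * g (w x) - lam * \<alpha> x * g (u x)\<bar> * (v x)\<^sup>2) \<partial>M) \<le>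
        (\<integral>\<^sup>+x. ennreal (L * \<epsilon>) * (1 + ennreal (\<bar>w x\<bar> powr p) + ennreal (\<bar>u x\<bar> powr p) + ennreal (\<bar>v x\<bar> powr p)) + ennreal (L * D) * ennreal (\<bar>w x - u x\<bar> powr p) \<partial>M)"
      proof (rule nn_integral_mono_AE, rule AE_mp[OF \<alpha>(2) AE_I2], intro impI)
        fix x assume a: "\<bar>\<alpha> x\<bar> \<le> A"
        have "\<bar>lam * \<alpha> x * g (w x) - lam * \<alpha> x * g (u x)\<bar> * (v x)\<^sup>2 = (\<bar>lam\<bar> * \<bar>\<alpha> x\<bar>) * (\<bar>g (w x) - g (u x)\<bar> * (v x)\<^sup>2)"
          by (simp add: abs_mult right_diff_distrib[symmetric])
        also have "\<dots> \<le> L * (\<epsilon> * (1 + \<bar>w x\<bar> powr p + \<bar>u x\<bar> powr p + \<bar>v x\<bar> powr p) + D * \<bar>w x - u x\<bar> powr p)"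
          unfolding L_def using a D(2)[of "w x" "u x" "v x"] \<alpha>(3) by (intro mult_mono mult_left_mono) auto
        also have "\<dots> = L * \<epsilon> * (1 + \<bar>w x\<bar> powr p + \<bar>u x\<bar> powr p + \<bar>v x\<bar> powr p) + L * D * \<bar>w x - u x\<bar> powr p"
          by (simp add: algebra_simps)
        finally have "ennreal (\<bar>lam * \<alpha> x * g (w x) - lam * \<alpha> x * g (u x)\<bar> * (v x)\<^sup>2) \<le>
           ennreal (L * \<epsilon> * (1 + \<bar>w x\<bar> powr p + \<bar>u x\<bar> powr p + \<bar>v x\<bar> powr p) + L * D * \<bar>w x - u x\<bar> powr p)"
          by (rule ennreal_leI)
        also have "\<dots> = ennreal (L * \<epsilon>) * (1 + ennreal (\<bar>w x\<bar> powr p) + ennreal (\<bar>u x\<bar> powr p) + ennreal (\<bar>v x\<bar> powr p)) + ennreal (L * D) * ennreal (\<bar>w x - u x\<bar> powr p)"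
          using L \<epsilon> D(1) by (simp add: ennreal_plus ennreal_mult)
        finally show "ennreal (\<bar>lam * \<alpha> x * g (w x) - lam * \<alpha> x * g (u x)\<bar> * (v x)\<^sup>2) \<le>
          ennreal (L * \<epsilon>) * (1 + ennreal (\<bar>w x\<bar> powr p) + ennreal (\<bar>u x\<bar> powr p) + ennreal (\<bar>v x\<bar> powr p)) + ennreal (L * D) * ennreal (\<bar>w x - u x\<bar> powr p)" .
      qed
      also have "\<dots> = ennreal (L * \<epsilon>) * (emeasure M (space M) + (\<integral>\<^sup>+x. ennreal (\<bar>w x\<bar> powr p) \<partial>M) + (\<integral>\<^sup>+x. ennreal (\<bar>u x\<bar> powr p) \<partial>M) + (\<integral>\<^sup>+x. ennreal (\<bar>v x\<bar> powr p) \<partial>M))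
         + ennreal (L * D) * (\<integral>\<^sup>+x. ennreal (\<bar>w x - u x\<bar> powr p) \<partial>M)"
        by (simp add: nn_integral_add nn_integral_cmult)
      also have "\<dots> \<le> ennreal (L * \<epsilon>) * (ennreal V + ennreal U + ennreal U + ennreal S) + ennreal (L * D) * ennreal \<delta>"
        unfolding emeasure_M V_def
        by (intro add_mono mult_left_mono b S(2)[OF v]) auto
      also have "\<dots> = ennreal (L * \<epsilon> * (V + U + U + S) + L * D * \<delta>)"
        using L \<epsilon> V U S(1) D(1) \<delta> by (simp add: ennreal_plus ennreal_mult, simp add: mult_2 add_ac)
      also have "\<dots> \<le> ennreal e"
        using \<epsilon>e \<delta>e by (intro ennreal_leI) linarith
      finally show "(\<integral>\<^sup>+x. ennreal (\<bar>lam * \<alpha> x * g (w x) - lam * \<alpha> x * g (u x)\<bar> * (v x)\<^sup>2) \<partial>M) \<le> ennreal e" .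
    qed
  qed
qed

section \<open>A common treatment of all dimensions\<close>

lemma admissible_cong:
  assumes "admissible \<beta>" "AE x in M. \<beta> x = \<beta>' x" "\<beta>' \<in> borel_measurable M"
  shows "admissible \<beta>'"
proof -
  have "(\<integral>\<^sup>+x. ennreal (\<bar>\<beta>' x\<bar> * (v x)\<^sup>2) \<partial>M) = (\<integral>\<^sup>+x. ennreal (\<bar>\<beta> x\<bar> * (v x)\<^sup>2) \<partial>M)" for v
    by (rule nn_integral_cong_AE) (use assms(2) in \<open>eventually_elim, simp\<close>)
  then show ?thesis using assms(1,3) unfolding admissible_def by simp
qed

lemma form_le_cong:
  assumes "form_le \<beta> e" "AE x in M. \<beta> x = \<beta>' x" "\<beta>' \<in> borel_measurable M"
  shows "form_le \<beta>' e"
proof -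
  have "(\<integral>\<^sup>+x. ennreal (\<bar>\<beta>' x\<bar> * (v x)\<^sup>2) \<partial>M) = (\<integral>\<^sup>+x. ennreal (\<bar>\<beta> x\<bar> * (v x)\<^sup>2) \<partial>M)" for v
    by (rule nn_integral_cong_AE) (use assms(2) in \<open>eventually_elim, simp\<close>)
  then show ?thesis using assms(1,3) unfolding form_le_def by simp
qed

text \<open>In dimension one, where no growth condition is imposed, the bound on \<open>u\<close> replaces it.\<close>
definition controlled :: "real \<Rightarrow> real \<Rightarrow> real \<Rightarrow> ('a \<Rightarrow> real) \<Rightarrow> bool" where
  "controlled p U R u \<longleftrightarrow> u \<in> borel_measurable M \<and> (\<integral>\<^sup>+x. ennreal (\<bar>u x\<bar> powr p) \<partial>M) \<le> ennreal U \<and>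
     (DIM('a) = 1 \<longrightarrow> (AE x in M. \<bar>u x\<bar> \<le> R))"

text \<open>A single exponent has to serve both the Sobolev bound and the growth of
  \<open>h\<close>. In dimension one \<open>h\<close> is cut off outside the range of the functions
  considered; in higher dimensions the bound on \<open>q\<close> leaves room for a suitable
  \<open>p\<close>.\<close>

lemma weight_family:
  fixes h :: "real \<Rightarrow> real"
  assumes h: "continuous_on UNIV h"
    and growth: "DIM('a) \<ge> 2 \<Longrightarrow> (\<exists>q>0. (DIM('a) \<ge> 3 \<longrightarrow> q < 4 / (real DIM('a) - 2)) \<and>
               (\<exists>C. \<forall>\<xi>. \<bar>h \<xi>\<bar> / (1 + \<bar>\<xi>\<bar> powr q) \<le> C))"
    and \<alpha>: "\<alpha> \<in> borel_measurable M" "AE x in M. \<bar>\<alpha> x\<bar> \<le> A" "0 \<le> A"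
  obtains p where "2 \<le> p" "real DIM('a) * (p - 2) / 2 < p"
    "\<And>U R u. 0 \<le> U \<Longrightarrow> 0 \<le> R \<Longrightarrow> controlled p U R u \<Longrightarrow> admissible (\<lambda>x. lam * \<alpha> x * h (u x))"
    "\<And>U R e. 0 \<le> U \<Longrightarrow> 0 \<le> R \<Longrightarrow> 0 < e \<Longrightarrow> \<exists>\<delta>>0. \<forall>u w. controlled p U R u \<longrightarrow> controlled p U R w \<longrightarrow>
       (\<integral>\<^sup>+x. ennreal (\<bar>w x - u x\<bar> powr p) \<partial>M) \<le> ennreal \<delta> \<longrightarrow>
       form_le (\<lambda>x. lam * \<alpha> x * h (w x) - lam * \<alpha> x * h (u x)) e"
proof -
  have [measurable]: "h \<in> borel_measurable borel" using h by (rule borel_measurable_continuous_onI)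
  note [measurable] = \<alpha>(1)
  show thesis
  proof (cases "DIM('a) = 1")
    case True
    \<comment> \<open>In dimension one every \<open>p \<ge> 2\<close> is subcritical. After the
      cutoff the growth exponent 1/2 is available, and 3 exceeds 1/2 + 2.\<close>
    have p: "2 \<le> (3::real)" "real DIM('a) * (3 - 2) / 2 < (3::real)" using True by auto
    have clamp: "\<exists>g C. continuous_on UNIV g \<and> 0 \<le> C \<and> (\<forall>x. \<bar>g x\<bar> \<le> C * (1 + \<bar>x\<bar> powr (1/2))) \<and> (\<forall>x. \<bar>x\<bar> \<le> R \<longrightarrow> g x = h x)"
      if R: "0 \<le> R" for R :: real
    proof -
      \<comment> \<open>Clamping the argument gives a bounded continuous function that agrees with
        \<open>h\<close> on all values of functions bounded by \<open>R\<close>.\<close>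
      define g where "g x = h (max (- R) (min R x))" for x
      have "compact (h ` {-R..R})" using h by (intro compact_continuous_image) (auto intro: continuous_on_subset)
      then obtain C where C: "\<And>x. x \<in> {-R..R} \<Longrightarrow> \<bar>h x\<bar> \<le> C" "0 < C"
        using compact_imp_bounded bounded_pos by (metis imageI real_norm_def)
      have "\<bar>g x\<bar> \<le> C * (1 + \<bar>x\<bar> powr (1/2))" for x
      proof -
        have "\<bar>g x\<bar> \<le> C" unfolding g_def using R by (intro C) auto
        also have "\<dots> \<le> C * (1 + \<bar>x\<bar> powr (1/2))" using C(2) by (simp add: distrib_left)
        finally show ?thesis .
      qed
      moreover have "continuous_on UNIV g"
        unfolding g_def by (rule continuous_on_compose2[OF h]) (auto intro!: continuous_intros)
      moreover have "g x = h x" if "\<bar>x\<bar> \<le> R" for x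
      proof -
        have "max (- R) (min R x) = x" using that by (auto simp: max_def min_def abs_le_iff)
        then show ?thesis by (simp add: g_def)
      qed
      ultimately show ?thesis using C(2) less_imp_le by blast
    qed
    show thesis
    proof (rule that[OF p])
      fix U R :: real and u assume UR: "0 \<le> U" "0 \<le> R" and u: "controlled 3 U R u"
      obtain g C where g: "continuous_on UNIV g" "0 \<le> C" "\<And>x. \<bar>g x\<bar> \<le> C * (1 + \<bar>x\<bar> powr (1/2))" "\<And>x. \<bar>x\<bar> \<le> R \<Longrightarrow> g x = h x"
        using clamp[OF UR(2)] by blast
      have u': "u \<in> borel_measurable M" "(\<integral>\<^sup>+x. ennreal (\<bar>u x\<bar> powr 3) \<partial>M) \<le> ennreal U" "AE x in M. \<bar>u x\<bar> \<le> R"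
        using u True by (auto simp: controlled_def)
      note [measurable] = u'(1)
      have "admissible (\<lambda>x. lam * \<alpha> x * g (u x))"
        by (rule growth_weight_admissible[OF p g(2,3) _ _ g(1) \<alpha> u'(1,2) UR(1)]) auto
      then show "admissible (\<lambda>x. lam * \<alpha> x * h (u x))"
      proof (rule admissible_cong)
        show "AE x in M. lam * \<alpha> x * g (u x) = lam * \<alpha> x * h (u x)"
          using u'(3) by eventually_elim (simp add: g(4))
      qed measurable
    next
      fix U R e :: real assume UR: "0 \<le> U" "0 \<le> R" and e: "0 < e"
      obtain g C where g: "continuous_on UNIV g" "0 \<le> C" "\<And>x. \<bar>g x\<bar> \<le> C * (1 + \<bar>x\<bar> powr (1/2))" "\<And>x. \<bar>x\<bar> \<le> R \<Longrightarrow> g x = h x"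
        using clamp[OF UR(2)] by blast
      have q: "0 < (1/2::real)" "1/2 + 2 < (3::real)" by auto
      obtain \<delta> where \<delta>: "0 < \<delta>" "\<And>u w. u \<in> borel_measurable M \<Longrightarrow> w \<in> borel_measurable M \<Longrightarrow>
         (\<integral>\<^sup>+x. ennreal (\<bar>u x\<bar> powr 3) \<partial>M) \<le> ennreal U \<Longrightarrow> (\<integral>\<^sup>+x. ennreal (\<bar>w x\<bar> powr 3) \<partial>M) \<le> ennreal U \<Longrightarrow>
         (\<integral>\<^sup>+x. ennreal (\<bar>w x - u x\<bar> powr 3) \<partial>M) \<le> ennreal \<delta> \<Longrightarrow>
         form_le (\<lambda>x. lam * \<alpha> x * g (w x) - lam * \<alpha> x * g (u x)) e"
        by (rule growth_weight_continuous[OF p g(2,3) q g(1) \<alpha> UR(1) e, of lam]) (rule that)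
      have "form_le (\<lambda>x. lam * \<alpha> x * h (w x) - lam * \<alpha> x * h (u x)) e"
        if u: "controlled 3 U R u" and w: "controlled 3 U R w" and d: "(\<integral>\<^sup>+x. ennreal (\<bar>w x - u x\<bar> powr 3) \<partial>M) \<le> ennreal \<delta>" for u w
      proof -
        have u': "u \<in> borel_measurable M" "(\<integral>\<^sup>+x. ennreal (\<bar>u x\<bar> powr 3) \<partial>M) \<le> ennreal U" "AE x in M. \<bar>u x\<bar> \<le> R"
          using u True by (auto simp: controlled_def)
        have w': "w \<in> borel_measurable M" "(\<integral>\<^sup>+x. ennreal (\<bar>w x\<bar> powr 3) \<partial>M) \<le> ennreal U" "AE x in M. \<bar>w x\<bar> \<le> R"
          using w True by (auto simp: controlled_def)
        note [measurable] = u'(1) w'(1)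
        from \<delta>(2)[OF u'(1) w'(1) u'(2) w'(2) d]
        show ?thesis
        proof (rule form_le_cong)
          show "AE x in M. lam * \<alpha> x * g (w x) - lam * \<alpha> x * g (u x) = lam * \<alpha> x * h (w x) - lam * \<alpha> x * h (u x)"
            using u'(3) w'(3) by eventually_elim (simp add: g(4))
        qed measurable
      qed
      then show "\<exists>\<delta>>0. \<forall>u w. controlled 3 U R u \<longrightarrow> controlled 3 U R w \<longrightarrow>
       (\<integral>\<^sup>+x. ennreal (\<bar>w x - u x\<bar> powr 3) \<partial>M) \<le> ennreal \<delta> \<longrightarrow>
       form_le (\<lambda>x. lam * \<alpha> x * h (w x) - lam * \<alpha> x * h (u x)) e" using \<delta>(1) by blast
    qed
  next
    case False
    have "0 < DIM('a)" by simp
    then have dim: "2 \<le> DIM('a)" using False by linarith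
    obtain q C where q: "0 < q" "DIM('a) \<ge> 3 \<longrightarrow> q < 4 / (real DIM('a) - 2)" "\<And>\<xi>. \<bar>h \<xi>\<bar> / (1 + \<bar>\<xi>\<bar> powr q) \<le> C"
      using growth[OF dim] by blast
    have C0: "0 \<le> C" using q(3)[of 0] by (rule order_trans[rotated]) simp
    have hC: "\<bar>h \<xi>\<bar> \<le> C * (1 + \<bar>\<xi>\<bar> powr q)" for \<xi>
    proof -
      have "0 < 1 + \<bar>\<xi>\<bar> powr q" using powr_ge_zero[of "\<bar>\<xi>\<bar>" q] by linarith
      then show ?thesis using q(3)[of \<xi>] by (simp add: pos_divide_le_eq)
    qed
    \<comment> \<open>The Sobolev condition is equivalent to \<open>(p - 2) * (n - 2) < 4\<close>.
      It holds for every \<open>p\<close> when \<open>n = 2\<close>; for \<open>n \<ge> 3\<close>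
      the number \<open>p - 2\<close> is placed strictly between \<open>q\<close> and
      \<open>4 / (n - 2)\<close>.\<close>
    have "\<exists>p. q + 2 < p \<and> real DIM('a) * (p - 2) / 2 < p"
    proof (cases "DIM('a) = 2")
      case True
      then show ?thesis by (intro exI[of _ "q + 3"]) simp
    next
      case False
      then have n: "0 < real DIM('a) - 2" "DIM('a) \<ge> 3" using dim by auto
      then have "q < 4 / (real DIM('a) - 2)" using q(2) by blast
      then obtain y where y: "q < y" "y < 4 / (real DIM('a) - 2)" using dense by blast
      have "y * (real DIM('a) - 2) < 4" using y(2) n by (simp add: pos_less_divide_eq)
      then show ?thesis using y(1) by (intro exI[of _ "y + 2"]) (simp add: algebra_simps)
    qed
    then obtain p where pq: "q + 2 < p" and p2: "real DIM('a) * (p - 2) / 2 < p" by blast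
    have p1: "2 \<le> p" using pq q(1) by linarith
    show thesis
    proof (rule that[OF p1 p2])
      fix U R :: real and u assume "0 \<le> U" "controlled p U R u"
      then show "admissible (\<lambda>x. lam * \<alpha> x * h (u x))"
        by (intro growth_weight_admissible[OF p1 p2 C0 hC q(1) pq h \<alpha>]) (auto simp: controlled_def)
    next
      fix U R e :: real assume UR: "0 \<le> U" and e: "0 < e"
      obtain \<delta> where "0 < \<delta>" "\<And>u w. u \<in> borel_measurable M \<Longrightarrow> w \<in> borel_measurable M \<Longrightarrow>
         (\<integral>\<^sup>+x. ennreal (\<bar>u x\<bar> powr p) \<partial>M) \<le> ennreal U \<Longrightarrow> (\<integral>\<^sup>+x. ennreal (\<bar>w x\<bar> powr p) \<partial>M) \<le> ennreal U \<Longrightarrow>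
         (\<integral>\<^sup>+x. ennreal (\<bar>w x - u x\<bar> powr p) \<partial>M) \<le> ennreal \<delta> \<Longrightarrow>
         form_le (\<lambda>x. lam * \<alpha> x * h (w x) - lam * \<alpha> x * h (u x)) e"
        by (rule growth_weight_continuous[OF p1 p2 C0 hC q(1) pq h \<alpha> UR e, of lam]) (rule that)
      then show "\<exists>\<delta>>0. \<forall>u w. controlled p U R u \<longrightarrow> controlled p U R w \<longrightarrow>
       (\<integral>\<^sup>+x. ennreal (\<bar>w x - u x\<bar> powr p) \<partial>M) \<le> ennreal \<delta> \<longrightarrow>
       form_le (\<lambda>x. lam * \<alpha> x * h (w x) - lam * \<alpha> x * h (u x)) e"
        unfolding controlled_def by (intro exI[of _ \<delta>]) blast
    qed
  qed
qed


lemma H10_powr_scaled: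
  assumes S: "\<And>u. u \<in> H10 \<Omega> \<Longrightarrow> H10_norm u \<le> 1 \<Longrightarrow> (\<integral>\<^sup>+x. ennreal (\<bar>u x\<bar> powr p) \<partial>M) \<le> ennreal S" "0 \<le> S"
    and u: "u \<in> H10 \<Omega>" "H10_norm u \<le> t" "0 < t"
  shows "(\<integral>\<^sup>+x. ennreal (\<bar>u x\<bar> powr p) \<partial>M) \<le> ennreal (t powr p * S)"
proof -
  have [measurable]: "u \<in> borel_measurable M" using H10_L2(1)[OF u(1)] by (simp add: L2_def)
  have "H10_norm (\<lambda>x. (1 / t) * u x) \<le> 1"
    using H10_norm_scale[OF u(1), of "1 / t"] u(2,3) by simp
  note le = S(1)[OF H10_scale[OF u(1)] this]
  have "(\<integral>\<^sup>+x. ennreal (\<bar>u x\<bar> powr p) \<partial>M) = (\<integral>\<^sup>+x. ennreal (t powr p) * ennreal (\<bar>(1 / t) * u x\<bar> powr p) \<partial>M)"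
    using u(3) by (intro nn_integral_cong) (simp add: ennreal_mult[symmetric] powr_mult[symmetric])
  also have "\<dots> = ennreal (t powr p) * (\<integral>\<^sup>+x. ennreal (\<bar>(1 / t) * u x\<bar> powr p) \<partial>M)"
    by (rule nn_integral_cmult) measurable
  also have "\<dots> \<le> ennreal (t powr p) * ennreal S" by (intro mult_left_mono le) simp
  also have "\<dots> = ennreal (t powr p * S)" using S(2) by (simp add: ennreal_mult)
  finally show ?thesis .
qed

lemma H10_controlled:
  assumes p: "2 \<le> p" "real DIM('a) * (p - 2) / 2 < p" and \<rho>: "0 \<le> \<rho>"
  obtains U R where "0 \<le> U" "0 \<le> R" "\<And>u. u \<in> H10 \<Omega> \<Longrightarrow> H10_norm u \<le> \<rho> \<Longrightarrow> controlled p U R u"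
proof -
  obtain S where S: "0 \<le> S" "\<And>u. u \<in> H10 \<Omega> \<Longrightarrow> H10_norm u \<le> 1 \<Longrightarrow>
     (\<integral>\<^sup>+x. ennreal (\<bar>u x\<bar> powr p) \<partial>M) \<le> ennreal S"
    by (rule H10_powr_bound[OF p]) (rule that)
  have "\<exists>C\<ge>0. DIM('a) = 1 \<longrightarrow> (\<forall>u\<in>H10 \<Omega>. H10_norm u \<le> 1 \<longrightarrow> (AE x in M. \<bar>u x\<bar> \<le> C))"
  proof (cases "DIM('a) = 1")
    case True
    obtain C where "0 \<le> C" "\<And>u. u \<in> H10 \<Omega> \<Longrightarrow> H10_norm u \<le> 1 \<Longrightarrow> AE x in M. \<bar>u x\<bar> \<le> C"
      by (rule H10_sup_bound_1D[OF True]) (rule that)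
    then show ?thesis by blast
  qed auto
  then obtain C where C: "0 \<le> C" "\<And>u. DIM('a) = 1 \<Longrightarrow> u \<in> H10 \<Omega> \<Longrightarrow> H10_norm u \<le> 1 \<Longrightarrow> AE x in M. \<bar>u x\<bar> \<le> C" by blast
  \<comment> \<open>Adding 1 permits scaling by \<open>1 / t\<close> also for
    \<open>\<rho> = 0\<close>.\<close>
  define t where "t = \<rho> + 1"
  have t: "t > 0" using \<rho> by (simp add: t_def)
  show thesis
  proof (rule that)
    show "0 \<le> t powr p * S" "0 \<le> t * C" using S C t by auto
    fix u assume u: "u \<in> H10 \<Omega>" "H10_norm u \<le> \<rho>"
    have ut: "H10_norm u \<le> t" using u(2) by (simp add: t_def)
    have "H10_norm (\<lambda>x. (1 / t) * u x) \<le> 1"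
      using H10_norm_scale[OF u(1), of "1 / t"] ut t by simp
    note C' = C(2)[OF _ H10_scale[OF u(1)] this]
    show "controlled p (t powr p * S) (t * C) u"
      unfolding controlled_def
    proof (intro conjI impI)
      show "u \<in> borel_measurable M" using H10_L2(1)[OF u(1)] by (simp add: L2_def)
      show "(\<integral>\<^sup>+x. ennreal (\<bar>u x\<bar> powr p) \<partial>M) \<le> ennreal (t powr p * S)"
        by (rule H10_powr_scaled[OF S(2,1) u(1) ut t])
      assume "DIM('a) = 1"
      from C'[OF this] show "AE x in M. \<bar>u x\<bar> \<le> t * C"
        by eventually_elim (use t in \<open>simp add: abs_mult pos_divide_le_eq mult.commute\<close>)
    qed
  qed
qed

lemma H10_powr_small:
  assumes p: "2 \<le> p" "real DIM('a) * (p - 2) / 2 < p" and \<delta>: "0 < \<delta>"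
  obtains t where "0 < t" "\<And>u. u \<in> H10 \<Omega> \<Longrightarrow> H10_norm u \<le> t \<Longrightarrow> (\<integral>\<^sup>+x. ennreal (\<bar>u x\<bar> powr p) \<partial>M) \<le> ennreal \<delta>"
proof -
  obtain S where S: "0 \<le> S" "\<And>u. u \<in> H10 \<Omega> \<Longrightarrow> H10_norm u \<le> 1 \<Longrightarrow>
     (\<integral>\<^sup>+x. ennreal (\<bar>u x\<bar> powr p) \<partial>M) \<le> ennreal S"
    by (rule H10_powr_bound[OF p]) (rule that)
  \<comment> \<open>The solution of \<open>t powr p * (S + 1) = \<delta>\<close>, since scaling the
    Sobolev bound to radius \<open>t\<close> gives \<open>t powr p * S\<close>.\<close>
  define t where "t = (\<delta> / (S + 1)) powr (1 / p)"
  have t: "t > 0" using \<delta> S(1) by (simp add: t_def)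
  have "t powr p = \<delta> / (S + 1)" using p(1) \<delta> S(1) by (simp add: t_def powr_powr)
  then have "t powr p * (S + 1) = \<delta>" using S(1) by simp
  moreover have "t powr p * S \<le> t powr p * (S + 1)" by (intro mult_left_mono) auto
  ultimately have tS: "t powr p * S \<le> \<delta>" by linarith
  show thesis
  proof (rule that[OF t])
    fix u assume u: "u \<in> H10 \<Omega>" "H10_norm u \<le> t"
    have "(\<integral>\<^sup>+x. ennreal (\<bar>u x\<bar> powr p) \<partial>M) \<le> ennreal (t powr p * S)" by (rule H10_powr_scaled[OF S(2,1) u t])
    also have "\<dots> \<le> ennreal \<delta>" by (intro ennreal_leI tS)
    finally show "(\<integral>\<^sup>+x. ennreal (\<bar>u x\<bar> powr p) \<partial>M) \<le> ennreal \<delta>" .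
  qed
qed

text \<open>The index \<open>k\<close> is used twice, as the number of bumps and as the power.
  Finitely many boxes keep the support compact, while at a point of the \<open>j\<close>-th box the
  factor \<open>\<beta> j x ^ k\<close>, with \<open>\<beta> j x < 1\<close>, forces the product to
  0.\<close>

lemma cutoff_sequence:
  obtains \<eta> :: "nat \<Rightarrow> 'a \<Rightarrow> real" where "\<And>k. test_fun \<Omega> (\<eta> k)" "\<And>k x. 0 \<le> \<eta> k x" "\<And>k x. \<eta> k x \<le> 1"
    "\<And>x. x \<in> \<Omega> \<Longrightarrow> (\<lambda>k. \<eta> k x) \<longlonglongrightarrow> 1"
proof -
  obtain a b where ab: "\<And>i::nat. cbox (a i) (b i) \<subseteq> \<Omega>" "(\<Union>i. box (a i) (b i)) = \<Omega>"
    using open_countable_box_cover[OF open_domain nonempty_domain] by metis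
  define \<beta> where "\<beta> i x = 1 - bump (a i) (b i) x" for i x
  have \<beta>: "0 \<le> \<beta> i x" "\<beta> i x \<le> 1" for i x using bump_bounds[of "a i" "b i" x] by (auto simp: \<beta>_def)
  define \<eta> where "\<eta> k x = 1 - (\<Prod>i<k. \<beta> i x ^ k)" for k :: nat and x
  have pr: "0 \<le> (\<Prod>i<k. \<beta> i x ^ k)" "(\<Prod>i<k. \<beta> i x ^ k) \<le> 1" for k x
    using \<beta> by (auto intro!: prod_nonneg prod_le_1 power_le_one)
  show thesis
  proof (rule that)
    show "test_fun \<Omega> (\<eta> k)" for k
    proof (rule test_fun_smooth_vanishing[of _ "\<Union>i<k. cbox (a i) (b i)"])
      show "smooth_fun (\<eta> k)"
        unfolding \<eta>_def \<beta>_def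
        by (intro smooth_fun_diff smooth_fun_prod smooth_fun_power smooth_fun_const smooth_fun_bump) auto
      show "compact (\<Union>i<k. cbox (a i) (b i))" by (intro compact_UN) auto
      show "(\<Union>i<k. cbox (a i) (b i)) \<subseteq> \<Omega>" using ab by blast
      fix x assume x: "x \<notin> (\<Union>i<k. cbox (a i) (b i))"
      have "\<beta> i x ^ k = 1" if "i < k" for i
      proof -
        have "x \<notin> box (a i) (b i)" using x that box_subset_cbox[of "a i" "b i"] by blast
        then have "bump (a i) (b i) x = 0" by (simp add: bump_eq_0_iff)
        then show ?thesis by (simp add: \<beta>_def)
      qed
      then show "\<eta> k x = 0" by (simp add: \<eta>_def)
    qed
    show "0 \<le> \<eta> k x" "\<eta> k x \<le> 1" for k x using pr[where k=k and x=x] by (auto simp: \<eta>_def)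
    fix x assume "x \<in> \<Omega>"
    then obtain j where j: "x \<in> box (a j) (b j)" using ab(2) by blast
    then have b1: "0 \<le> \<beta> j x" "\<beta> j x < 1"
      using \<beta>(1)[of j x] bump_bounds(1)[of "a j" "b j" x] bump_eq_0_iff[of "a j" "b j" x] by (auto simp: \<beta>_def less_le)
    have le: "(\<Prod>i<k. \<beta> i x ^ k) \<le> \<beta> j x ^ k" if "k > j" for k
    proof -
      have "(\<Prod>i<k. \<beta> i x ^ k) = \<beta> j x ^ k * (\<Prod>i\<in>{..<k} - {j}. \<beta> i x ^ k)"
        using that by (intro prod.remove) auto
      also have "\<dots> \<le> \<beta> j x ^ k * 1"
        using \<beta> by (intro mult_left_mono prod_le_1) (auto intro: power_le_one)
      finally show ?thesis by simp
    qed
    have "(\<lambda>k. \<Prod>i<k. \<beta> i x ^ k) \<longlonglongrightarrow> 0"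
    proof (rule tendsto_sandwich[of "\<lambda>_. 0" _ _ "\<lambda>k. \<beta> j x ^ k"])
      show "\<forall>\<^sub>F k in sequentially. 0 \<le> (\<Prod>i<k. \<beta> i x ^ k)" using pr(1) by simp
      show "\<forall>\<^sub>F k in sequentially. (\<Prod>i<k. \<beta> i x ^ k) \<le> \<beta> j x ^ k"
        using le by (intro eventually_sequentiallyI[of "Suc j"]) simp
      show "(\<lambda>k. \<beta> j x ^ k) \<longlonglongrightarrow> 0" using b1 by (rule LIMSEQ_realpow_zero)
    qed simp
    from tendsto_diff[OF tendsto_const[of 1] this] show "(\<lambda>k. \<eta> k x) \<longlonglongrightarrow> 1" by (simp add: \<eta>_def)
  qed
qed

lemma test_fun_measurable_M: "test_fun \<Omega> \<phi> \<Longrightarrow> \<phi> \<in> borel_measurable M"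
  using test_fun_L2(1) by (simp add: L2_def)

text \<open>A non-zero constant is not in \<open>H10 \<Omega>\<close>, but its multiples by cutoffs
  tend to it in L^p by dominated convergence. Gradients remain uncontrolled; the bound by
  \<open>\<bar>c\<bar>\<close> is kept for dimension one.\<close>

lemma approx_constant:
  fixes c p :: real
  assumes p: "2 \<le> p" and \<delta>: "0 < \<delta>"
  obtains u where "u \<in> H10 \<Omega>" "\<And>x. \<bar>u x\<bar> \<le> \<bar>c\<bar>" "(\<integral>\<^sup>+x. ennreal (\<bar>u x - c\<bar> powr p) \<partial>M) \<le> ennreal \<delta>"
proof -
  obtain \<eta> :: "nat \<Rightarrow> 'a \<Rightarrow> real" where \<eta>: "\<And>k. test_fun \<Omega> (\<eta> k)" "\<And>k x. 0 \<le> \<eta> k x" "\<And>k x. \<eta> k x \<le> 1"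
    "\<And>x. x \<in> \<Omega> \<Longrightarrow> (\<lambda>k. \<eta> k x) \<longlonglongrightarrow> 1"
    by (rule cutoff_sequence) (rule that)
  note [measurable] = test_fun_measurable_M[OF \<eta>(1)]
  have b: "\<bar>c * \<eta> k x - c\<bar> \<le> \<bar>c\<bar>" "\<bar>c * \<eta> k x\<bar> \<le> \<bar>c\<bar>" for k x
  proof -
    have "c * \<eta> k x - c = c * (\<eta> k x - 1)" by (simp add: algebra_simps)
    moreover have "\<bar>\<eta> k x - 1\<bar> \<le> 1" "\<bar>\<eta> k x\<bar> \<le> 1" using \<eta>(2,3)[of k x] by auto
    ultimately show "\<bar>c * \<eta> k x - c\<bar> \<le> \<bar>c\<bar>" "\<bar>c * \<eta> k x\<bar> \<le> \<bar>c\<bar>" by (simp_all add: abs_mult mult_left_le)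
  qed
  have "(\<lambda>k. \<integral>x. \<bar>c * \<eta> k x - c\<bar> powr p \<partial>M) \<longlonglongrightarrow> (\<integral>x. 0 \<partial>M)"
  proof (rule integral_dominated_convergence[where w="\<lambda>_. \<bar>c\<bar> powr p"])
    show "AE x in M. (\<lambda>k. \<bar>c * \<eta> k x - c\<bar> powr p) \<longlonglongrightarrow> 0"
    proof (rule AE_I2)
      fix x assume "x \<in> space M"
      then have "(\<lambda>k. \<eta> k x) \<longlonglongrightarrow> 1" by (intro \<eta>) (simp add: space_restrict_space)
      then have "(\<lambda>k. \<bar>c * \<eta> k x - c\<bar> powr p) \<longlonglongrightarrow> \<bar>c * 1 - c\<bar> powr p"
        by (intro tendsto_powr' tendsto_intros) (use p in auto)
      then show "(\<lambda>k. \<bar>c * \<eta> k x - c\<bar> powr p) \<longlonglongrightarrow> 0" by simp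
    qed
    show "AE x in M. norm (\<bar>c * \<eta> k x - c\<bar> powr p) \<le> \<bar>c\<bar> powr p" for k
      using b p by (intro AE_I2) (simp add: powr_mono2)
  qed auto
  then have "\<forall>\<^sub>F k in sequentially. (\<integral>x. \<bar>c * \<eta> k x - c\<bar> powr p \<partial>M) < \<delta>"
    using \<delta> by (intro order_tendstoD(2)[where y=0]) simp_all
  then obtain k where k: "(\<integral>x. \<bar>c * \<eta> k x - c\<bar> powr p \<partial>M) < \<delta>"
    unfolding eventually_sequentially by blast
  have int: "integrable M (\<lambda>x. \<bar>c * \<eta> k x - c\<bar> powr p)"
    by (rule M.integrable_const_bound[of _ "\<bar>c\<bar> powr p"]) (use b p in \<open>auto intro!: AE_I2 powr_mono2\<close>)
  show thesis
  proof (rule that[of "\<lambda>x. c * \<eta> k x"])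
    show "(\<lambda>x. c * \<eta> k x) \<in> H10 \<Omega>" by (intro H10_scale test_fun_H10 \<eta>)
    show "\<bar>c * \<eta> k x\<bar> \<le> \<bar>c\<bar>" for x by (rule b)
    show "(\<integral>\<^sup>+x. ennreal (\<bar>c * \<eta> k x - c\<bar> powr p) \<partial>M) \<le> ennreal \<delta>"
      using k by (subst nn_integral_eq_integral[OF int]) (auto intro: ennreal_leI)
  qed
qed

lemma controlled_bounded:
  assumes "u \<in> borel_measurable M" "\<And>x. \<bar>u x\<bar> \<le> R" "0 \<le> p"
  shows "controlled p (R powr p * measure M \<Omega>) R u"
  unfolding controlled_def
proof (intro conjI impI)
  have "(\<integral>\<^sup>+x. ennreal (\<bar>u x\<bar> powr p) \<partial>M) \<le> (\<integral>\<^sup>+x. ennreal (R powr p) \<partial>M)"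
    using assms by (intro nn_integral_mono ennreal_leI powr_mono2) auto
  also have "\<dots> = ennreal (R powr p * measure M \<Omega>)"
    by (simp only: nn_integral_const emeasure_M) (simp add: ennreal_mult)
  finally show "(\<integral>\<^sup>+x. ennreal (\<bar>u x\<bar> powr p) \<partial>M) \<le> ennreal (R powr p * measure M \<Omega>)" .
qed (use assms in auto)

context
  fixes \<alpha> :: "'a \<Rightarrow> real" and A :: real
  assumes \<alpha>: "\<alpha> \<in> borel_measurable M" "AE x in M. \<bar>\<alpha> x\<bar> \<le> A" "0 \<le> A"
    and \<alpha>_nonneg: "AE x in M. 0 \<le> \<alpha> x" and \<alpha>_nonzero: "\<not> ae_zero \<Omega> \<alpha>"
begin

section \<open>The first eigenvalue and constant nonlinearities\<close>

lemma alpha_integral_nonneg: "0 \<le> (\<integral>x. \<alpha> x * (v x)\<^sup>2 \<partial>M)"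
  by (rule integral_nonneg_AE) (use \<alpha>_nonneg in \<open>eventually_elim, simp\<close>)

text \<open>The weighted integrals of the squared cutoffs tend to the integral of
  \<open>\<alpha>\<close>, which is positive. Without such an element, \<open>first_eig\<close>
  would be an infimum over the empty set and carry no information.\<close>

lemma alpha_positive_witness: "\<exists>v\<in>H10 \<Omega>. 0 < (\<integral>x. \<alpha> x * (v x)\<^sup>2 \<partial>M)"
proof -
  obtain \<eta> :: "nat \<Rightarrow> 'a \<Rightarrow> real" where \<eta>: "\<And>k. test_fun \<Omega> (\<eta> k)" "\<And>k x. 0 \<le> \<eta> k x" "\<And>k x. \<eta> k x \<le> 1"
    "\<And>x. x \<in> \<Omega> \<Longrightarrow> (\<lambda>k. \<eta> k x) \<longlonglongrightarrow> 1"
    by (rule cutoff_sequence) (rule that)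
  note [measurable] = test_fun_measurable_M[OF \<eta>(1)] \<alpha>(1)
  have int: "integrable M \<alpha>" by (rule M.integrable_const_bound[of _ A]) (use \<alpha> in auto)
  have "(\<lambda>k. \<integral>x. \<alpha> x * (\<eta> k x)\<^sup>2 \<partial>M) \<longlonglongrightarrow> (\<integral>x. \<alpha> x \<partial>M)"
  proof (rule integral_dominated_convergence[where w="\<lambda>x. \<bar>\<alpha> x\<bar>"])
    show "AE x in M. (\<lambda>k. \<alpha> x * (\<eta> k x)\<^sup>2) \<longlonglongrightarrow> \<alpha> x"
    proof (rule AE_I2)
      fix x assume "x \<in> space M"
      then have "(\<lambda>k. \<eta> k x) \<longlonglongrightarrow> 1" by (intro \<eta>) (simp add: space_restrict_space)
      then have "(\<lambda>k. \<alpha> x * (\<eta> k x)\<^sup>2) \<longlonglongrightarrow> \<alpha> x * 1\<^sup>2" by (intro tendsto_intros)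
      then show "(\<lambda>k. \<alpha> x * (\<eta> k x)\<^sup>2) \<longlonglongrightarrow> \<alpha> x" by simp
    qed
    show "AE x in M. norm (\<alpha> x * (\<eta> k x)\<^sup>2) \<le> \<bar>\<alpha> x\<bar>" for k
      using \<eta>(2,3) by (intro AE_I2) (simp add: abs_mult mult_left_le power_le_one)
  qed (use int in auto)
  moreover have "0 < (\<integral>x. \<alpha> x \<partial>M)"
  proof -
    have "0 \<le> (\<integral>x. \<alpha> x \<partial>M)" using \<alpha>_nonneg by (rule integral_nonneg_AE)
    moreover have "(\<integral>x. \<alpha> x \<partial>M) \<noteq> 0"
      using \<alpha>_nonzero integral_nonneg_eq_0_iff_AE[OF int \<alpha>_nonneg] by (simp add: ae_zero_def)
    ultimately show ?thesis by linarith
  qed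
  ultimately have "\<forall>\<^sub>F k in sequentially. 0 < (\<integral>x. \<alpha> x * (\<eta> k x)\<^sup>2 \<partial>M)" by (rule order_tendstoD(1))
  then obtain k where "0 < (\<integral>x. \<alpha> x * (\<eta> k x)\<^sup>2 \<partial>M)" unfolding eventually_sequentially by blast
  then show ?thesis using test_fun_H10[OF \<eta>(1)] by blast
qed

lemma pos_integral_imp_not_ae_zero:
  assumes "0 < (\<integral>x. \<alpha> x * (v x)\<^sup>2 \<partial>M)"
  shows "\<not> ae_zero \<Omega> v"
proof
  assume "ae_zero \<Omega> v"
  then have "AE x in M. \<alpha> x * (v x)\<^sup>2 = 0" unfolding ae_zero_def by eventually_elim simp
  then have "(\<integral>x. \<alpha> x * (v x)\<^sup>2 \<partial>M) = 0" by (rule integral_eq_zero_AE)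
  with assms show False by simp
qed

lemma first_eig_nonneg: "0 \<le> first_eig \<Omega> \<alpha>"
  unfolding first_eig_def
proof (rule cInf_greatest)
  show "{H10_inner \<Omega> v v / (\<integral>x. \<alpha> x * (v x)\<^sup>2 \<partial>M) | v. v \<in> H10 \<Omega> \<and> \<not> ae_zero \<Omega> v \<and> (\<integral>x. \<alpha> x * (v x)\<^sup>2 \<partial>M) > 0} \<noteq> {}"
    using alpha_positive_witness pos_integral_imp_not_ae_zero by blast
qed (auto simp: H10_inner_self)

text \<open>Multiplied out, the bound extends to elements whose weighted integral is 0, which the
  infimum leaves out.\<close>

lemma first_eig_le:
  assumes v: "v \<in> H10 \<Omega>"
  shows "first_eig \<Omega> \<alpha> * (\<integral>x. \<alpha> x * (v x)\<^sup>2 \<partial>M) \<le> (H10_norm v)\<^sup>2"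
proof (cases "0 < (\<integral>x. \<alpha> x * (v x)\<^sup>2 \<partial>M)")
  case True
  have "first_eig \<Omega> \<alpha> \<le> H10_inner \<Omega> v v / (\<integral>x. \<alpha> x * (v x)\<^sup>2 \<partial>M)"
    unfolding first_eig_def
  proof (rule cInf_lower)
    show "bdd_below {H10_inner \<Omega> v v / (\<integral>x. \<alpha> x * (v x)\<^sup>2 \<partial>M) | v. v \<in> H10 \<Omega> \<and> \<not> ae_zero \<Omega> v \<and> (\<integral>x. \<alpha> x * (v x)\<^sup>2 \<partial>M) > 0}"
      by (rule bdd_belowI[of _ 0]) (auto simp: H10_inner_self)
  qed (use v True pos_integral_imp_not_ae_zero in blast)
  then show ?thesis using True by (simp add: H10_inner_self pos_le_divide_eq)
next
  case False
  then have "(\<integral>x. \<alpha> x * (v x)\<^sup>2 \<partial>M) = 0" using alpha_integral_nonneg[of v] by linarith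
  then show ?thesis by simp
qed

lemma first_eig_less:
  assumes "first_eig \<Omega> \<alpha> < y"
  obtains v where "v \<in> H10 \<Omega>" "0 < (\<integral>x. \<alpha> x * (v x)\<^sup>2 \<partial>M)" "(H10_norm v)\<^sup>2 < y * (\<integral>x. \<alpha> x * (v x)\<^sup>2 \<partial>M)"
proof -
  let ?E = "{H10_inner \<Omega> v v / (\<integral>x. \<alpha> x * (v x)\<^sup>2 \<partial>M) | v. v \<in> H10 \<Omega> \<and> \<not> ae_zero \<Omega> v \<and> (\<integral>x. \<alpha> x * (v x)\<^sup>2 \<partial>M) > 0}"
  have "?E \<noteq> {}" using alpha_positive_witness pos_integral_imp_not_ae_zero by blast
  then obtain z where "z \<in> ?E" "z < y" using assms unfolding first_eig_def by (rule cInf_lessD[THEN bexE])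
  then obtain v where "v \<in> H10 \<Omega>" "0 < (\<integral>x. \<alpha> x * (v x)\<^sup>2 \<partial>M)" "H10_inner \<Omega> v v / (\<integral>x. \<alpha> x * (v x)\<^sup>2 \<partial>M) < y" by blast
  then show thesis using that by (simp add: H10_inner_self pos_divide_less_eq)
qed

lemma constant_weight_integral:
  "(\<integral>x. lam * \<alpha> x * s * v x * v x \<partial>M) = lam * s * (\<integral>x. \<alpha> x * (v x)\<^sup>2 \<partial>M)"
proof -
  have "(\<integral>x. lam * \<alpha> x * s * v x * v x \<partial>M) = (\<integral>x. (lam * s) * (\<alpha> x * (v x)\<^sup>2) \<partial>M)"
    by (intro Bochner_Integration.integral_cong) (auto simp: power2_eq_square)
  then show ?thesis by simp
qed

lemma top_eig_constant_gt:
  assumes K: "form_le (\<lambda>x. lam * \<alpha> x * s) K" and "first_eig \<Omega> \<alpha> < lam * s"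
  shows "1 < top_eig (\<lambda>x. lam * \<alpha> x * s)"
proof -
  obtain v where v: "v \<in> H10 \<Omega>" "0 < (\<integral>x. \<alpha> x * (v x)\<^sup>2 \<partial>M)" "(H10_norm v)\<^sup>2 < lam * s * (\<integral>x. \<alpha> x * (v x)\<^sup>2 \<partial>M)"
    by (rule first_eig_less[OF assms(2)]) (rule that)
  define n where "n = H10_norm v"
  have "n \<noteq> 0"
    using H10_norm_0_imp_AE[OF v(1)] pos_integral_imp_not_ae_zero[OF v(2)] by (auto simp: n_def ae_zero_def)
  then have n: "n > 0" by (simp add: n_def less_le)
  let ?z = "\<lambda>x. (1 / n) * v x"
  have "H10_norm ?z \<le> 1" using H10_norm_scale[OF v(1), of "1 / n"] n by (simp add: n_def)
  from top_eig_upper[OF K H10_scale[OF v(1)] this]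
  have "lam * s * (\<integral>x. \<alpha> x * ((1 / n) * v x)\<^sup>2 \<partial>M) \<le> top_eig (\<lambda>x. lam * \<alpha> x * s)"
    by (simp only: constant_weight_integral)
  moreover have "(\<integral>x. \<alpha> x * ((1 / n) * v x)\<^sup>2 \<partial>M) = (1 / n\<^sup>2) * (\<integral>x. \<alpha> x * (v x)\<^sup>2 \<partial>M)"
  proof -
    have "(\<integral>x. \<alpha> x * ((1 / n) * v x)\<^sup>2 \<partial>M) = (\<integral>x. (1 / n\<^sup>2) * (\<alpha> x * (v x)\<^sup>2) \<partial>M)"
      by (intro Bochner_Integration.integral_cong) (auto simp: power_divide)
    then show ?thesis by (simp only: integral_mult_right_zero)
  qed
  moreover have "1 < lam * s * ((1 / n\<^sup>2) * (\<integral>x. \<alpha> x * (v x)\<^sup>2 \<partial>M))"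
    using v(3) n by (simp add: n_def pos_less_divide_eq)
  ultimately show ?thesis by simp
qed

lemma top_eig_constant_lt:
  assumes "lam * s < first_eig \<Omega> \<alpha>" "0 < first_eig \<Omega> \<alpha>"
  shows "top_eig (\<lambda>x. lam * \<alpha> x * s) < 1"
proof -
  \<comment> \<open>The maximum with 0 covers \<open>lam * s \<le> 0\<close>, where the form is
    nonpositive and the zero function attains the supremum.\<close>
  have "top_eig (\<lambda>x. lam * \<alpha> x * s) \<le> max 0 (lam * s / first_eig \<Omega> \<alpha>)"
  proof (rule top_eig_least, unfold constant_weight_integral)
    fix v assume v: "v \<in> H10 \<Omega>" "H10_norm v \<le> 1"
    let ?I = "\<integral>x. \<alpha> x * (v x)\<^sup>2 \<partial>M"
    have "first_eig \<Omega> \<alpha> * ?I \<le> 1"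
      using first_eig_le[OF v(1)] v(2) power_le_one[OF H10_norm_nonneg v(2), of 2] by linarith
    then have I: "?I \<le> 1 / first_eig \<Omega> \<alpha>" using assms(2) by (simp add: pos_le_divide_eq mult.commute)
    show "lam * s * ?I \<le> max 0 (lam * s / first_eig \<Omega> \<alpha>)"
    proof (cases "lam * s \<le> 0")
      case True
      then have "lam * s * ?I \<le> 0" using alpha_integral_nonneg[of v] by (simp add: mult_nonpos_nonneg)
      then show ?thesis by simp
    next
      case False
      then have "lam * s * ?I \<le> lam * s * (1 / first_eig \<Omega> \<alpha>)" using I by (intro mult_left_mono) auto
      then show ?thesis by simp
    qed
  qed
  also have "\<dots> < 1" using assms by simp
  finally show ?thesis .
qed

theorem singular_set_of_nonlinearity:
  fixes h :: "real \<Rightarrow> real"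
  assumes h: "continuous_on UNIV h"
    and growth: "DIM('a) \<ge> 2 \<Longrightarrow> (\<exists>q>0. (DIM('a) \<ge> 3 \<longrightarrow> q < 4 / (real DIM('a) - 2)) \<and>
               (\<exists>C. \<forall>\<xi>. \<bar>h \<xi>\<bar> / (1 + \<bar>\<xi>\<bar> powr q) \<le> C))"
    and E: "0 < first_eig \<Omega> \<alpha>"
    and c0: "first_eig \<Omega> \<alpha> < lam * h c0" and c1: "lam * h c1 < first_eig \<Omega> \<alpha>"
  shows "closedin (H10_top \<Omega>) (singular_set (\<lambda>u x. lam * \<alpha> x * h (u x)))"
    "\<not> sigma_compactin (H10_top \<Omega>) (singular_set (\<lambda>u x. lam * \<alpha> x * h (u x)))"
proof -
  obtain p where p: "2 \<le> p" "real DIM('a) * (p - 2) / 2 < p"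
    and adm: "\<And>U R u. 0 \<le> U \<Longrightarrow> 0 \<le> R \<Longrightarrow> controlled p U R u \<Longrightarrow> admissible (\<lambda>x. lam * \<alpha> x * h (u x))"
    and cont: "\<And>U R e. 0 \<le> U \<Longrightarrow> 0 \<le> R \<Longrightarrow> 0 < e \<Longrightarrow> \<exists>\<delta>>0. \<forall>u w. controlled p U R u \<longrightarrow> controlled p U R w \<longrightarrow>
       (\<integral>\<^sup>+x. ennreal (\<bar>w x - u x\<bar> powr p) \<partial>M) \<le> ennreal \<delta> \<longrightarrow>
       form_le (\<lambda>x. lam * \<alpha> x * h (w x) - lam * \<alpha> x * h (u x)) e"
    by (rule weight_family[OF h growth \<alpha>, of lam]) (assumption, rule that)
  have admH: "admissible (\<lambda>x. lam * \<alpha> x * h (u x))" if u: "u \<in> H10 \<Omega>" for u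
  proof -
    obtain U R where UR: "0 \<le> U" "0 \<le> R" "\<And>w. w \<in> H10 \<Omega> \<Longrightarrow> H10_norm w \<le> H10_norm u \<Longrightarrow> controlled p U R w"
      by (rule H10_controlled[OF p H10_norm_nonneg[of u]]) (rule that)
    show ?thesis by (rule adm[OF UR(1,2) UR(3)[OF u order_refl]])
  qed
  have contH: "\<exists>\<delta>>0. \<forall>w\<in>H10 \<Omega>. H10_norm (\<lambda>x. w x - u x) < \<delta> \<longrightarrow> form_le (\<lambda>x. lam * \<alpha> x * h (w x) - lam * \<alpha> x * h (u x)) e"
    if u: "u \<in> H10 \<Omega>" and e: "0 < e" for u e
  proof -
    \<comment> \<open>The larger radius gives bounds valid for every \<open>w\<close> at distance
      less than 1 from \<open>u\<close>; this is the origin of the 1 in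
      \<open>min 1 t\<close>.\<close>
    have "0 \<le> H10_norm u + 1" by simp
    then obtain U R where UR: "0 \<le> U" "0 \<le> R" "\<And>w. w \<in> H10 \<Omega> \<Longrightarrow> H10_norm w \<le> H10_norm u + 1 \<Longrightarrow> controlled p U R w"
      by (rule H10_controlled[OF p]) (rule that)
    obtain \<delta> where \<delta>: "0 < \<delta>" "\<And>u w. controlled p U R u \<Longrightarrow> controlled p U R w \<Longrightarrow>
       (\<integral>\<^sup>+x. ennreal (\<bar>w x - u x\<bar> powr p) \<partial>M) \<le> ennreal \<delta> \<Longrightarrow>
       form_le (\<lambda>x. lam * \<alpha> x * h (w x) - lam * \<alpha> x * h (u x)) e"
      using cont[OF UR(1,2) e] by blast
    obtain t where t: "0 < t" "\<And>u. u \<in> H10 \<Omega> \<Longrightarrow> H10_norm u \<le> t \<Longrightarrow> (\<integral>\<^sup>+x. ennreal (\<bar>u x\<bar> powr p) \<partial>M) \<le> ennreal \<delta>"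
      by (rule H10_powr_small[OF p \<delta>(1)]) (rule that)
    have "form_le (\<lambda>x. lam * \<alpha> x * h (w x) - lam * \<alpha> x * h (u x)) e"
      if w: "w \<in> H10 \<Omega>" "H10_norm (\<lambda>x. w x - u x) < min 1 t" for w
    proof (rule \<delta>(2))
      show "controlled p U R u" by (rule UR(3)[OF u]) simp
      have "H10_norm w \<le> H10_norm u + 1" using H10_norm_add[OF H10_diff[OF w(1) u] u] w(2) by simp
      then show "controlled p U R w" by (rule UR(3)[OF w(1)])
      show "(\<integral>\<^sup>+x. ennreal (\<bar>w x - u x\<bar> powr p) \<partial>M) \<le> ennreal \<delta>"
        using w(2) by (intro t(2) H10_diff w u) auto
    qed
    then show ?thesis using t(1) by (intro exI[of _ "min 1 t"]) auto
  qed
  \<comment> \<open>The constant \<open>c\<close> is \<open>controlled\<close> with the bound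
    \<open>\<bar>c\<bar>\<close>, and so is an approximant from \<open>H10 \<Omega>\<close> bounded
    by the same number. The continuity statement therefore applies to this pair although
    \<open>c\<close> may lie outside the space.\<close>
  have near_const: "\<exists>u\<in>H10 \<Omega>. \<bar>top_eig (\<lambda>x. lam * \<alpha> x * h (u x)) - top_eig (\<lambda>x. lam * \<alpha> x * h c)\<bar> \<le> e" if e: "0 < e" for c e
  proof -
    define U where "U = \<bar>c\<bar> powr p * measure M \<Omega>"
    have U: "0 \<le> U" by (simp add: U_def)
    have cc: "controlled p U \<bar>c\<bar> (\<lambda>x. c)" unfolding U_def by (rule controlled_bounded) (use p in auto)
    obtain \<delta> where \<delta>: "0 < \<delta>" "\<And>u w. controlled p U \<bar>c\<bar> u \<Longrightarrow> controlled p U \<bar>c\<bar> w \<Longrightarrow>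
       (\<integral>\<^sup>+x. ennreal (\<bar>w x - u x\<bar> powr p) \<partial>M) \<le> ennreal \<delta> \<Longrightarrow>
       form_le (\<lambda>x. lam * \<alpha> x * h (w x) - lam * \<alpha> x * h (u x)) e"
      using cont[OF U abs_ge_zero[of c] e] by blast
    obtain u where u: "u \<in> H10 \<Omega>" "\<And>x. \<bar>u x\<bar> \<le> \<bar>c\<bar>" "(\<integral>\<^sup>+x. ennreal (\<bar>u x - c\<bar> powr p) \<partial>M) \<le> ennreal \<delta>"
      by (rule approx_constant[OF p(1) \<delta>(1), of c]) (rule that)
    have cu: "controlled p U \<bar>c\<bar> u"
      unfolding U_def using H10_L2(1)[OF u(1)] u(2) p by (intro controlled_bounded) (auto simp: L2_def)
    obtain K where K: "form_le (\<lambda>x. lam * \<alpha> x * h c) K" by (rule admissible_form_le[OF adm[OF U abs_ge_zero cc]])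
    obtain K' where K': "form_le (\<lambda>x. lam * \<alpha> x * h (u x)) K'" by (rule admissible_form_le[OF admH[OF u(1)]])
    show ?thesis using top_eig_close[OF K K' \<delta>(2)[OF cc cu u(3)]] u(1) by blast
  qed
  have "1 < top_eig (\<lambda>x. lam * \<alpha> x * h c0)"
  proof -
    have "controlled p (\<bar>c0\<bar> powr p * measure M \<Omega>) \<bar>c0\<bar> (\<lambda>x. c0)" by (rule controlled_bounded) (use p in auto)
    from adm[OF _ _ this] have "admissible (\<lambda>x. lam * \<alpha> x * h c0)" by simp
    then obtain K where "form_le (\<lambda>x. lam * \<alpha> x * h c0) K" by (rule admissible_form_le)
    then show ?thesis by (rule top_eig_constant_gt[OF _ c0])
  qed
  moreover have "top_eig (\<lambda>x. lam * \<alpha> x * h c1) < 1" by (rule top_eig_constant_lt[OF c1 E])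
  moreover define T where "T c = top_eig (\<lambda>x. lam * \<alpha> x * h c)" for c
  moreover define F where "F u = top_eig (\<lambda>x. lam * \<alpha> x * h (u x))" for u
  ultimately have T: "1 < T c0" "T c1 < 1" by (simp_all only:)
  have near: "\<exists>u\<in>H10 \<Omega>. \<bar>F u - T c\<bar> \<le> e" if "0 < e" for c e
    using near_const[OF that] by (simp only: F_def T_def)
  \<comment> \<open>An error of half the gap to 1 keeps the inequality strict.\<close>
  obtain u0 where u0: "u0 \<in> H10 \<Omega>" "\<bar>F u0 - T c0\<bar> \<le> (T c0 - 1) / 2"
    using near[of "(T c0 - 1) / 2" c0] T(1) by auto
  have "1 < F u0" using u0(2) T(1) by argo
  then have u0': "1 < top_eig (\<lambda>x. lam * \<alpha> x * h (u0 x))" by (simp only: F_def)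
  obtain u1 where u1: "u1 \<in> H10 \<Omega>" "\<bar>F u1 - T c1\<bar> \<le> (1 - T c1) / 2"
    using near[of "(1 - T c1) / 2" c1] T(2) by auto
  have "F u1 < 1" using u1(2) T(2) by argo
  then have u1': "top_eig (\<lambda>x. lam * \<alpha> x * h (u1 x)) < 1" by (simp only: F_def)
  show "closedin (H10_top \<Omega>) (singular_set (\<lambda>u x. lam * \<alpha> x * h (u x)))"
    "\<not> sigma_compactin (H10_top \<Omega>) (singular_set (\<lambda>u x. lam * \<alpha> x * h (u x)))"
    using singular_set_closed_not_sigma_compact[of "\<lambda>u x. lam * \<alpha> x * h (u x)", OF admH contH u0(1) u0' u1(1) u1'] by blast+
qed

end

end

text \<open>By the mean value theorem on either side of 0, the quotient at \<open>\<xi>\<close>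
  equals \<open>f 0 / \<xi>\<close> plus a value of \<open>f'\<close>. An equation is divided and
  not an inequality, so the sign of \<open>\<xi>\<close> does no harm, and
  \<open>f 0 / \<xi>\<close> disappears at infinity.\<close>

lemma Limsup_quotient_ge:
  fixes f f' :: "real \<Rightarrow> real"
  assumes d: "\<And>x. (f has_real_derivative f' x) (at x)" and \<kappa>: "\<And>x. \<kappa> \<le> f' x"
  shows "ereal \<kappa> \<le> Limsup at_infinity (\<lambda>\<xi>. ereal (f \<xi> / \<xi>))"
proof -
  have ge: "\<kappa> + f 0 / \<xi> \<le> f \<xi> / \<xi>" if "\<xi> \<noteq> 0" for \<xi>
  proof (cases "0 < \<xi>")
    case True
    obtain z where "f \<xi> - f 0 = (\<xi> - 0) * f' z" using MVT2[OF True, of f f'] d by blast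
    then have "f \<xi> / \<xi> = f 0 / \<xi> + f' z" using that by (simp add: field_simps)
    then show ?thesis using \<kappa>[of z] by simp
  next
    case False
    then have neg: "\<xi> < 0" using that by simp
    obtain z where "f 0 - f \<xi> = (0 - \<xi>) * f' z" using MVT2[OF neg, of f f'] d by blast
    then have "f \<xi> = f 0 + \<xi> * f' z" by (simp add: algebra_simps)
    then have "f \<xi> / \<xi> = f 0 / \<xi> + f' z" using that by (simp add: add_divide_distrib)
    then show ?thesis using \<kappa>[of z] by simp
  qed
  have "((\<lambda>\<xi>. \<kappa> + f 0 * inverse \<xi>) \<longlongrightarrow> \<kappa> + f 0 * 0) (at_infinity :: real filter)"
    by (intro tendsto_intros tendsto_inverse_0)
  then have "((\<lambda>\<xi>. ereal (\<kappa> + f 0 / \<xi>)) \<longlongrightarrow> ereal \<kappa>) (at_infinity :: real filter)"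
    by (simp add: divide_inverse)
  then have "Limsup at_infinity (\<lambda>\<xi>. ereal (\<kappa> + f 0 / \<xi>)) = ereal \<kappa>"
    by (rule lim_imp_Limsup[OF trivial_limit_at_infinity])
  moreover have "Limsup at_infinity (\<lambda>\<xi>. ereal (\<kappa> + f 0 / \<xi>)) \<le> Limsup at_infinity (\<lambda>\<xi>. ereal (f \<xi> / \<xi>))"
  proof (rule Limsup_mono)
    have "\<forall>\<^sub>F \<xi> in at_infinity. (\<xi>::real) \<noteq> 0"
      unfolding eventually_at_infinity by (intro exI[of _ 1]) auto
    then show "\<forall>\<^sub>F \<xi> in at_infinity. ereal (\<kappa> + f 0 / \<xi>) \<le> ereal (f \<xi> / \<xi>)"
      by eventually_elim (simp add: ge)
  qed
  ultimately show ?thesis by simp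
qed

theorem theorem1:
  fixes \<Omega> :: "'a::euclidean_space set"
    and f f' :: "real \<Rightarrow> real"
    and \<alpha> :: "'a \<Rightarrow> real"
    and lam :: real
  assumes dom: "smooth_bounded_domain \<Omega>"
    and f_deriv: "\<forall>x. (f has_real_derivative f' x) (at x)"
    and f'_cont: "continuous_on UNIV f'"
    and Mf_lt: "max 0 (max (2 * Limsup at_infinity (\<lambda>\<xi>. ereal ((LBINT t=ereal 0..ereal \<xi>. f t) / \<xi>\<^sup>2)))
                           (Limsup at_infinity (\<lambda>\<xi>. ereal (f \<xi> / \<xi>))))
                < (SUP \<xi>. ereal (f' \<xi>))"
    and growth: "DIM('a) \<ge> 2 \<Longrightarrow>
        (\<exists>q>0. (DIM('a) \<ge> 3 \<longrightarrow> q < 4 / (real DIM('a) - 2)) \<and>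
               (\<exists>C. \<forall>\<xi>. \<bar>f' \<xi>\<bar> / (1 + \<bar>\<xi>\<bar> powr q) \<le> C))"
    and alpha: "Linf_fun \<Omega> \<alpha>" "\<not> ae_zero \<Omega> \<alpha>" "AE x in lebesgue_on \<Omega>. \<alpha> x \<ge> 0"
    and lam: "ereal (first_eig \<Omega> \<alpha>) / (SUP \<xi>. ereal (f' \<xi>)) < ereal lam"
             "ereal lam < ereal (first_eig \<Omega> \<alpha>) /
                max 0 (max (2 * Limsup at_infinity (\<lambda>\<xi>. ereal ((LBINT t=ereal 0..ereal \<xi>. f t) / \<xi>\<^sup>2)))
                           (Limsup at_infinity (\<lambda>\<xi>. ereal (f \<xi> / \<xi>))))"
  shows "closedin (H10_top \<Omega>)
           {u \<in> H10 \<Omega>. \<exists>v. \<not> ae_zero \<Omega> v \<and> weak_sol \<Omega> (\<lambda>x. lam * \<alpha> x * f' (u x)) v}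
       \<and> \<not> sigma_compactin (H10_top \<Omega>)
           {u \<in> H10 \<Omega>. \<exists>v. \<not> ae_zero \<Omega> v \<and> weak_sol \<Omega> (\<lambda>x. lam * \<alpha> x * f' (u x)) v}"
proof -
  interpret bounded_domain \<Omega>
    using dom by unfold_locales (auto simp: smooth_bounded_domain_def)
  obtain C where C: "\<alpha> \<in> borel_measurable M" "AE x in M. \<bar>\<alpha> x\<bar> \<le> C"
    using alpha(1) by (auto simp: Linf_fun_def)
  have \<alpha>: "\<alpha> \<in> borel_measurable M" "AE x in M. \<bar>\<alpha> x\<bar> \<le> max 0 C" "0 \<le> max 0 C"
    using C by auto
  define E where "E = first_eig \<Omega> \<alpha>"
  have E0: "0 \<le> E" unfolding E_def by (rule first_eig_nonneg[OF \<alpha> alpha(3,2)])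
  define S where "S = (SUP \<xi>. ereal (f' \<xi>))"
  define Mf where "Mf = max 0 (max (2 * Limsup at_infinity (\<lambda>\<xi>. ereal ((LBINT t=ereal 0..ereal \<xi>. f t) / \<xi>\<^sup>2)))
                           (Limsup at_infinity (\<lambda>\<xi>. ereal (f \<xi> / \<xi>))))"
  have MS: "Mf < S" using Mf_lt by (simp only: Mf_def S_def)
  have l1: "ereal E / S < ereal lam" using lam(1) by (simp only: E_def S_def)
  have l2: "ereal lam < ereal E / Mf" using lam(2) by (simp only: E_def Mf_def)
  have M0: "0 \<le> Mf" by (simp add: Mf_def)
  have S0: "0 < S" using M0 MS by (rule le_less_trans)
  have "0 \<le> ereal E / S" using E0 S0 by (intro zero_le_divide_ereal) auto
  then have "0 < ereal lam" using l1 by (rule le_less_trans)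
  then have lam0: "0 < lam" by simp
  \<comment> \<open>In \<open>ereal\<close>, 0 divided by \<open>Mf\<close> is 0 even if
    \<open>Mf\<close> is 0, so a vanishing eigenvalue would force \<open>lam < 0\<close>, against
    the lower bound.\<close>
  have Epos: "0 < E"
  proof (rule ccontr)
    assume "\<not> 0 < E"
    then have "E = 0" using E0 by simp
    then have "ereal lam < 0" using l2 by (simp add: zero_ereal_def[symmetric])
    then show False using lam0 by simp
  qed
  \<comment> \<open>Immediate if the supremum of \<open>f'\<close> is infinite; otherwise the lower
    bound on \<open>lam\<close> is a real inequality with positive denominators.\<close>
  have "ereal (E / lam) < S"
  proof (cases S)
    case (real s)
    then have s: "0 < s" using S0 by simp
    then have "E / s < lam" using l1 real by simp
    then show ?thesis using s lam0 real by (simp add: field_simps)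
  qed (use S0 in auto)
  then obtain c0 where "ereal (E / lam) < ereal (f' c0)" unfolding S_def less_SUP_iff by blast
  then have c0: "E < lam * f' c0" using lam0 by (simp add: field_simps)
  have "\<exists>c1. lam * f' c1 < E"
  proof (rule ccontr)
    assume "\<not> ?thesis"
    then have "E / lam \<le> f' x" for x using lam0 by (simp add: not_less pos_divide_le_eq mult.commute)
    then have "ereal (E / lam) \<le> Limsup at_infinity (\<lambda>\<xi>. ereal (f \<xi> / \<xi>))"
      using f_deriv by (intro Limsup_quotient_ge) auto
    also have "\<dots> \<le> Mf" unfolding Mf_def by (rule max.coboundedI2[OF max.cobounded2])
    finally have "ereal (E / lam) \<le> Mf" .
    \<comment> \<open>\<open>Mf\<close> is finite, being below the supremum of \<open>f'\<close>,
      and positive, since it dominates \<open>E / lam\<close>. The upper bound on \<open>lam\<close>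
      thus becomes a real inequality, free of the conventions for division.\<close>
    moreover have "Mf \<noteq> \<infinity>" using MS by auto
    ultimately obtain m where m: "Mf = ereal m" "E / lam \<le> m" by (cases Mf) auto
    have "0 < E / lam" using Epos lam0 by simp
    then have m0: "0 < m" using m(2) by linarith
    then have "lam < E / m" using l2 m(1) by simp
    then have "lam * m < E" using m0 by (simp add: field_simps)
    moreover have "E \<le> lam * m" using m(2) lam0 by (simp add: field_simps)
    ultimately show False by simp
  qed
  then obtain c1 where c1: "lam * f' c1 < E" by blast
  show ?thesis
    using singular_set_of_nonlinearity[OF \<alpha> alpha(3,2) f'_cont growth Epos[unfolded E_def] c0[unfolded E_def] c1[unfolded E_def]]
    unfolding singular_set_def by blast
qed

end
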